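(* Let $\Omega\subset\mathbb{R}^N$ ($N\ge 2$) be a bounded domain with smooth boundary, let $p,q,s\in C(\overline\Omega)$ satisfy $$1<p(x),\,q(x)<N<s(x)\quad\text{and}\quad s'(x)q(x)=\frac{s(x)q(x)}{s(x)-1}<p^*(x)\qquad\text{for all }x\in\overline\Omega,$$ and let $V\in L^{s(x)}(\Omega)$ with $V>0$. Assume moreover that $q^+<p^-$. Then $\Lambda=(0,+\infty)$, that is, the set of eigenvalues of the problem $-\Delta_{p(x)}u=\lambda V(x)|u|^{q(x)-2}u$ in $\Omega$, $u=0$ on $\partial\Omega$, on $X$ is exactly $(0,+\infty)$; and hence $\lambda_*=\mu_*=0$ (for every $\alpha>0$ in the definition of $\lambda_*$).
   Context: For $h\in C(\overline\Omega)$ put $h^-=\min_{\overline\Omega}h$, $h^+=\max_{\overline\Omega}h$. $p^*(x)=\frac{Np(x)}{N-p(x)}$ when $p(x)<N$. $L^{s(x)}(\Omega)$ is the variable exponent Lebesgue space (Luxemburg norm $\|\cdot\|_{s(x)}$). $X=W_0^{1,p(x)}(\Omega)$ is the closure of $C_0^\infty(\Omega)$ in the variable exponent Sobolev space $W^{1,p(x)}(\Omega)$, with norm $\|u\|=\|\nabla u\|_{p(x)}$. $\Delta_{p(x)}u=\mathrm{div}(|\nabla u|^{p(x)-2}\nabla u)$. A pair $(\lambda,u)\in\mathbb{R}\times X$ with $u\ne0$ is an eigenpair ($\lambda$ an eigenvalue, $u$ an associated eigenfunction) if $$\int_\Omega|\nabla u|^{p(x)-2}\nabla u\cdot\nabla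 v\,dx=\lambda\int_\Omega V(x)|u|^{q(x)-2}uv\,dx\qquad\forall v\in X.$$ $\Lambda$ is the set of all $\lambda\in\mathbb{R}$ for which there is $u\in X\setminus\{0\}$ such that $(\lambda,u)$ is an eigenpair. For $u\in X$: $G(u)=\int_\Omega\frac{1}{p(x)}|\nabla u|^{p(x)}dx$, $\psi(u)=\int_\Omega|\nabla u|^{p(x)}dx$, $\phi(u)=\int_\Omega V(x)|u|^{q(x)}dx$. For $\alpha>0$: $\widetilde{M_\alpha}=\{u\in X: G(u)\le\alpha\}$ and $\lambda_*=\inf_{u\in\widetilde{M_\alpha}\setminus\{0\}}\frac{\psi(u)}{\phi(u)}$. Also $\mu_*=\inf_{u\in X\setminus\{0\}}\frac{\psi(u)}{\phi(u)}$. *)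

theory Defs
  imports "HOL-Analysis.Analysis"
begin

text \<open>Functions on a domain \<open>\<Omega>\<close> are total functions on the ambient Euclidean space; only their
  values on \<open>\<Omega>\<close> matter (on \<open>closure \<Omega>\<close> for the exponents). Elements of Lebesgue and Sobolev spaces
  are representatives, and two representatives are identified when they agree almost everywhere
  on \<open>\<Omega>\<close>.\<close>

subsection \<open>Smooth functions, test functions, smooth domains\<close>

definition partial :: "'a::euclidean_space \<Rightarrow> ('a \<Rightarrow> real) \<Rightarrow> 'a \<Rightarrow> real" where
  "partial b f x = frechet_derivative f (at x) b"

primrec C_k :: "nat \<Rightarrow> ('a::euclidean_space \<Rightarrow> real) \<Rightarrow> bool" where
  "C_k 0 f \<longleftrightarrow> continuous_on UNIV f"
| "C_k (Suc k) f \<longleftrightarrow> f differentiable_on UNIV \<and> (\<forall>b\<in>Basis. C_k k (partial b f))"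

definition C_infinity :: "('a::euclidean_space \<Rightarrow> real) \<Rightarrow> bool" where
  "C_infinity f \<longleftrightarrow> (\<forall>k. C_k k f)"

definition test_functions :: "'a::euclidean_space set \<Rightarrow> ('a \<Rightarrow> real) set" where
  "test_functions \<Omega> =
     {f. C_infinity f \<and> compact (closure {x. f x \<noteq> 0}) \<and> closure {x. f x \<noteq> 0} \<subseteq> \<Omega>}"

text \<open>Near each boundary point, \<open>\<Omega>\<close> is the region strictly above the graph of a smooth function.
  Instead of rotating coordinates, the vertical direction is an arbitrary unit vector \<open>e\<close>, and a
  function on the hyperplane orthogonal to \<open>e\<close> is a function on the whole space that is invariant
  under translations along \<open>e\<close>.\<close>

definition smooth_boundary :: "'a::euclidean_space set \<Rightarrow> bool" where
  "smooth_boundary \<Omega> \<longleftrightarrow>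
     (\<forall>z\<in>frontier \<Omega>. \<exists>r>0. \<exists>e \<gamma>. norm e = 1 \<and> C_infinity \<gamma> \<and>
        (\<forall>x t. \<gamma> (x + t *\<^sub>R e) = \<gamma> x) \<and>
        \<Omega> \<inter> ball z r = {x \<in> ball z r. \<gamma> x < x \<bullet> e})"

definition bounded_smooth_domain :: "'a::euclidean_space set \<Rightarrow> bool" where
  "bounded_smooth_domain \<Omega> \<longleftrightarrow>
     open \<Omega> \<and> connected \<Omega> \<and> \<Omega> \<noteq> {} \<and> bounded \<Omega> \<and> smooth_boundary \<Omega>"

subsection \<open>Exponents\<close>

text \<open>For continuous \<open>h\<close> and bounded nonempty \<open>\<Omega>\<close> these are the minimum and the maximum of \<open>h\<close> on
  the compact set \<open>closure \<Omega>\<close>.\<close>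

definition exp_minus :: "'a::euclidean_space set \<Rightarrow> ('a \<Rightarrow> real) \<Rightarrow> real" where
  "exp_minus \<Omega> h = (INF x\<in>closure \<Omega>. h x)"

definition exp_plus :: "'a::euclidean_space set \<Rightarrow> ('a \<Rightarrow> real) \<Rightarrow> real" where
  "exp_plus \<Omega> h = (SUP x\<in>closure \<Omega>. h x)"

text \<open>The formula is only meant for \<open>p x < DIM('a)\<close>.\<close>

definition sobolev_conj :: "('a::euclidean_space \<Rightarrow> real) \<Rightarrow> 'a \<Rightarrow> real" where
  "sobolev_conj p x = real DIM('a) * p x / (real DIM('a) - p x)"

subsection \<open>Variable exponent Lebesgue spaces\<close>

definition modular ::
    "'a::euclidean_space set \<Rightarrow> ('a \<Rightarrow> real) \<Rightarrow> ('a \<Rightarrow> 'b::real_normed_vector) \<Rightarrow> ennreal" where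
  "modular \<Omega> p f = (\<integral>\<^sup>+ x. ennreal (norm (f x) powr p x) \<partial>(lebesgue_on \<Omega>))"

definition Lp_var ::
    "'a::euclidean_space set \<Rightarrow> ('a \<Rightarrow> real) \<Rightarrow> ('a \<Rightarrow> 'b::real_normed_vector) set" where
  "Lp_var \<Omega> p = {f \<in> borel_measurable (lebesgue_on \<Omega>). modular \<Omega> p f < \<infinity>}"

definition luxemburg_norm ::
    "'a::euclidean_space set \<Rightarrow> ('a \<Rightarrow> real) \<Rightarrow> ('a \<Rightarrow> 'b::real_normed_vector) \<Rightarrow> real" where
  "luxemburg_norm \<Omega> p f = Inf {\<tau>. \<tau> > 0 \<and> modular \<Omega> p (\<lambda>x. f x /\<^sub>R \<tau>) \<le> 1}"

subsection \<open>Variable exponent Sobolev spaces\<close>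

definition locally_integrable ::
    "'a::euclidean_space set \<Rightarrow> ('a \<Rightarrow> 'b::euclidean_space) \<Rightarrow> bool" where
  "locally_integrable \<Omega> f \<longleftrightarrow> (\<forall>K. compact K \<and> K \<subseteq> \<Omega> \<longrightarrow> integrable (lebesgue_on K) f)"

definition is_weak_gradient ::
    "'a::euclidean_space set \<Rightarrow> ('a \<Rightarrow> real) \<Rightarrow> ('a \<Rightarrow> 'a) \<Rightarrow> bool" where
  "is_weak_gradient \<Omega> u g \<longleftrightarrow>
     locally_integrable \<Omega> u \<and> locally_integrable \<Omega> g \<and>
     (\<forall>\<eta>\<in>test_functions \<Omega>. \<forall>b\<in>Basis.
        (\<integral>x. u x * partial b \<eta> x \<partial>(lebesgue_on \<Omega>)) =
        - (\<integral>x. (g x \<bullet> b) * \<eta> x \<partial>(lebesgue_on \<Omega>)))"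

text \<open>The weak gradient is unique up to null sets, so the choice of representative is immaterial.\<close>

definition weak_grad :: "'a::euclidean_space set \<Rightarrow> ('a \<Rightarrow> real) \<Rightarrow> 'a \<Rightarrow> 'a" where
  "weak_grad \<Omega> u = (SOME g. is_weak_gradient \<Omega> u g)"

definition W1p :: "'a::euclidean_space set \<Rightarrow> ('a \<Rightarrow> real) \<Rightarrow> ('a \<Rightarrow> real) set" where
  "W1p \<Omega> p = {u \<in> Lp_var \<Omega> p. \<exists>g. is_weak_gradient \<Omega> u g \<and> g \<in> Lp_var \<Omega> p}"

definition W1p_norm :: "'a::euclidean_space set \<Rightarrow> ('a \<Rightarrow> real) \<Rightarrow> ('a \<Rightarrow> real) \<Rightarrow> real" where
  "W1p_norm \<Omega> p u = luxemburg_norm \<Omega> p u + luxemburg_norm \<Omega> p (weak_grad \<Omega> u)"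

definition W1p0 :: "'a::euclidean_space set \<Rightarrow> ('a \<Rightarrow> real) \<Rightarrow> ('a \<Rightarrow> real) set" where
  "W1p0 \<Omega> p =
     {u \<in> W1p \<Omega> p. \<forall>\<epsilon>>0. \<exists>\<eta>\<in>test_functions \<Omega>. W1p_norm \<Omega> p (\<lambda>x. u x - \<eta> x) < \<epsilon>}"

definition W1p0_nonzero :: "'a::euclidean_space set \<Rightarrow> ('a \<Rightarrow> real) \<Rightarrow> ('a \<Rightarrow> real) set" where
  "W1p0_nonzero \<Omega> p = {u \<in> W1p0 \<Omega> p. \<not> (AE x in lebesgue_on \<Omega>. u x = 0)}"

subsection \<open>The eigenvalue problem\<close>

text \<open>Since \<open>0 powr a = 0\<close>, the integrands \<open>|\<nabla>u|\<^sup>p\<^sup>-\<^sup>2 \<nabla>u \<cdot> \<nabla>v\<close> and \<open>V |u|\<^sup>q\<^sup>-\<^sup>2 u v\<close> vanish where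
  \<open>\<nabla>u = 0\<close>, respectively \<open>u = 0\<close>, also for exponents below 2. Under the hypotheses on \<open>p\<close>, \<open>q\<close>, \<open>s\<close>
  and \<open>V\<close> all integrands below are integrable for \<open>u, v \<in> W1p0 \<Omega> p\<close> (Sobolev embedding and
  Hoelder's inequality), so the value 0 of a divergent Bochner integral never enters.\<close>

definition eigenpair ::
    "'a::euclidean_space set \<Rightarrow> ('a \<Rightarrow> real) \<Rightarrow> ('a \<Rightarrow> real) \<Rightarrow> ('a \<Rightarrow> real) \<Rightarrow>
     real \<Rightarrow> ('a \<Rightarrow> real) \<Rightarrow> bool" where
  "eigenpair \<Omega> p q V l u \<longleftrightarrow>
     u \<in> W1p0_nonzero \<Omega> p \<and>
     (\<forall>v\<in>W1p0 \<Omega> p.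
        (\<integral>x. norm (weak_grad \<Omega> u x) powr (p x - 2) * (weak_grad \<Omega> u x \<bullet> weak_grad \<Omega> v x)
           \<partial>(lebesgue_on \<Omega>)) =
        l * (\<integral>x. V x * \<bar>u x\<bar> powr (q x - 2) * u x * v x \<partial>(lebesgue_on \<Omega>)))"

definition eigenvalues ::
    "'a::euclidean_space set \<Rightarrow> ('a \<Rightarrow> real) \<Rightarrow> ('a \<Rightarrow> real) \<Rightarrow> ('a \<Rightarrow> real) \<Rightarrow> real set" where
  "eigenvalues \<Omega> p q V = {l. \<exists>u. eigenpair \<Omega> p q V l u}"

definition G_fun :: "'a::euclidean_space set \<Rightarrow> ('a \<Rightarrow> real) \<Rightarrow> ('a \<Rightarrow> real) \<Rightarrow> real" where
  "G_fun \<Omega> p u = (\<integral>x. 1 / p x * norm (weak_grad \<Omega> u x) powr p x \<partial>(lebesgue_on \<Omega>))"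

definition psi_fun :: "'a::euclidean_space set \<Rightarrow> ('a \<Rightarrow> real) \<Rightarrow> ('a \<Rightarrow> real) \<Rightarrow> real" where
  "psi_fun \<Omega> p u = (\<integral>x. norm (weak_grad \<Omega> u x) powr p x \<partial>(lebesgue_on \<Omega>))"

definition phi_fun ::
    "'a::euclidean_space set \<Rightarrow> ('a \<Rightarrow> real) \<Rightarrow> ('a \<Rightarrow> real) \<Rightarrow> ('a \<Rightarrow> real) \<Rightarrow> real" where
  "phi_fun \<Omega> q V u = (\<integral>x. V x * \<bar>u x\<bar> powr q x \<partial>(lebesgue_on \<Omega>))"

text \<open>The infima are over nonempty sets of nonnegative reals when \<open>V > 0\<close> almost everywhere.\<close>

definition lambda_star ::
    "'a::euclidean_space set \<Rightarrow> ('a \<Rightarrow> real) \<Rightarrow> ('a \<Rightarrow> real) \<Rightarrow> ('a \<Rightarrow> real) \<Rightarrow> real \<Rightarrow> real" where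
  "lambda_star \<Omega> p q V \<alpha> =
     (INF u\<in>{u \<in> W1p0_nonzero \<Omega> p. G_fun \<Omega> p u \<le> \<alpha>}. psi_fun \<Omega> p u / phi_fun \<Omega> q V u)"

definition mu_star ::
    "'a::euclidean_space set \<Rightarrow> ('a \<Rightarrow> real) \<Rightarrow> ('a \<Rightarrow> real) \<Rightarrow> ('a \<Rightarrow> real) \<Rightarrow> real" where
  "mu_star \<Omega> p q V = (INF u\<in>W1p0_nonzero \<Omega> p. psi_fun \<Omega> p u / phi_fun \<Omega> q V u)"

end

theory Submission
  imports Defs "HOL-Complex_Analysis.Great_Picard" "HOL-Library.Diagonal_Subsequence"
begin

text \<open>For \<open>l > 0\<close> an eigenfunction is a global minimiser of
  \<open>\<integral> |\<nabla>u|\<^sup>p / p - l \<integral> V |u|\<^sup>q / q\<close>, which is coercive because \<open>q\<^sup>+ < p\<^sup>-\<close> and negative along \<open>t \<eta>\<close>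
  for small \<open>t\<close>. As \<open>V\<close> lies in \<open>L\<^sup>\<sigma>\<close> with \<open>\<sigma> = s\<^sup>- > N\<close>, constant exponent Sobolev estimates for
  \<open>p\<^sup>-\<close> make the lower order term continuous along sequences of test functions that are bounded in
  energy and converge almost everywhere; Rellich's theorem supplies such subsequences. Uniform
  convexity applied to midpoints of a minimising sequence then shows that its gradients are Cauchy,
  so no weak compactness is needed. That the functions themselves converge in the modular of \<open>p\<close> is a
  Poincare inequality, which for merely continuous \<open>p\<close> is proved on cells of small oscillation of \<open>p\<close>.
  Conversely testing with \<open>u\<close> gives \<open>l > 0\<close>, and both infima vanish since
  \<open>\<psi>(t \<eta>) / \<phi>(t \<eta>)\<close> is of order \<open>t\<close> to the power \<open>p\<^sup>- - q\<^sup>+\<close>.\<close>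

subsection \<open>Test functions\<close>

text \<open>The functional is not convex, since the lower order term enters with a minus sign.
  Midpoints of a minimising sequence are useful only because that term has the same limit along the
  sequence and along the midpoints, so that the midpoint defect of the energy alone tends to zero.
  The norm of \<open>W1p0\<close> is awkward for limits, being built from Luxemburg infima and from
  the arbitrarily chosen \<open>weak_grad\<close>. The work is therefore done with pairs of a
  function and a gradient that are joint modular limits of test functions
  (\<open>sobolev_pair\<close>): estimates are proved for smooth functions, and the way back to
  \<open>W1p0\<close> rests on uniqueness of weak gradients. Two constants bound p throughout: r
  from below, which is the integrability exponent, and P from above, which makes constants uniform
  in the point. The gap between q and r acts through a single estimate: values above L contribute at
  most a factor L powr (Q - r) times the r-th moment. It yields both coercivity and the convergence
  of the lower order term.\<close>

lemma partial_eqI: "(f has_derivative f') (at x) \<Longrightarrow> partial b f x = f' b"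
  unfolding partial_def by (metis frechet_derivative_at)

lemma C_k_Suc_imp: "C_k (Suc k) f \<Longrightarrow> C_k k f"
proof (induction k arbitrary: f)
  case 0
  then show ?case by (auto intro: differentiable_imp_continuous_on)
next
  case (Suc k)
  then show ?case by (metis C_k.simps(2))
qed

lemma C_k_const [simp]: "C_k k (\<lambda>x. c)"
proof (induction k arbitrary: c)
  case (Suc k)
  have "partial b (\<lambda>x. c) = (\<lambda>x. 0)" for b :: 'a
    by (rule ext) (rule partial_eqI, rule has_derivative_const)
  with Suc show ?case by simp
qed simp

lemma C_k_add: "C_k k f \<Longrightarrow> C_k k g \<Longrightarrow> C_k k (\<lambda>x. f x + g x)"
proof (induction k arbitrary: f g)
  case 0
  then show ?case by (auto intro: continuous_on_add)
next
  case (Suc k)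
  have d: "f differentiable (at x)" "g differentiable (at x)" for x
    using Suc.prems by (auto simp: differentiable_on_def)
  have "partial b (\<lambda>x. f x + g x) = (\<lambda>x. partial b f x + partial b g x)" for b
    by (rule ext, rule partial_eqI[OF has_derivative_add[OF d(1)[THEN frechet_derivative_works[THEN iffD1]]
          d(2)[THEN frechet_derivative_works[THEN iffD1]]], of b, folded partial_def])
  with Suc show ?case by (auto intro: differentiable_on_add)
qed

lemma C_k_mult: "C_k k f \<Longrightarrow> C_k k g \<Longrightarrow> C_k k (\<lambda>x. f x * g x)"
proof (induction k arbitrary: f g)
  case 0
  then show ?case by (auto intro: continuous_on_mult)
next
  case (Suc k)
  have d: "f differentiable (at x)" "g differentiable (at x)" for x
    using Suc.prems by (auto simp: differentiable_on_def)
  have "partial b (\<lambda>x. f x * g x) = (\<lambda>x. f x * partial b g x + partial b f x * g x)" for b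
    by (rule ext, rule partial_eqI[OF has_derivative_mult[OF d(1)[THEN frechet_derivative_works[THEN iffD1]]
          d(2)[THEN frechet_derivative_works[THEN iffD1]]], of b, folded partial_def])
  moreover have "C_k k f" "C_k k g" using Suc.prems C_k_Suc_imp by blast+
  ultimately show ?case using Suc
    by (auto intro!: differentiable_on_mult C_k_add)
qed

lemma C_k_prod: "finite I \<Longrightarrow> (\<And>i. i \<in> I \<Longrightarrow> C_k k (f i)) \<Longrightarrow> C_k k (\<lambda>x. \<Prod>i\<in>I. f i x)"
  by (induction I rule: finite_induct) (auto intro: C_k_mult)

section \<open>Flat functions built from exp (-1/t)\<close>

definition bump_fam :: "nat \<Rightarrow> real \<Rightarrow> real" where
  "bump_fam m t = (if t \<le> 0 then 0 else exp (- 1 / t) / t ^ m)"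

lemma power_le_fact_exp: "0 \<le> (x::real) \<Longrightarrow> x ^ n \<le> fact n * exp x"
proof -
  assume x: "0 \<le> x"
  have "(\<Sum>k\<in>{n}. x ^ k /\<^sub>R fact k) \<le> (\<Sum>k. x ^ k /\<^sub>R fact k)"
    by (rule sum_le_suminf) (use x summable_exp_generic[of x] in auto)
  then show ?thesis by (simp add: exp_def field_simps)
qed

text \<open>Taking the exponent m + 2 in the exponential series bound leaves two spare powers of t
  after division by t^m. A function of order t^2 has derivative 0 at the origin.\<close>

lemma bump_fam_quadratic: "\<bar>bump_fam m t\<bar> \<le> fact (m + 2) * t ^ 2"
proof (cases "t \<le> 0")
  case False
  then have t: "0 < t" by simp
  have "(1/t) ^ (m+2) \<le> fact (m+2) * exp (1/t)"
    using t by (intro power_le_fact_exp) auto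
  then have "exp (- (1/t)) * (1/t)^(m+2) \<le> exp (- (1/t)) * (fact (m+2) * exp (1/t))"
    by (intro mult_left_mono) auto
  also have "exp (- (1/t)) * (fact (m+2) * exp (1/t)) = fact (m+2)"
    by (simp add: exp_minus del: fact_Suc add_2_eq_Suc')
  finally have "exp (- (1/t)) * (1/t)^(m+2) \<le> fact (m+2)" .
  then have "exp (- (1/t)) * (1/t)^(m+2) * t^2 \<le> fact (m+2) * t^2"
    using t by (intro mult_right_mono) auto
  moreover have "exp (- (1/t)) * (1/t)^(m+2) * t^2 = exp (- 1 / t) / t ^ m"
    using t by (simp add: field_simps power_add power2_eq_square)
  ultimately show ?thesis using t by (simp add: bump_fam_def)
qed (simp add: bump_fam_def)

text \<open>The quotient rule after cancellation, with T standing for t^m. Keeping T a variable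
  prevents simplification from rewriting the power.\<close>

lemma exp_recip_derivative_quotient:
  fixes t T e m :: real
  assumes "t \<noteq> 0" "T \<noteq> 0"
  shows "(e * (1 / t^2) * T - e * (m * T / t)) / (T * T) = - m * (e / (T * t)) + e / (T * t^2)"
proof -
  have "(e * (1 / t^2) * T - e * (m * T / t)) / (T * T) = (e / t^2) / T - (e * m / t) / T"
    using assms by (simp add: diff_divide_distrib)
  then show ?thesis by (simp add: mult.commute)
qed

text \<open>The derivative is a combination of members with larger index, so the family is closed
  under differentiation up to linear combinations. This is the reason for the denominator t^m:
  smoothness follows by induction on the order with m arbitrary.\<close>

lemma DERIV_bump_fam:
  "(bump_fam m has_real_derivative (- real m * bump_fam (m+1) t + bump_fam (m+2) t)) (at t)"
proof -
  consider "t < 0" | "t > 0" | "t = 0" by linarith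
  then show ?thesis
  proof cases
    case 1
    have "((\<lambda>t. 0) has_real_derivative 0) (at t)" by simp
    then have "(bump_fam m has_real_derivative 0) (at t)"
      by (rule has_field_derivative_transform_within_open[where S="{..<0}"])
        (use 1 in \<open>auto simp: bump_fam_def\<close>)
    then show ?thesis using 1 by (simp add: bump_fam_def)
  next
    case 2
    have "((\<lambda>t. exp (- 1 / t) / t ^ m) has_real_derivative
        (- real m * (exp (- 1 / t) / t ^ (m+1)) + exp (- 1 / t) / t ^ (m+2))) (at t)"
    proof -
      have "((\<lambda>t. exp (- 1 / t) / t ^ m) has_real_derivative
        (exp (- 1 / t) * (1 / t^2) * t ^ m - exp (- 1 / t) * (real m * t ^ (m - 1))) / (t ^ m * t ^ m)) (at t)"
        using 2 by (auto intro!: derivative_eq_intros simp: power2_eq_square)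
      moreover have "real m * t ^ (m - 1) = real m * t ^ m / t"
        using 2 by (cases m) auto
      then have "(exp (- 1 / t) * (1 / t^2) * t ^ m - exp (- 1 / t) * (real m * t ^ (m - 1))) / (t ^ m * t ^ m) =
        - real m * (exp (- 1 / t) / t ^ (m+1)) + exp (- 1 / t) / t ^ (m+2)"
        using exp_recip_derivative_quotient[of t "t ^ m" "exp (- 1 / t)" "real m"] 2
        unfolding power_add power_one_right by simp
      ultimately show ?thesis by simp
    qed
    then have "(bump_fam m has_real_derivative
        (- real m * (exp (- 1 / t) / t ^ (m+1)) + exp (- 1 / t) / t ^ (m+2))) (at t)"
      by (rule has_field_derivative_transform_within_open[where S="{0<..}"])
        (use 2 in \<open>auto simp: bump_fam_def\<close>)
    then show ?thesis using 2 by (simp add: bump_fam_def)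
  next
    \<comment> \<open>At the origin the quadratic bound leaves a difference quotient of size at most
      a multiple of |h|.\<close>
    case 3
    have "(\<lambda>h. (bump_fam m (0 + h) - bump_fam m 0) / h) \<midarrow>0\<rightarrow> 0"
    proof (rule Lim_null_comparison)
      show "\<forall>\<^sub>F h in at 0. norm ((bump_fam m (0 + h) - bump_fam m 0) / h) \<le> fact (m+2) * \<bar>h\<bar>"
      proof (rule eventually_at_topological[THEN iffD2], intro exI[of _ UNIV] conjI ballI impI)
        fix h :: real assume "h \<noteq> 0"
        then have "fact (m+2) * h^2 / \<bar>h\<bar> = fact (m+2) * \<bar>h\<bar>"
          by (cases "0 < h") (auto simp: power2_eq_square)
        then show "norm ((bump_fam m (0 + h) - bump_fam m 0) / h) \<le> fact (m+2) * \<bar>h\<bar>"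
          using divide_right_mono[OF bump_fam_quadratic[of m h], of "\<bar>h\<bar>"]
          by (simp add: bump_fam_def[of _ 0] del: fact_Suc add_2_eq_Suc')
      qed auto
      show "(\<lambda>h. fact (m+2) * \<bar>h\<bar>) \<midarrow>0\<rightarrow> (0::real)"
        by (auto intro!: tendsto_eq_intros)
    qed
    then have "(bump_fam m has_real_derivative 0) (at 0)"
      by (simp add: DERIV_def)
    then show ?thesis using 3 by (simp add: bump_fam_def[of _ 0])
  qed
qed

lemma C_k_bump_affine:
  fixes d :: "'a::euclidean_space"
  shows "C_k k (\<lambda>x. bump_fam m (c + x \<bullet> d))"
proof (induction k arbitrary: m)
  case 0
  have "continuous_on UNIV (bump_fam m)"
    by (intro continuous_at_imp_continuous_on) (use DERIV_bump_fam DERIV_isCont in blast)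
  then have "continuous_on UNIV (\<lambda>x. bump_fam m (c + x \<bullet> d))"
    by (rule continuous_on_compose2[where s=UNIV and f="\<lambda>x. c + x \<bullet> d"]) (rule continuous_on_add continuous_on_inner continuous_on_const continuous_on_id subset_UNIV)+
  then show ?case by simp
next
  case (Suc k)
  have D: "((\<lambda>x. bump_fam m (c + x \<bullet> d)) has_derivative
      (\<lambda>h. (- real m * bump_fam (m+1) (c + x \<bullet> d) + bump_fam (m+2) (c + x \<bullet> d)) * (h \<bullet> d))) (at x)" for x
  proof -
    have "((\<lambda>x. c + x \<bullet> d) has_derivative (\<lambda>h. h \<bullet> d)) (at x)"
      by (auto intro!: derivative_eq_intros)
    from has_derivative_compose[OF this DERIV_bump_fam[of m "c + x \<bullet> d", unfolded has_field_derivative_def]]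
    show ?thesis .
  qed
  have P: "partial b (\<lambda>x. bump_fam m (c + x \<bullet> d)) =
      (\<lambda>x. (- real m * bump_fam (m+1) (c + x \<bullet> d) + bump_fam (m+2) (c + x \<bullet> d)) * (b \<bullet> d))" for b
    by (rule ext) (rule partial_eqI[OF D])
  have "(\<lambda>x. bump_fam m (c + x \<bullet> d)) differentiable_on UNIV"
    using D by (auto simp: differentiable_on_def differentiable_def)
  moreover have "C_k k (\<lambda>x. (- real m * bump_fam (m+1) (c + x \<bullet> d) + bump_fam (m+2) (c + x \<bullet> d)) * (b \<bullet> d))" for b
    by (intro C_k_mult C_k_add Suc C_k_const)
  ultimately show ?case by (simp add: P)
qed

section \<open>Test functions and their gradients\<close>

lemma test_functions_iff:
  "f \<in> test_functions \<Omega> \<longleftrightarrow> C_infinity f \<and> (\<exists>K. compact K \<and> K \<subseteq> \<Omega> \<and> (\<forall>x. x \<notin> K \<longrightarrow> f x = 0))"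
proof (safe)
  assume "f \<in> test_functions \<Omega>"
  then show "\<exists>K. compact K \<and> K \<subseteq> \<Omega> \<and> (\<forall>x. x \<notin> K \<longrightarrow> f x = 0)"
    by (intro exI[of _ "closure {x. f x \<noteq> 0}"])
       (auto simp: test_functions_def intro: closure_subset[THEN subsetD] ccontr)
next
  fix K assume K: "compact K" "K \<subseteq> \<Omega>" "\<forall>x. x \<notin> K \<longrightarrow> f x = 0" and f: "C_infinity f"
  then have "closure {x. f x \<noteq> 0} \<subseteq> K"
    by (intro closure_minimal) (auto intro: compact_imp_closed)
  then show "f \<in> test_functions \<Omega>"
    using K f by (auto simp: test_functions_def intro: compact_closure[THEN iffD2] bounded_subset[OF compact_imp_bounded]
        closure_subset[THEN subset_trans])
qed (simp add: test_functions_def)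

lemma test_add: assumes "f \<in> test_functions \<Omega>" "g \<in> test_functions \<Omega>"
  shows "(\<lambda>x. f x + g x) \<in> test_functions \<Omega>"
proof -
  obtain K L where "compact K" "K \<subseteq> \<Omega>" "\<forall>x. x \<notin> K \<longrightarrow> f x = 0" "compact L" "L \<subseteq> \<Omega>" "\<forall>x. x \<notin> L \<longrightarrow> g x = 0"
    using assms by (auto simp: test_functions_iff)
  then have "\<exists>K. compact K \<and> K \<subseteq> \<Omega> \<and> (\<forall>x. x \<notin> K \<longrightarrow> f x + g x = 0)"
    by (intro exI[of _ "K \<union> L"]) auto
  then show ?thesis using assms by (auto simp: test_functions_iff C_infinity_def intro: C_k_add)
qed

lemma test_mult: assumes "f \<in> test_functions \<Omega>" "C_infinity g"
  shows "(\<lambda>x. f x * g x) \<in> test_functions \<Omega>"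
  using assms by (force simp: test_functions_iff C_infinity_def intro: C_k_mult)

lemma test_imp_smooth: "f \<in> test_functions \<Omega> \<Longrightarrow> C_infinity f"
  by (simp add: test_functions_iff)

lemma test_scale: "f \<in> test_functions \<Omega> \<Longrightarrow> (\<lambda>x. c * f x) \<in> test_functions \<Omega>"
  using test_mult[of f \<Omega> "\<lambda>x. c"] by (simp add: C_infinity_def mult.commute)

lemma test_zero: "(\<lambda>x. 0) \<in> test_functions \<Omega>"
  by (auto simp: test_functions_iff C_infinity_def)

lemma test_diff: "f \<in> test_functions \<Omega> \<Longrightarrow> g \<in> test_functions \<Omega> \<Longrightarrow> (\<lambda>x. f x - g x) \<in> test_functions \<Omega>"
  using test_add[of f \<Omega> "\<lambda>x. (-1) * g x"] test_scale[of g \<Omega> "-1"] by simp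

lemma test_zero_outside: "f \<in> test_functions \<Omega> \<Longrightarrow> x \<notin> \<Omega> \<Longrightarrow> f x = 0"
  by (force simp: test_functions_iff)

definition grad :: "('a::euclidean_space \<Rightarrow> real) \<Rightarrow> 'a \<Rightarrow> 'a" where
  "grad f x = (\<Sum>b\<in>Basis. partial b f x *\<^sub>R b)"

lemma smooth_has_derivative:
  assumes "C_infinity f"
  shows "(f has_derivative (\<lambda>h. grad f x \<bullet> h)) (at x)"
proof -
  have "C_k 1 f" using assms by (simp add: C_infinity_def)
  then have "f differentiable (at x)" by (simp add: differentiable_on_def)
  then have D: "(f has_derivative frechet_derivative f (at x)) (at x)"
    by (rule frechet_derivative_works[THEN iffD1])
  have lin: "linear (frechet_derivative f (at x))"
    using D has_derivative_linear by blast
  have "frechet_derivative f (at x) = (\<lambda>h. grad f x \<bullet> h)"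
  proof
    fix h
    have "frechet_derivative f (at x) h = frechet_derivative f (at x) (\<Sum>b\<in>Basis. (h \<bullet> b) *\<^sub>R b)"
      by (simp add: euclidean_representation)
    also have "\<dots> = (\<Sum>b\<in>Basis. (h \<bullet> b) * frechet_derivative f (at x) b)"
      by (simp add: linear_sum[OF lin] linear_scale[OF lin])
    also have "\<dots> = grad f x \<bullet> h"
      unfolding grad_def inner_sum_left partial_def inner_scaleR_left
      by (intro sum.cong refl) (simp add: inner_commute[of h])
    finally show "frechet_derivative f (at x) h = grad f x \<bullet> h" .
  qed
  with D show ?thesis by simp
qed

lemma partial_grad: "C_infinity f \<Longrightarrow> partial b f x = grad f x \<bullet> b"
  by (rule partial_eqI[OF smooth_has_derivative])

lemma grad_eqI: assumes "(f has_derivative (\<lambda>h. v \<bullet> h)) (at x)" shows "grad f x = v"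
  unfolding grad_def by (simp add: partial_eqI[OF assms] euclidean_representation)

lemma smooth_cont: "C_infinity f \<Longrightarrow> continuous_on UNIV f"
  unfolding C_infinity_def using C_k.simps(1) by blast

lemma smooth_cont_grad: assumes "C_infinity f" shows "continuous_on UNIV (grad f)"
proof -
  have "C_k (Suc 0) f" using assms by (simp add: C_infinity_def)
  then show ?thesis unfolding grad_def by (auto intro!: continuous_intros)
qed

lemma grad_add: "C_infinity f \<Longrightarrow> C_infinity g \<Longrightarrow> grad (\<lambda>x. f x + g x) x = grad f x + grad g x"
  by (rule grad_eqI) (auto intro!: derivative_eq_intros smooth_has_derivative simp: inner_add_left)

lemma grad_diff: "C_infinity f \<Longrightarrow> C_infinity g \<Longrightarrow> grad (\<lambda>x. f x - g x) x = grad f x - grad g x"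
  by (rule grad_eqI) (auto intro!: derivative_eq_intros smooth_has_derivative simp: inner_diff_left)

lemma grad_scale: "C_infinity f \<Longrightarrow> grad (\<lambda>x. c * f x) x = c *\<^sub>R grad f x"
  by (rule grad_eqI) (auto intro!: derivative_eq_intros smooth_has_derivative)

lemma grad_mult: "C_infinity f \<Longrightarrow> C_infinity g \<Longrightarrow> grad (\<lambda>x. f x * g x) x = f x *\<^sub>R grad g x + g x *\<^sub>R grad f x"
  by (rule grad_eqI) (auto intro!: derivative_eq_intros smooth_has_derivative simp: inner_add_left mult.commute)

lemma test_support:
  assumes "f \<in> test_functions \<Omega>"
  obtains K where "compact K" "K \<subseteq> \<Omega>" "\<And>x. x \<notin> K \<Longrightarrow> f x = 0" "\<And>x. x \<notin> K \<Longrightarrow> grad f x = 0"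
proof -
  obtain K where K: "compact K" "K \<subseteq> \<Omega>" "\<And>x. x \<notin> K \<Longrightarrow> f x = 0"
    using assms by (auto simp: test_functions_iff)
  have "grad f x = 0" if "x \<notin> K" for x
  proof (rule grad_eqI)
    have "((\<lambda>x. 0) has_derivative (\<lambda>h. 0 \<bullet> h)) (at x)" by simp
    then show "(f has_derivative (\<lambda>h. 0 \<bullet> h)) (at x)"
      by (rule has_derivative_transform_within_open[where s="-K"])
        (use that K in \<open>auto simp: compact_imp_closed\<close>)
  qed
  with K show ?thesis using that by blast
qed

lemma grad_zero_outside: "f \<in> test_functions \<Omega> \<Longrightarrow> x \<notin> \<Omega> \<Longrightarrow> grad f x = 0"
  by (metis in_mono test_support)

lemma test_bounded:
  assumes "f \<in> test_functions \<Omega>"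
  obtains B where "0 \<le> B" "\<And>x. \<bar>f x\<bar> \<le> B" "\<And>x. norm (grad f x) \<le> B"
proof -
  obtain K where K: "compact K" "\<And>x. x \<notin> K \<Longrightarrow> f x = 0" "\<And>x. x \<notin> K \<Longrightarrow> grad f x = 0"
    using test_support[OF assms] by metis
  note s = test_imp_smooth[OF assms]
  have "bounded (f ` K)" "bounded (grad f ` K)"
    using K smooth_cont[OF s] smooth_cont_grad[OF s]
    by (meson compact_continuous_image compact_imp_bounded continuous_on_subset subset_UNIV)+
  then obtain a b where ab: "\<forall>x\<in>K. \<bar>f x\<bar> \<le> a" "\<forall>x\<in>K. norm (grad f x) \<le> b"
    by (auto simp: bounded_iff)
  show ?thesis
  proof (rule that[of "max 0 (max a b)"])
    show "\<bar>f x\<bar> \<le> max 0 (max a b)" for x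
      using ab(1) K(2)[of x] by (cases "x \<in> K") (auto simp: le_max_iff_disj)
    show "norm (grad f x) \<le> max 0 (max a b)" for x
      using ab(2) K(3)[of x] by (cases "x \<in> K") (auto simp: le_max_iff_disj)
  qed simp
qed

lemma
  assumes "f \<in> test_functions \<Omega>"
  shows test_measurable: "f \<in> borel_measurable borel" and grad_measurable: "grad f \<in> borel_measurable borel"
  using smooth_cont[OF test_imp_smooth[OF assms]] smooth_cont_grad[OF test_imp_smooth[OF assms]]
  by (auto intro: borel_measurable_continuous_onI)

section \<open>Smooth approximations of indicators of boxes\<close>

definition box_bump :: "nat \<Rightarrow> 'a::euclidean_space \<Rightarrow> 'a \<Rightarrow> 'a \<Rightarrow> real" where
  "box_bump k a b x = (\<Prod>i\<in>Basis. bump_fam 0 (real (Suc k) * (x \<bullet> i - a \<bullet> i)) * bump_fam 0 (real (Suc k) * (b \<bullet> i - x \<bullet> i)))"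

lemma bump_fam0: "0 \<le> bump_fam 0 t" "bump_fam 0 t \<le> 1" "0 < t \<Longrightarrow> 0 < bump_fam 0 t" "t \<le> 0 \<Longrightarrow> bump_fam 0 t = 0"
  by (auto simp: bump_fam_def)

lemma box_bump_bounds: "0 \<le> box_bump k a b x" "box_bump k a b x \<le> 1"
  unfolding box_bump_def using bump_fam0
  by (auto intro!: prod_nonneg prod_le_1 mult_le_one)

lemma box_bump_outside: assumes "x \<notin> box a b" shows "box_bump k a b x = 0"
proof -
  obtain i where i: "i \<in> Basis" "x \<bullet> i - a \<bullet> i \<le> 0 \<or> b \<bullet> i - x \<bullet> i \<le> 0"
    using assms by (force simp: mem_box not_less)
  then have "real (Suc k) * (x \<bullet> i - a \<bullet> i) \<le> 0 \<or> real (Suc k) * (b \<bullet> i - x \<bullet> i) \<le> 0"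
    by (auto simp: mult_le_0_iff)
  then have "bump_fam 0 (real (Suc k) * (x \<bullet> i - a \<bullet> i)) * bump_fam 0 (real (Suc k) * (b \<bullet> i - x \<bullet> i)) = 0"
    using bump_fam0(4) by auto
  with i show ?thesis unfolding box_bump_def
    by (intro prod_zero) auto
qed

lemma box_bump_pos: assumes "x \<in> box a b" shows "0 < box_bump k a b x"
  unfolding box_bump_def using assms bump_fam0
  by (auto intro!: prod_pos mult_pos_pos simp: mem_box)

lemma box_bump_smooth: "C_infinity (box_bump k a b)"
  unfolding C_infinity_def
proof
  fix j
  have "C_k j (\<lambda>x. \<Prod>i\<in>Basis. bump_fam 0 (- (real (Suc k) * (a \<bullet> i)) + x \<bullet> (real (Suc k) *\<^sub>R i)) *
     bump_fam 0 (real (Suc k) * (b \<bullet> i) + x \<bullet> (- real (Suc k) *\<^sub>R i)))"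
    by (intro C_k_prod C_k_mult C_k_bump_affine) auto
  then show "C_k j (box_bump k a b)"
    unfolding box_bump_def[abs_def] by (simp add: algebra_simps)
qed

lemma box_bump_test: assumes "cbox a b \<subseteq> \<Omega>" shows "box_bump k a b \<in> test_functions \<Omega>"
  unfolding test_functions_iff using assms box_bump_smooth box_bump_outside
  by (metis compact_cbox in_mono box_subset_cbox)

text \<open>The factor \<open>Suc k\<close> in the arguments steepens the bumps: inside the box each
  factor has the form exp (-1 / ((k + 1) d)) with d > 0 and tends to 1, while outside the product is
  0 for every k.\<close>

lemma box_bump_tendsto: "(\<lambda>k. box_bump k a b x) \<longlonglongrightarrow> indicator (box a b) x"
proof (cases "x \<in> box a b")
  case True
  have 1: "(\<lambda>k. bump_fam 0 (real (Suc k) * d)) \<longlonglongrightarrow> 1" if "d > 0" for d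
  proof -
    have "(\<lambda>k. inverse d * inverse (real (Suc k))) \<longlonglongrightarrow> inverse d * 0"
      by (intro tendsto_mult tendsto_const LIMSEQ_inverse_real_of_nat)
    then have "(\<lambda>k. exp (- (inverse d * inverse (real (Suc k))))) \<longlonglongrightarrow> exp (- 0)"
      by (intro tendsto_intros) simp
    then show ?thesis using that by (simp add: bump_fam_def not_le[symmetric] field_simps mult_le_0_iff del: of_nat_Suc)
  qed
  have "(\<lambda>k. box_bump k a b x) \<longlonglongrightarrow> (\<Prod>i\<in>(Basis::'a set). 1 * 1)"
    unfolding box_bump_def using True by (intro tendsto_prod tendsto_mult 1) (auto simp: mem_box)
  with True show ?thesis by simp
qed (simp add: box_bump_outside)

subsection \<open>Weak gradients\<close>

lemma nn_integral_lebesgue_on: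
  assumes "open \<Omega>" "f \<in> borel_measurable borel"
  shows "(\<integral>\<^sup>+ x. f x \<partial>lebesgue_on \<Omega>) = (\<integral>\<^sup>+ x. f x * indicator \<Omega> x \<partial>lborel)"
  using assms by (subst nn_integral_restrict_space) (auto simp: nn_integral_completion)

lemma measurable_lebesgue_onI:
  assumes "open \<Omega>" "f \<in> borel_measurable borel"
  shows "f \<in> borel_measurable (lebesgue_on \<Omega>)"
  using assms by (intro measurable_restrict_space1 measurable_completion) auto

lemma integral_lebesgue_on:
  fixes f :: "'a::euclidean_space \<Rightarrow> 'b::euclidean_space"
  assumes "open \<Omega>" "f \<in> borel_measurable borel" "\<And>x. x \<notin> \<Omega> \<Longrightarrow> f x = 0"
  shows "integral\<^sup>L (lebesgue_on \<Omega>) f = integral\<^sup>L lborel f"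
    and "integrable (lebesgue_on \<Omega>) f \<longleftrightarrow> integrable lborel f"
proof -
  have "(\<lambda>x. indicator \<Omega> x *\<^sub>R f x) = f" using assms(3) by (auto simp: fun_eq_iff indicator_def)
  then show "integral\<^sup>L (lebesgue_on \<Omega>) f = integral\<^sup>L lborel f"
    "integrable (lebesgue_on \<Omega>) f \<longleftrightarrow> integrable lborel f"
    using assms by (simp_all add: integral_restrict_space integrable_restrict_space integral_completion integrable_completion)
qed

lemma test_integrable:
  fixes f :: "'a::euclidean_space \<Rightarrow> 'b::euclidean_space"
  assumes "f \<in> borel_measurable borel" "bounded S" "\<And>x. x \<notin> S \<Longrightarrow> f x = 0" "\<And>x. norm (f x) \<le> B"
  shows "integrable lborel f"
proof -
  obtain R where R: "S \<subseteq> cball 0 R"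
    using \<open>bounded S\<close> bounded_subset_ballD[of S 0] ball_subset_cball by blast
  show ?thesis
  proof (rule integrableI_bounded_set[where A="cball 0 R" and B=B])
    show "AE x in lborel. x \<notin> cball 0 R \<longrightarrow> f x = 0"
      using assms R by (intro AE_I2) blast
    show "AE x in lborel. x \<in> cball 0 R \<longrightarrow> norm (f x) \<le> B" using assms by auto
    show "emeasure lborel (cball (0::'a) R) < \<infinity>" by (rule emeasure_bounded_finite) auto
  qed (use assms in auto)
qed

lemma lborel_integral_translate:
  fixes f :: "'a::euclidean_space \<Rightarrow> real"
  assumes [measurable]: "f \<in> borel_measurable borel"
  shows "(\<integral>x. f (c + x) \<partial>lborel) = integral\<^sup>L lborel f"
proof -
  have "integral\<^sup>L lborel f = integral\<^sup>L (distr lborel borel ((+) c)) f" by (simp add: lborel_distr_plus)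
  also have "\<dots> = (\<integral>x. f (c + x) \<partial>lborel)" by (rule integral_distr) auto
  finally show ?thesis by simp
qed

lemma test_lipschitz:
  assumes "f \<in> test_functions \<Omega>" "\<And>x. norm (grad f x) \<le> B"
  shows "\<bar>f x - f y\<bar> \<le> B * norm (x - y)"
proof -
  have "norm (f x - f y) \<le> B * norm (x - y)"
  proof (rule differentiable_bound[of UNIV f "\<lambda>x h. grad f x \<bullet> h"])
    show "onorm ((\<bullet>) (grad f x)) \<le> B" for x
      using assms(2)[of x] by (intro order_trans[OF _ assms(2)[of x]] onorm_bound) (auto simp: Cauchy_Schwarz_ineq2)
  qed (auto intro: smooth_has_derivative test_imp_smooth assms)
  then show ?thesis by simp
qed

lemma test_line_derivative:
  assumes "C_infinity f"
  shows "((\<lambda>t. f (x + t *\<^sub>R b)) has_real_derivative (grad f (x + t *\<^sub>R b) \<bullet> b)) (at t)"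
proof -
  have "((\<lambda>t. x + t *\<^sub>R b) has_derivative (\<lambda>t. t *\<^sub>R b)) (at t)"
    by (auto intro!: derivative_eq_intros)
  from has_derivative_compose[OF this smooth_has_derivative[OF assms]]
  show ?thesis by (simp add: has_field_derivative_def mult_commute_abs)
qed

text \<open>By translation invariance every difference quotient of f has integral zero, and the
  quotients converge dominatedly to the directional derivative. Applied to a product of test
  functions this becomes integration by parts.\<close>

lemma integral_grad_zero:
  fixes \<Omega> :: "'a::euclidean_space set"
  assumes f: "f \<in> test_functions \<Omega>"
  shows "(\<integral>x. grad f x \<bullet> b \<partial>lborel) = 0"
proof -
  obtain K where K: "compact K" "\<And>x. x \<notin> K \<Longrightarrow> f x = 0" "\<And>x. x \<notin> K \<Longrightarrow> grad f x = 0"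
    using test_support[OF f] by metis
  obtain B where B: "0 \<le> B" "\<And>x. \<bar>f x\<bar> \<le> B" "\<And>x. norm (grad f x) \<le> B"
    using test_bounded[OF f] by metis
  obtain R where R: "\<And>x. x \<in> K \<Longrightarrow> norm x \<le> R"
    using compact_imp_bounded[OF K(1)] by (auto simp: bounded_iff)
  note [measurable] = test_measurable[OF f] grad_measurable[OF f]
  have fint: "integrable lborel f"
    by (rule test_integrable[of _ K B]) (use K B compact_imp_bounded in auto)
  define t where "t n = inverse (real (Suc n))" for n
  have t: "0 < t n" "t n \<le> 1" for n by (auto simp: t_def inverse_le_1_iff)
  have tl: "t \<longlonglongrightarrow> 0" unfolding t_def by (rule LIMSEQ_inverse_real_of_nat)
  define D where "D n x = (f (x + t n *\<^sub>R b) - f x) / t n" for n x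
  have "(\<lambda>n. integral\<^sup>L lborel (D n)) \<longlonglongrightarrow> (\<integral>x. grad f x \<bullet> b \<partial>lborel)"
  \<comment> \<open>The Lipschitz bound gives B |b|. As the steps t n are at most 1, both terms of
    the quotient vanish outside the support enlarged by |b|.\<close>
  proof (rule integral_dominated_convergence[where w="\<lambda>x. B * norm b * indicator (cball 0 (R + norm b)) x"])
    show "integrable lborel (\<lambda>x::'a. B * norm b * indicator (cball 0 (R + norm b)) x)"
      by (intro integrable_mult_right integrable_real_indicator) (use emeasure_bounded_finite[of "cball (0::'a) (R + norm b)"] in auto)
    show "AE x in lborel. (\<lambda>n. D n x) \<longlonglongrightarrow> grad f x \<bullet> b"
    proof (rule AE_I2)
      fix x
      have "((\<lambda>h. (f (x + h *\<^sub>R b) - f x) / h) \<longlongrightarrow> grad f x \<bullet> b) (at 0)"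
        using test_line_derivative[OF test_imp_smooth[OF f], of x b 0] by (simp add: DERIV_def)
      moreover have "filterlim t (at 0) sequentially"
        using tl t(1) by (auto simp: filterlim_at less_imp_neq[THEN not_sym] eventually_sequentially)
      ultimately show "(\<lambda>n. D n x) \<longlonglongrightarrow> grad f x \<bullet> b"
        unfolding D_def by (rule filterlim_compose)
    qed
    show "AE x in lborel. norm (D n x) \<le> B * norm b * indicator (cball 0 (R + norm b)) x" for n
    proof (rule AE_I2)
      fix x
      show "norm (D n x) \<le> B * norm b * indicator (cball 0 (R + norm b)) x"
      proof (cases "x \<in> cball 0 (R + norm b)")
        case True
        have "\<bar>f (x + t n *\<^sub>R b) - f x\<bar> \<le> B * norm (x + t n *\<^sub>R b - x)"
          by (rule test_lipschitz[OF f B(3)])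
        then show ?thesis using True t[of n] by (simp add: D_def abs_divide divide_le_eq mult.assoc mult.commute[of "t n"])
      next
        case False
        then have n: "norm x > R + norm b" by simp
        then have "x \<notin> K" using R[of x] by (smt (verit) norm_ge_zero)
        moreover have "x + t n *\<^sub>R b \<notin> K"
        proof
          assume "x + t n *\<^sub>R b \<in> K"
          then have "norm (x + t n *\<^sub>R b) \<le> R" by (rule R)
          moreover have "norm x \<le> norm (x + t n *\<^sub>R b) + norm (t n *\<^sub>R b)"
            using norm_diff_ineq[of x "t n *\<^sub>R b"] by linarith
          moreover have "norm (t n *\<^sub>R b) \<le> norm b" using t[of n] by (simp add: mult_left_le_one_le)
          ultimately show False using n by simp
        qed
        ultimately show ?thesis using K(2) False by (simp add: D_def)
      qed
    qed
    show "D n \<in> borel_measurable lborel" for n unfolding D_def[abs_def] by measurable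
  qed auto
  moreover have "integral\<^sup>L lborel (D n) = 0" for n
  proof -
    have eq: "integral\<^sup>L lborel (\<lambda>x. f (x + t n *\<^sub>R b)) = integral\<^sup>L lborel f"
      using lborel_integral_translate[of f "t n *\<^sub>R b"] by (simp add: add.commute)
    have i: "integrable lborel (\<lambda>x. f (x + t n *\<^sub>R b))"
    proof (rule test_integrable[of _ "cball 0 (R + norm b)" B])
      fix x :: 'a assume "x \<notin> cball 0 (R + norm b)"
      then have n: "norm x > R + norm b" by simp
      have "x + t n *\<^sub>R b \<notin> K"
      proof
        assume "x + t n *\<^sub>R b \<in> K"
        then have "norm (x + t n *\<^sub>R b) \<le> R" by (rule R)
        moreover have "norm x \<le> norm (x + t n *\<^sub>R b) + norm (t n *\<^sub>R b)"
            using norm_diff_ineq[of x "t n *\<^sub>R b"] by linarith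
        moreover have "norm (t n *\<^sub>R b) \<le> norm b" using t[of n] by (simp add: mult_left_le_one_le)
        ultimately show False using n by simp
      qed
      then show "f (x + t n *\<^sub>R b) = 0" by (rule K(2))
    qed (use B in auto)
    show ?thesis unfolding D_def using i fint eq by simp
  qed
  ultimately show ?thesis by (simp add: LIMSEQ_const_iff)
qed

section \<open>The fundamental lemma of the calculus of variations\<close>

lemma AE_zero_of_box_integrals:
  fixes h :: "'a::euclidean_space \<Rightarrow> real"
  assumes h: "integrable lborel h" and z: "\<And>a b. (\<integral>x. indicator (box a b) x * h x \<partial>lborel) = 0"
  shows "AE x in lborel. h x = 0"
proof -
  have [measurable]: "h \<in> borel_measurable borel" using h by simp
  let ?M = "density lborel (\<lambda>x. ennreal (h x))" and ?N = "density lborel (\<lambda>x. ennreal (- h x))"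
  have fin: "(\<integral>\<^sup>+ x. ennreal (h x) \<partial>lborel) < \<infinity>" "(\<integral>\<^sup>+ x. ennreal (- h x) \<partial>lborel) < \<infinity>"
    using h by (auto simp: real_integrable_def less_top)
  \<comment> \<open>The positive and the negative part of h define finite measures that agree on
    boxes, an intersection-stable generator; hence they are equal. Evaluating them on the sets h > 0
    and h < 0 then annihilates both parts.\<close>
  have "?M = ?N"
  proof (rule measure_eqI_generator_eq[where E="range (\<lambda>(a, b). box a b)" and \<Omega>=UNIV and A="\<lambda>n::nat. box (- (real n *\<^sub>R One)) (real n *\<^sub>R One)"])
    show "Int_stable (range (\<lambda>(a, b). box a b :: 'a set))"
      by (auto simp: Int_stable_def box_Int_box)
    show "sets ?M = sigma_sets UNIV (range (\<lambda>(a, b). box a b :: 'a set))"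
      "sets ?N = sigma_sets UNIV (range (\<lambda>(a, b). box a b :: 'a set))"
      by (simp_all add: borel_eq_box)
    show "(\<Union>i::nat. box (- (real i *\<^sub>R One)) (real i *\<^sub>R One)) = (UNIV :: 'a set)"
      by (rule UN_box_eq_UNIV)
    show "emeasure ?M (box (- (real i *\<^sub>R One)) (real i *\<^sub>R One)) \<noteq> \<infinity>" for i :: nat
    proof -
      have "emeasure ?M (box (- (real i *\<^sub>R One)) (real i *\<^sub>R One)) \<le> emeasure ?M (space ?M)"
        by (rule emeasure_space)
      also have "\<dots> < \<infinity>" using fin by (simp add: emeasure_density)
      finally show ?thesis by simp
    qed
  next
    fix X assume "X \<in> range (\<lambda>(a, b). box a b :: 'a set)"
    then obtain a b where X: "X = box a b" by auto
    have hi: "integrable lborel (\<lambda>x. indicator X x * h x)"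
      using integrable_mult_indicator[OF _ h, of X] by (simp add: X)
    have e: "(\<lambda>x. ennreal (h x) * indicator X x) = (\<lambda>x. ennreal (indicator X x * h x))"
      "(\<lambda>x. ennreal (- h x) * indicator X x) = (\<lambda>x. ennreal (- (indicator X x * h x)))"
      by (auto simp: fun_eq_iff indicator_def)
    have "enn2real (\<integral>\<^sup>+ x. ennreal (h x) * indicator X x \<partial>lborel) = enn2real (\<integral>\<^sup>+ x. ennreal (- h x) * indicator X x \<partial>lborel)"
      using z[of a b] real_lebesgue_integral_def[OF hi] unfolding e unfolding X by linarith
    moreover have "(\<integral>\<^sup>+ x. ennreal (h x) * indicator X x \<partial>lborel) < \<infinity>" "(\<integral>\<^sup>+ x. ennreal (- h x) * indicator X x \<partial>lborel) < \<infinity>"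
      using hi by (auto simp: e real_integrable_def less_top)
    ultimately show "emeasure ?M X = emeasure ?N X"
      by (simp add: emeasure_density X) (metis ennreal_enn2real infinity_ennreal_def)
  qed auto
  then have E: "emeasure ?M A = emeasure ?N A" for A by simp
  have "(\<integral>\<^sup>+ x. ennreal (h x) * indicator {x. h x > 0} x \<partial>lborel) = (\<integral>\<^sup>+ x. ennreal (- h x) * indicator {x. h x > 0} x \<partial>lborel)"
    using E[of "{x. h x > 0}"] by (simp add: emeasure_density)
  also have "\<dots> = (\<integral>\<^sup>+ x. 0 \<partial>(lborel :: 'a measure))"
    by (intro nn_integral_cong) (auto simp: indicator_def ennreal_neg)
  finally have "(\<integral>\<^sup>+ x. ennreal (h x) * indicator {x. h x > 0} x \<partial>lborel) = 0" by simp
  then have 1: "AE x in lborel. ennreal (h x) * indicator {x. h x > 0} x = 0"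
    by (subst (asm) nn_integral_0_iff_AE) auto
  have "(\<integral>\<^sup>+ x. ennreal (- h x) * indicator {x. h x < 0} x \<partial>lborel) = (\<integral>\<^sup>+ x. ennreal (h x) * indicator {x. h x < 0} x \<partial>lborel)"
    using E[of "{x. h x < 0}"] by (simp add: emeasure_density)
  also have "\<dots> = (\<integral>\<^sup>+ x. 0 \<partial>(lborel :: 'a measure))"
    by (intro nn_integral_cong) (auto simp: indicator_def ennreal_neg)
  finally have "(\<integral>\<^sup>+ x. ennreal (- h x) * indicator {x. h x < 0} x \<partial>lborel) = 0" by simp
  then have 2: "AE x in lborel. ennreal (- h x) * indicator {x. h x < 0} x = 0"
    by (subst (asm) nn_integral_0_iff_AE) auto
  from 1 2 show ?thesis
    by eventually_elim (auto simp: indicator_def ennreal_eq_0_iff split: if_splits)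
qed

lemma locally_integrable_mult_test:
  fixes w :: "'a::euclidean_space \<Rightarrow> real"
  assumes "open \<Omega>" "locally_integrable \<Omega> w" "\<eta> \<in> test_functions \<Omega>"
  shows "integrable (lebesgue_on \<Omega>) (\<lambda>x. w x * \<eta> x)"
proof -
  obtain K where K: "compact K" "K \<subseteq> \<Omega>" "\<And>x. x \<notin> K \<Longrightarrow> \<eta> x = 0" using test_support[OF assms(3)] by metis
  obtain B where B: "0 \<le> B" "\<And>x. \<bar>\<eta> x\<bar> \<le> B" using test_bounded[OF assms(3)] by metis
  have Kb: "K \<in> sets lebesgue" using K(1) by (simp add: compact_imp_closed)
  have "integrable (lebesgue_on K) w" using assms K by (simp add: locally_integrable_def)
  then have i: "integrable lebesgue (\<lambda>x. indicator K x *\<^sub>R w x)"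
    using Kb by (subst (asm) integrable_restrict_space) auto
  have [measurable]: "\<eta> \<in> borel_measurable lebesgue"
    using test_measurable[OF assms(3)] by (intro measurable_completion) auto
  have "integrable lebesgue (\<lambda>x. (indicator K x *\<^sub>R w x) * \<eta> x)"
  proof (rule Bochner_Integration.integrable_bound[OF integrable_mult_right[OF i, of B]])
    show "(\<lambda>x. indicat_real K x *\<^sub>R w x * \<eta> x) \<in> borel_measurable lebesgue"
      using borel_measurable_integrable[OF i] by measurable
    show "AE x in lebesgue. norm (indicat_real K x *\<^sub>R w x * \<eta> x) \<le> norm (B * (indicat_real K x *\<^sub>R w x))"
    proof (rule AE_I2)
      fix x
      have "\<bar>\<eta> x\<bar> * \<bar>w x\<bar> \<le> \<bar>B\<bar> * \<bar>w x\<bar>" using B by (intro mult_right_mono) auto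
      then show "norm (indicat_real K x *\<^sub>R w x * \<eta> x) \<le> norm (B * (indicat_real K x *\<^sub>R w x))"
        by (simp add: indicator_def abs_mult mult.commute)
    qed
  qed
  moreover have "(\<lambda>x. (indicator K x *\<^sub>R w x) * \<eta> x) = (\<lambda>x. indicator \<Omega> x *\<^sub>R (w x * \<eta> x))"
    using K by (auto simp: indicator_def fun_eq_iff)
  ultimately show ?thesis using \<open>open \<Omega>\<close> by (subst integrable_restrict_space) auto
qed

text \<open>The box bumps lead from test functions to indicators of boxes, with |w| on a closed box
  inside \<Omega> as the dominating function. Vanishing box integrals give w = 0 locally, and
  countably many closed boxes cover \<Omega>.\<close>

lemma fundamental_lemma:
  fixes w :: "'a::euclidean_space \<Rightarrow> real"
  assumes op: "open \<Omega>" and w: "locally_integrable \<Omega> w"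
    and z: "\<And>\<eta>. \<eta> \<in> test_functions \<Omega> \<Longrightarrow> (\<integral>x. w x * \<eta> x \<partial>(lebesgue_on \<Omega>)) = 0"
  shows "AE x in lebesgue_on \<Omega>. w x = 0"
proof -
  have box: "AE x in lebesgue. x \<in> box c d \<longrightarrow> w x = 0" if cd: "cbox c d \<subseteq> \<Omega>" for c d
  proof -
    let ?K = "cbox c d"
    have "integrable (lebesgue_on ?K) w" using w cd by (simp add: locally_integrable_def)
    then have i: "integrable lebesgue (\<lambda>x. indicator ?K x * w x)"
      by (subst (asm) integrable_restrict_space) auto
    have iG: "integrable lebesgue (\<lambda>x. indicator (box c d) x * w x)" (is "integrable _ ?G")
    proof -
      have "integrable lebesgue (\<lambda>x. indicator (box c d) x *\<^sub>R (indicator ?K x * w x))"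
        by (rule integrable_mult_indicator[OF _ i]) auto
      moreover have "(\<lambda>x. indicator (box c d) x *\<^sub>R (indicator ?K x * w x)) = ?G"
        using box_subset_cbox[of c d] by (auto simp: indicator_def fun_eq_iff)
      ultimately show ?thesis by simp
    qed
    \<comment> \<open>w is only Lebesgue measurable, while the argument with boxes lives on
      \<open>lborel\<close>; a Borel representative bridges the two.\<close>
    obtain F where F: "F \<in> borel_measurable lborel" "AE x in lborel. ?G x = F x"
      using completion_ex_borel_measurable_real[OF borel_measurable_integrable[OF iG]] by metis
    have F': "AE x in lebesgue. ?G x = F x" using F(2) by (rule AE_completion)
    have Fl: "F \<in> borel_measurable lebesgue" using F(1) by (rule measurable_completion)
    have "integrable lebesgue F"
      using iG F' Fl by (subst integrable_cong_AE[symmetric, of ?G]) auto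
    then have iF: "integrable lborel F" using F(1) by (simp add: integrable_completion)
    have "AE x in lborel. F x = 0"
    proof (rule AE_zero_of_box_integrals[OF iF])
      fix a b
      \<comment> \<open>An arbitrary box has to be cut down to the fixed one. The intersection is
        again a box, and its closed version stays inside because it is the closure; this makes the
        bumps admissible. An empty intersection is represented by the box from One to 0.\<close>
      have bx: "\<exists>a' b'. box a b \<inter> box c d = box a' b' \<and> cbox a' b' \<subseteq> ?K"
      proof (cases "box a b \<inter> box c d = {}")
        case True
        obtain i :: 'a where "i \<in> Basis" using nonempty_Basis by blast
        then have "box One (0::'a) = {}" "cbox One (0::'a) = {}"
          unfolding box_eq_empty by (auto intro!: bexI[of _ i])
        then have "box a b \<inter> box c d = box One 0" "cbox One 0 \<subseteq> ?K"
          using True by auto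
        then show ?thesis by blast
      next
        case False
        then obtain a' b' where ab: "box a b \<inter> box c d = box a' b'" using box_Int_box[of a b c d] by blast
        then have "closure (box a' b') \<subseteq> closure (box c d)" by (metis Int_lower2 closure_mono)
        then show ?thesis using False ab by (metis closure_box closure_empty empty_iff subset_empty Int_empty_right)
      qed
      then obtain a' b' where ab: "box a b \<inter> box c d = box a' b'" "cbox a' b' \<subseteq> ?K" by blast
      have 0: "(\<integral>x. box_bump k a' b' x * (indicator ?K x * w x) \<partial>lebesgue) = 0" for k
      proof -
        have t: "box_bump k a' b' \<in> test_functions \<Omega>" using ab cd by (intro box_bump_test) auto
        have "(\<integral>x. w x * box_bump k a' b' x \<partial>(lebesgue_on \<Omega>)) = (\<integral>x. indicator \<Omega> x *\<^sub>R (w x * box_bump k a' b' x) \<partial>lebesgue)"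
          using op by (subst integral_restrict_space) auto
        also have "(\<lambda>x. indicator \<Omega> x *\<^sub>R (w x * box_bump k a' b' x)) = (\<lambda>x. box_bump k a' b' x * (indicator ?K x * w x))"
        proof
          fix x show "indicator \<Omega> x *\<^sub>R (w x * box_bump k a' b' x) = box_bump k a' b' x * (indicator ?K x * w x)"
            using ab(2) cd box_subset_cbox[of a' b'] box_bump_outside[of x a' b' k]
            by (cases "x \<in> box a' b'") (auto simp: indicator_def)
        qed
        finally show ?thesis using z[OF t] by simp
      qed
      have "(\<lambda>k. \<integral>x. box_bump k a' b' x * (indicator ?K x * w x) \<partial>lebesgue) \<longlonglongrightarrow> (\<integral>x. indicator (box a' b') x * (indicator ?K x * w x) \<partial>lebesgue)"
      proof (rule integral_dominated_convergence[where w="\<lambda>x. \<bar>indicator ?K x * w x\<bar>"])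
        have mm: "(\<lambda>x. indicator ?K x * w x) \<in> borel_measurable lebesgue" by (rule borel_measurable_integrable[OF i])
        show "(\<lambda>x. indicat_real (box a' b') x * (indicat_real ?K x * w x)) \<in> borel_measurable lebesgue"
          by (rule borel_measurable_times[OF measurable_completion mm]) simp
        show "(\<lambda>x. box_bump k a' b' x * (indicat_real ?K x * w x)) \<in> borel_measurable lebesgue" for k
        proof (rule borel_measurable_times[OF _ mm])
          show "box_bump k a' b' \<in> borel_measurable lebesgue"
            using smooth_cont[OF box_bump_smooth] borel_measurable_continuous_onI by (intro measurable_completion) auto
        qed
        show "AE x in lebesgue. (\<lambda>k. box_bump k a' b' x * (indicat_real ?K x * w x)) \<longlonglongrightarrow> indicat_real (box a' b') x * (indicat_real ?K x * w x)"
          by (intro AE_I2 tendsto_mult box_bump_tendsto tendsto_const)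
        show "AE x in lebesgue. norm (box_bump k a' b' x * (indicat_real ?K x * w x)) \<le> \<bar>indicat_real ?K x * w x\<bar>" for k
          using box_bump_bounds[of k a' b'] by (intro AE_I2) (auto simp: abs_mult intro!: mult_left_le_one_le)
      qed (use i in auto)
      then have "(\<integral>x. indicator (box a' b') x * (indicator ?K x * w x) \<partial>lebesgue) = 0"
        by (simp add: 0 LIMSEQ_const_iff)
      also have "(\<lambda>x. indicator (box a' b') x * (indicator ?K x * w x)) = (\<lambda>x. indicator (box a b) x * ?G x)"
        using box_subset_cbox[of c d] by (auto simp: fun_eq_iff ab(1)[symmetric] indicator_def)
      also have "integral\<^sup>L lebesgue (\<lambda>x. indicator (box a b) x * ?G x) = integral\<^sup>L lebesgue (\<lambda>x. indicator (box a b) x * F x)"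
      proof (rule integral_cong_AE)
        show "(\<lambda>x. indicator (box a b) x * ?G x) \<in> borel_measurable lebesgue"
          by (rule borel_measurable_times[OF measurable_completion borel_measurable_integrable[OF iG]]) simp
        show "(\<lambda>x. indicator (box a b) x * F x) \<in> borel_measurable lebesgue"
          by (rule borel_measurable_times[OF measurable_completion Fl]) simp
        show "AE x in lebesgue. indicator (box a b) x * ?G x = indicator (box a b) x * F x"
          using F' by eventually_elim simp
      qed
      also have "\<dots> = (\<integral>x. indicator (box a b) x * F x \<partial>lborel)"
        using F(1) by (intro integral_completion) auto
      finally show "(\<integral>x. indicator (box a b) x * F x \<partial>lborel) = 0" .
    qed
    then have "AE x in lebesgue. F x = 0" by (rule AE_completion)
    with F' show ?thesis by eventually_elim (auto simp: indicator_def)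
  qed
  obtain \<D> where D: "countable \<D>" "\<D> \<subseteq> Pow \<Omega>" "\<And>X. X \<in> \<D> \<Longrightarrow> \<exists>a b. X = cbox a b" "\<Union>\<D> = \<Omega>"
    using open_countable_Union_open_cbox[OF op] by metis
  have "AE x in lebesgue. x \<in> X \<longrightarrow> w x = 0" if XD: "X \<in> \<D>" for X
  proof -
    obtain a b where ab: "X = cbox a b" using D(3)[OF XD] by blast
    then have X: "X = cbox a b" "cbox a b \<subseteq> \<Omega>" using D(2) XD by auto
    \<comment> \<open>The cover consists of closed boxes, whereas the local argument reaches only
      their interiors; the faces are negligible.\<close>
    have "cbox a b - box a b \<in> null_sets lebesgue"
      using negligible_frontier_interval[of a b] by (simp add: negligible_iff_null_sets)
    then have "AE x in lebesgue. x \<notin> cbox a b - box a b" by (rule AE_not_in)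
    with box[OF X(2)] show ?thesis unfolding X(1) by eventually_elim auto
  qed
  then have "AE x in lebesgue. \<forall>X\<in>\<D>. x \<in> X \<longrightarrow> w x = 0"
    using D(1) by (subst AE_ball_countable) auto
  then have "AE x in lebesgue. x \<in> \<Omega> \<longrightarrow> w x = 0"
    by eventually_elim (use D(4) in blast)
  then show ?thesis using op by (subst AE_restrict_space_iff) auto
qed

section \<open>Calculus and uniqueness of weak gradients\<close>

lemma partial_test:
  assumes f: "f \<in> test_functions \<Omega>" and b: "b \<in> Basis"
  shows "partial b f \<in> test_functions \<Omega>"
proof -
  have s: "C_infinity f" by (rule test_imp_smooth[OF f])
  obtain K where K: "compact K" "K \<subseteq> \<Omega>" "\<And>x. x \<notin> K \<Longrightarrow> grad f x = 0" using test_support[OF f] by metis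
  have "C_k (Suc k) f" for k using s unfolding C_infinity_def by blast
  then have "C_infinity (partial b f)" unfolding C_infinity_def using b by simp
  moreover have "\<forall>x. x \<notin> K \<longrightarrow> partial b f x = 0" using K(3) by (simp add: partial_grad[OF s])
  ultimately show ?thesis using K by (auto simp: test_functions_iff)
qed

lemma integrable_imp_locally:
  assumes "open \<Omega>" "integrable (lebesgue_on \<Omega>) f" shows "locally_integrable \<Omega> f"
  unfolding locally_integrable_def
proof (intro allI impI)
  fix K :: "'a set" assume K: "compact K \<and> K \<subseteq> \<Omega>"
  then have Kb: "K \<in> sets lebesgue" by (simp add: compact_imp_closed)
  have "integrable lebesgue (\<lambda>x. indicator \<Omega> x *\<^sub>R f x)"
    using assms by (subst (asm) integrable_restrict_space) auto
  then have "integrable lebesgue (\<lambda>x. indicator K x *\<^sub>R (indicator \<Omega> x *\<^sub>R f x))"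
    by (rule integrable_mult_indicator[OF Kb])
  also have "(\<lambda>x. indicator K x *\<^sub>R (indicator \<Omega> x *\<^sub>R f x)) = (\<lambda>x. indicator K x *\<^sub>R f x)"
    using K by (auto simp: indicator_def fun_eq_iff)
  finally show "integrable (lebesgue_on K) f" using Kb by (subst integrable_restrict_space) auto
qed

lemma locally_integrable_lincomb:
  assumes "locally_integrable \<Omega> f" "locally_integrable \<Omega> g"
  shows "locally_integrable \<Omega> (\<lambda>x. f x + c *\<^sub>R g x)"
  using assms unfolding locally_integrable_def by simp

lemma locally_integrable_inner:
  assumes "locally_integrable \<Omega> f" shows "locally_integrable \<Omega> (\<lambda>x. f x \<bullet> b)"
  using assms unfolding locally_integrable_def by simp

lemma weak_gradient_lincomb:
  assumes "open \<Omega>" and u: "is_weak_gradient \<Omega> u g" and v: "is_weak_gradient \<Omega> v h"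
  shows "is_weak_gradient \<Omega> (\<lambda>x. u x + c * v x) (\<lambda>x. g x + c *\<^sub>R h x)"
  unfolding is_weak_gradient_def
proof (intro conjI ballI)
  have l: "locally_integrable \<Omega> u" "locally_integrable \<Omega> v" "locally_integrable \<Omega> g" "locally_integrable \<Omega> h"
    using u v by (auto simp: is_weak_gradient_def)
  show "locally_integrable \<Omega> (\<lambda>x. u x + c * v x)" using locally_integrable_lincomb[OF l(1,2), of c] by simp
  show "locally_integrable \<Omega> (\<lambda>x. g x + c *\<^sub>R h x)" by (rule locally_integrable_lincomb[OF l(3,4)])
  fix \<eta> :: "'a \<Rightarrow> real" and b :: 'a assume e: "\<eta> \<in> test_functions \<Omega>" and b: "b \<in> Basis"
  note i = locally_integrable_mult_test[OF assms(1)]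
  note i1 = i[OF l(1) partial_test[OF e b]] and i2 = i[OF l(2) partial_test[OF e b]]
  note i3 = i[OF locally_integrable_inner[OF l(3), of b] e] and i4 = i[OF locally_integrable_inner[OF l(4), of b] e]
  have "(\<integral>x. (u x + c * v x) * partial b \<eta> x \<partial>lebesgue_on \<Omega>) =
     (\<integral>x. u x * partial b \<eta> x \<partial>lebesgue_on \<Omega>) + c * (\<integral>x. v x * partial b \<eta> x \<partial>lebesgue_on \<Omega>)"
    using i1 i2 by (simp add: distrib_right mult.assoc)
  moreover have "(\<integral>x. ((g x + c *\<^sub>R h x) \<bullet> b) * \<eta> x \<partial>lebesgue_on \<Omega>) =
     (\<integral>x. (g x \<bullet> b) * \<eta> x \<partial>lebesgue_on \<Omega>) + c * (\<integral>x. (h x \<bullet> b) * \<eta> x \<partial>lebesgue_on \<Omega>)"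
    using i3 i4 by (simp add: inner_add_left distrib_right mult.assoc)
  ultimately show "(\<integral>x. (u x + c * v x) * partial b \<eta> x \<partial>lebesgue_on \<Omega>) =
    - (\<integral>x. ((g x + c *\<^sub>R h x) \<bullet> b) * \<eta> x \<partial>lebesgue_on \<Omega>)"
    using u v e b by (simp add: is_weak_gradient_def)
qed

text \<open>The product with a test function is again a test function, so its gradient integrates to
  zero; the product rule turns this into the weak identity.\<close>

lemma weak_gradient_test:
  fixes \<Omega> :: "'a::euclidean_space set"
  assumes "open \<Omega>" "bounded \<Omega>" and f: "f \<in> test_functions \<Omega>"
  shows "is_weak_gradient \<Omega> f (grad f)"
  unfolding is_weak_gradient_def
proof (intro conjI ballI)
  obtain B where B: "0 \<le> B" "\<And>x. \<bar>f x\<bar> \<le> B" "\<And>x. norm (grad f x) \<le> B"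
    using test_bounded[OF f] by metis
  note m = test_measurable[OF f] grad_measurable[OF f]
  have "integrable lborel f" "integrable lborel (grad f)"
    using B m test_zero_outside[OF f] grad_zero_outside[OF f] by (auto intro!: test_integrable[OF _ assms(2), of _ B])
  then have i: "integrable (lebesgue_on \<Omega>) f" "integrable (lebesgue_on \<Omega>) (grad f)"
    using assms m test_zero_outside[OF f] grad_zero_outside[OF f] by (simp_all add: integral_lebesgue_on(2))
  show l: "locally_integrable \<Omega> f" "locally_integrable \<Omega> (grad f)"
    using i assms by (auto intro: integrable_imp_locally)
  fix \<eta> :: "'a \<Rightarrow> real" and b :: 'a assume e: "\<eta> \<in> test_functions \<Omega>" and b: "b \<in> Basis"
  note s = test_imp_smooth[OF f] test_imp_smooth[OF e]
  have t: "(\<lambda>x. f x * \<eta> x) \<in> test_functions \<Omega>" by (rule test_mult[OF f s(2)])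
  have "(\<integral>x. grad (\<lambda>x. f x * \<eta> x) x \<bullet> b \<partial>lebesgue_on \<Omega>) = (\<integral>x. grad (\<lambda>x. f x * \<eta> x) x \<bullet> b \<partial>lborel)"
    using grad_measurable[OF t] grad_zero_outside[OF t] assms by (intro integral_lebesgue_on) auto
  also have "\<dots> = 0" by (rule integral_grad_zero[OF t])
  finally have "(\<integral>x. f x * partial b \<eta> x + (grad f x \<bullet> b) * \<eta> x \<partial>lebesgue_on \<Omega>) = 0"
    by (simp only: grad_mult[OF s] partial_grad[OF s(2)] inner_add_left inner_scaleR_left mult.commute[of "\<eta> _"])
  moreover have "integrable (lebesgue_on \<Omega>) (\<lambda>x. f x * partial b \<eta> x)" "integrable (lebesgue_on \<Omega>) (\<lambda>x. (grad f x \<bullet> b) * \<eta> x)"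
    using locally_integrable_mult_test[OF assms(1) l(1) partial_test[OF e b]]
      locally_integrable_mult_test[OF assms(1) locally_integrable_inner[OF l(2)] e] by auto
  ultimately show "(\<integral>x. f x * partial b \<eta> x \<partial>lebesgue_on \<Omega>) = - (\<integral>x. (grad f x \<bullet> b) * \<eta> x \<partial>lebesgue_on \<Omega>)"
    by simp
qed

text \<open>The difference of two candidates is a weak gradient of u - u, so each of its components
  is annihilated by all test functions.\<close>

lemma weak_gradient_unique:
  assumes "open \<Omega>" and g: "is_weak_gradient \<Omega> u g" and h: "is_weak_gradient \<Omega> u h"
  shows "AE x in lebesgue_on \<Omega>. g x = h x"
proof -
  have d: "is_weak_gradient \<Omega> (\<lambda>x. u x + (-1) * u x) (\<lambda>x. g x + (-1) *\<^sub>R h x)"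
    by (rule weak_gradient_lincomb[OF assms])
  have "AE x in lebesgue_on \<Omega>. (g x + (-1) *\<^sub>R h x) \<bullet> b = 0" if b: "b \<in> Basis" for b
  proof (rule fundamental_lemma[OF assms(1)])
    show "locally_integrable \<Omega> (\<lambda>x. (g x + (-1) *\<^sub>R h x) \<bullet> b)"
      using d by (intro locally_integrable_inner) (simp add: is_weak_gradient_def)
    show "(\<integral>x. (g x + (-1) *\<^sub>R h x) \<bullet> b * \<eta> x \<partial>lebesgue_on \<Omega>) = 0" if "\<eta> \<in> test_functions \<Omega>" for \<eta>
      using d that b by (simp add: is_weak_gradient_def)
  qed
  then have "AE x in lebesgue_on \<Omega>. \<forall>b\<in>Basis. (g x + (-1) *\<^sub>R h x) \<bullet> b = 0"
    by (intro AE_finite_allI) auto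
  then show ?thesis
    by eventually_elim (auto simp: inner_diff_left intro: euclidean_eqI)
qed

lemma weak_grad_works: "is_weak_gradient \<Omega> u g \<Longrightarrow> is_weak_gradient \<Omega> u (weak_grad \<Omega> u)"
  unfolding weak_grad_def by (rule someI[of "is_weak_gradient \<Omega> u"])

lemma weak_grad_AE: "open \<Omega> \<Longrightarrow> is_weak_gradient \<Omega> u g \<Longrightarrow> AE x in lebesgue_on \<Omega>. weak_grad \<Omega> u x = g x"
  using weak_gradient_unique weak_grad_works by blast

subsection \<open>Modulars\<close>

lemma ennreal_tendsto_0I:
  fixes x :: "nat \<Rightarrow> ennreal"
  assumes "\<And>e. 0 < e \<Longrightarrow> \<forall>\<^sub>F n in sequentially. x n \<le> ennreal e"
  shows "x \<longlonglongrightarrow> 0"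
proof (rule order_tendstoI)
  fix a :: ennreal assume "0 < a"
  then obtain b where b: "0 < b" "b < a" using dense by blast
  then have "b < top" using top_greatest[of a] by (rule_tac less_le_trans)
  then obtain e where "b = ennreal e" "0 \<le> e" by (cases b) auto
  with b have "0 < e" "ennreal e < a" by auto
  with assms[of e] show "\<forall>\<^sub>F n in sequentially. x n < a"
    by (auto elim: eventually_mono)
qed auto

lemma ennreal_tendsto_0D:
  fixes x :: "nat \<Rightarrow> ennreal"
  assumes "x \<longlonglongrightarrow> 0" "0 < e" shows "\<forall>\<^sub>F n in sequentially. x n \<le> ennreal e"
  using order_tendstoD(2)[OF assms(1), of "ennreal e"] assms(2)
  by (auto elim: eventually_mono)

lemma ennreal_tendsto_0_mult:
  fixes x :: "nat \<Rightarrow> ennreal"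
  assumes "x \<longlonglongrightarrow> 0" shows "(\<lambda>n. ennreal c * x n) \<longlonglongrightarrow> 0"
  using ennreal_tendsto_cmult[OF _ assms, of "ennreal c"] by simp

lemma ennreal_tendsto_0_le:
  fixes x :: "nat \<Rightarrow> ennreal"
  assumes "x \<longlonglongrightarrow> 0" "\<And>n. y n \<le> x n" shows "y \<longlonglongrightarrow> 0"
  by (rule tendsto_sandwich[OF _ _ tendsto_const assms(1)]) (use assms in auto)

lemma powr_add_le:
  fixes x y :: real
  assumes "0 \<le> x" "0 \<le> y" "0 \<le> q" "q \<le> P"
  shows "(x + y) powr q \<le> 2 powr P * (x powr q + y powr q)"
proof -
  have "(x + y) powr q \<le> (2 * max x y) powr q"
    using assms by (intro powr_mono2) auto
  also have "\<dots> = 2 powr q * max x y powr q" using assms by (intro powr_mult)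
  also have "\<dots> \<le> 2 powr P * (x powr q + y powr q)"
    using assms by (intro mult_mono powr_mono) (auto simp: max_def)
  finally show ?thesis .
qed

text \<open>The trade-off behind every comparison of a modular with a lower constant exponent: the
  additive term becomes small with d, at the price of a large factor in front of the higher power.
  Above d the quotient of the powers is at most d powr (a - q), hence at most d powr (-P).\<close>

lemma powr_split_le:
  fixes y :: real
  assumes "0 < d" "d \<le> 1" "0 \<le> y" "0 \<le> a" "a \<le> q" "q \<le> P"
  shows "y powr a \<le> d powr a + d powr (- P) * y powr q"
proof (cases "y \<le> d")
  case True
  then have "y powr a \<le> d powr a" using assms by (intro powr_mono2) auto
  moreover have "0 \<le> d powr (- P) * y powr q" by simp
  ultimately show ?thesis by linarith
next
  case False
  then have y: "d < y" "0 < y" using assms by auto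
  have "y powr (a - q) \<le> d powr (a - q)"
    using y assms by (intro powr_mono2') auto
  also have "\<dots> \<le> d powr (- P)" using assms by (intro powr_mono') auto
  finally have "y powr (a - q) * y powr q \<le> d powr (- P) * y powr q" by (intro mult_right_mono) auto
  moreover have "y powr (a - q) * y powr q = y powr a" by (simp add: powr_add[symmetric])
  moreover have "0 \<le> d powr a" by simp
  ultimately show ?thesis by linarith
qed

lemma Fatou_le:
  fixes u :: "nat \<Rightarrow> 'a \<Rightarrow> ennreal"
  assumes [measurable]: "\<And>n. u n \<in> borel_measurable M"
    and lim: "AE x in M. (\<lambda>n. u n x) \<longlonglongrightarrow> v x" and le: "\<forall>\<^sub>F n in sequentially. (\<integral>\<^sup>+ x. u n x \<partial>M) \<le> K"
  shows "(\<integral>\<^sup>+ x. v x \<partial>M) \<le> K"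
proof -
  have "(\<integral>\<^sup>+ x. v x \<partial>M) = (\<integral>\<^sup>+ x. liminf (\<lambda>n. u n x) \<partial>M)"
    using lim by (intro nn_integral_cong_AE) (auto elim!: eventually_mono simp: lim_imp_Liminf)
  also have "\<dots> \<le> liminf (\<lambda>n. \<integral>\<^sup>+ x. u n x \<partial>M)" by (rule nn_integral_liminf) auto
  also have "\<dots> \<le> limsup (\<lambda>n. \<integral>\<^sup>+ x. u n x \<partial>M)" by (rule Liminf_le_Limsup) simp
  also have "\<dots> \<le> K" by (rule Limsup_bounded[OF le])
  finally show ?thesis .
qed

lemma L1_Cauchy_subseq:
  fixes f :: "nat \<Rightarrow> 'a \<Rightarrow> 'b::{banach, second_countable_topology}"
  assumes m[measurable]: "\<And>n. f n \<in> borel_measurable M" and fin: "\<And>n. (\<integral>\<^sup>+ x. ennreal (norm (f n x)) \<partial>M) < \<infinity>"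
    and C: "\<And>e. 0 < e \<Longrightarrow> \<exists>N. \<forall>i\<ge>N. \<forall>j\<ge>N. (\<integral>\<^sup>+ x. ennreal (norm (f i x - f j x)) \<partial>M) \<le> ennreal e"
  obtains s g where "strict_mono s" "g \<in> borel_measurable M" "AE x in M. (\<lambda>i. f (s i) x) \<longlonglongrightarrow> g x"
proof -
  have int: "integrable M (f n)" for n using fin[of n] by (simp add: integrable_iff_bounded)
  have "\<exists>N. \<forall>i\<ge>N. \<forall>j\<ge>N. (LINT x|M. norm (f i x - f j x)) < e" if e: "0 < e" for e :: real
  proof -
    from C[of "e/2"] e obtain N where N: "\<And>i j. i \<ge> N \<Longrightarrow> j \<ge> N \<Longrightarrow> (\<integral>\<^sup>+ x. ennreal (norm (f i x - f j x)) \<partial>M) \<le> ennreal (e/2)"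
      by auto
    have "(LINT x|M. norm (f i x - f j x)) < e" if "i \<ge> N" "j \<ge> N" for i j
    proof -
      have "ennreal (LINT x|M. norm (f i x - f j x)) = (\<integral>\<^sup>+ x. ennreal (norm (f i x - f j x)) \<partial>M)"
        using int by (intro nn_integral_eq_integral[symmetric]) auto
      also have "\<dots> \<le> ennreal (e/2)" by (rule N[OF that])
      finally show ?thesis using e by (simp add: ennreal_le_iff)
    qed
    then show ?thesis by blast
  qed
  from cauchy_L1_AE_cauchy_subseq[OF int this]
  obtain s where s: "strict_mono s" "AE x in M. Cauchy (\<lambda>i. f (s i) x)" by blast
  show ?thesis
  proof (rule that[OF s(1), of "\<lambda>x. lim (\<lambda>i. f (s i) x)"])
    show "AE x in M. (\<lambda>i. f (s i) x) \<longlonglongrightarrow> lim (\<lambda>i. f (s i) x)"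
      using s(2) by eventually_elim (simp add: Cauchy_convergent_iff convergent_LIMSEQ_iff)
  qed measurable
qed

lemma L1_lim_AE_subseq:
  fixes f :: "nat \<Rightarrow> 'a \<Rightarrow> 'b::{banach, second_countable_topology}"
  assumes [measurable]: "\<And>n. f n \<in> borel_measurable M" "g \<in> borel_measurable M"
    and lim: "(\<lambda>n. \<integral>\<^sup>+ x. ennreal (norm (f n x - g x)) \<partial>M) \<longlonglongrightarrow> 0"
  obtains s where "strict_mono s" "AE x in M. (\<lambda>i. f (s i) x) \<longlonglongrightarrow> g x"
proof -
  \<comment> \<open>For small indices the integrals may be infinite; the sequence is shifted to
    where the differences are integrable.\<close>
  from ennreal_tendsto_0D[OF lim, of 1] obtain N
    where N: "\<And>n. n \<ge> N \<Longrightarrow> (\<integral>\<^sup>+ x. ennreal (norm (f n x - g x)) \<partial>M) \<le> 1"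
    by (auto simp: eventually_sequentially)
  have int: "integrable M (\<lambda>x. f (n + N) x - g x)" for n
    unfolding integrable_iff_bounded using N[of "n + N"] by (auto intro: le_less_trans)
  have lim2: "(\<lambda>n. \<integral>\<^sup>+ x. ennreal (norm (f (n + N) x - g x)) \<partial>M) \<longlonglongrightarrow> 0"
    using lim by (rule LIMSEQ_ignore_initial_segment)
  have "(\<lambda>n. \<integral>\<^sup>+ x. ennreal (norm (f (n + N) x - g x)) \<partial>M) = (\<lambda>n. ennreal (\<integral>x. norm (f (n + N) x - g x) \<partial>M))"
    using int by (intro ext nn_integral_eq_integral) auto
  with lim2 have "(\<lambda>n. \<integral>x. norm (f (n + N) x - g x) \<partial>M) \<longlonglongrightarrow> 0"
    by (simp add: ennreal_tendsto_0_iff)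
  from tendsto_L1_AE_subseq[OF int this] obtain r where r: "strict_mono r" "AE x in M. (\<lambda>n. f (r n + N) x - g x) \<longlonglongrightarrow> 0"
    by auto
  show ?thesis
  proof (rule that[of "\<lambda>n. r n + N"])
    show "strict_mono (\<lambda>n. r n + N)" using r(1) by (simp add: strict_mono_def)
    show "AE x in M. (\<lambda>i. f (r i + N) x) \<longlonglongrightarrow> g x"
      using r(2) by eventually_elim (simp add: LIM_zero_iff)
  qed
qed

text \<open>Lebesgue measure is complete, so measurability survives a change on a null set. This is
  needed because \<open>weak_grad\<close> is known only up to null sets.\<close>

lemma measurable_AE_lebesgue_on:
  fixes f g :: "'a::euclidean_space \<Rightarrow> 'b::topological_space"
  assumes "open \<Omega>" and f: "f \<in> borel_measurable (lebesgue_on \<Omega>)" and ae: "AE x in lebesgue_on \<Omega>. f x = g x"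
  shows "g \<in> borel_measurable (lebesgue_on \<Omega>)"
proof (rule measurableI)
  fix A :: "'b set" assume A: "A \<in> sets borel"
  have O: "\<Omega> \<in> sets lebesgue" using \<open>open \<Omega>\<close> by simp
  have "f -` A \<inter> \<Omega> \<in> sets (lebesgue_on \<Omega>)" using measurable_sets[OF f A] by simp
  then have 1: "f -` A \<inter> \<Omega> \<in> sets lebesgue" using O by (simp add: sets_restrict_space_iff)
  have "AE x in lebesgue. x \<in> \<Omega> \<longrightarrow> f x = g x"
    using ae O by (subst (asm) AE_restrict_space_iff) auto
  then have "AE x in lebesgue. x \<in> f -` A \<inter> \<Omega> \<longleftrightarrow> x \<in> g -` A \<inter> \<Omega>"
    by eventually_elim auto
  then have "g -` A \<inter> \<Omega> \<in> sets lebesgue"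
    by (rule completion.in_sets_AE[OF _ 1]) auto
  then show "g -` A \<inter> space (lebesgue_on \<Omega>) \<in> sets (lebesgue_on \<Omega>)"
    using O by (simp add: sets_restrict_space_iff)
qed auto

section \<open>Modulars of a bounded variable exponent\<close>

locale exponent_domain =
  fixes \<Omega> :: "'a::euclidean_space set" and p :: "'a \<Rightarrow> real" and r P :: real
  assumes open_dom: "open \<Omega>" and bounded_dom: "bounded \<Omega>"
    and p_cont: "continuous_on (closure \<Omega>) p" and r_gt_1: "1 < r"
    and p_bounds: "\<And>x. x \<in> \<Omega> \<Longrightarrow> r \<le> p x \<and> p x \<le> P"
begin

abbreviation \<mu> :: "'a measure" where "\<mu> \<equiv> lebesgue_on \<Omega>"

lemma p_pos: "x \<in> \<Omega> \<Longrightarrow> 0 < p x" using p_bounds r_gt_1 by force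

lemma p_measurable [measurable]: "p \<in> borel_measurable \<mu>"
  using open_dom by (intro continuous_imp_measurable_on_sets_lebesgue continuous_on_subset[OF p_cont] closure_subset) auto

lemma modular_integrand_measurable [measurable]:
  fixes f :: "'a \<Rightarrow> 'b::euclidean_space"
  assumes [measurable]: "f \<in> borel_measurable \<mu>"
  shows "(\<lambda>x. norm (f x) powr p x) \<in> borel_measurable \<mu>"
  by measurable

lemma modular_mono:
  assumes "AE x in \<mu>. norm (f x) \<le> norm (g x)"
  shows "modular \<Omega> p f \<le> modular \<Omega> p g"
  unfolding modular_def
proof (rule nn_integral_mono_AE)
  show "AE x in \<mu>. ennreal (norm (f x) powr p x) \<le> ennreal (norm (g x) powr p x)"
    using assms AE_space by eventually_elim (auto intro!: ennreal_leI powr_mono2 simp: less_imp_le p_pos)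
qed

lemma modular_cong: "AE x in \<mu>. f x = g x \<Longrightarrow> modular \<Omega> p f = modular \<Omega> p g"
  by (intro antisym modular_mono) (auto elim: eventually_mono)

lemma modular_minus_commute: "modular \<Omega> p (\<lambda>x. f x - g x) = modular \<Omega> p (\<lambda>x. g x - f x)"
  by (simp add: modular_def norm_minus_commute)

text \<open>Quasi-triangle inequality. Its factor does not depend on the point, which is why
  modulars can replace norms in limit arguments.\<close>

lemma modular_add:
  fixes f g :: "'a \<Rightarrow> 'b::euclidean_space"
  assumes [measurable]: "f \<in> borel_measurable \<mu>" "g \<in> borel_measurable \<mu>"
  shows "modular \<Omega> p (\<lambda>x. f x + g x) \<le> ennreal (2 powr P) * (modular \<Omega> p f + modular \<Omega> p g)"
proof -
  have "modular \<Omega> p (\<lambda>x. f x + g x) \<le> (\<integral>\<^sup>+ x. ennreal (2 powr P) * (ennreal (norm (f x) powr p x) + ennreal (norm (g x) powr p x)) \<partial>\<mu>)"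
    unfolding modular_def
  proof (rule nn_integral_mono)
    fix x assume x: "x \<in> space \<mu>"
    have "norm (f x + g x) powr p x \<le> (norm (f x) + norm (g x)) powr p x"
      using x by (intro powr_mono2 norm_triangle_ineq) (auto simp: less_imp_le p_pos)
    also have "\<dots> \<le> 2 powr P * (norm (f x) powr p x + norm (g x) powr p x)"
      using x p_bounds p_pos[of x] by (intro powr_add_le) (auto simp: less_imp_le)
    finally show "ennreal (norm (f x + g x) powr p x) \<le> ennreal (2 powr P) * (ennreal (norm (f x) powr p x) + ennreal (norm (g x) powr p x))"
      by (simp add: ennreal_mult[symmetric] ennreal_plus[symmetric] ennreal_leI del: ennreal_plus)
  qed
  also have "\<dots> = ennreal (2 powr P) * (modular \<Omega> p f + modular \<Omega> p g)"
    by (simp add: modular_def nn_integral_cmult nn_integral_add)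
  finally show ?thesis .
qed

lemma modular_scale_le:
  fixes f :: "'a \<Rightarrow> 'b::euclidean_space"
  assumes [measurable]: "f \<in> borel_measurable \<mu>"
    and C: "\<And>x. x \<in> \<Omega> \<Longrightarrow> \<bar>c\<bar> powr p x \<le> C" and C0: "0 \<le> C"
  shows "modular \<Omega> p (\<lambda>x. c *\<^sub>R f x) \<le> ennreal C * modular \<Omega> p f"
proof -
  have "modular \<Omega> p (\<lambda>x. c *\<^sub>R f x) \<le> (\<integral>\<^sup>+ x. ennreal C * ennreal (norm (f x) powr p x) \<partial>\<mu>)"
    unfolding modular_def
  proof (rule nn_integral_mono)
    fix x assume x: "x \<in> space \<mu>"
    have "norm (c *\<^sub>R f x) powr p x = \<bar>c\<bar> powr p x * norm (f x) powr p x" by (simp add: powr_mult)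
    also have "\<dots> \<le> C * norm (f x) powr p x" using x C by (intro mult_right_mono) auto
    finally show "ennreal (norm (c *\<^sub>R f x) powr p x) \<le> ennreal C * ennreal (norm (f x) powr p x)"
      using C0 by (simp add: ennreal_mult[symmetric] ennreal_leI)
  qed
  also have "\<dots> = ennreal C * modular \<Omega> p f" by (simp add: modular_def nn_integral_cmult)
  finally show ?thesis .
qed

lemma powr_le_max: "x \<in> \<Omega> \<Longrightarrow> \<bar>c\<bar> powr p x \<le> max 1 (\<bar>c\<bar> powr P)"
proof -
  assume x: "x \<in> \<Omega>"
  show ?thesis
  proof (cases "\<bar>c\<bar> \<le> 1")
    case True
    then have "\<bar>c\<bar> powr p x \<le> 1" using p_pos[OF x] by (intro powr_le1) auto
    then show ?thesis by simp
  next
    case False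
    then have "\<bar>c\<bar> powr p x \<le> \<bar>c\<bar> powr P" using p_bounds[OF x] by (intro powr_mono) auto
    then show ?thesis by simp
  qed
qed

lemma modular_scale:
  fixes f :: "'a \<Rightarrow> 'b::euclidean_space"
  assumes "f \<in> borel_measurable \<mu>"
  shows "modular \<Omega> p (\<lambda>x. c *\<^sub>R f x) \<le> ennreal (max 1 (\<bar>c\<bar> powr P)) * modular \<Omega> p f"
  using assms powr_le_max by (rule modular_scale_le) auto

lemma modular_scale_small:
  fixes f :: "'a \<Rightarrow> 'b::euclidean_space"
  assumes "f \<in> borel_measurable \<mu>" "\<bar>c\<bar> \<le> 1"
  shows "modular \<Omega> p (\<lambda>x. c *\<^sub>R f x) \<le> ennreal (\<bar>c\<bar> powr r) * modular \<Omega> p f"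
  using assms p_bounds by (intro modular_scale_le) (auto intro: powr_mono')

lemma emeasure_dom: "emeasure lebesgue \<Omega> = ennreal (measure lebesgue \<Omega>)"
  by (rule emeasure_eq_measure2) (rule lmeasurable_open[OF bounded_dom open_dom])

lemma finite_dom: "finite_measure \<mu>"
  by (rule finite_measure_lebesgue_on) (rule lmeasurable_open[OF bounded_dom open_dom])

text \<open>Integrated form of \<open>powr_split_le\<close>. The set D lets a be a lower bound of p
  on a small region instead of all of \<Omega>, which the local Poincare estimate exploits.\<close>

lemma moment_le:
  fixes f :: "'a \<Rightarrow> 'b::euclidean_space"
  assumes [measurable]: "f \<in> borel_measurable \<mu>" and D: "D \<subseteq> \<Omega>" "\<And>x. x \<in> D \<Longrightarrow> a \<le> p x"
    and "0 < d" "d \<le> 1" "0 \<le> a"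
  shows "(\<integral>\<^sup>+ x. ennreal (norm (f x) powr a) * indicator D x \<partial>\<mu>) \<le>
    ennreal (d powr a * measure lebesgue \<Omega>) + ennreal (d powr (- P)) * modular \<Omega> p f"
proof -
  have "(\<integral>\<^sup>+ x. ennreal (norm (f x) powr a) * indicator D x \<partial>\<mu>) \<le>
    (\<integral>\<^sup>+ x. ennreal (d powr a) + ennreal (d powr (- P)) * ennreal (norm (f x) powr p x) \<partial>\<mu>)"
  proof (rule nn_integral_mono)
    fix x assume x: "x \<in> space \<mu>"
    show "ennreal (norm (f x) powr a) * indicator D x \<le> ennreal (d powr a) + ennreal (d powr (- P)) * ennreal (norm (f x) powr p x)"
    proof (cases "x \<in> D")
      case True
      have "norm (f x) powr a \<le> d powr a + d powr (- P) * norm (f x) powr p x"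
        using assms D(2)[OF True] p_bounds[of x] x by (intro powr_split_le) auto
      then show ?thesis using True by (simp add: ennreal_mult[symmetric] ennreal_plus[symmetric] ennreal_leI del: ennreal_plus)
    qed simp
  qed
  also have "\<dots> = ennreal (d powr a * measure lebesgue \<Omega>) + ennreal (d powr (- P)) * modular \<Omega> p f"
    using open_dom by (simp add: nn_integral_add nn_integral_cmult modular_def emeasure_restrict_space emeasure_dom ennreal_mult)
  finally show ?thesis .
qed

lemma moment_tendsto:
  fixes f :: "nat \<Rightarrow> 'a \<Rightarrow> 'b::euclidean_space"
  assumes m: "\<And>n. f n \<in> borel_measurable \<mu>" and D: "D \<subseteq> \<Omega>" "\<And>x. x \<in> D \<Longrightarrow> a \<le> p x"
    and a: "0 < a" and lim: "(\<lambda>n. modular \<Omega> p (f n)) \<longlonglongrightarrow> 0"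
  shows "(\<lambda>n. \<integral>\<^sup>+ x. ennreal (norm (f n x) powr a) * indicator D x \<partial>\<mu>) \<longlonglongrightarrow> 0"
proof (rule ennreal_tendsto_0I)
  fix e :: real assume e: "0 < e"
  define m where "m = measure lebesgue \<Omega>"
  have m0: "0 \<le> m" by (simp add: m_def)
  \<comment> \<open>d is fixed first and makes the additive term at most e/2 for every n; the +1
    covers m = 0. Only then is n taken large against the factor d powr (-P).\<close>
  define d where "d = min 1 ((e / (2 * (m + 1))) powr (1 / a))"
  have d: "0 < d" "d \<le> 1" using e m0 by (auto simp: d_def)
  have "d powr a \<le> ((e / (2 * (m + 1))) powr (1 / a)) powr a"
    using a d by (intro powr_mono2) (auto simp: d_def)
  also have "\<dots> = e / (2 * (m + 1))" using a e m0 by (simp add: powr_powr)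
  finally have "d powr a * m \<le> e / (2 * (m + 1)) * m" using m0 by (intro mult_right_mono)
  also have "\<dots> \<le> e / 2" using e m0 by (simp add: field_simps)
  finally have dm: "d powr a * m \<le> e / 2" .
  have "(\<lambda>n. ennreal (d powr (- P)) * modular \<Omega> p (f n)) \<longlonglongrightarrow> 0"
    by (rule ennreal_tendsto_0_mult[OF lim])
  from ennreal_tendsto_0D[OF this, of "e/2"] e
  have "\<forall>\<^sub>F n in sequentially. ennreal (d powr (- P)) * modular \<Omega> p (f n) \<le> ennreal (e/2)" by simp
  then show "\<forall>\<^sub>F n in sequentially. (\<integral>\<^sup>+ x. ennreal (norm (f n x) powr a) * indicator D x \<partial>\<mu>) \<le> ennreal e"
  proof eventually_elim
    fix n assume n: "ennreal (d powr (- P)) * modular \<Omega> p (f n) \<le> ennreal (e/2)"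
    have "(\<integral>\<^sup>+ x. ennreal (norm (f n x) powr a) * indicator D x \<partial>\<mu>) \<le> ennreal (d powr a * m) + ennreal (d powr (- P)) * modular \<Omega> p (f n)"
      unfolding m_def using assms d by (intro moment_le) auto
    also have "\<dots> \<le> ennreal (e/2) + ennreal (e/2)" using dm n by (intro add_mono ennreal_leI) auto
    also have "\<dots> = ennreal e" using e by (simp add: ennreal_plus[symmetric] del: ennreal_plus)
    finally show "(\<integral>\<^sup>+ x. ennreal (norm (f n x) powr a) * indicator D x \<partial>\<mu>) \<le> ennreal e" .
  qed
qed

lemma L1_le_modular:
  fixes f :: "'a \<Rightarrow> 'b::euclidean_space"
  assumes "f \<in> borel_measurable \<mu>" "0 < d" "d \<le> 1"
  shows "(\<integral>\<^sup>+ x. ennreal (norm (f x)) \<partial>\<mu>) \<le> ennreal (d * measure lebesgue \<Omega>) + ennreal (d powr (- P)) * modular \<Omega> p f"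
proof -
  have "(\<integral>\<^sup>+ x. ennreal (norm (f x)) \<partial>\<mu>) = (\<integral>\<^sup>+ x. ennreal (norm (f x) powr 1) * indicator \<Omega> x \<partial>\<mu>)"
    by (intro nn_integral_cong) auto
  also have "\<dots> \<le> ennreal (d powr 1 * measure lebesgue \<Omega>) + ennreal (d powr (- P)) * modular \<Omega> p f"
    using assms p_bounds r_gt_1 by (intro moment_le) force+
  finally show ?thesis using assms by simp
qed

lemma L1_tendsto:
  fixes f :: "nat \<Rightarrow> 'a \<Rightarrow> 'b::euclidean_space"
  assumes "\<And>n. f n \<in> borel_measurable \<mu>" "(\<lambda>n. modular \<Omega> p (f n)) \<longlonglongrightarrow> 0"
  shows "(\<lambda>n. \<integral>\<^sup>+ x. ennreal (norm (f n x)) \<partial>\<mu>) \<longlonglongrightarrow> 0"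
proof -
  have "(\<lambda>n. \<integral>\<^sup>+ x. ennreal (norm (f n x) powr 1) * indicator \<Omega> x \<partial>\<mu>) \<longlonglongrightarrow> 0"
    using assms p_bounds r_gt_1 by (intro moment_tendsto) force+
  moreover have "(\<integral>\<^sup>+ x. ennreal (norm (f n x) powr 1) * indicator \<Omega> x \<partial>\<mu>) = (\<integral>\<^sup>+ x. ennreal (norm (f n x)) \<partial>\<mu>)" for n
    by (intro nn_integral_cong) auto
  ultimately show ?thesis by simp
qed

lemma modular_finite_integrable:
  fixes f :: "'a \<Rightarrow> 'b::euclidean_space"
  assumes [measurable]: "f \<in> borel_measurable \<mu>" and "modular \<Omega> p f < \<infinity>"
  shows "integrable \<mu> f" "integrable \<mu> (\<lambda>x. norm (f x) powr p x)"
proof -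
  have "(\<integral>\<^sup>+ x. ennreal (norm (f x)) \<partial>\<mu>) \<le> ennreal (1 * measure lebesgue \<Omega>) + ennreal (1 powr (- P)) * modular \<Omega> p f"
    by (rule L1_le_modular) auto
  also have "\<dots> < \<infinity>" using assms(2) by simp
  finally show "integrable \<mu> f" by (simp add: integrable_iff_bounded)
  show "integrable \<mu> (\<lambda>x. norm (f x) powr p x)"
    using assms(2) by (simp add: integrable_iff_bounded modular_def)
qed

lemma modular_AE_subseq:
  fixes f :: "nat \<Rightarrow> 'a \<Rightarrow> 'b::euclidean_space"
  assumes [measurable]: "\<And>n. f n \<in> borel_measurable \<mu>" "g \<in> borel_measurable \<mu>"
    and "(\<lambda>n. modular \<Omega> p (\<lambda>x. f n x - g x)) \<longlonglongrightarrow> 0"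
  obtains s where "strict_mono s" "AE x in \<mu>. (\<lambda>i. f (s i) x) \<longlonglongrightarrow> g x"
proof (rule L1_lim_AE_subseq[of f "\<mu>" g])
  show "(\<lambda>n. \<integral>\<^sup>+ x. ennreal (norm (f n x - g x)) \<partial>\<mu>) \<longlonglongrightarrow> 0"
    by (rule L1_tendsto[of "\<lambda>n x. f n x - g x"]) (use assms in auto)
qed (use that in auto)

text \<open>Fatou's lemma sends one index of the Cauchy condition to infinity along the subsequence.
  The limit g is given in advance because for the minimiser it comes from compactness rather than
  from completeness.\<close>

lemma modular_limit_of_Cauchy:
  fixes f :: "nat \<Rightarrow> 'a \<Rightarrow> 'b::euclidean_space"
  assumes [measurable]: "\<And>n. f n \<in> borel_measurable \<mu>" "g \<in> borel_measurable \<mu>"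
    and s: "strict_mono s" "AE x in \<mu>. (\<lambda>i. f (s i) x) \<longlonglongrightarrow> g x"
    and C: "\<And>e. 0 < e \<Longrightarrow> \<exists>N. \<forall>i\<ge>N. \<forall>j\<ge>N. modular \<Omega> p (\<lambda>x. f i x - f j x) \<le> ennreal e"
  shows "(\<lambda>n. modular \<Omega> p (\<lambda>x. g x - f n x)) \<longlonglongrightarrow> 0"
proof (rule ennreal_tendsto_0I)
  fix e :: real assume "0 < e"
  from C[OF this] obtain N where N: "\<And>i j. i \<ge> N \<Longrightarrow> j \<ge> N \<Longrightarrow> modular \<Omega> p (\<lambda>x. f i x - f j x) \<le> ennreal e" by blast
  have "modular \<Omega> p (\<lambda>x. g x - f n x) \<le> ennreal e" if n: "n \<ge> N" for n
    unfolding modular_def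
  proof (rule Fatou_le)
    show "AE x in \<mu>. (\<lambda>k. ennreal (norm (f (s k) x - f n x) powr p x)) \<longlonglongrightarrow> ennreal (norm (g x - f n x) powr p x)"
      using s(2) AE_space
    proof eventually_elim
      fix x assume l: "(\<lambda>i. f (s i) x) \<longlonglongrightarrow> g x" and x: "x \<in> space \<mu>"
      have "(\<lambda>k. norm (f (s k) x - f n x) powr p x) \<longlonglongrightarrow> norm (g x - f n x) powr p x"
        using x p_pos by (intro tendsto_powr' tendsto_norm tendsto_diff l tendsto_const) auto
      then show "(\<lambda>k. ennreal (norm (f (s k) x - f n x) powr p x)) \<longlonglongrightarrow> ennreal (norm (g x - f n x) powr p x)"
        by (rule tendsto_ennrealI)
    qed
    show "\<forall>\<^sub>F k in sequentially. (\<integral>\<^sup>+ x. ennreal (norm (f (s k) x - f n x) powr p x) \<partial>\<mu>) \<le> ennreal e"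
    proof (rule eventually_sequentiallyI[of N])
      fix k assume "N \<le> k"
      then have "N \<le> s k" using seq_suble[OF s(1), of k] by simp
      from N[OF this n] show "(\<integral>\<^sup>+ x. ennreal (norm (f (s k) x - f n x) powr p x) \<partial>\<mu>) \<le> ennreal e"
        by (simp add: modular_def)
    qed
  qed measurable
  then show "\<forall>\<^sub>F n in sequentially. modular \<Omega> p (\<lambda>x. g x - f n x) \<le> ennreal e"
    by (auto simp: eventually_sequentially)
qed

lemma modular_complete:
  fixes f :: "nat \<Rightarrow> 'a \<Rightarrow> 'b::euclidean_space"
  assumes m: "\<And>n. f n \<in> borel_measurable \<mu>" and fin: "\<And>n. modular \<Omega> p (f n) < \<infinity>"
    and C: "\<And>e. 0 < e \<Longrightarrow> \<exists>N. \<forall>i\<ge>N. \<forall>j\<ge>N. modular \<Omega> p (\<lambda>x. f i x - f j x) \<le> ennreal e"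
  obtains g where "g \<in> borel_measurable \<mu>" "(\<lambda>n. modular \<Omega> p (\<lambda>x. g x - f n x)) \<longlonglongrightarrow> 0"
proof -
  note [measurable] = m
  obtain s g where sg: "strict_mono s" "g \<in> borel_measurable \<mu>" "AE x in \<mu>. (\<lambda>i. f (s i) x) \<longlonglongrightarrow> g x"
  proof (rule L1_Cauchy_subseq[of f "\<mu>"])
    show "(\<integral>\<^sup>+ x. ennreal (norm (f n x)) \<partial>\<mu>) < \<infinity>" for n
      using modular_finite_integrable(1)[OF m fin] by (simp add: integrable_iff_bounded)
    fix e :: real assume e: "0 < e"
    define m where "m = measure lebesgue \<Omega>"
    have m0: "0 \<le> m" by (simp add: m_def)
    define d where "d = min 1 (e / (2 * (m + 1)))"
    have d: "0 < d" "d \<le> 1" using e m0 by (auto simp: d_def)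
    have "d * m \<le> e / (2 * (m + 1)) * m" using m0 by (intro mult_right_mono) (auto simp: d_def)
    also have "\<dots> \<le> e / 2" using e m0 by (simp add: field_simps)
    finally have dm: "d * m \<le> e / 2" .
    \<comment> \<open>Compensates the factor d powr (-P) in the comparison of the L1 norm with the
      modular.\<close>
    define e' where "e' = d powr P * (e / 2)"
    have "0 < e'" using d e by (simp add: e'_def)
    from C[OF this] obtain N where N: "\<And>i j. i \<ge> N \<Longrightarrow> j \<ge> N \<Longrightarrow> modular \<Omega> p (\<lambda>x. f i x - f j x) \<le> ennreal e'" by blast
    have "(\<integral>\<^sup>+ x. ennreal (norm (f i x - f j x)) \<partial>\<mu>) \<le> ennreal e" if "i \<ge> N" "j \<ge> N" for i j
    proof -
      have "(\<integral>\<^sup>+ x. ennreal (norm (f i x - f j x)) \<partial>\<mu>) \<le> ennreal (d * m) + ennreal (d powr (- P)) * modular \<Omega> p (\<lambda>x. f i x - f j x)"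
        unfolding m_def using d by (intro L1_le_modular) auto
      also have "\<dots> \<le> ennreal (e/2) + ennreal (d powr (- P)) * ennreal e'"
        using dm N[OF that] by (intro add_mono ennreal_leI mult_left_mono) auto
      also have "ennreal (d powr (- P)) * ennreal e' = ennreal (e/2)"
        using d e by (simp add: e'_def ennreal_mult[symmetric] powr_minus)
      also have "ennreal (e/2) + ennreal (e/2) = ennreal e" using e by (simp add: ennreal_plus[symmetric] del: ennreal_plus)
      finally show ?thesis .
    qed
    then show "\<exists>N. \<forall>i\<ge>N. \<forall>j\<ge>N. (\<integral>\<^sup>+ x. ennreal (norm (f i x - f j x)) \<partial>\<mu>) \<le> ennreal e" by blast
  qed (use that in auto)
  from modular_limit_of_Cauchy[OF m sg(2,1,3) C] sg(2) show ?thesis by (intro that) auto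
qed

lemma modular_bounded_finite:
  fixes f :: "'a \<Rightarrow> 'b::euclidean_space"
  assumes "\<And>x. norm (f x) \<le> B" shows "modular \<Omega> p f < \<infinity>"
proof -
  interpret finite_measure "\<mu>" by (rule finite_dom)
  have "modular \<Omega> p f \<le> (\<integral>\<^sup>+ x. ennreal (max 1 (\<bar>B\<bar> powr P)) \<partial>\<mu>)"
    unfolding modular_def
  proof (rule nn_integral_mono)
    fix x assume x: "x \<in> space \<mu>"
    have "norm (f x) powr p x \<le> \<bar>B\<bar> powr p x"
      using assms[of x] x p_pos by (intro powr_mono2) (auto simp: less_imp_le)
    also have "\<dots> \<le> max 1 (\<bar>B\<bar> powr P)" using x by (intro powr_le_max) auto
    finally show "ennreal (norm (f x) powr p x) \<le> ennreal (max 1 (\<bar>B\<bar> powr P))" by (rule ennreal_leI)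
  qed
  also have "\<dots> < \<infinity>" by (simp add: ennreal_mult_eq_top_iff less_top[symmetric] emeasure_finite[of \<Omega>, simplified])
  finally show ?thesis .
qed

lemma test_modular_finite: "f \<in> test_functions \<Omega> \<Longrightarrow> modular \<Omega> p f < \<infinity>"
  "f \<in> test_functions \<Omega> \<Longrightarrow> modular \<Omega> p (grad f) < \<infinity>"
  by (metis modular_bounded_finite test_bounded real_norm_def)+

lemma test_measurable_on: "f \<in> test_functions \<Omega> \<Longrightarrow> f \<in> borel_measurable \<mu>"
  "f \<in> test_functions \<Omega> \<Longrightarrow> grad f \<in> borel_measurable \<mu>"
  using measurable_lebesgue_onI[OF open_dom] test_measurable grad_measurable by blast+

end

subsection \<open>Sobolev functions as limits of test functions\<close>

context exponent_domain begin

section \<open>Comparison of the Luxemburg norm with the modular\<close>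

lemma luxemburg_set_nonempty:
  fixes f :: "'a \<Rightarrow> 'b::euclidean_space"
  assumes f: "f \<in> borel_measurable \<mu>" and fin: "modular \<Omega> p f < \<infinity>"
  shows "{\<tau>. \<tau> > 0 \<and> modular \<Omega> p (\<lambda>x. f x /\<^sub>R \<tau>) \<le> 1} \<noteq> {}"
proof -
  obtain K where K: "modular \<Omega> p f = ennreal K" "0 \<le> K" using fin by (cases "modular \<Omega> p f") auto
  \<comment> \<open>As r > 1 and t >= 1, dividing by t lowers the modular at least by the factor 1 /
    t, and K / t is at most 1. Nonemptiness matters because the infimum of an empty set of reals
    carries no information.\<close>
  define t where "t = max 1 K"
  have t: "1 \<le> t" "K \<le> t" "0 < t" by (auto simp: t_def)
  have "modular \<Omega> p (\<lambda>x. f x /\<^sub>R t) \<le> ennreal (\<bar>inverse t\<bar> powr r) * modular \<Omega> p f"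
    using t by (intro modular_scale_small f) (auto simp: inverse_le_1_iff)
  also have "\<dots> \<le> ennreal (inverse t) * ennreal K"
  proof -
    have "\<bar>inverse t\<bar> powr r \<le> \<bar>inverse t\<bar> powr 1"
      using t r_gt_1 by (intro powr_mono') (auto simp: inverse_le_1_iff)
    then show ?thesis using t K by (intro mult_mono) (auto intro!: ennreal_leI)
  qed
  also have "\<dots> \<le> 1" using t K by (simp add: ennreal_mult[symmetric] field_simps)
  finally show ?thesis using t by blast
qed

lemma luxemburg_nonneg:
  fixes f :: "'a \<Rightarrow> 'b::euclidean_space"
  assumes "f \<in> borel_measurable \<mu>" "modular \<Omega> p f < \<infinity>"
  shows "0 \<le> luxemburg_norm \<Omega> p f"
  unfolding luxemburg_norm_def using luxemburg_set_nonempty[OF assms] by (intro cInf_greatest) auto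

text \<open>Together with \<open>luxemburg_less_imp_modular\<close> this shows that convergence to
  zero is the same for norm and modular. For e <= 1, division by e costs at most the factor (1 / e)
  powr P, whence the power P here; the converse estimate has the power r.\<close>

lemma luxemburg_le:
  fixes f :: "'a \<Rightarrow> 'b::euclidean_space"
  assumes f: "f \<in> borel_measurable \<mu>" and e: "0 < e" "e \<le> 1" and m: "modular \<Omega> p f \<le> ennreal (e powr P)"
  shows "luxemburg_norm \<Omega> p f \<le> e"
  unfolding luxemburg_norm_def
proof (rule cInf_lower)
  have "modular \<Omega> p (\<lambda>x. f x /\<^sub>R e) \<le> ennreal ((1/e) powr P) * modular \<Omega> p f"
  proof (rule modular_scale_le[OF f])
    fix x assume "x \<in> \<Omega>"
    then show "\<bar>inverse e\<bar> powr p x \<le> (1/e) powr P"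
      using e p_bounds[of x] by (auto simp: inverse_eq_divide intro!: powr_mono)
  qed simp
  also have "\<dots> \<le> ennreal ((1/e) powr P) * ennreal (e powr P)" by (intro mult_left_mono m) simp
  also have "\<dots> = 1" using e by (simp add: ennreal_mult[symmetric] powr_mult[symmetric])
  finally show "e \<in> {\<tau>. 0 < \<tau> \<and> modular \<Omega> p (\<lambda>x. f x /\<^sub>R \<tau>) \<le> 1}" using e by simp
qed (auto intro!: bdd_belowI[of _ 0])

lemma luxemburg_less_imp_modular:
  fixes f :: "'a \<Rightarrow> 'b::euclidean_space"
  assumes f: "f \<in> borel_measurable \<mu>" and fin: "modular \<Omega> p f < \<infinity>"
    and e: "e \<le> 1" and m: "luxemburg_norm \<Omega> p f < e"
  shows "modular \<Omega> p f \<le> ennreal (e powr r)"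
proof -
  obtain t where t: "0 < t" "t < e" "modular \<Omega> p (\<lambda>x. f x /\<^sub>R t) \<le> 1"
    using m luxemburg_set_nonempty[OF f fin] unfolding luxemburg_norm_def
    by (subst (asm) cInf_less_iff) (auto intro!: bdd_belowI[of _ 0])
  have "modular \<Omega> p f = modular \<Omega> p (\<lambda>x. t *\<^sub>R (f x /\<^sub>R t))" using t by simp
  also have "\<dots> \<le> ennreal (\<bar>t\<bar> powr r) * modular \<Omega> p (\<lambda>x. f x /\<^sub>R t)"
    using f t e by (intro modular_scale_small) auto
  also have "\<dots> \<le> ennreal (e powr r) * 1"
    using t r_gt_1 by (intro mult_mono ennreal_leI powr_mono2) auto
  finally show ?thesis by simp
qed

text \<open>Elements of \<open>W1p0\<close> together with a gradient, described by one sequence of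
  test functions whose values and gradients both converge in modular. Neither the chosen
  \<open>weak_grad\<close> nor a norm occurs. The equivalence with \<open>W1p0\<close> is given by
  \<open>sobolev_pair_imp_W1p0\<close> and \<open>W1p0_imp_sobolev_pair\<close>.\<close>

definition sobolev_pair :: "('a \<Rightarrow> real) \<Rightarrow> ('a \<Rightarrow> 'a) \<Rightarrow> bool" where
  "sobolev_pair u g \<longleftrightarrow> u \<in> borel_measurable \<mu> \<and> g \<in> borel_measurable \<mu> \<and>
     (\<exists>\<eta>. (\<forall>n. \<eta> n \<in> test_functions \<Omega>) \<and> (\<lambda>n. modular \<Omega> p (\<lambda>x. u x - \<eta> n x)) \<longlonglongrightarrow> 0 \<and>
          (\<lambda>n. modular \<Omega> p (\<lambda>x. g x - grad (\<eta> n) x)) \<longlonglongrightarrow> 0)"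

lemma sobolev_pair_test: "\<eta> \<in> test_functions \<Omega> \<Longrightarrow> sobolev_pair \<eta> (grad \<eta>)"
  unfolding sobolev_pair_def by (auto simp: test_measurable_on modular_def intro!: exI[of _ "\<lambda>n. \<eta>"])

lemma sobolev_pair_lincomb:
  assumes "sobolev_pair u g" "sobolev_pair v h"
  shows "sobolev_pair (\<lambda>x. u x + c * v x) (\<lambda>x. g x + c *\<^sub>R h x)"
proof -
  obtain \<eta> \<zeta> where e: "\<And>n. \<eta> n \<in> test_functions \<Omega>" "(\<lambda>n. modular \<Omega> p (\<lambda>x. u x - \<eta> n x)) \<longlonglongrightarrow> 0"
      "(\<lambda>n. modular \<Omega> p (\<lambda>x. g x - grad (\<eta> n) x)) \<longlonglongrightarrow> 0"
    and z: "\<And>n. \<zeta> n \<in> test_functions \<Omega>" "(\<lambda>n. modular \<Omega> p (\<lambda>x. v x - \<zeta> n x)) \<longlonglongrightarrow> 0"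
      "(\<lambda>n. modular \<Omega> p (\<lambda>x. h x - grad (\<zeta> n) x)) \<longlonglongrightarrow> 0"
    using assms by (auto simp: sobolev_pair_def)
  have [measurable]: "u \<in> borel_measurable \<mu>" "g \<in> borel_measurable \<mu>"
    "v \<in> borel_measurable \<mu>" "h \<in> borel_measurable \<mu>"
    using assms by (auto simp: sobolev_pair_def)
  note [measurable] = test_measurable_on[OF e(1)] test_measurable_on[OF z(1)]
  let ?C = "ennreal (max 1 (\<bar>c\<bar> powr P))"
  \<comment> \<open>Stated over an arbitrary Euclidean target so as to serve both the functions and
    their gradients.\<close>
  have gen: "(\<lambda>n. modular \<Omega> p (\<lambda>x. (a x + c *\<^sub>R b x) - (a' n x + c *\<^sub>R b' n x))) \<longlonglongrightarrow> 0"
    if m[measurable]: "a \<in> borel_measurable \<mu>" "b \<in> borel_measurable \<mu>"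
      "\<And>n. a' n \<in> borel_measurable \<mu>" "\<And>n. b' n \<in> borel_measurable \<mu>"
      and l: "(\<lambda>n. modular \<Omega> p (\<lambda>x. a x - a' n x)) \<longlonglongrightarrow> 0" "(\<lambda>n. modular \<Omega> p (\<lambda>x. b x - b' n x)) \<longlonglongrightarrow> 0"
    for a b :: "'a \<Rightarrow> 'b::euclidean_space" and a' b'
  proof (rule ennreal_tendsto_0_le)
    have "(\<lambda>n. modular \<Omega> p (\<lambda>x. a x - a' n x) + ?C * modular \<Omega> p (\<lambda>x. b x - b' n x)) \<longlonglongrightarrow> 0 + 0"
      by (intro tendsto_add l ennreal_tendsto_0_mult)
    then show "(\<lambda>n. ennreal (2 powr P) * (modular \<Omega> p (\<lambda>x. a x - a' n x) + ?C * modular \<Omega> p (\<lambda>x. b x - b' n x))) \<longlonglongrightarrow> 0"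
      by (intro ennreal_tendsto_0_mult) simp
    fix n
    have "modular \<Omega> p (\<lambda>x. (a x + c *\<^sub>R b x) - (a' n x + c *\<^sub>R b' n x)) = modular \<Omega> p (\<lambda>x. (a x - a' n x) + c *\<^sub>R (b x - b' n x))"
      by (simp add: algebra_simps)
    also have "\<dots> \<le> ennreal (2 powr P) * (modular \<Omega> p (\<lambda>x. a x - a' n x) + modular \<Omega> p (\<lambda>x. c *\<^sub>R (b x - b' n x)))"
      by (intro modular_add) measurable
    also have "\<dots> \<le> ennreal (2 powr P) * (modular \<Omega> p (\<lambda>x. a x - a' n x) + ?C * modular \<Omega> p (\<lambda>x. b x - b' n x))"
      by (intro mult_left_mono add_left_mono modular_scale) auto
    finally show "modular \<Omega> p (\<lambda>x. (a x + c *\<^sub>R b x) - (a' n x + c *\<^sub>R b' n x)) \<le>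
      ennreal (2 powr P) * (modular \<Omega> p (\<lambda>x. a x - a' n x) + ?C * modular \<Omega> p (\<lambda>x. b x - b' n x))" .
  qed
  show ?thesis unfolding sobolev_pair_def
  proof (intro conjI exI[of _ "\<lambda>n x. \<eta> n x + c * \<zeta> n x"] allI)
    show "(\<lambda>x. \<eta> n x + c * \<zeta> n x) \<in> test_functions \<Omega>" for n by (intro test_add test_scale e z)
    show "(\<lambda>n. modular \<Omega> p (\<lambda>x. u x + c * v x - (\<eta> n x + c * \<zeta> n x))) \<longlonglongrightarrow> 0"
      using gen[of u v \<eta> \<zeta>] e(2) z(2) test_measurable_on(1)[OF e(1)] test_measurable_on(1)[OF z(1)] by simp
    have "grad (\<lambda>x. \<eta> n x + c * \<zeta> n x) = (\<lambda>x. grad (\<eta> n) x + c *\<^sub>R grad (\<zeta> n) x)" for n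
      using test_imp_smooth[OF e(1)] test_imp_smooth[OF z(1)] test_imp_smooth[OF test_scale[OF z(1)]]
      by (simp add: fun_eq_iff grad_add grad_scale)
    then show "(\<lambda>n. modular \<Omega> p (\<lambda>x. g x + c *\<^sub>R h x - grad (\<lambda>x. \<eta> n x + c * \<zeta> n x) x)) \<longlonglongrightarrow> 0"
      using gen[of g h "\<lambda>n. grad (\<eta> n)" "\<lambda>n. grad (\<zeta> n)"] e(3) z(3) test_measurable_on(2)[OF e(1)] test_measurable_on(2)[OF z(1)] by simp
  qed measurable
qed

lemma modular_finite_of_approx:
  fixes f :: "'a \<Rightarrow> 'b::euclidean_space"
  assumes [measurable]: "f \<in> borel_measurable \<mu>" "\<And>n. f' n \<in> borel_measurable \<mu>"
    and fin: "\<And>n. modular \<Omega> p (f' n) < \<infinity>" and l: "(\<lambda>n. modular \<Omega> p (\<lambda>x. f x - f' n x)) \<longlonglongrightarrow> 0"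
  shows "modular \<Omega> p f < \<infinity>"
proof -
  from ennreal_tendsto_0D[OF l, of 1] obtain n where n: "modular \<Omega> p (\<lambda>x. f x - f' n x) \<le> 1"
    by (auto simp: eventually_sequentially)
  have "modular \<Omega> p f = modular \<Omega> p (\<lambda>x. (f x - f' n x) + f' n x)" by simp
  also have "\<dots> \<le> ennreal (2 powr P) * (modular \<Omega> p (\<lambda>x. f x - f' n x) + modular \<Omega> p (f' n))"
    by (intro modular_add) auto
  also have "\<dots> < \<infinity>" using n fin[of n] by (auto simp: ennreal_mult_less_top intro: le_less_trans)
  finally show ?thesis .
qed

lemma sobolev_pairD:
  assumes "sobolev_pair u g"
  shows "u \<in> borel_measurable \<mu>" "g \<in> borel_measurable \<mu>"
    "modular \<Omega> p u < \<infinity>" "modular \<Omega> p g < \<infinity>"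
proof -
  show u: "u \<in> borel_measurable \<mu>" and g: "g \<in> borel_measurable \<mu>"
    using assms by (auto simp: sobolev_pair_def)
  obtain \<eta> where e: "\<And>n. \<eta> n \<in> test_functions \<Omega>" "(\<lambda>n. modular \<Omega> p (\<lambda>x. u x - \<eta> n x)) \<longlonglongrightarrow> 0"
      "(\<lambda>n. modular \<Omega> p (\<lambda>x. g x - grad (\<eta> n) x)) \<longlonglongrightarrow> 0"
    using assms by (auto simp: sobolev_pair_def)
  show "modular \<Omega> p u < \<infinity>"
    by (rule modular_finite_of_approx[OF u test_measurable_on(1)[OF e(1)] test_modular_finite(1)[OF e(1)] e(2)])
  show "modular \<Omega> p g < \<infinity>"
    by (rule modular_finite_of_approx[OF g test_measurable_on(2)[OF e(1)] test_modular_finite(2)[OF e(1)] e(3)])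
qed

text \<open>Modular convergence implies L1 convergence, and a test function and its partial
  derivatives are bounded; hence both sides of the integration by parts formula pass to the
  limit.\<close>

lemma sobolev_pair_weak_gradient:
  assumes "sobolev_pair u g" shows "is_weak_gradient \<Omega> u g"
  unfolding is_weak_gradient_def
proof (intro conjI ballI)
  note D = sobolev_pairD[OF assms]
  note ui = modular_finite_integrable(1)[OF D(1,3)] and gi = modular_finite_integrable(1)[OF D(2,4)]
  show l: "locally_integrable \<Omega> u" "locally_integrable \<Omega> g"
    using ui gi open_dom by (auto intro: integrable_imp_locally)
  obtain \<eta> where e: "\<And>n. \<eta> n \<in> test_functions \<Omega>" "(\<lambda>n. modular \<Omega> p (\<lambda>x. u x - \<eta> n x)) \<longlonglongrightarrow> 0"
      "(\<lambda>n. modular \<Omega> p (\<lambda>x. g x - grad (\<eta> n) x)) \<longlonglongrightarrow> 0"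
    using assms by (auto simp: sobolev_pair_def)
  fix \<phi> :: "'a \<Rightarrow> real" and b :: 'a assume f: "\<phi> \<in> test_functions \<Omega>" and b: "b \<in> Basis"
  note wg = weak_gradient_test[OF open_dom bounded_dom e(1)]
  note [measurable] = D(1,2) test_measurable_on[OF e(1)] test_measurable_on[OF f] test_measurable_on(1)[OF partial_test[OF f b]]
  \<comment> \<open>The vector c lets one statement cover both sides: c = 1 in the reals for the
    values, c = b for a component of the gradient.\<close>
  have gen: "(\<lambda>n. \<integral>x. (f' n x \<bullet> c) * w x \<partial>\<mu>) \<longlonglongrightarrow> (\<integral>x. (f x \<bullet> c) * w x \<partial>\<mu>)"
    if m[measurable]: "f \<in> borel_measurable \<mu>" "\<And>n. f' n \<in> borel_measurable \<mu>"
      and i: "locally_integrable \<Omega> f" "\<And>n. locally_integrable \<Omega> (f' n)"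
      and lm: "(\<lambda>n. modular \<Omega> p (\<lambda>x. f x - f' n x)) \<longlonglongrightarrow> 0" and w: "w \<in> test_functions \<Omega>" and c: "norm c \<le> 1"
    for f :: "'a \<Rightarrow> 'b::euclidean_space" and f' w c
  proof (rule tendsto_L1_int)
    note [measurable] = test_measurable_on(1)[OF w]
    show "integrable \<mu> (\<lambda>x. (f x \<bullet> c) * w x)" "integrable \<mu> (\<lambda>x. (f' n x \<bullet> c) * w x)" for n
      using i by (auto intro!: locally_integrable_mult_test[OF open_dom _ w] locally_integrable_inner)
    obtain B where B: "0 \<le> B" "\<And>x. \<bar>w x\<bar> \<le> B" using test_bounded[OF w] by metis
    have "(\<lambda>n. \<integral>\<^sup>+ x. ennreal (norm (f x - f' n x)) \<partial>\<mu>) \<longlonglongrightarrow> 0"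
      by (intro L1_tendsto lm) measurable
    from ennreal_tendsto_0_mult[OF this, of B]
    show "(\<lambda>n. \<integral>\<^sup>+ x. ennreal (norm (f' n x \<bullet> c * w x - f x \<bullet> c * w x)) \<partial>\<mu>) \<longlonglongrightarrow> 0"
    proof (rule ennreal_tendsto_0_le)
      fix n
      have "(\<integral>\<^sup>+ x. ennreal (norm (f' n x \<bullet> c * w x - f x \<bullet> c * w x)) \<partial>\<mu>) \<le>
        (\<integral>\<^sup>+ x. ennreal B * ennreal (norm (f x - f' n x)) \<partial>\<mu>)"
      proof (rule nn_integral_mono)
        fix x
        have "norm (f' n x \<bullet> c * w x - f x \<bullet> c * w x) = \<bar>(f x - f' n x) \<bullet> c\<bar> * \<bar>w x\<bar>"
          by (simp add: inner_diff_left left_diff_distrib[symmetric] abs_mult abs_minus_commute)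
        also have "\<dots> \<le> norm (f x - f' n x) * B"
        proof (intro mult_mono B)
          have "\<bar>(f x - f' n x) \<bullet> c\<bar> \<le> norm (f x - f' n x) * norm c" by (rule Cauchy_Schwarz_ineq2)
          also have "\<dots> \<le> norm (f x - f' n x) * 1" by (intro mult_left_mono c) simp
          finally show "\<bar>(f x - f' n x) \<bullet> c\<bar> \<le> norm (f x - f' n x)" by simp
        qed auto
        finally show "ennreal (norm (f' n x \<bullet> c * w x - f x \<bullet> c * w x)) \<le> ennreal B * ennreal (norm (f x - f' n x))"
          using B by (simp add: ennreal_mult[symmetric] ennreal_leI mult.commute)
      qed
      also have "\<dots> = ennreal B * (\<integral>\<^sup>+ x. ennreal (norm (f x - f' n x)) \<partial>\<mu>)"
        by (rule nn_integral_cmult) measurable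
      finally show "(\<integral>\<^sup>+ x. ennreal (norm (f' n x \<bullet> c * w x - f x \<bullet> c * w x)) \<partial>\<mu>) \<le>
        ennreal B * (\<integral>\<^sup>+ x. ennreal (norm (f x - f' n x)) \<partial>\<mu>)" .
    qed
  qed
  have "(\<lambda>n. \<integral>x. (\<eta> n x \<bullet> 1) * partial b \<phi> x \<partial>\<mu>) \<longlonglongrightarrow> (\<integral>x. (u x \<bullet> 1) * partial b \<phi> x \<partial>\<mu>)"
    using wg by (intro gen l e partial_test f b) (auto simp: is_weak_gradient_def)
  moreover have "(\<lambda>n. \<integral>x. (grad (\<eta> n) x \<bullet> b) * \<phi> x \<partial>\<mu>) \<longlonglongrightarrow> (\<integral>x. (g x \<bullet> b) * \<phi> x \<partial>\<mu>)"
    using wg b by (intro gen l e partial_test f b) (auto simp: is_weak_gradient_def)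
  moreover have "(\<integral>x. \<eta> n x * partial b \<phi> x \<partial>\<mu>) = - (\<integral>x. (grad (\<eta> n) x \<bullet> b) * \<phi> x \<partial>\<mu>)" for n
    using wg[of n] f b by (simp add: is_weak_gradient_def)
  ultimately have "(\<lambda>n. - (\<integral>x. (grad (\<eta> n) x \<bullet> b) * \<phi> x \<partial>\<mu>)) \<longlonglongrightarrow> (\<integral>x. u x * partial b \<phi> x \<partial>\<mu>)"
    "(\<lambda>n. - (\<integral>x. (grad (\<eta> n) x \<bullet> b) * \<phi> x \<partial>\<mu>)) \<longlonglongrightarrow> - (\<integral>x. (g x \<bullet> b) * \<phi> x \<partial>\<mu>)"
    by (auto intro: tendsto_minus)
  then show "(\<integral>x. u x * partial b \<phi> x \<partial>\<mu>) = - (\<integral>x. (g x \<bullet> b) * \<phi> x \<partial>\<mu>)"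
    by (rule LIMSEQ_unique)
qed

lemma sobolev_pair_AE:
  assumes "sobolev_pair u g" shows "AE x in \<mu>. weak_grad \<Omega> u x = g x"
  by (rule weak_grad_AE[OF open_dom sobolev_pair_weak_gradient[OF assms]])

lemma sobolev_pair_imp_W1p0:
  assumes "sobolev_pair u g" shows "u \<in> W1p0 \<Omega> p"
proof -
  note D = sobolev_pairD[OF assms]
  obtain \<eta> where e: "\<And>n. \<eta> n \<in> test_functions \<Omega>" "(\<lambda>n. modular \<Omega> p (\<lambda>x. u x - \<eta> n x)) \<longlonglongrightarrow> 0"
      "(\<lambda>n. modular \<Omega> p (\<lambda>x. g x - grad (\<eta> n) x)) \<longlonglongrightarrow> 0"
    using assms by (auto simp: sobolev_pair_def)
  note [measurable] = D(1,2) test_measurable_on[OF e(1)]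
  have "u \<in> W1p \<Omega> p"
    using D sobolev_pair_weak_gradient[OF assms] by (auto simp: W1p_def Lp_var_def)
  moreover have "\<exists>\<eta>\<in>test_functions \<Omega>. W1p_norm \<Omega> p (\<lambda>x. u x - \<eta> x) < \<epsilon>" if eps: "0 < \<epsilon>" for \<epsilon>
  proof -
    define d where "d = min 1 (\<epsilon> / 3)"
    have d: "0 < d" "d \<le> 1" "2 * d < \<epsilon>" using eps by (auto simp: d_def)
    have "0 < d powr P" using d by simp
    then have "\<forall>\<^sub>F n in sequentially. modular \<Omega> p (\<lambda>x. u x - \<eta> n x) \<le> ennreal (d powr P) \<and>
       modular \<Omega> p (\<lambda>x. g x - grad (\<eta> n) x) \<le> ennreal (d powr P)"
      using ennreal_tendsto_0D[OF e(2)] ennreal_tendsto_0D[OF e(3)] by (auto intro: eventually_conj)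
    then obtain n where n: "modular \<Omega> p (\<lambda>x. u x - \<eta> n x) \<le> ennreal (d powr P)"
       "modular \<Omega> p (\<lambda>x. g x - grad (\<eta> n) x) \<le> ennreal (d powr P)"
      by (auto simp: eventually_sequentially)
    have "sobolev_pair (\<lambda>x. u x + (-1) * \<eta> n x) (\<lambda>x. g x + (-1) *\<^sub>R grad (\<eta> n) x)"
      by (intro sobolev_pair_lincomb assms sobolev_pair_test e)
    then have ae: "AE x in \<mu>. weak_grad \<Omega> (\<lambda>x. u x - \<eta> n x) x = g x - grad (\<eta> n) x"
      using sobolev_pair_AE by fastforce
    have m2: "weak_grad \<Omega> (\<lambda>x. u x - \<eta> n x) \<in> borel_measurable \<mu>"
      by (rule measurable_AE_lebesgue_on[OF open_dom, of "\<lambda>x. g x - grad (\<eta> n) x"]) (use ae in \<open>auto elim: eventually_mono\<close>)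
    have "modular \<Omega> p (weak_grad \<Omega> (\<lambda>x. u x - \<eta> n x)) \<le> ennreal (d powr P)"
      using modular_cong[OF ae] n(2) by simp
    then have "luxemburg_norm \<Omega> p (weak_grad \<Omega> (\<lambda>x. u x - \<eta> n x)) \<le> d"
      by (intro luxemburg_le m2 d)
    moreover have "luxemburg_norm \<Omega> p (\<lambda>x. u x - \<eta> n x) \<le> d"
      using n(1) d by (intro luxemburg_le) auto
    ultimately have "W1p_norm \<Omega> p (\<lambda>x. u x - \<eta> n x) < \<epsilon>" using d by (simp add: W1p_norm_def)
    then show ?thesis using e(1) by blast
  qed
  ultimately show ?thesis by (simp add: W1p0_def)
qed

text \<open>Approximants with norm below 1 / (n + 1) are converted into modular bounds. Splitting
  the sum of the two Luxemburg norms requires both to be nonnegative, hence finite modulars, and the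
  chosen gradient of the difference must be identified almost everywhere with the difference of the
  gradients.\<close>

lemma W1p0_imp_sobolev_pair:
  assumes "u \<in> W1p0 \<Omega> p" shows "sobolev_pair u (weak_grad \<Omega> u)"
proof -
  obtain g where g: "is_weak_gradient \<Omega> u g" "g \<in> Lp_var \<Omega> p" and u: "u \<in> Lp_var \<Omega> p"
    using assms by (auto simp: W1p0_def W1p_def)
  have um[measurable]: "u \<in> borel_measurable \<mu>" "g \<in> borel_measurable \<mu>"
    using u g by (auto simp: Lp_var_def)
  have fin: "modular \<Omega> p u < \<infinity>" "modular \<Omega> p g < \<infinity>" using u g by (auto simp: Lp_var_def)
  have aeg: "AE x in \<mu>. weak_grad \<Omega> u x = g x" by (rule weak_grad_AE[OF open_dom g(1)])
  have wm[measurable]: "weak_grad \<Omega> u \<in> borel_measurable \<mu>"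
    by (rule measurable_AE_lebesgue_on[OF open_dom um(2)]) (use aeg in \<open>auto elim: eventually_mono\<close>)
  have "\<forall>n. \<exists>\<eta>\<in>test_functions \<Omega>. W1p_norm \<Omega> p (\<lambda>x. u x - \<eta> x) < inverse (real (Suc n))"
    using assms by (auto simp: W1p0_def simp del: of_nat_Suc)
  then obtain \<eta> where e: "\<And>n. \<eta> n \<in> test_functions \<Omega>" "\<And>n. W1p_norm \<Omega> p (\<lambda>x. u x - \<eta> n x) < inverse (real (Suc n))"
    by metis
  note [measurable] = test_measurable_on[OF e(1)]
  have lim: "(\<lambda>n. ennreal (inverse (real (Suc n)) powr r)) \<longlonglongrightarrow> 0"
  proof -
    have "(\<lambda>n. inverse (real (Suc n)) powr r) \<longlonglongrightarrow> 0 powr r"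
      using r_gt_1 by (intro tendsto_powr' LIMSEQ_inverse_real_of_nat tendsto_const) auto
    then show ?thesis by (simp add: ennreal_tendsto_0_iff)
  qed
  have key: "modular \<Omega> p (\<lambda>x. u x - \<eta> n x) \<le> ennreal (inverse (real (Suc n)) powr r) \<and>
    modular \<Omega> p (\<lambda>x. weak_grad \<Omega> u x - grad (\<eta> n) x) \<le> ennreal (inverse (real (Suc n)) powr r)" for n
  proof -
    have "is_weak_gradient \<Omega> (\<lambda>x. u x + (-1) * \<eta> n x) (\<lambda>x. g x + (-1) *\<^sub>R grad (\<eta> n) x)"
      by (intro weak_gradient_lincomb open_dom g weak_gradient_test e bounded_dom)
    then have ae: "AE x in \<mu>. weak_grad \<Omega> (\<lambda>x. u x - \<eta> n x) x = g x - grad (\<eta> n) x"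
      using weak_grad_AE[OF open_dom] by fastforce
    have m2: "weak_grad \<Omega> (\<lambda>x. u x - \<eta> n x) \<in> borel_measurable \<mu>"
      by (rule measurable_AE_lebesgue_on[OF open_dom, of "\<lambda>x. g x - grad (\<eta> n) x"]) (use ae in \<open>auto elim: eventually_mono\<close>)
    have f1: "modular \<Omega> p (\<lambda>x. u x - \<eta> n x) < \<infinity>"
    proof -
      have "modular \<Omega> p (\<lambda>x. u x + (- \<eta> n x)) \<le> ennreal (2 powr P) * (modular \<Omega> p u + modular \<Omega> p (\<lambda>x. - \<eta> n x))"
        by (intro modular_add) auto
      also have "modular \<Omega> p (\<lambda>x. - \<eta> n x) = modular \<Omega> p (\<eta> n)" by (simp add: modular_def)
      also have "ennreal (2 powr P) * (modular \<Omega> p u + modular \<Omega> p (\<eta> n)) < \<infinity>"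
        using fin test_modular_finite[OF e(1)[of n]] by (simp add: ennreal_mult_less_top)
      finally show ?thesis by simp
    qed
    have f2: "modular \<Omega> p (\<lambda>x. g x - grad (\<eta> n) x) < \<infinity>"
    proof -
      have "modular \<Omega> p (\<lambda>x. g x + (- grad (\<eta> n) x)) \<le> ennreal (2 powr P) * (modular \<Omega> p g + modular \<Omega> p (\<lambda>x. - grad (\<eta> n) x))"
        by (intro modular_add) auto
      also have "modular \<Omega> p (\<lambda>x. - grad (\<eta> n) x) = modular \<Omega> p (grad (\<eta> n))" by (simp add: modular_def)
      also have "ennreal (2 powr P) * (modular \<Omega> p g + modular \<Omega> p (grad (\<eta> n))) < \<infinity>"
        using fin test_modular_finite[OF e(1)[of n]] by (simp add: ennreal_mult_less_top)
      finally show ?thesis by simp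
    qed
    have f2': "modular \<Omega> p (weak_grad \<Omega> (\<lambda>x. u x - \<eta> n x)) < \<infinity>"
      using f2 modular_cong[OF ae] by simp
    have sum: "luxemburg_norm \<Omega> p (\<lambda>x. u x - \<eta> n x) + luxemburg_norm \<Omega> p (weak_grad \<Omega> (\<lambda>x. u x - \<eta> n x)) < inverse (real (Suc n))"
      using e(2)[of n] by (simp add: W1p_norm_def)
    have nn: "0 \<le> luxemburg_norm \<Omega> p (\<lambda>x. u x - \<eta> n x)" "0 \<le> luxemburg_norm \<Omega> p (weak_grad \<Omega> (\<lambda>x. u x - \<eta> n x))"
      using f1 f2' m2 by (auto intro!: luxemburg_nonneg)
    have le1: "inverse (real (Suc n)) \<le> 1" by (simp add: inverse_le_1_iff)
    have "modular \<Omega> p (\<lambda>x. u x - \<eta> n x) \<le> ennreal (inverse (real (Suc n)) powr r)"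
      using sum nn f1 by (intro luxemburg_less_imp_modular le1) auto
    moreover have "modular \<Omega> p (weak_grad \<Omega> (\<lambda>x. u x - \<eta> n x)) \<le> ennreal (inverse (real (Suc n)) powr r)"
      using sum nn f2' m2 by (intro luxemburg_less_imp_modular le1) auto
    moreover have "modular \<Omega> p (weak_grad \<Omega> (\<lambda>x. u x - \<eta> n x)) = modular \<Omega> p (\<lambda>x. weak_grad \<Omega> u x - grad (\<eta> n) x)"
      using ae aeg by (intro modular_cong) (auto elim: eventually_elim2)
    ultimately show ?thesis by simp
  qed
  show ?thesis unfolding sobolev_pair_def
    using um wm e(1) key by (auto intro!: exI[of _ \<eta>] ennreal_tendsto_0_le[OF lim])
qed

end

subsection \<open>Averaging over directions\<close>

text \<open>Mean value theorem between z and 1, using that x powr (b - 1) is strictly increasing.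
  Strictness is kept because uniform convexity will be deduced from it by compactness.\<close>

lemma Bernoulli_powr_strict:
  fixes z :: real
  assumes b: "1 < b" and z: "0 \<le> z" "z \<noteq> 1"
  shows "1 + b * (z - 1) < z powr b"
proof -
  have D: "((\<lambda>z. z powr b) has_real_derivative b * x powr (b - 1)) (at x)" if "0 < x" for x
    using that by (rule has_real_derivative_powr)
  consider "z = 0" | "0 < z" "z < 1" | "1 < z" using z by linarith
  then show ?thesis
  proof cases
    case 1
    then show ?thesis using b by simp
  next
    case 2
    obtain x where x: "z < x" "x < 1" "1 powr b - z powr b = (1 - z) * (b * x powr (b - 1))"
      using MVT2[of z 1 "\<lambda>z. z powr b" "\<lambda>x. b * x powr (b - 1)"] D 2 by force
    have "x powr (b - 1) < 1 powr (b - 1)" using x 2 b by (intro powr_less_mono2) auto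
    then have "(1 - z) * (b * x powr (b - 1)) < (1 - z) * (b * 1)"
      using 2 b by (intro mult_strict_left_mono) auto
    then show ?thesis using x by (simp add: algebra_simps)
  next
    case 3
    obtain x where x: "1 < x" "x < z" "z powr b - 1 powr b = (z - 1) * (b * x powr (b - 1))"
      using MVT2[of 1 z "\<lambda>z. z powr b" "\<lambda>x. b * x powr (b - 1)"] D 3 by force
    have "1 powr (b - 1) < x powr (b - 1)" using x b by (intro powr_less_mono2) auto
    then have "(z - 1) * (b * 1) < (z - 1) * (b * x powr (b - 1))"
      using 3 b by (intro mult_strict_left_mono) auto
    then show ?thesis using x by (simp add: algebra_simps)
  qed
qed

text \<open>Bernoulli's inequality at z = y / c, multiplied by c powr b: the power function lies
  above its tangent at c.\<close>

lemma powr_tangent_strict: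
  fixes y :: real
  assumes b: "1 < b" and y: "0 \<le> y" and c: "0 < c" and ne: "y \<noteq> c"
  shows "b * c powr (b - 1) * y < y powr b + (b - 1) * c powr b"
proof -
  have "1 + b * (y / c - 1) < (y / c) powr b"
    using assms by (intro Bernoulli_powr_strict) auto
  then have "c powr b * (1 + b * (y / c - 1)) < c powr b * (y / c) powr b"
    using c by (intro mult_strict_left_mono) auto
  also have "\<dots> = y powr b" using c y by (simp add: powr_mult[symmetric])
  also have "c powr b * (1 + b * (y / c - 1)) = b * (c powr b / c) * y - (b - 1) * c powr b"
    using c by (simp add: field_simps)
  also have "c powr b / c = c powr (b - 1)" using c by (simp add: powr_diff)
  finally show ?thesis by simp
qed

lemma powr_tangent:
  fixes y :: real
  assumes "1 \<le> b" "0 \<le> y" "0 < c"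
  shows "b * c powr (b - 1) * y \<le> y powr b + (b - 1) * c powr b"
proof (cases "b = 1")
  case False
  show ?thesis
  proof (cases "y = c")
    case True
    have "c powr (b - 1) * c = c powr b" using assms by (simp add: powr_diff)
    then have e: "b * c powr (b - 1) * c = b * c powr b" by (simp add: mult.assoc)
    show ?thesis unfolding True e by (simp add: algebra_simps)
  qed (use powr_tangent_strict[of b y c] False assms in auto)
qed (use assms in auto)

text \<open>The tangent inequality at the mean c = I / m is integrated. Since I need only be a lower
  bound of the integral, a quantity dominated by an average can be inserted directly.\<close>

lemma nn_integral_Jensen_powr:
  assumes [measurable]: "f \<in> borel_measurable M" and f: "\<And>x. 0 \<le> f x"
    and m: "emeasure M (space M) = ennreal m" "0 < m" and b: "1 \<le> b" and I: "0 \<le> I"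
    and le: "ennreal I \<le> (\<integral>\<^sup>+ x. ennreal (f x) \<partial>M)"
  shows "ennreal (I powr b) \<le> ennreal (m powr (b - 1)) * (\<integral>\<^sup>+ x. ennreal (f x powr b) \<partial>M)"
proof (cases "I = 0 \<or> (\<integral>\<^sup>+ x. ennreal (f x powr b) \<partial>M) = \<infinity>")
  case True
  then show ?thesis using m by (auto simp: ennreal_mult_top)
next
  case False
  then obtain X where X: "(\<integral>\<^sup>+ x. ennreal (f x powr b) \<partial>M) = ennreal X" "0 \<le> X"
    by (cases "\<integral>\<^sup>+ x. ennreal (f x powr b) \<partial>M") auto
  define c where "c = I / m"
  have c: "0 < c" "I = c * m" using False I m by (auto simp: c_def)
  have "ennreal (b * c powr (b - 1)) * ennreal I \<le> ennreal (b * c powr (b - 1)) * (\<integral>\<^sup>+ x. ennreal (f x) \<partial>M)"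
    by (intro mult_left_mono le) simp
  also have "\<dots> = (\<integral>\<^sup>+ x. ennreal (b * c powr (b - 1)) * ennreal (f x) \<partial>M)"
    by (rule nn_integral_cmult[symmetric]) measurable
  also have "\<dots> \<le> (\<integral>\<^sup>+ x. ennreal (f x powr b) + ennreal ((b - 1) * c powr b) \<partial>M)"
  proof (rule nn_integral_mono)
    fix x
    show "ennreal (b * c powr (b - 1)) * ennreal (f x) \<le> ennreal (f x powr b) + ennreal ((b - 1) * c powr b)"
      using powr_tangent[OF b f c(1), of x] b f[of x] by (simp add: ennreal_mult[symmetric] ennreal_plus[symmetric] ennreal_leI del: ennreal_plus)
  qed
  also have "\<dots> = ennreal X + ennreal ((b - 1) * c powr b) * ennreal m"
    using X m by (simp add: nn_integral_add)
  also have "\<dots> = ennreal (X + (b - 1) * c powr b * m)"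
    using X m b by (simp add: ennreal_mult[symmetric] ennreal_plus[symmetric] del: ennreal_plus)
  also have "ennreal (b * c powr (b - 1)) * ennreal I = ennreal (b * c powr b * m)"
  proof -
    have "c powr (b - 1) * c = c powr b" using c by (simp add: powr_diff)
    then have e: "b * c powr (b - 1) * I = b * c powr b * m"
      unfolding c(2) by (metis mult.assoc)
    have "ennreal (b * c powr (b - 1)) * ennreal I = ennreal (b * c powr (b - 1) * I)"
      using b I by (intro ennreal_mult[symmetric]) auto
    then show ?thesis unfolding e .
  qed
  finally have "b * c powr b * m \<le> X + (b - 1) * c powr b * m"
    using X m b by (subst (asm) ennreal_le_iff) auto
  then have le2: "c powr b * m \<le> X" by (simp add: algebra_simps)
  have "I powr b = c powr b * m powr b" using c m by (simp add: powr_mult)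
  also have "m powr b = m powr (b - 1) * m" using m by (simp add: powr_diff)
  also have "c powr b * (m powr (b - 1) * m) = m powr (b - 1) * (c powr b * m)" by simp
  also have "\<dots> \<le> m powr (b - 1) * X" by (intro mult_left_mono le2) simp
  finally show ?thesis using X by (simp add: ennreal_mult[symmetric] ennreal_leI)
qed

lemma nn_integral_affine:
  fixes f :: "'a::euclidean_space \<Rightarrow> ennreal"
  assumes [measurable]: "f \<in> borel_measurable borel" and t: "0 < t"
  shows "(\<integral>\<^sup>+ y. f (x + t *\<^sub>R y) \<partial>lborel) = ennreal (1 / t ^ DIM('a)) * (\<integral>\<^sup>+ y. f y \<partial>lborel)"
proof -
  have "(\<integral>\<^sup>+ y. f y \<partial>lborel) = (\<integral>\<^sup>+ y. f y \<partial>density (distr lborel borel (\<lambda>y. x + t *\<^sub>R y)) (\<lambda>_. ennreal (\<bar>t\<bar> ^ DIM('a))))"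
    using t by (subst lborel_affine[of t x]) (auto simp: ennreal_power)
  also have "\<dots> = ennreal (t ^ DIM('a)) * (\<integral>\<^sup>+ y. f (x + t *\<^sub>R y) \<partial>lborel)"
    using t by (simp add: nn_integral_density nn_integral_distr nn_integral_cmult)
  finally have "ennreal (1 / t ^ DIM('a)) * (\<integral>\<^sup>+ y. f y \<partial>lborel) =
     (ennreal (1 / t ^ DIM('a)) * ennreal (t ^ DIM('a))) * (\<integral>\<^sup>+ y. f (x + t *\<^sub>R y) \<partial>lborel)"
    by (simp add: mult.assoc)
  also have "ennreal (1 / t ^ DIM('a)) * ennreal (t ^ DIM('a)) = 1"
    using t by (simp add: ennreal_mult[symmetric])
  finally show ?thesis by simp
qed

lemma nn_integral_translate:
  fixes f :: "'a::euclidean_space \<Rightarrow> ennreal"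
  assumes [measurable]: "f \<in> borel_measurable borel"
  shows "(\<integral>\<^sup>+ x. f (x + c) \<partial>lborel) = (\<integral>\<^sup>+ x. f x \<partial>lborel)"
  using nn_integral_affine[OF assms, of 1 c] by (simp add: add.commute)

lemma nn_integral_powr_0:
  assumes "-1 < e" "0 < \<rho>"
  shows "(\<integral>\<^sup>+ t. ennreal (t powr e) * indicator {0<..<\<rho>} t \<partial>lborel) = ennreal (\<rho> powr (e + 1) / (e + 1))"
proof -
  have "(\<integral>\<^sup>+ t. ennreal (t powr e) * indicator {0<..<\<rho>} t \<partial>lborel) = (\<integral>\<^sup>+ t. ennreal (t powr e) * indicator {0..\<rho>} t \<partial>lborel)"
    using AE_lborel_singleton[of 0] AE_lborel_singleton[of \<rho>]
    by (intro nn_integral_cong_AE) (auto elim!: eventually_elim2 simp: indicator_def)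
  also have "\<dots> = ennreal (\<rho> powr (e + 1) / (e + 1))"
    using assms by (intro nn_integral_has_integral_lebesgue' has_integral_powr_from_0) auto
  finally show ?thesis .
qed

text \<open>The averages over the dilated sets \<open>t *\<^sub>R B\<close> are controlled in mean by \<open>\<integral> h\<close> and pointwise by
  \<open>t\<^sup>-\<^sup>N \<integral> h\<close>. Interpolating between the two raises the integrability exponent; the weight
  \<open>t powr - \<kappa>\<close> in the application of Jensen's inequality is chosen so that all exponents below the
  Sobolev exponent are reached.\<close>

definition averaging_const :: "'a::euclidean_space set \<Rightarrow> real \<Rightarrow> real \<Rightarrow> real \<Rightarrow> real \<Rightarrow> bool" where
  "averaging_const B \<rho> a b C \<longleftrightarrow> 0 \<le> C \<and> (\<forall>(g :: 'a \<Rightarrow> real) D U F H. g \<in> borel_measurable borel \<longrightarrow> (\<forall>x. 0 \<le> g x) \<longrightarrow> (\<exists>K. \<forall>x. g x \<le> K) \<longrightarrow>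
     D \<in> sets borel \<longrightarrow> U \<in> sets borel \<longrightarrow> (\<forall>x\<in>D. \<forall>t\<in>{0<..<\<rho>}. \<forall>\<theta>\<in>B. x + t *\<^sub>R \<theta> \<in> U) \<longrightarrow> 0 < H \<longrightarrow>
     (\<integral>\<^sup>+ x. ennreal (g x powr a) * indicator U x \<partial>lborel) \<le> ennreal H \<longrightarrow>
     (\<forall>x\<in>D. 0 \<le> F x \<and> ennreal (F x) \<le> (\<integral>\<^sup>+ t. (\<integral>\<^sup>+ \<theta>. ennreal (g (x + t *\<^sub>R \<theta>)) * indicator B \<theta> \<partial>lborel) * indicator {0<..<\<rho>} t \<partial>lborel)) \<longrightarrow>
     (\<integral>\<^sup>+ x. ennreal (F x powr b) * indicator D x \<partial>lborel) \<le> ennreal (C * H powr (b / a)))"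

lemma averaging_constD:
  fixes g :: "'a::euclidean_space \<Rightarrow> real"
  assumes C: "averaging_const B \<rho> a b C"
    and h: "g \<in> borel_measurable borel" "\<And>x. 0 \<le> g x" "\<And>x. g x \<le> K" "D \<in> sets borel" "U \<in> sets borel"
      "\<And>x t \<theta>. x \<in> D \<Longrightarrow> t \<in> {0<..<\<rho>} \<Longrightarrow> \<theta> \<in> B \<Longrightarrow> x + t *\<^sub>R \<theta> \<in> U" "0 < H"
      "(\<integral>\<^sup>+ x. ennreal (g x powr a) * indicator U x \<partial>lborel) \<le> ennreal H"
      "\<And>x. x \<in> D \<Longrightarrow> 0 \<le> F x"
      "\<And>x. x \<in> D \<Longrightarrow> ennreal (F x) \<le> (\<integral>\<^sup>+ t. (\<integral>\<^sup>+ \<theta>. ennreal (g (x + t *\<^sub>R \<theta>)) * indicator B \<theta> \<partial>lborel) * indicator {0<..<\<rho>} t \<partial>lborel)"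
  shows "(\<integral>\<^sup>+ x. ennreal (F x powr b) * indicator D x \<partial>lborel) \<le> ennreal (C * H powr (b / a))"
proof -
  have all: "\<forall>(g :: 'a \<Rightarrow> real) D U F H. g \<in> borel_measurable borel \<longrightarrow> (\<forall>x. 0 \<le> g x) \<longrightarrow> (\<exists>K. \<forall>x. g x \<le> K) \<longrightarrow>
     D \<in> sets borel \<longrightarrow> U \<in> sets borel \<longrightarrow> (\<forall>x\<in>D. \<forall>t\<in>{0<..<\<rho>}. \<forall>\<theta>\<in>B. x + t *\<^sub>R \<theta> \<in> U) \<longrightarrow> 0 < H \<longrightarrow>
     (\<integral>\<^sup>+ x. ennreal (g x powr a) * indicator U x \<partial>lborel) \<le> ennreal H \<longrightarrow>
     (\<forall>x\<in>D. 0 \<le> F x \<and> ennreal (F x) \<le> (\<integral>\<^sup>+ t. (\<integral>\<^sup>+ \<theta>. ennreal (g (x + t *\<^sub>R \<theta>)) * indicator B \<theta> \<partial>lborel) * indicator {0<..<\<rho>} t \<partial>lborel)) \<longrightarrow>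
     (\<integral>\<^sup>+ x. ennreal (F x powr b) * indicator D x \<partial>lborel) \<le> ennreal (C * H powr (b / a))"
    using C unfolding averaging_const_def by (rule conjunct2)
  have "\<exists>K. \<forall>x. g x \<le> K" "\<forall>x. 0 \<le> g x" "\<forall>x\<in>D. \<forall>t\<in>{0<..<\<rho>}. \<forall>\<theta>\<in>B. x + t *\<^sub>R \<theta> \<in> U"
    "\<forall>x\<in>D. 0 \<le> F x \<and> ennreal (F x) \<le> (\<integral>\<^sup>+ t. (\<integral>\<^sup>+ \<theta>. ennreal (g (x + t *\<^sub>R \<theta>)) * indicator B \<theta> \<partial>lborel) * indicator {0<..<\<rho>} t \<partial>lborel)"
    using h by auto
  note h' = h(1) this(2,1) h(4,5) this(3) h(7,8) this(4)
  show ?thesis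
    by (rule all[THEN spec[of _ g], THEN spec[of _ D], THEN spec[of _ U], THEN spec[of _ F], THEN spec[of _ H],
        THEN mp, THEN mp, THEN mp, THEN mp, THEN mp, THEN mp, THEN mp, THEN mp, THEN mp]) (fact h')+
qed

text \<open>Write A for the integral of g over the directions at dilation t and M for that of the
  a-th power. Jensen's inequality bounds A powr a by a multiple of M. With c = b / a, the factor M
  powr (c - 1) is estimated pointwise by a power of t and of H, while the remaining factor M is
  integrated over x and gives at most \<beta> H. A second Jensen inequality treats the integral over
  t. The hypothesis on a and b says N(c - 1) < b.\<close>

lemma averaging_bound:
  fixes B :: "'a::euclidean_space set"
  assumes [measurable]: "B \<in> sets borel" and \<beta>: "emeasure lborel B = ennreal \<beta>" "0 < \<beta>" and \<rho>: "0 < \<rho>"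
    and ab: "1 \<le> a" "a \<le> b" "real DIM('a) * (b - a) < a * b"
  obtains C where "0 \<le> C" "averaging_const B \<rho> a b C"
proof -
  define N where "N = real DIM('a)"
  define c where "c = b / a"
  have c1: "1 \<le> c" using ab by (simp add: c_def)
  have b1: "1 \<le> b" using ab by simp
  have Nc: "N * (c - 1) < b"
  proof -
    have "N * (c - 1) = N * (b - a) / a" using ab by (simp add: c_def field_simps)
    also have "\<dots> < a * b / a" using ab by (intro divide_strict_right_mono) (auto simp: N_def)
    finally show ?thesis using ab by simp
  qed
  \<comment> \<open>\<kappa> < 1 makes the weight integrable at 0, and the last condition makes the
    final exponent \<open>e1\<close> exceed -1. Both can be met because N(c - 1) - 1 < b - 1; for b
    = 1 the choice 0 does.\<close>
  obtain \<kappa> where \<kappa>: "0 \<le> \<kappa>" "\<kappa> < 1" "N * (c - 1) - 1 < \<kappa> * (b - 1)"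
  proof (cases "b = 1")
    case True
    then show ?thesis using Nc by (intro that[of 0]) auto
  next
    case False
    then have b: "0 < b - 1" using b1 by simp
    define q where "q = (N * (c - 1) - 1) / (b - 1)"
    have q1: "q < 1" using Nc b by (simp add: q_def divide_less_eq)
    then obtain k where k: "max 0 q < k" "k < 1" using dense[of "max 0 q" 1] by auto
    then have "q < k" by simp
    then have "N * (c - 1) - 1 < k * (b - 1)" using b unfolding q_def by (simp add: pos_divide_less_eq)
    then show ?thesis using k by (intro that[of k]) auto
  qed
  \<comment> \<open>The total power of t: -\<kappa> from the weight, \<kappa> b from the rescaled
    integrand and -N(c - 1) from the pointwise bound of M.\<close>
  define e1 where "e1 = \<kappa> * (b - 1) - N * (c - 1)"
  have e1: "-1 < e1" using \<kappa> by (simp add: e1_def)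
  define m where "m = \<rho> powr (1 - \<kappa>) / (1 - \<kappa>)"
  have m: "0 < m" using \<rho> \<kappa> by (simp add: m_def)
  define m1 where "m1 = \<rho> powr (e1 + 1) / (e1 + 1)"
  have m1: "0 < m1" using \<rho> e1 by (simp add: m1_def)
  define C1 where "C1 = \<beta> powr ((a - 1) * c)"
  have C1: "0 < C1" using \<beta> by (simp add: C1_def)
  define C where "C = m powr (b - 1) * C1 * \<beta> * m1"
  have C: "0 \<le> C" using C1 m1 \<beta> m by (simp add: C_def)
  have "averaging_const B \<rho> a b C" unfolding averaging_const_def
  proof (intro conjI C allI impI)
    fix g :: "'a \<Rightarrow> real" and D U and F :: "'a \<Rightarrow> real" and H :: real
    assume [measurable]: "g \<in> borel_measurable borel" and g0: "\<forall>x. 0 \<le> g x" and gK: "\<exists>K. \<forall>x. g x \<le> K"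
      and [measurable]: "D \<in> sets borel" "U \<in> sets borel" and U: "\<forall>x\<in>D. \<forall>t\<in>{0<..<\<rho>}. \<forall>\<theta>\<in>B. x + t *\<^sub>R \<theta> \<in> U"
      and H: "0 < H" "(\<integral>\<^sup>+ x. ennreal (g x powr a) * indicator U x \<partial>lborel) \<le> ennreal H"
      and F: "\<forall>x\<in>D. 0 \<le> F x \<and> ennreal (F x) \<le> (\<integral>\<^sup>+ t. (\<integral>\<^sup>+ \<theta>. ennreal (g (x + t *\<^sub>R \<theta>)) * indicator B \<theta> \<partial>lborel) * indicator {0<..<\<rho>} t \<partial>lborel)"
    obtain K where K: "\<And>x. g x \<le> K" using gK by blast
    define h where "h x = ennreal (g x powr a) * indicator U x" for x
    have [measurable]: "h \<in> borel_measurable borel" unfolding h_def[abs_def] by measurable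
    define M where "M t x = (\<integral>\<^sup>+ \<theta>. h (x + t *\<^sub>R \<theta>) * indicator B \<theta> \<partial>lborel)" for t x
    \<comment> \<open>The inner integral is finite because g is bounded, so passing to its real
      value loses nothing.\<close>
    define A where "A t x = enn2real (\<integral>\<^sup>+ \<theta>. ennreal (g (x + t *\<^sub>R \<theta>)) * indicator B \<theta> \<partial>lborel)" for t x
    have Aeq: "ennreal (A t x) = (\<integral>\<^sup>+ \<theta>. ennreal (g (x + t *\<^sub>R \<theta>)) * indicator B \<theta> \<partial>lborel)" for t x
    proof -
      have "(\<integral>\<^sup>+ \<theta>. ennreal (g (x + t *\<^sub>R \<theta>)) * indicator B \<theta> \<partial>lborel) \<le> (\<integral>\<^sup>+ \<theta>. ennreal K * indicator B \<theta> \<partial>lborel)"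
        using K by (intro nn_integral_mono mult_right_mono ennreal_leI) auto
      also have "\<dots> < \<infinity>" using \<beta> by (simp add: nn_integral_cmult_indicator ennreal_mult_less_top)
      finally show ?thesis by (simp add: A_def)
    qed
    have A0: "0 \<le> A t x" for t x by (simp add: A_def)
    have [measurable]: "(\<lambda>t. A t x) \<in> borel_measurable borel" for x
      unfolding A_def by measurable
    have [measurable]: "(\<lambda>(t, x). M t x) \<in> borel_measurable (lborel \<Otimes>\<^sub>M lborel)"
      unfolding M_def by measurable
    have Mle: "M t x \<le> ennreal (t powr (- N) * H)" if t: "0 < t" for t x
    proof -
      have "M t x \<le> (\<integral>\<^sup>+ \<theta>. h (x + t *\<^sub>R \<theta>) \<partial>lborel)"
        unfolding M_def by (intro nn_integral_mono) (auto simp: indicator_def)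
      also have "\<dots> = ennreal (1 / t ^ DIM('a)) * (\<integral>\<^sup>+ y. h y \<partial>lborel)"
        using t by (intro nn_integral_affine) auto
      also have "\<dots> \<le> ennreal (1 / t ^ DIM('a)) * ennreal H"
        using H by (intro mult_left_mono) (auto simp: h_def)
      also have "\<dots> = ennreal (t powr (- N) * H)"
        using t H by (simp add: ennreal_mult[symmetric] N_def powr_minus powr_realpow divide_inverse)
      finally show ?thesis .
    qed
    have Mint: "(\<integral>\<^sup>+ x. M t x \<partial>lborel) \<le> ennreal (\<beta> * H)" for t
    proof -
      have "(\<integral>\<^sup>+ x. M t x \<partial>lborel) = (\<integral>\<^sup>+ \<theta>. (\<integral>\<^sup>+ x. h (x + t *\<^sub>R \<theta>) * indicator B \<theta> \<partial>lborel) \<partial>lborel)"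
        unfolding M_def by (rule lborel_pair.Fubini') measurable
      also have "\<dots> = (\<integral>\<^sup>+ \<theta>. (\<integral>\<^sup>+ x. h x \<partial>lborel) * indicator B \<theta> \<partial>lborel)"
      proof (rule nn_integral_cong)
        fix \<theta>
        have "(\<integral>\<^sup>+ x. h (x + t *\<^sub>R \<theta>) * indicator B \<theta> \<partial>lborel) = (\<integral>\<^sup>+ x. h (x + t *\<^sub>R \<theta>) \<partial>lborel) * indicator B \<theta>"
          by (rule nn_integral_multc) measurable
        then show "(\<integral>\<^sup>+ x. h (x + t *\<^sub>R \<theta>) * indicator B \<theta> \<partial>lborel) = (\<integral>\<^sup>+ x. h x \<partial>lborel) * indicator B \<theta>"
          by (simp add: nn_integral_translate)
      qed
      also have "\<dots> = (\<integral>\<^sup>+ x. h x \<partial>lborel) * ennreal \<beta>" using \<beta> by (simp add: nn_integral_cmult_indicator)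
      also have "\<dots> \<le> ennreal H * ennreal \<beta>" using H by (intro mult_right_mono) (auto simp: h_def)
      finally show ?thesis using H \<beta> by (simp add: ennreal_mult[symmetric] mult.commute)
    qed
    have Aa: "ennreal (A t x powr a) \<le> ennreal (\<beta> powr (a - 1)) * M t x" if x: "x \<in> D" and t: "t \<in> {0<..<\<rho>}" for t x
    proof -
      have "ennreal (A t x powr a) \<le> ennreal (\<beta> powr (a - 1)) * (\<integral>\<^sup>+ \<theta>. ennreal (g (x + t *\<^sub>R \<theta>) powr a) \<partial>density lborel (indicator B))"
      proof (rule nn_integral_Jensen_powr)
        show "ennreal (A t x) \<le> (\<integral>\<^sup>+ \<theta>. ennreal (g (x + t *\<^sub>R \<theta>)) \<partial>density lborel (indicator B))"
          by (simp add: nn_integral_density Aeq mult.commute)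
      qed (use \<beta> ab g0 A0 in \<open>auto simp: emeasure_density\<close>)
      also have "(\<integral>\<^sup>+ \<theta>. ennreal (g (x + t *\<^sub>R \<theta>) powr a) \<partial>density lborel (indicator B)) = M t x"
        using U x t by (auto simp: nn_integral_density M_def h_def indicator_def intro!: nn_integral_cong)
      finally show ?thesis .
    qed
    have Ab: "ennreal (A t x powr b) \<le> ennreal (C1 * H powr (c - 1) * t powr (- N * (c - 1))) * M t x"
      if x: "x \<in> D" and t: "t \<in> {0<..<\<rho>}" for t x
    proof -
      have t0: "0 < t" using t by simp
      define M' where "M' = enn2real (M t x)"
      have M': "M t x = ennreal M'" "0 \<le> M'"
        using le_less_trans[OF Mle[OF t0, of x] ennreal_less_top] by (auto simp: M'_def)
      have M'le: "M' \<le> t powr (- N) * H" using Mle[OF t0, of x] M' H by (simp add: ennreal_le_iff)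
      have 1: "A t x powr a \<le> \<beta> powr (a - 1) * M'"
        using Aa[OF x t] M' by (simp add: ennreal_mult[symmetric] ennreal_le_iff)
      have "A t x powr b = (A t x powr a) powr c" using ab by (simp add: powr_powr c_def)
      also have "\<dots> \<le> (\<beta> powr (a - 1) * M') powr c" using 1 c1 by (intro powr_mono2) auto
      also have "\<dots> = C1 * M' powr c" using M' by (simp add: powr_mult powr_powr C1_def)
      also have "M' powr c = M' powr (c - 1) * M'" using M' powr_mult_base[of M' "c - 1"] by (simp add: mult.commute)
      also have "\<dots> \<le> (t powr (- N) * H) powr (c - 1) * M'"
        using M' M'le c1 by (intro mult_right_mono powr_mono2) auto
      also have "(t powr (- N) * H) powr (c - 1) = t powr (- N * (c - 1)) * H powr (c - 1)"
        using H by (simp add: powr_mult powr_powr)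
      finally have "A t x powr b \<le> C1 * H powr (c - 1) * t powr (- N * (c - 1)) * M'"
        using C1 by (simp add: mult_ac)
      then show ?thesis using M' C1 by (simp add: ennreal_mult[symmetric] ennreal_leI)
    qed
    \<comment> \<open>Multiplying and dividing by t powr \<kappa> replaces dt by a measure of total
      mass m on the interval, to which Jensen's inequality applies.\<close>
    let ?w = "\<lambda>t. ennreal (t powr (- \<kappa>)) * indicator {0<..<\<rho>} t"
    have FD: "ennreal (F x powr b) * indicator D x \<le> ennreal (m powr (b - 1) * C1 * H powr (c - 1)) *
        (\<integral>\<^sup>+ t. (ennreal (t powr e1) * indicator {0<..<\<rho>} t) * M t x \<partial>lborel)" for x
    proof (cases "x \<in> D")
      case True
      have "ennreal (F x powr b) \<le> ennreal (m powr (b - 1)) * (\<integral>\<^sup>+ t. ennreal ((t powr \<kappa> * A t x) powr b) \<partial>density lborel ?w)"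
      proof (rule nn_integral_Jensen_powr)
        show "emeasure (density lborel ?w) (space (density lborel ?w)) = ennreal m"
          using nn_integral_powr_0[of "- \<kappa>" \<rho>] \<kappa> \<rho> by (simp add: emeasure_density m_def)
        have "ennreal (F x) \<le> (\<integral>\<^sup>+ t. ennreal (A t x) * indicator {0<..<\<rho>} t \<partial>lborel)"
          using F True by (simp add: Aeq)
        also have "\<dots> = (\<integral>\<^sup>+ t. ?w t * ennreal (t powr \<kappa> * A t x) \<partial>lborel)"
        proof (rule nn_integral_cong)
          fix t :: real
          show "ennreal (A t x) * indicator {0<..<\<rho>} t = ?w t * ennreal (t powr \<kappa> * A t x)"
            using A0[of t x] by (auto simp: indicator_def ennreal_mult[symmetric] mult.assoc[symmetric] powr_add[symmetric])
        qed
        also have "\<dots> = (\<integral>\<^sup>+ t. ennreal (t powr \<kappa> * A t x) \<partial>density lborel ?w)"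
          by (rule nn_integral_density[symmetric]) measurable
        finally show "ennreal (F x) \<le> (\<integral>\<^sup>+ t. ennreal (t powr \<kappa> * A t x) \<partial>density lborel ?w)" .
      qed (use m b1 F True A0 in auto)
      also have "(\<integral>\<^sup>+ t. ennreal ((t powr \<kappa> * A t x) powr b) \<partial>density lborel ?w) =
          (\<integral>\<^sup>+ t. ?w t * ennreal ((t powr \<kappa> * A t x) powr b) \<partial>lborel)"
        by (rule nn_integral_density) measurable
      also have "\<dots> \<le> (\<integral>\<^sup>+ t. ennreal (C1 * H powr (c - 1)) * ((ennreal (t powr e1) * indicator {0<..<\<rho>} t) * M t x) \<partial>lborel)"
      proof (rule nn_integral_mono)
        fix t :: real
        show "?w t * ennreal ((t powr \<kappa> * A t x) powr b) \<le> ennreal (C1 * H powr (c - 1)) * ((ennreal (t powr e1) * indicator {0<..<\<rho>} t) * M t x)"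
        proof (cases "t \<in> {0<..<\<rho>}")
          case t: True
          have "?w t * ennreal ((t powr \<kappa> * A t x) powr b) = ennreal (t powr (- \<kappa>) * t powr (\<kappa> * b)) * ennreal (A t x powr b)"
            using t A0[of t x] by (simp add: powr_mult powr_powr ennreal_mult[symmetric] mult.assoc)
          also have "\<dots> \<le> ennreal (t powr (- \<kappa>) * t powr (\<kappa> * b)) * (ennreal (C1 * H powr (c - 1) * t powr (- N * (c - 1))) * M t x)"
            by (intro mult_left_mono Ab True t) simp
          also have "\<dots> = ennreal (t powr (- \<kappa>) * t powr (\<kappa> * b) * (C1 * H powr (c - 1) * t powr (- N * (c - 1)))) * M t x"
            using C1 by (simp add: ennreal_mult mult.assoc)
          also have "t powr (- \<kappa>) * t powr (\<kappa> * b) * (C1 * H powr (c - 1) * t powr (- N * (c - 1))) = C1 * H powr (c - 1) * t powr e1"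
          proof -
            have "t powr (- \<kappa>) * t powr (\<kappa> * b) * t powr (- N * (c - 1)) = t powr e1"
              by (simp add: powr_add[symmetric] e1_def algebra_simps)
            then show ?thesis by (simp add: mult_ac)
          qed
          also have "ennreal (C1 * H powr (c - 1) * t powr e1) * M t x = ennreal (C1 * H powr (c - 1)) * ((ennreal (t powr e1) * indicator {0<..<\<rho>} t) * M t x)"
            using C1 t by (simp add: ennreal_mult mult.assoc)
          finally show ?thesis .
        qed simp
      qed
      also have "\<dots> = ennreal (C1 * H powr (c - 1)) * (\<integral>\<^sup>+ t. (ennreal (t powr e1) * indicator {0<..<\<rho>} t) * M t x \<partial>lborel)"
        by (rule nn_integral_cmult) measurable
      finally have "ennreal (F x powr b) \<le> ennreal (m powr (b - 1)) * (ennreal (C1 * H powr (c - 1)) * (\<integral>\<^sup>+ t. (ennreal (t powr e1) * indicator {0<..<\<rho>} t) * M t x \<partial>lborel))"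
        by (simp add: mult_left_mono)
      then show ?thesis using True C1 by (simp add: ennreal_mult mult.assoc)
    qed simp
    have "(\<integral>\<^sup>+ x. ennreal (F x powr b) * indicator D x \<partial>lborel) \<le>
      (\<integral>\<^sup>+ x. ennreal (m powr (b - 1) * C1 * H powr (c - 1)) * (\<integral>\<^sup>+ t. (ennreal (t powr e1) * indicator {0<..<\<rho>} t) * M t x \<partial>lborel) \<partial>lborel)"
      by (rule nn_integral_mono) (rule FD)
    also have "\<dots> = ennreal (m powr (b - 1) * C1 * H powr (c - 1)) * (\<integral>\<^sup>+ x. (\<integral>\<^sup>+ t. (ennreal (t powr e1) * indicator {0<..<\<rho>} t) * M t x \<partial>lborel) \<partial>lborel)"
      by (rule nn_integral_cmult) measurable
    also have "(\<integral>\<^sup>+ x. (\<integral>\<^sup>+ t. (ennreal (t powr e1) * indicator {0<..<\<rho>} t) * M t x \<partial>lborel) \<partial>lborel) =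
        (\<integral>\<^sup>+ t. (\<integral>\<^sup>+ x. (ennreal (t powr e1) * indicator {0<..<\<rho>} t) * M t x \<partial>lborel) \<partial>lborel)"
      by (rule lborel_pair.Fubini') measurable
    also have "\<dots> = (\<integral>\<^sup>+ t. (ennreal (t powr e1) * indicator {0<..<\<rho>} t) * (\<integral>\<^sup>+ x. M t x \<partial>lborel) \<partial>lborel)"
      by (intro nn_integral_cong nn_integral_cmult) measurable
    also have "\<dots> \<le> (\<integral>\<^sup>+ t. (ennreal (t powr e1) * indicator {0<..<\<rho>} t) * ennreal (\<beta> * H) \<partial>lborel)"
      by (intro nn_integral_mono mult_left_mono Mint) simp
    also have "\<dots> = ennreal m1 * ennreal (\<beta> * H)"
      using nn_integral_powr_0[OF e1 \<rho>] by (subst nn_integral_multc) (auto simp: m1_def)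
    also have "ennreal (m powr (b - 1) * C1 * H powr (c - 1)) * (ennreal m1 * ennreal (\<beta> * H)) = ennreal (C * H powr c)"
    proof -
      have "H powr c = H powr (c - 1) * H" using H by (simp add: powr_diff)
      then show ?thesis using C1 m1 \<beta> H by (simp add: ennreal_mult[symmetric] C_def mult_ac)
    qed
    finally show "(\<integral>\<^sup>+ x. ennreal (F x powr b) * indicator D x \<partial>lborel) \<le> ennreal (C * H powr (b / a))"
      by (simp add: mult_left_mono c_def)
  qed
  with C show ?thesis by (rule that)
qed

subsection \<open>Sobolev and Poincare inequalities\<close>

lemma line_bound:
  fixes \<theta> :: "'a::euclidean_space"
  assumes f: "f \<in> test_functions \<Omega>" and \<theta>: "norm \<theta> \<le> K" and \<rho>: "0 < \<rho>"
  shows "ennreal \<bar>f (x + \<rho> *\<^sub>R \<theta>) - f x\<bar> \<le> ennreal K * (\<integral>\<^sup>+ t. ennreal (norm (grad f (x + t *\<^sub>R \<theta>))) * indicator {0<..<\<rho>} t \<partial>lborel)"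
proof -
  note s = test_imp_smooth[OF f]
  note [measurable] = grad_measurable[OF f]
  have cont: "isCont (\<lambda>t. grad f (x + t *\<^sub>R \<theta>) \<bullet> \<theta>) t" for t
  proof -
    have "isCont (grad f) y" for y using smooth_cont_grad[OF s] by (simp add: continuous_on_eq_continuous_at)
    then have "isCont (\<lambda>t. grad f (x + t *\<^sub>R \<theta>)) t"
      by (rule isCont_o2[rotated, where g="grad f"]) (auto intro!: continuous_intros)
    then show ?thesis by (rule continuous_inner) (rule continuous_const)
  qed
  have FTC: "has_bochner_integral lborel (\<lambda>t. (grad f (x + t *\<^sub>R \<theta>) \<bullet> \<theta>) * indicator {0..\<rho>} t) (f (x + \<rho> *\<^sub>R \<theta>) - f (x + 0 *\<^sub>R \<theta>))"
    by (rule has_bochner_integral_FTC_Icc_real) (use \<rho> cont test_line_derivative[OF s] in auto)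
  have "ennreal \<bar>f (x + \<rho> *\<^sub>R \<theta>) - f x\<bar> = ennreal (norm (integral\<^sup>L lborel (\<lambda>t. (grad f (x + t *\<^sub>R \<theta>) \<bullet> \<theta>) * indicator {0..\<rho>} t)))"
    using has_bochner_integral_integral_eq[OF FTC] by simp
  also have "\<dots> \<le> (\<integral>\<^sup>+ t. ennreal (norm ((grad f (x + t *\<^sub>R \<theta>) \<bullet> \<theta>) * indicator {0..\<rho>} t)) \<partial>lborel)"
    using FTC by (intro integral_norm_bound_ennreal) (auto simp: has_bochner_integral_iff)
  also have "\<dots> \<le> (\<integral>\<^sup>+ t. ennreal K * (ennreal (norm (grad f (x + t *\<^sub>R \<theta>))) * indicator {0<..<\<rho>} t) \<partial>lborel)"
  proof (rule nn_integral_mono_AE)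
    show "AE t in lborel. ennreal (norm ((grad f (x + t *\<^sub>R \<theta>) \<bullet> \<theta>) * indicator {0..\<rho>} t)) \<le> ennreal K * (ennreal (norm (grad f (x + t *\<^sub>R \<theta>))) * indicator {0<..<\<rho>} t)"
      using AE_lborel_singleton[of 0] AE_lborel_singleton[of \<rho>]
    proof eventually_elim
      fix t :: real assume t: "t \<noteq> 0" "t \<noteq> \<rho>"
      have "\<bar>grad f (x + t *\<^sub>R \<theta>) \<bullet> \<theta>\<bar> \<le> norm (grad f (x + t *\<^sub>R \<theta>)) * norm \<theta>" by (rule Cauchy_Schwarz_ineq2)
      also have "\<dots> \<le> norm (grad f (x + t *\<^sub>R \<theta>)) * K" by (intro mult_left_mono \<theta>) simp
      finally have "\<bar>grad f (x + t *\<^sub>R \<theta>) \<bullet> \<theta>\<bar> \<le> K * norm (grad f (x + t *\<^sub>R \<theta>))" by (simp add: mult.commute)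
      moreover have "0 \<le> K" using \<theta> norm_ge_zero order_trans by blast
      ultimately show "ennreal (norm ((grad f (x + t *\<^sub>R \<theta>) \<bullet> \<theta>) * indicator {0..\<rho>} t)) \<le> ennreal K * (ennreal (norm (grad f (x + t *\<^sub>R \<theta>))) * indicator {0<..<\<rho>} t)"
        using t by (auto simp: indicator_def ennreal_mult[symmetric] intro!: ennreal_leI)
    qed
  qed
  also have "\<dots> = ennreal K * (\<integral>\<^sup>+ t. ennreal (norm (grad f (x + t *\<^sub>R \<theta>))) * indicator {0<..<\<rho>} t \<partial>lborel)"
    by (rule nn_integral_cmult) measurable
  finally show ?thesis .
qed

text \<open>The fundamental theorem of calculus along x + t \<theta>, averaged over the directions;
  the factor 2 bounds their length. The term at the far end is kept: for large \<rho> it vanishes,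
  for small \<rho> it is controlled by the L1 norm of f.\<close>

lemma averaged_line_bound:
  fixes B :: "'a::euclidean_space set"
  assumes f: "f \<in> test_functions \<Omega>" and [measurable]: "B \<in> sets borel" and \<beta>: "emeasure lborel B = ennreal \<beta>" "0 < \<beta>"
    and B: "\<And>\<theta>. \<theta> \<in> B \<Longrightarrow> norm \<theta> \<le> 2" and \<rho>: "0 < \<rho>"
  shows "ennreal (\<beta> * \<bar>f x\<bar>) \<le> (\<integral>\<^sup>+ \<theta>. ennreal \<bar>f (x + \<rho> *\<^sub>R \<theta>)\<bar> * indicator B \<theta> \<partial>lborel) +
     2 * (\<integral>\<^sup>+ t. (\<integral>\<^sup>+ \<theta>. ennreal (norm (grad f (x + t *\<^sub>R \<theta>))) * indicator B \<theta> \<partial>lborel) * indicator {0<..<\<rho>} t \<partial>lborel)"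
proof -
  note [measurable] = test_measurable[OF f] grad_measurable[OF f]
  have "ennreal (\<beta> * \<bar>f x\<bar>) = (\<integral>\<^sup>+ \<theta>. ennreal \<bar>f x\<bar> * indicator B \<theta> \<partial>lborel)"
    using \<beta> by (subst nn_integral_cmult_indicator) (auto simp: ennreal_mult mult.commute)
  also have "\<dots> \<le> (\<integral>\<^sup>+ \<theta>. ennreal \<bar>f (x + \<rho> *\<^sub>R \<theta>)\<bar> * indicator B \<theta> + 2 * ((\<integral>\<^sup>+ t. ennreal (norm (grad f (x + t *\<^sub>R \<theta>))) * indicator {0<..<\<rho>} t \<partial>lborel) * indicator B \<theta>) \<partial>lborel)"
  proof (rule nn_integral_mono)
    fix \<theta>
    show "ennreal \<bar>f x\<bar> * indicator B \<theta> \<le> ennreal \<bar>f (x + \<rho> *\<^sub>R \<theta>)\<bar> * indicator B \<theta> + 2 * ((\<integral>\<^sup>+ t. ennreal (norm (grad f (x + t *\<^sub>R \<theta>))) * indicator {0<..<\<rho>} t \<partial>lborel) * indicator B \<theta>)"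
    proof (cases "\<theta> \<in> B")
      case True
      have "ennreal \<bar>f x\<bar> \<le> ennreal (\<bar>f (x + \<rho> *\<^sub>R \<theta>)\<bar> + \<bar>f (x + \<rho> *\<^sub>R \<theta>) - f x\<bar>)" by (intro ennreal_leI) linarith
      also have "\<dots> = ennreal \<bar>f (x + \<rho> *\<^sub>R \<theta>)\<bar> + ennreal \<bar>f (x + \<rho> *\<^sub>R \<theta>) - f x\<bar>" by simp
      also have "\<dots> \<le> ennreal \<bar>f (x + \<rho> *\<^sub>R \<theta>)\<bar> + 2 * (\<integral>\<^sup>+ t. ennreal (norm (grad f (x + t *\<^sub>R \<theta>))) * indicator {0<..<\<rho>} t \<partial>lborel)"
        using line_bound[OF f B[OF True] \<rho>, of x] by (intro add_left_mono) simp
      finally show ?thesis using True by simp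
    qed simp
  qed
  also have "\<dots> = (\<integral>\<^sup>+ \<theta>. ennreal \<bar>f (x + \<rho> *\<^sub>R \<theta>)\<bar> * indicator B \<theta> \<partial>lborel) + 2 * (\<integral>\<^sup>+ \<theta>. (\<integral>\<^sup>+ t. ennreal (norm (grad f (x + t *\<^sub>R \<theta>))) * indicator {0<..<\<rho>} t \<partial>lborel) * indicator B \<theta> \<partial>lborel)"
    by (subst nn_integral_add) (auto simp: nn_integral_cmult)
  also have "(\<integral>\<^sup>+ \<theta>. (\<integral>\<^sup>+ t. ennreal (norm (grad f (x + t *\<^sub>R \<theta>))) * indicator {0<..<\<rho>} t \<partial>lborel) * indicator B \<theta> \<partial>lborel) =
     (\<integral>\<^sup>+ \<theta>. (\<integral>\<^sup>+ t. ennreal (norm (grad f (x + t *\<^sub>R \<theta>))) * indicator {0<..<\<rho>} t * indicator B \<theta> \<partial>lborel) \<partial>lborel)"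
    by (intro nn_integral_cong nn_integral_multc[symmetric]) measurable
  also have "\<dots> = (\<integral>\<^sup>+ t. (\<integral>\<^sup>+ \<theta>. ennreal (norm (grad f (x + t *\<^sub>R \<theta>))) * indicator {0<..<\<rho>} t * indicator B \<theta> \<partial>lborel) \<partial>lborel)"
    by (rule lborel_pair.Fubini') measurable
  also have "\<dots> = (\<integral>\<^sup>+ t. (\<integral>\<^sup>+ \<theta>. ennreal (norm (grad f (x + t *\<^sub>R \<theta>))) * indicator B \<theta> \<partial>lborel) * indicator {0<..<\<rho>} t \<partial>lborel)"
  proof (rule nn_integral_cong)
    fix t :: real
    have "(\<integral>\<^sup>+ \<theta>. ennreal (norm (grad f (x + t *\<^sub>R \<theta>))) * indicator {0<..<\<rho>} t * indicator B \<theta> \<partial>lborel) =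
      (\<integral>\<^sup>+ \<theta>. (ennreal (norm (grad f (x + t *\<^sub>R \<theta>))) * indicator B \<theta>) * indicator {0<..<\<rho>} t \<partial>lborel)"
      by (intro nn_integral_cong) (simp add: mult_ac)
    also have "\<dots> = (\<integral>\<^sup>+ \<theta>. ennreal (norm (grad f (x + t *\<^sub>R \<theta>))) * indicator B \<theta> \<partial>lborel) * indicator {0<..<\<rho>} t"
      by (rule nn_integral_multc) measurable
    finally show "(\<integral>\<^sup>+ \<theta>. ennreal (norm (grad f (x + t *\<^sub>R \<theta>))) * indicator {0<..<\<rho>} t * indicator B \<theta> \<partial>lborel) =
      (\<integral>\<^sup>+ \<theta>. ennreal (norm (grad f (x + t *\<^sub>R \<theta>))) * indicator B \<theta> \<partial>lborel) * indicator {0<..<\<rho>} t" .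
  qed
  finally show ?thesis .
qed

text \<open>A ball around a unit vector that stays away from the origin: vectors bounded below in
  length carry every point of a bounded set out of it after a large dilation.\<close>

lemma direction_set_exists:
  obtains B :: "'a::euclidean_space set" and \<beta> where "B \<in> sets borel" "emeasure lborel B = ennreal \<beta>" "0 < \<beta>"
    "\<And>\<theta>. \<theta> \<in> B \<Longrightarrow> norm \<theta> \<le> 2" "\<And>\<theta>. \<theta> \<in> B \<Longrightarrow> 1 / 2 < norm \<theta>"
proof -
  obtain e :: 'a where e: "e \<in> Basis" using nonempty_Basis by blast
  let ?B = "ball e (1/2) :: 'a set"
  show ?thesis
  proof (rule that[of ?B "measure lborel ?B"])
    show "emeasure lborel ?B = ennreal (measure lborel ?B)"
      using emeasure_bounded_finite[of ?B] by (intro emeasure_eq_ennreal_measure) auto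
    show "0 < measure lborel ?B" using content_ball_pos[of "1/2" e] by simp
    fix \<theta> assume "\<theta> \<in> ?B"
    then have d: "norm (e - \<theta>) < 1 / 2" by (simp add: dist_norm)
    have n: "norm e = 1" using e by simp
    show "norm \<theta> \<le> 2" using norm_triangle_ineq3[of e \<theta>] d n by linarith
    show "1 / 2 < norm \<theta>" using norm_triangle_ineq3[of e \<theta>] d n by linarith
  qed simp
qed

text \<open>The far end of every segment lies outside \<Omega>, so f is bounded by averages of its
  gradient alone and the averaging estimate applies. For a < N the condition on b says b < N a / (N
  - a), strictly below the critical exponent.\<close>

lemma sobolev_inequality:
  fixes \<Omega> :: "'a::euclidean_space set"
  assumes "open \<Omega>" "bounded \<Omega>" and ab: "1 \<le> a" "a \<le> b" "real DIM('a) * (b - a) < a * b"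
  shows "\<exists>C\<ge>0. \<forall>f\<in>test_functions \<Omega>. \<forall>H>0. (\<integral>\<^sup>+ x. ennreal (norm (grad f x) powr a) \<partial>lborel) \<le> ennreal H \<longrightarrow>
     (\<integral>\<^sup>+ x. ennreal (\<bar>f x\<bar> powr b) \<partial>lborel) \<le> ennreal (C * H powr (b / a))"
proof -
  obtain B :: "'a set" and \<beta> where B: "B \<in> sets borel" "emeasure lborel B = ennreal \<beta>" "0 < \<beta>"
    "\<And>\<theta>. \<theta> \<in> B \<Longrightarrow> norm \<theta> \<le> 2" "\<And>\<theta>. \<theta> \<in> B \<Longrightarrow> 1 / 2 < norm \<theta>"
    by (rule direction_set_exists) blast
  obtain R where R: "0 < R" "\<And>x. x \<in> \<Omega> \<Longrightarrow> norm x \<le> R" using bounded_pos[of \<Omega>] assms(2) by blast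
  \<comment> \<open>Directions are longer than 1/2, so \<rho> \<theta> is longer than 2 R and moves
    each point of \<Omega> beyond radius R.\<close>
  define \<rho> where "\<rho> = 4 * R"
  have \<rho>: "0 < \<rho>" using R by (simp add: \<rho>_def)
  obtain C where C: "0 \<le> C" and Cb: "averaging_const B \<rho> a b C"
    by (rule averaging_bound[OF B(1-3) \<rho> ab])
  show ?thesis
  proof (intro exI[of _ "(2 / \<beta>) powr b * C"] conjI ballI allI impI)
    show "0 \<le> (2 / \<beta>) powr b * C" using C by simp
    fix f :: "'a \<Rightarrow> real" and H :: real assume f: "f \<in> test_functions \<Omega>" and H: "0 < H" "(\<integral>\<^sup>+ x. ennreal (norm (grad f x) powr a) \<partial>lborel) \<le> ennreal H"
    note [measurable] = test_measurable[OF f] grad_measurable[OF f]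
    obtain M where M: "\<And>x. norm (grad f x) \<le> M" using test_bounded[OF f] by metis
    have F: "ennreal (\<beta> * \<bar>f x\<bar> / 2) \<le> (\<integral>\<^sup>+ t. (\<integral>\<^sup>+ \<theta>. ennreal (norm (grad f (x + t *\<^sub>R \<theta>))) * indicator B \<theta> \<partial>lborel) * indicator {0<..<\<rho>} t \<partial>lborel)" (is "_ \<le> ?I")
      if x: "x \<in> \<Omega>" for x
    proof -
      have z: "f (x + \<rho> *\<^sub>R \<theta>) = 0" if "\<theta> \<in> B" for \<theta>
      proof (rule test_zero_outside[OF f])
        have "\<rho> * (1/2) < \<rho> * norm \<theta>" using B(5)[OF that] \<rho> by (intro mult_strict_left_mono) auto
        also have "\<dots> = norm (\<rho> *\<^sub>R \<theta>)" using \<rho> by simp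
        also have "\<dots> \<le> norm (x + \<rho> *\<^sub>R \<theta>) + norm x" using norm_triangle_ineq4[of "x + \<rho> *\<^sub>R \<theta>" x] by simp
        finally have "R < norm (x + \<rho> *\<^sub>R \<theta>)" using R(2)[OF x] by (simp add: \<rho>_def)
        then show "x + \<rho> *\<^sub>R \<theta> \<notin> \<Omega>" using R(2) by force
      qed
      have "(\<integral>\<^sup>+ \<theta>. ennreal \<bar>f (x + \<rho> *\<^sub>R \<theta>)\<bar> * indicator B \<theta> \<partial>lborel) = (\<integral>\<^sup>+ \<theta>. 0 \<partial>(lborel :: 'a measure))"
        by (intro nn_integral_cong) (auto simp: indicator_def z)
      then have "ennreal (\<beta> * \<bar>f x\<bar>) \<le> 2 * ?I"
        using averaged_line_bound[OF f B(1-4) \<rho>, of x] by simp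
      then show ?thesis
      proof (cases ?I)
        case (real i)
        then have "ennreal (\<beta> * \<bar>f x\<bar>) \<le> ennreal (2 * i)"
          using \<open>ennreal (\<beta> * \<bar>f x\<bar>) \<le> 2 * ?I\<close> by (simp add: ennreal_mult)
        then have "\<beta> * \<bar>f x\<bar> \<le> 2 * i" using real B(3) by (subst (asm) ennreal_le_iff) auto
        then show ?thesis using real by (simp add: ennreal_leI)
      qed simp
    qed
    have "(\<integral>\<^sup>+ x. ennreal ((\<beta> * \<bar>f x\<bar> / 2) powr b) * indicator \<Omega> x \<partial>lborel) \<le> ennreal (C * H powr (b / a))"
    proof (rule averaging_constD[OF Cb, where g="\<lambda>x. norm (grad f x)" and U=UNIV])
      show "norm (grad f x) \<le> M" for x by (rule M)
    qed (use assms(1) F B(3) H in auto)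
    then have le: "ennreal ((2 / \<beta>) powr b) * (\<integral>\<^sup>+ x. ennreal ((\<beta> * \<bar>f x\<bar> / 2) powr b) * indicator \<Omega> x \<partial>lborel) \<le> ennreal ((2 / \<beta>) powr b) * ennreal (C * H powr (b / a))"
      by (intro mult_left_mono) auto
    have "(\<integral>\<^sup>+ x. ennreal (\<bar>f x\<bar> powr b) \<partial>lborel) = (\<integral>\<^sup>+ x. ennreal ((2 / \<beta>) powr b) * (ennreal ((\<beta> * \<bar>f x\<bar> / 2) powr b) * indicator \<Omega> x) \<partial>lborel)"
    proof (rule nn_integral_cong)
      fix x
      have "\<bar>f x\<bar> powr b = (2 / \<beta>) powr b * (\<beta> * \<bar>f x\<bar> / 2) powr b"
        using B(3) by (simp add: powr_mult[symmetric])
      then show "ennreal (\<bar>f x\<bar> powr b) = ennreal ((2 / \<beta>) powr b) * (ennreal ((\<beta> * \<bar>f x\<bar> / 2) powr b) * indicator \<Omega> x)"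
        using test_zero_outside[OF f, of x] by (auto simp: indicator_def ennreal_mult[symmetric])
    qed
    also have "\<dots> = ennreal ((2 / \<beta>) powr b) * (\<integral>\<^sup>+ x. ennreal ((\<beta> * \<bar>f x\<bar> / 2) powr b) * indicator \<Omega> x \<partial>lborel)"
      using assms(1) by (intro nn_integral_cmult) auto
    also note le
    finally show "(\<integral>\<^sup>+ x. ennreal (\<bar>f x\<bar> powr b) \<partial>lborel) \<le> ennreal ((2 / \<beta>) powr b * C * H powr (b / a))"
      using C by (simp add: ennreal_mult[symmetric] mult.assoc)
  qed
qed

section \<open>A Poincare inequality in the modular\<close>

context exponent_domain begin

lemma test_nn_integral_on:
  assumes f: "f \<in> test_functions \<Omega>" and a: "0 < a" and [measurable]: "U \<in> sets borel"
  shows "(\<integral>\<^sup>+ x. ennreal (norm (grad f x) powr a) * indicator U x \<partial>\<mu>) = (\<integral>\<^sup>+ x. ennreal (norm (grad f x) powr a) * indicator U x \<partial>lborel)"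
    "(\<integral>\<^sup>+ x. ennreal (\<bar>f x\<bar> powr a) * indicator U x \<partial>\<mu>) = (\<integral>\<^sup>+ x. ennreal (\<bar>f x\<bar> powr a) * indicator U x \<partial>lborel)"
proof -
  note [measurable] = test_measurable[OF f] grad_measurable[OF f]
  show "(\<integral>\<^sup>+ x. ennreal (norm (grad f x) powr a) * indicator U x \<partial>\<mu>) = (\<integral>\<^sup>+ x. ennreal (norm (grad f x) powr a) * indicator U x \<partial>lborel)"
    using grad_zero_outside[OF f] a by (subst nn_integral_lebesgue_on[OF open_dom]) (auto intro!: nn_integral_cong simp: indicator_def)
  show "(\<integral>\<^sup>+ x. ennreal (\<bar>f x\<bar> powr a) * indicator U x \<partial>\<mu>) = (\<integral>\<^sup>+ x. ennreal (\<bar>f x\<bar> powr a) * indicator U x \<partial>lborel)"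
    using test_zero_outside[OF f] a by (subst nn_integral_lebesgue_on[OF open_dom]) (auto intro!: nn_integral_cong simp: indicator_def)
qed

text \<open>Gradients that vanish in modular vanish in L1, and the case a = b = 1 of the Sobolev
  inequality passes this to the functions.\<close>

lemma test_L1_tendsto:
  assumes w: "\<And>n. w n \<in> test_functions \<Omega>" and lim: "(\<lambda>n. modular \<Omega> p (grad (w n))) \<longlonglongrightarrow> 0"
  shows "(\<lambda>n. \<integral>\<^sup>+ x. ennreal \<bar>w n x\<bar> \<partial>lborel) \<longlonglongrightarrow> 0"
proof -
  obtain C where C: "0 \<le> C" "\<And>f H. f \<in> test_functions \<Omega> \<Longrightarrow> 0 < H \<Longrightarrow> (\<integral>\<^sup>+ x. ennreal (norm (grad f x) powr 1) \<partial>lborel) \<le> ennreal H \<Longrightarrow>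
     (\<integral>\<^sup>+ x. ennreal (\<bar>f x\<bar> powr 1) \<partial>lborel) \<le> ennreal (C * H powr (1 / 1))"
    using sobolev_inequality[OF open_dom bounded_dom, of 1 1] by auto
  have l1: "(\<lambda>n. \<integral>\<^sup>+ x. ennreal (norm (grad (w n) x)) \<partial>lborel) \<longlonglongrightarrow> 0"
    using L1_tendsto[OF test_measurable_on(2)[OF w] lim] test_nn_integral_on(1)[OF w, of 1 UNIV] by simp
  show ?thesis
  proof (rule ennreal_tendsto_0I)
    fix e :: real assume e: "0 < e"
    define H where "H = e / (C + 1)"
    have H: "0 < H" "C * H \<le> e" using e C by (auto simp: H_def field_simps)
    from ennreal_tendsto_0D[OF l1 H(1)]
    show "\<forall>\<^sub>F n in sequentially. (\<integral>\<^sup>+ x. ennreal \<bar>w n x\<bar> \<partial>lborel) \<le> ennreal e"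
    proof eventually_elim
      fix n assume "(\<integral>\<^sup>+ x. ennreal (norm (grad (w n) x)) \<partial>lborel) \<le> ennreal H"
      then have "(\<integral>\<^sup>+ x. ennreal \<bar>w n x\<bar> \<partial>lborel) \<le> ennreal (C * H)" using C(2)[OF w H(1), of n] H by simp
      also have "\<dots> \<le> ennreal e" by (rule ennreal_leI[OF H(2)])
      finally show "(\<integral>\<^sup>+ x. ennreal \<bar>w n x\<bar> \<partial>lborel) \<le> ennreal e" .
    qed
  qed
qed

text \<open>On a cell where \<open>p\<close> oscillates little, the averaging estimate gains enough to pass from the
  infimum to the supremum of \<open>p\<close>; the remaining average of \<open>w n\<close> itself is controlled uniformly by
  its \<open>L\<^sup>1\<close> norm.\<close>

lemma local_poincare:
  assumes w: "\<And>n. w n \<in> test_functions \<Omega>" and lim: "(\<lambda>n. modular \<Omega> p (grad (w n))) \<longlonglongrightarrow> 0"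
    and \<delta>: "0 < \<delta>" and ab: "1 \<le> a" "a \<le> b" "real DIM('a) * (b - a) < a * b"
    and osc: "\<And>x. x \<in> \<Omega> \<Longrightarrow> x \<in> ball z \<delta> \<Longrightarrow> a \<le> p x \<and> p x \<le> b"
  shows "(\<lambda>n. \<integral>\<^sup>+ x. ennreal (\<bar>w n x\<bar> powr p x) * indicator (ball z (\<delta> / 2) \<inter> \<Omega>) x \<partial>\<mu>) \<longlonglongrightarrow> 0"
proof -
  obtain B :: "'a set" and \<beta> where B: "B \<in> sets borel" "emeasure lborel B = ennreal \<beta>" "0 < \<beta>"
    "\<And>\<theta>. \<theta> \<in> B \<Longrightarrow> norm \<theta> \<le> 2"
    by (rule direction_set_exists) blast
  \<comment> \<open>Directions have length at most 2, so displacements are at most \<delta> / 4 and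
    segments that start in the half ball stay in the ball where a <= p <= b.\<close>
  define \<rho> where "\<rho> = \<delta> / 8"
  have \<rho>: "0 < \<rho>" using \<delta> by (simp add: \<rho>_def)
  let ?D = "ball z (\<delta> / 2) \<inter> \<Omega>" and ?U = "ball z \<delta>"
  have Dm[measurable]: "?D \<in> sets borel" using open_dom by auto
  \<comment> \<open>Both target exponents are needed: p lies between a and b on the cell, and F powr
    p is at most F powr a + F powr b.\<close>
  have aa: "1 \<le> a" "a \<le> a" "real DIM('a) * (a - a) < a * a" using ab by auto
  obtain Ca where Ca: "0 \<le> Ca" "averaging_const B \<rho> a a Ca" by (rule averaging_bound[OF B(1-3) \<rho> aa])
  obtain Cb where Cb: "0 \<le> Cb" "averaging_const B \<rho> a b Cb" by (rule averaging_bound[OF B(1-3) \<rho> ab])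
  note C0 = Ca(1) Cb(1)
  define N where "N = DIM('a)"
  define K where "K = max 1 ((2 / \<beta>) powr P)"
  have K: "1 \<le> K" by (simp add: K_def)
  define m where "m = measure lebesgue \<Omega>"
  have m0: "0 \<le> m" by (simp add: m_def)
  have main: "(\<integral>\<^sup>+ x. ennreal (\<bar>f x\<bar> powr p x) * indicator ?D x \<partial>\<mu>) \<le>
      ennreal (2 powr P * (c * m + K * (Ca * H powr (a / a) + Cb * H powr (b / a))))"
    if f: "f \<in> test_functions \<Omega>" and c: "0 < c" "c \<le> 1" and H: "0 < H"
      and fL: "(\<integral>\<^sup>+ x. ennreal \<bar>f x\<bar> \<partial>lborel) \<le> ennreal (c * \<beta> * \<rho> ^ N)"
      and gH: "(\<integral>\<^sup>+ x. ennreal (norm (grad f x) powr a) * indicator ?U x \<partial>lborel) \<le> ennreal H" for f c H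
  proof -
    note [measurable] = test_measurable[OF f] grad_measurable[OF f]
    \<comment> \<open>The values at the far end contribute an additive error c \<beta>. F is the
      excess of \<beta> |f| over that error, halved so that the gradient average dominates it;
      conversely |f| is at most c + 2 F / \<beta>.\<close>
    define F where "F x = max 0 ((\<beta> * \<bar>f x\<bar> - c * \<beta>) / 2)" for x
    have [measurable]: "F \<in> borel_measurable borel" unfolding F_def[abs_def] by measurable
    have F0: "0 \<le> F x" for x by (simp add: F_def)
    have Fle: "ennreal (F x) \<le> (\<integral>\<^sup>+ t. (\<integral>\<^sup>+ \<theta>. ennreal (norm (grad f (x + t *\<^sub>R \<theta>))) * indicator B \<theta> \<partial>lborel) * indicator {0<..<\<rho>} t \<partial>lborel)" (is "_ \<le> ?I") for x
    proof -
      have "(\<integral>\<^sup>+ \<theta>. ennreal \<bar>f (x + \<rho> *\<^sub>R \<theta>)\<bar> * indicator B \<theta> \<partial>lborel) \<le> (\<integral>\<^sup>+ \<theta>. ennreal \<bar>f (x + \<rho> *\<^sub>R \<theta>)\<bar> \<partial>lborel)"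
        by (intro nn_integral_mono) (auto simp: indicator_def)
      also have "\<dots> = ennreal (1 / \<rho> ^ DIM('a)) * (\<integral>\<^sup>+ x. ennreal \<bar>f x\<bar> \<partial>lborel)"
        by (rule nn_integral_affine[OF _ \<rho>]) measurable
      also have "\<dots> \<le> ennreal (1 / \<rho> ^ DIM('a)) * ennreal (c * \<beta> * \<rho> ^ N)"
        by (intro mult_left_mono fL) simp
      also have "\<dots> = ennreal (c * \<beta>)" using \<rho> c B(3) by (simp add: N_def ennreal_mult[symmetric])
      finally have "ennreal (\<beta> * \<bar>f x\<bar>) \<le> ennreal (c * \<beta>) + 2 * ?I"
        using averaged_line_bound[OF f B(1-4) \<rho>, of x] by (meson add_right_mono order_trans)
      then show ?thesis
      proof (cases ?I)
        case (real i)
        then have "ennreal (\<beta> * \<bar>f x\<bar>) \<le> ennreal (c * \<beta> + 2 * i)"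
          using \<open>ennreal (\<beta> * \<bar>f x\<bar>) \<le> ennreal (c * \<beta>) + 2 * ?I\<close> c B(3) by (simp add: ennreal_mult ennreal_plus)
        then have "\<beta> * \<bar>f x\<bar> \<le> c * \<beta> + 2 * i" using real B(3) c by (subst (asm) ennreal_le_iff) auto
        then show ?thesis using real by (auto simp: F_def intro!: ennreal_leI)
      qed simp
    qed
    have sub: "x + t *\<^sub>R \<theta> \<in> ?U" if x: "x \<in> ?D" and t: "t \<in> {0<..<\<rho>}" and \<theta>: "\<theta> \<in> B" for x t \<theta>
    proof -
      have "t * norm \<theta> \<le> \<rho> * 2" using t B(4)[OF \<theta>] by (intro mult_mono) auto
      then have "norm (t *\<^sub>R \<theta>) \<le> \<delta> / 4" using t by (simp add: \<rho>_def)
      moreover have "norm (z - x) < \<delta> / 2" using x by (simp add: dist_norm)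
      moreover have "norm (z - (x + t *\<^sub>R \<theta>)) \<le> norm (z - x) + norm (t *\<^sub>R \<theta>)"
        using norm_triangle_ineq4[of "z - x" "t *\<^sub>R \<theta>"] by (simp add: diff_diff_eq)
      ultimately show ?thesis using \<delta> by (simp add: dist_norm)
    qed
    obtain M where M: "\<And>x. norm (grad f x) \<le> M" using test_bounded[OF f] by metis
    have appl: "(\<integral>\<^sup>+ x. ennreal (F x powr c') * indicator ?D x \<partial>lborel) \<le> ennreal (C' * H powr (c' / a))"
      if "averaging_const B \<rho> a c' C'" for C' c'
      by (rule averaging_constD[OF that, where g="\<lambda>x. norm (grad f x)" and U="?U"])
        (use M sub H gH F0 Fle Dm in auto)
    have on: "(\<integral>\<^sup>+ x. ennreal (F x powr c') * indicator ?D x \<partial>\<mu>) = (\<integral>\<^sup>+ x. ennreal (F x powr c') * indicator ?D x \<partial>lborel)" for c'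
    proof -
      have "(\<lambda>x. ennreal (F x powr c') * indicator ?D x) \<in> borel_measurable borel" by measurable
      from nn_integral_lebesgue_on[OF open_dom this] show ?thesis
        by (auto intro!: nn_integral_cong simp: indicator_def)
    qed
    have Dl[measurable]: "?D \<in> sets \<mu>"
      using open_dom by (auto simp: sets_restrict_space_iff)
    have Fl[measurable]: "F \<in> borel_measurable \<mu>" by (rule measurable_lebesgue_onI[OF open_dom]) measurable
    have "(\<integral>\<^sup>+ x. ennreal (\<bar>f x\<bar> powr p x) * indicator ?D x \<partial>\<mu>) \<le>
      (\<integral>\<^sup>+ x. ennreal (2 powr P) * (ennreal c + ennreal K * (ennreal (F x powr a) * indicator ?D x + ennreal (F x powr b) * indicator ?D x)) \<partial>\<mu>)"
    proof (rule nn_integral_mono)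
      fix x assume "x \<in> space \<mu>"
      then have x: "x \<in> \<Omega>" by simp
      show "ennreal (\<bar>f x\<bar> powr p x) * indicator ?D x \<le> ennreal (2 powr P) * (ennreal c + ennreal K * (ennreal (F x powr a) * indicator ?D x + ennreal (F x powr b) * indicator ?D x))"
      proof (cases "x \<in> ?D")
        case True
        have px: "a \<le> p x" "p x \<le> b" using osc[OF x] True \<delta> by auto
        note pp = p_bounds[OF x] p_pos[OF x]
        have "\<bar>f x\<bar> \<le> c + 2 / \<beta> * F x"
          using B(3) by (auto simp: F_def max_def field_simps)
        then have "\<bar>f x\<bar> powr p x \<le> (c + 2 / \<beta> * F x) powr p x" using pp by (intro powr_mono2) auto
        also have "\<dots> \<le> 2 powr P * (c powr p x + (2 / \<beta> * F x) powr p x)"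
          using c B(3) F0[of x] pp by (intro powr_add_le) auto
        also have "\<dots> \<le> 2 powr P * (c + K * (F x powr a + F x powr b))"
        proof (intro mult_left_mono add_mono)
          show "c powr p x \<le> c" using c pp r_gt_1 by (intro powr_le_one_le) auto
          have "(2 / \<beta> * F x) powr p x = (2 / \<beta>) powr p x * F x powr p x" using B(3) F0[of x] by (intro powr_mult)
          also have "\<dots> \<le> K * (F x powr a + F x powr b)"
          proof (intro mult_mono)
            show "(2 / \<beta>) powr p x \<le> K" using powr_le_max[OF x, of "2 / \<beta>"] B(3) by (simp add: K_def)
            show "F x powr p x \<le> F x powr a + F x powr b"
            proof (cases "F x \<le> 1")
              case True
              then have "F x powr p x \<le> F x powr a" using F0[of x] px ab by (intro powr_mono') auto
              then show ?thesis by (simp add: add_increasing2)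
            next
              case False
              then have "F x powr p x \<le> F x powr b" using px by (intro powr_mono) auto
              then show ?thesis by (simp add: add_increasing)
            qed
          qed (use K in auto)
          finally show "(2 / \<beta> * F x) powr p x \<le> K * (F x powr a + F x powr b)" .
        qed auto
        finally have "\<bar>f x\<bar> powr p x \<le> 2 powr P * (c + K * (F x powr a + F x powr b))" .
        then show ?thesis using True c K by (simp add: ennreal_mult[symmetric] ennreal_plus[symmetric] ennreal_leI del: ennreal_plus)
      qed simp
    qed
    also have "\<dots> = ennreal (2 powr P) * (ennreal c * ennreal m + ennreal K * ((\<integral>\<^sup>+ x. ennreal (F x powr a) * indicator ?D x \<partial>\<mu>) + (\<integral>\<^sup>+ x. ennreal (F x powr b) * indicator ?D x \<partial>\<mu>)))"
      using open_dom by (simp add: nn_integral_cmult nn_integral_add emeasure_restrict_space emeasure_dom m_def)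
    also have "\<dots> \<le> ennreal (2 powr P) * (ennreal c * ennreal m + ennreal K * (ennreal (Ca * H powr (a / a)) + ennreal (Cb * H powr (b / a))))"
      unfolding on by (intro mult_left_mono add_left_mono add_mono appl Ca(2) Cb(2)) auto
    also have "\<dots> = ennreal (2 powr P * (c * m + K * (Ca * H powr (a / a) + Cb * H powr (b / a))))"
      using c K m0 C0 by (simp add: ennreal_mult[symmetric] ennreal_plus[symmetric] del: ennreal_plus)
    finally show ?thesis .
  qed
  have gl: "(\<lambda>n. \<integral>\<^sup>+ x. ennreal (norm (grad (w n) x) powr a) * indicator ?U x \<partial>lborel) \<longlonglongrightarrow> 0"
  proof -
    have "(\<lambda>n. \<integral>\<^sup>+ x. ennreal (norm (grad (w n) x) powr a) * indicator (?U \<inter> \<Omega>) x \<partial>\<mu>) \<longlonglongrightarrow> 0"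
      using osc ab by (intro moment_tendsto test_measurable_on w lim) auto
    moreover have "(\<integral>\<^sup>+ x. ennreal (norm (grad (w n) x) powr a) * indicator (?U \<inter> \<Omega>) x \<partial>\<mu>) =
      (\<integral>\<^sup>+ x. ennreal (norm (grad (w n) x) powr a) * indicator ?U x \<partial>lborel)" for n
    proof -
      have "(\<integral>\<^sup>+ x. ennreal (norm (grad (w n) x) powr a) * indicator (?U \<inter> \<Omega>) x \<partial>\<mu>) =
        (\<integral>\<^sup>+ x. ennreal (norm (grad (w n) x) powr a) * indicator (?U \<inter> \<Omega>) x \<partial>lborel)"
        using open_dom ab by (intro test_nn_integral_on w) auto
      also have "\<dots> = (\<integral>\<^sup>+ x. ennreal (norm (grad (w n) x) powr a) * indicator ?U x \<partial>lborel)"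
        using grad_zero_outside[OF w[of n]] ab by (intro nn_integral_cong) (auto simp: indicator_def)
      finally show ?thesis .
    qed
    ultimately show ?thesis by simp
  qed
  show ?thesis
  proof (rule ennreal_tendsto_0I)
    fix e :: real assume e: "0 < e"
    \<comment> \<open>One small h serves both as the threshold c and as the gradient bound
      H.\<close>
    have "((\<lambda>h. 2 powr P * (h * m + K * (Ca * h powr (a / a) + Cb * h powr (b / a)))) \<longlongrightarrow> 2 powr P * (0 * m + K * (Ca * 0 powr (a / a) + Cb * 0 powr (b / a)))) (at_right 0)"
      using ab by (intro tendsto_intros tendsto_powr') (auto simp: eventually_at_right_less eventually_at_filter)
    then have "((\<lambda>h. 2 powr P * (h * m + K * (Ca * h powr (a / a) + Cb * h powr (b / a)))) \<longlongrightarrow> 0) (at_right 0)"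
      using ab by simp
    from order_tendstoD(2)[OF this e]
    have "\<forall>\<^sub>F h in at_right 0. 2 powr P * (h * m + K * (Ca * h powr (a / a) + Cb * h powr (b / a))) < e" .
    moreover have "\<forall>\<^sub>F h in at_right (0::real). h < 1" "\<forall>\<^sub>F h in at_right (0::real). 0 < h"
      by (auto intro: eventually_at_rightI[of 0 1])
    ultimately have "\<forall>\<^sub>F h in at_right 0. 2 powr P * (h * m + K * (Ca * h powr (a / a) + Cb * h powr (b / a))) < e \<and> h < 1 \<and> 0 < h"
      by (intro eventually_conj)
    then obtain h where h: "2 powr P * (h * m + K * (Ca * h powr (a / a) + Cb * h powr (b / a))) < e" "h < 1" "0 < h"
      using eventually_happens'[OF trivial_limit_at_right_real] by (metis (no_types, lifting))
    have "0 < h * \<beta> * \<rho> ^ N" using h B(3) \<rho> by simp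
    from ennreal_tendsto_0D[OF test_L1_tendsto[OF w lim] this] ennreal_tendsto_0D[OF gl h(3)]
    show "\<forall>\<^sub>F n in sequentially. (\<integral>\<^sup>+ x. ennreal (\<bar>w n x\<bar> powr p x) * indicator ?D x \<partial>\<mu>) \<le> ennreal e"
    proof eventually_elim
      fix n assume 1: "(\<integral>\<^sup>+ x. ennreal \<bar>w n x\<bar> \<partial>lborel) \<le> ennreal (h * \<beta> * \<rho> ^ N)"
        and 2: "(\<integral>\<^sup>+ x. ennreal (norm (grad (w n) x) powr a) * indicator ?U x \<partial>lborel) \<le> ennreal h"
      have "(\<integral>\<^sup>+ x. ennreal (\<bar>w n x\<bar> powr p x) * indicator ?D x \<partial>\<mu>) \<le> ennreal (2 powr P * (h * m + K * (Ca * h powr (a / a) + Cb * h powr (b / a))))"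
        by (rule main[OF w _ _ _ 1 2]) (use h in auto)
      also have "\<dots> \<le> ennreal e" using h by (intro ennreal_leI) simp
      finally show "(\<integral>\<^sup>+ x. ennreal (\<bar>w n x\<bar> powr p x) * indicator ?D x \<partial>\<mu>) \<le> ennreal e" .
    qed
  qed
qed

text \<open>Uniform continuity of p provides finitely many balls covering the closure of \<Omega> on
  which the oscillation of p is below the gain of the averaging estimate; the local statements are
  then summed.\<close>

lemma modular_poincare:
  assumes w: "\<And>n. w n \<in> test_functions \<Omega>" and lim: "(\<lambda>n. modular \<Omega> p (grad (w n))) \<longlonglongrightarrow> 0"
  shows "(\<lambda>n. modular \<Omega> p (w n)) \<longlonglongrightarrow> 0"
proof -
  define N where "N = real DIM('a)"
  have N: "1 \<le> N" using DIM_positive[where 'a='a] unfolding N_def by linarith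
  \<comment> \<open>The exponents on a cell are a = p z - \<epsilon> and b = p z + \<epsilon>. The
    first bound gives N(b - a) < 1 <= a b; the second keeps a at least 1, as p z is within
    \<epsilon> of a value of p in \<Omega> and those are at least r.\<close>
  define \<epsilon> where "\<epsilon> = min (1 / (8 * N)) ((r - 1) / 2)"
  have \<epsilon>: "0 < \<epsilon>" "N * (2 * \<epsilon>) < 1" "2 * \<epsilon> \<le> r - 1"
  proof -
    show "0 < \<epsilon>" using N r_gt_1 by (auto simp: \<epsilon>_def)
    have "\<epsilon> \<le> (r - 1) / 2" unfolding \<epsilon>_def by (rule min.cobounded2)
    then show "2 * \<epsilon> \<le> r - 1" by simp
    have "N * (2 * \<epsilon>) \<le> N * (2 * (1 / (8 * N)))" using N by (intro mult_left_mono) (auto simp: \<epsilon>_def)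
    also have "\<dots> < 1" using N by simp
    finally show "N * (2 * \<epsilon>) < 1" .
  qed
  have cpt: "compact (closure \<Omega>)" using bounded_dom by (simp add: compact_closure)
  have "uniformly_continuous_on (closure \<Omega>) p" by (rule compact_uniformly_continuous[OF p_cont cpt])
  then obtain \<delta> where \<delta>: "0 < \<delta>" "\<And>x y. x \<in> closure \<Omega> \<Longrightarrow> y \<in> closure \<Omega> \<Longrightarrow> dist x y < \<delta> \<Longrightarrow> \<bar>p x - p y\<bar> < \<epsilon>"
    using \<epsilon>(1) unfolding uniformly_continuous_on_def dist_real_def by (metis dist_commute)
  obtain T where T: "T \<subseteq> closure \<Omega>" "finite T" "closure \<Omega> \<subseteq> (\<Union>x\<in>T. ball x (\<delta> / 2))"
  proof (rule compactE_image[OF cpt, of "closure \<Omega>" "\<lambda>x. ball x (\<delta> / 2)"])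
    show "closure \<Omega> \<subseteq> (\<Union>x\<in>closure \<Omega>. ball x (\<delta> / 2))"
      using \<delta>(1) by force
  qed auto
  let ?D = "\<lambda>z. ball z (\<delta> / 2) \<inter> \<Omega>"
  have loc: "(\<lambda>n. \<integral>\<^sup>+ x. ennreal (\<bar>w n x\<bar> powr p x) * indicator (?D z) x \<partial>\<mu>) \<longlonglongrightarrow> 0" if z: "z \<in> T" for z
  proof (cases "?D z = {}")
    case False
    then obtain y where y: "y \<in> \<Omega>" "dist z y < \<delta> / 2" by auto
    have zc: "z \<in> closure \<Omega>" using z T by auto
    have osc: "\<bar>p z - p x\<bar> < \<epsilon>" if "x \<in> \<Omega>" "x \<in> ball z \<delta>" for x
      using \<delta>(2)[of z x] that zc closure_subset by auto
    have "p z - \<epsilon> \<ge> 1" using osc[OF y(1)] y \<delta>(1) p_bounds[OF y(1)] \<epsilon> by force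
    then show ?thesis
    proof (intro local_poincare[OF w lim \<delta>(1), of "p z - \<epsilon>" "p z + \<epsilon>"])
      assume 1: "1 \<le> p z - \<epsilon>"
      have "1 * 1 \<le> (p z - \<epsilon>) * (p z + \<epsilon>)" using 1 \<epsilon> by (intro mult_mono) auto
      then show "real DIM('a) * (p z + \<epsilon> - (p z - \<epsilon>)) < (p z - \<epsilon>) * (p z + \<epsilon>)" using \<epsilon>(2) by (simp add: N_def)
      show "p z - \<epsilon> \<le> p x \<and> p x \<le> p z + \<epsilon>" if "x \<in> \<Omega>" "x \<in> ball z \<delta>" for x using osc[OF that] by auto
    qed (use \<epsilon> in auto)
  next
    case True
    then show ?thesis unfolding True by simp
  qed
  have "(\<lambda>n. \<Sum>z\<in>T. \<integral>\<^sup>+ x. ennreal (\<bar>w n x\<bar> powr p x) * indicator (?D z) x \<partial>\<mu>) \<longlonglongrightarrow> (\<Sum>z\<in>T. 0)"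
    by (intro tendsto_sum loc)
  then have l: "(\<lambda>n. \<Sum>z\<in>T. \<integral>\<^sup>+ x. ennreal (\<bar>w n x\<bar> powr p x) * indicator (?D z) x \<partial>\<mu>) \<longlonglongrightarrow> 0"
    by simp
  show ?thesis
  proof (rule ennreal_tendsto_0_le[OF l])
    fix n
    note [measurable] = test_measurable_on[OF w[of n]]
    have Dm: "?D z \<in> sets \<mu>" for z using open_dom by (auto simp: sets_restrict_space_iff)
    have "modular \<Omega> p (w n) \<le> (\<integral>\<^sup>+ x. (\<Sum>z\<in>T. ennreal (\<bar>w n x\<bar> powr p x) * indicator (?D z) x) \<partial>\<mu>)"
      unfolding modular_def
    proof (rule nn_integral_mono)
      fix x assume "x \<in> space \<mu>"
      then have x: "x \<in> \<Omega>" by simp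
      then have "x \<in> (\<Union>x\<in>T. ball x (\<delta> / 2))" using T(3) closure_subset[of \<Omega>] by (meson subsetD)
      then obtain z where z: "z \<in> T" "x \<in> ?D z" using x by auto
      have "ennreal (\<bar>w n x\<bar> powr p x) * indicator (?D z) x \<le> (\<Sum>z\<in>T. ennreal (\<bar>w n x\<bar> powr p x) * indicator (?D z) x)"
        by (rule member_le_sum) (use z T in auto)
      then show "ennreal (norm (w n x) powr p x) \<le> (\<Sum>z\<in>T. ennreal (\<bar>w n x\<bar> powr p x) * indicator (?D z) x)"
        using z by simp
    qed
    also have "\<dots> = (\<Sum>z\<in>T. \<integral>\<^sup>+ x. ennreal (\<bar>w n x\<bar> powr p x) * indicator (?D z) x \<partial>\<mu>)"
    proof (rule nn_integral_sum)
      fix z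
      have [measurable]: "?D z \<in> sets \<mu>" by (rule Dm)
      have "(\<lambda>x. norm (w n x) powr p x) \<in> borel_measurable \<mu>" by measurable
      then have [measurable]: "(\<lambda>x. \<bar>w n x\<bar> powr p x) \<in> borel_measurable \<mu>" by simp
      show "(\<lambda>x. ennreal (\<bar>w n x\<bar> powr p x) * indicator (?D z) x) \<in> borel_measurable \<mu>"
        by (intro borel_measurable_times_ennreal borel_measurable_indicator Dm) measurable
    qed
    finally show "modular \<Omega> p (w n) \<le> (\<Sum>z\<in>T. \<integral>\<^sup>+ x. ennreal (\<bar>w n x\<bar> powr p x) * indicator (?D z) x \<partial>\<mu>)" .
  qed
qed

end

subsection \<open>Compactness\<close>

text \<open>The mean of f over the ball of radius \<epsilon> around x, parametrised by the unit
  ball. This rough kernel suffices as a mollifier because equicontinuity is drawn from the gradient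
  of f and not from smoothness of the kernel.\<close>

definition ball_average :: "real \<Rightarrow> ('a::euclidean_space \<Rightarrow> real) \<Rightarrow> 'a \<Rightarrow> real" where
  "ball_average \<epsilon> f x = (\<integral>\<theta>. f (x + \<epsilon> *\<^sub>R \<theta>) * indicator (ball 0 1) \<theta> \<partial>lborel) / measure lborel (ball (0::'a) 1)"

context
  fixes \<Omega> :: "'a::euclidean_space set" and f :: "'a \<Rightarrow> real"
  assumes f: "f \<in> test_functions \<Omega>"
begin

lemma ball_average_integrable: "integrable lborel (\<lambda>\<theta>. f (x + \<epsilon> *\<^sub>R \<theta>) * indicator (ball 0 1) \<theta>)"
proof -
  obtain B where B: "\<And>x. \<bar>f x\<bar> \<le> B" using test_bounded[OF f] by metis
  note [measurable] = test_measurable[OF f]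
  have B0: "0 \<le> B" using B[of 0] by linarith
  show ?thesis
    by (rule test_integrable[of _ "ball 0 1" B]) (use B B0 in \<open>auto simp: indicator_def abs_mult\<close>)
qed

lemma ball_average_measurable: "ball_average \<epsilon> f \<in> borel_measurable borel"
proof -
  note [measurable] = test_measurable[OF f]
  have [measurable]: "ball (0::'a) 1 \<in> sets borel" by simp
  have "(\<lambda>x. \<integral>\<theta>. f (x + \<epsilon> *\<^sub>R \<theta>) * indicator (ball 0 1) \<theta> \<partial>lborel) \<in> borel_measurable borel" by measurable
  then show ?thesis unfolding ball_average_def[abs_def] by (intro borel_measurable_divide borel_measurable_const)
qed

lemma unit_ball_measure: "emeasure lborel (ball (0::'a) 1) = ennreal (measure lborel (ball (0::'a) 1))" "0 < measure lborel (ball (0::'a) 1)"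
proof -
  show "emeasure lborel (ball (0::'a) 1) = ennreal (measure lborel (ball (0::'a) 1))"
    using emeasure_bounded_finite[of "ball (0::'a) 1"] by (intro emeasure_eq_ennreal_measure) auto
  show "0 < measure lborel (ball (0::'a) 1)" using content_ball_pos[of 1 "0::'a"] by simp
qed

text \<open>At fixed \<epsilon> this supplies the uniform bound for Arzela-Ascoli and
  \<open>ball_average_lipschitz\<close> the equicontinuity, both from L1 bounds alone. Their
  constants blow up as \<epsilon> decreases, but only \<open>ball_average_approx\<close> is used for
  small \<epsilon>.\<close>

lemma ball_average_le:
  assumes "0 < \<epsilon>"
  shows "ennreal \<bar>ball_average \<epsilon> f x\<bar> \<le> ennreal (1 / (measure lborel (ball (0::'a) 1) * \<epsilon> ^ DIM('a))) * (\<integral>\<^sup>+ x. ennreal \<bar>f x\<bar> \<partial>lborel)"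
proof -
  note [measurable] = test_measurable[OF f]
  let ?\<beta> = "measure lborel (ball (0::'a) 1)"
  have "ennreal \<bar>ball_average \<epsilon> f x\<bar> = ennreal (1 / ?\<beta>) * ennreal (norm (\<integral>\<theta>. f (x + \<epsilon> *\<^sub>R \<theta>) * indicator (ball 0 1) \<theta> \<partial>lborel))"
    using unit_ball_measure by (simp add: ball_average_def ennreal_mult[symmetric] abs_divide)
  also have "\<dots> \<le> ennreal (1 / ?\<beta>) * (\<integral>\<^sup>+ \<theta>. ennreal (norm (f (x + \<epsilon> *\<^sub>R \<theta>) * indicator (ball 0 1) \<theta>)) \<partial>lborel)"
    by (intro mult_left_mono integral_norm_bound_ennreal ball_average_integrable) simp
  also have "\<dots> \<le> ennreal (1 / ?\<beta>) * (\<integral>\<^sup>+ \<theta>. ennreal \<bar>f (x + \<epsilon> *\<^sub>R \<theta>)\<bar> \<partial>lborel)"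
    by (intro mult_left_mono nn_integral_mono) (auto simp: indicator_def)
  also have "(\<integral>\<^sup>+ \<theta>. ennreal \<bar>f (x + \<epsilon> *\<^sub>R \<theta>)\<bar> \<partial>lborel) = ennreal (1 / \<epsilon> ^ DIM('a)) * (\<integral>\<^sup>+ x. ennreal \<bar>f x\<bar> \<partial>lborel)"
    using assms by (intro nn_integral_affine) auto
  finally show ?thesis using assms unit_ball_measure
    by (simp add: mult.assoc[symmetric] ennreal_mult[symmetric])
qed

text \<open>The segment from y to x is translated by \<epsilon> \<theta>; integrating over \<theta>
  before t replaces pointwise values of the gradient by its L1 norm.\<close>

lemma ball_average_lipschitz:
  assumes \<epsilon>: "0 < \<epsilon>"
  shows "ennreal \<bar>ball_average \<epsilon> f x - ball_average \<epsilon> f y\<bar> \<le>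
    ennreal (norm (x - y) / (measure lborel (ball (0::'a) 1) * \<epsilon> ^ DIM('a))) * (\<integral>\<^sup>+ x. ennreal (norm (grad f x)) \<partial>lborel)"
proof -
  note [measurable] = test_measurable[OF f] grad_measurable[OF f]
  let ?\<beta> = "measure lborel (ball (0::'a) 1)"
  let ?g = "\<lambda>z. ennreal (norm (grad f z))"
  have "ennreal \<bar>ball_average \<epsilon> f x - ball_average \<epsilon> f y\<bar> = ennreal (1 / ?\<beta>) *
     ennreal (norm (\<integral>\<theta>. f (x + \<epsilon> *\<^sub>R \<theta>) * indicator (ball 0 1) \<theta> - f (y + \<epsilon> *\<^sub>R \<theta>) * indicator (ball 0 1) \<theta> \<partial>lborel))"
    using unit_ball_measure ball_average_integrable
    by (simp add: ball_average_def ennreal_mult[symmetric] abs_divide diff_divide_distrib[symmetric])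
  also have "\<dots> \<le> ennreal (1 / ?\<beta>) * (\<integral>\<^sup>+ \<theta>. ennreal (norm (f (x + \<epsilon> *\<^sub>R \<theta>) * indicator (ball 0 1) \<theta> - f (y + \<epsilon> *\<^sub>R \<theta>) * indicator (ball 0 1) \<theta>)) \<partial>lborel)"
    by (intro mult_left_mono integral_norm_bound_ennreal Bochner_Integration.integrable_diff ball_average_integrable) simp
  also have "\<dots> \<le> ennreal (1 / ?\<beta>) * (\<integral>\<^sup>+ \<theta>. ennreal (norm (x - y)) * (\<integral>\<^sup>+ t. ?g ((y + t *\<^sub>R (x - y)) + \<epsilon> *\<^sub>R \<theta>) * indicator {0<..<1} t \<partial>lborel) \<partial>lborel)"
  proof (intro mult_left_mono nn_integral_mono)
    fix \<theta>
    have "ennreal (norm (f (x + \<epsilon> *\<^sub>R \<theta>) * indicator (ball 0 1) \<theta> - f (y + \<epsilon> *\<^sub>R \<theta>) * indicator (ball 0 1) \<theta>)) \<le>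
      ennreal \<bar>f ((y + \<epsilon> *\<^sub>R \<theta>) + 1 *\<^sub>R (x - y)) - f (y + \<epsilon> *\<^sub>R \<theta>)\<bar>"
      by (auto simp: indicator_def algebra_simps)
    also have "\<dots> \<le> ennreal (norm (x - y)) * (\<integral>\<^sup>+ t. ?g ((y + \<epsilon> *\<^sub>R \<theta>) + t *\<^sub>R (x - y)) * indicator {0<..<1} t \<partial>lborel)"
      by (rule line_bound[OF f order_refl]) simp
    finally show "ennreal (norm (f (x + \<epsilon> *\<^sub>R \<theta>) * indicator (ball 0 1) \<theta> - f (y + \<epsilon> *\<^sub>R \<theta>) * indicator (ball 0 1) \<theta>)) \<le>
      ennreal (norm (x - y)) * (\<integral>\<^sup>+ t. ?g ((y + t *\<^sub>R (x - y)) + \<epsilon> *\<^sub>R \<theta>) * indicator {0<..<1} t \<partial>lborel)"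
      by (simp add: add_ac)
  qed simp
  also have "(\<integral>\<^sup>+ \<theta>. ennreal (norm (x - y)) * (\<integral>\<^sup>+ t. ?g ((y + t *\<^sub>R (x - y)) + \<epsilon> *\<^sub>R \<theta>) * indicator {0<..<1} t \<partial>lborel) \<partial>lborel) =
     ennreal (norm (x - y)) * (\<integral>\<^sup>+ \<theta>. (\<integral>\<^sup>+ t. ?g ((y + t *\<^sub>R (x - y)) + \<epsilon> *\<^sub>R \<theta>) * indicator {0<..<1} t \<partial>lborel) \<partial>lborel)"
    by (rule nn_integral_cmult) measurable
  also have "(\<integral>\<^sup>+ \<theta>. (\<integral>\<^sup>+ t. ?g ((y + t *\<^sub>R (x - y)) + \<epsilon> *\<^sub>R \<theta>) * indicator {0<..<1} t \<partial>lborel) \<partial>lborel) =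
     (\<integral>\<^sup>+ t. (\<integral>\<^sup>+ \<theta>. ?g ((y + t *\<^sub>R (x - y)) + \<epsilon> *\<^sub>R \<theta>) * indicator {0<..<1} t \<partial>lborel) \<partial>lborel)"
    by (rule lborel_pair.Fubini') measurable
  also have "\<dots> = (\<integral>\<^sup>+ t. (ennreal (1 / \<epsilon> ^ DIM('a)) * (\<integral>\<^sup>+ z. ?g z \<partial>lborel)) * indicator {0<..<1} t \<partial>(lborel :: real measure))"
  proof (rule nn_integral_cong)
    fix t :: real
    have "(\<integral>\<^sup>+ \<theta>. ?g ((y + t *\<^sub>R (x - y)) + \<epsilon> *\<^sub>R \<theta>) * indicator {0<..<1} t \<partial>lborel) =
      (\<integral>\<^sup>+ \<theta>. ?g ((y + t *\<^sub>R (x - y)) + \<epsilon> *\<^sub>R \<theta>) \<partial>lborel) * indicator {0<..<1} t"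
      by (rule nn_integral_multc) measurable
    also have "(\<integral>\<^sup>+ \<theta>. ?g ((y + t *\<^sub>R (x - y)) + \<epsilon> *\<^sub>R \<theta>) \<partial>lborel) = ennreal (1 / \<epsilon> ^ DIM('a)) * (\<integral>\<^sup>+ z. ?g z \<partial>lborel)"
      by (rule nn_integral_affine[OF _ \<epsilon>]) measurable
    finally show "(\<integral>\<^sup>+ \<theta>. ?g ((y + t *\<^sub>R (x - y)) + \<epsilon> *\<^sub>R \<theta>) * indicator {0<..<1} t \<partial>lborel) =
       (ennreal (1 / \<epsilon> ^ DIM('a)) * (\<integral>\<^sup>+ z. ?g z \<partial>lborel)) * indicator {0<..<1} t" .
  qed
  also have "\<dots> = ennreal (1 / \<epsilon> ^ DIM('a)) * (\<integral>\<^sup>+ z. ?g z \<partial>lborel)"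
    by (subst nn_integral_cmult_indicator) auto
  also have "ennreal (1 / ?\<beta>) * (ennreal (norm (x - y)) * (ennreal (1 / \<epsilon> ^ DIM('a)) * (\<integral>\<^sup>+ z. ?g z \<partial>lborel))) =
    (ennreal (1 / ?\<beta>) * ennreal (norm (x - y)) * ennreal (1 / \<epsilon> ^ DIM('a))) * (\<integral>\<^sup>+ z. ?g z \<partial>lborel)"
    by (simp only: mult.assoc)
  also have "ennreal (1 / ?\<beta>) * ennreal (norm (x - y)) * ennreal (1 / \<epsilon> ^ DIM('a)) = ennreal (norm (x - y) / (?\<beta> * \<epsilon> ^ DIM('a)))"
    using \<epsilon> unit_ball_measure(2) by (simp add: ennreal_mult[symmetric])
  finally show ?thesis .
qed

text \<open>The bound along the segment from x to x + \<epsilon> \<theta> is integrated over x. By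
  translation invariance each t contributes the full L1 norm of the gradient, and t ranges over an
  interval of length \<epsilon>.\<close>

lemma ball_average_approx:
  assumes \<epsilon>: "0 < \<epsilon>"
  shows "(\<integral>\<^sup>+ x. ennreal \<bar>ball_average \<epsilon> f x - f x\<bar> \<partial>lborel) \<le> ennreal \<epsilon> * (\<integral>\<^sup>+ x. ennreal (norm (grad f x)) \<partial>lborel)"
proof -
  note [measurable] = test_measurable[OF f] grad_measurable[OF f] ball_average_measurable
  have [measurable]: "ball (0::'a) 1 \<in> sets borel" by simp
  let ?\<beta> = "measure lborel (ball (0::'a) 1)" and ?B = "ball (0::'a) 1"
  let ?g = "\<lambda>z. ennreal (norm (grad f z))"
  have pt: "ennreal \<bar>ball_average \<epsilon> f x - f x\<bar> \<le> ennreal (1 / ?\<beta>) * (\<integral>\<^sup>+ \<theta>. (\<integral>\<^sup>+ t. ?g (x + t *\<^sub>R \<theta>) * indicator {0<..<\<epsilon>} t \<partial>lborel) * indicator ?B \<theta> \<partial>lborel)" for x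
  proof -
    have i: "integrable lborel (\<lambda>\<theta>. f x * indicator ?B \<theta>)"
      by (intro integrable_mult_right integrable_real_indicator) (use unit_ball_measure in auto)
    have fx: "f x = (\<integral>\<theta>. f x * indicator ?B \<theta> \<partial>lborel) / ?\<beta>"
      using unit_ball_measure by simp
    have "ball_average \<epsilon> f x - f x = (\<integral>\<theta>. f (x + \<epsilon> *\<^sub>R \<theta>) * indicator ?B \<theta> - f x * indicator ?B \<theta> \<partial>lborel) / ?\<beta>"
      unfolding Bochner_Integration.integral_diff[OF ball_average_integrable i] diff_divide_distrib fx[symmetric] ball_average_def ..
    then have "ennreal \<bar>ball_average \<epsilon> f x - f x\<bar> = ennreal (1 / ?\<beta>) * ennreal (norm (\<integral>\<theta>. f (x + \<epsilon> *\<^sub>R \<theta>) * indicator ?B \<theta> - f x * indicator ?B \<theta> \<partial>lborel))"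
      using unit_ball_measure by (simp add: ennreal_mult[symmetric] abs_divide)
    also have "\<dots> \<le> ennreal (1 / ?\<beta>) * (\<integral>\<^sup>+ \<theta>. ennreal (norm (f (x + \<epsilon> *\<^sub>R \<theta>) * indicator ?B \<theta> - f x * indicator ?B \<theta>)) \<partial>lborel)"
      by (intro mult_left_mono integral_norm_bound_ennreal Bochner_Integration.integrable_diff ball_average_integrable i) simp
    also have "\<dots> \<le> ennreal (1 / ?\<beta>) * (\<integral>\<^sup>+ \<theta>. (\<integral>\<^sup>+ t. ?g (x + t *\<^sub>R \<theta>) * indicator {0<..<\<epsilon>} t \<partial>lborel) * indicator ?B \<theta> \<partial>lborel)"
    proof (intro mult_left_mono nn_integral_mono)
      fix \<theta> :: 'a
      show "ennreal (norm (f (x + \<epsilon> *\<^sub>R \<theta>) * indicator ?B \<theta> - f x * indicator ?B \<theta>)) \<le> (\<integral>\<^sup>+ t. ?g (x + t *\<^sub>R \<theta>) * indicator {0<..<\<epsilon>} t \<partial>lborel) * indicator ?B \<theta>"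
      proof (cases "\<theta> \<in> ?B")
        case True
        then have "norm \<theta> \<le> 1" by simp
        from line_bound[OF f this \<epsilon>, of x] show ?thesis using True by simp
      qed simp
    qed simp
    finally show ?thesis .
  qed
  have "(\<integral>\<^sup>+ x. ennreal \<bar>ball_average \<epsilon> f x - f x\<bar> \<partial>lborel) \<le>
     (\<integral>\<^sup>+ x. ennreal (1 / ?\<beta>) * (\<integral>\<^sup>+ \<theta>. (\<integral>\<^sup>+ t. ?g (x + t *\<^sub>R \<theta>) * indicator {0<..<\<epsilon>} t \<partial>lborel) * indicator ?B \<theta> \<partial>lborel) \<partial>lborel)"
    by (rule nn_integral_mono) (rule pt)
  also have "\<dots> = ennreal (1 / ?\<beta>) * (\<integral>\<^sup>+ x. (\<integral>\<^sup>+ \<theta>. (\<integral>\<^sup>+ t. ?g (x + t *\<^sub>R \<theta>) * indicator {0<..<\<epsilon>} t \<partial>lborel) * indicator ?B \<theta> \<partial>lborel) \<partial>lborel)"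
    by (rule nn_integral_cmult) measurable
  also have "(\<integral>\<^sup>+ x. (\<integral>\<^sup>+ \<theta>. (\<integral>\<^sup>+ t. ?g (x + t *\<^sub>R \<theta>) * indicator {0<..<\<epsilon>} t \<partial>lborel) * indicator ?B \<theta> \<partial>lborel) \<partial>lborel) =
     (\<integral>\<^sup>+ \<theta>. (\<integral>\<^sup>+ x. (\<integral>\<^sup>+ t. ?g (x + t *\<^sub>R \<theta>) * indicator {0<..<\<epsilon>} t \<partial>lborel) * indicator ?B \<theta> \<partial>lborel) \<partial>lborel)"
    by (rule lborel_pair.Fubini') measurable
  also have "\<dots> = (\<integral>\<^sup>+ \<theta>. (ennreal \<epsilon> * (\<integral>\<^sup>+ z. ?g z \<partial>lborel)) * indicator ?B \<theta> \<partial>lborel)"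
  proof (rule nn_integral_cong)
    fix \<theta> :: 'a
    have "(\<integral>\<^sup>+ x. (\<integral>\<^sup>+ t. ?g (x + t *\<^sub>R \<theta>) * indicator {0<..<\<epsilon>} t \<partial>lborel) \<partial>lborel) =
      (\<integral>\<^sup>+ t. (\<integral>\<^sup>+ x. ?g (x + t *\<^sub>R \<theta>) * indicator {0<..<\<epsilon>} t \<partial>lborel) \<partial>lborel)"
      by (rule lborel_pair.Fubini') measurable
    also have "\<dots> = (\<integral>\<^sup>+ t. (\<integral>\<^sup>+ z. ?g z \<partial>lborel) * indicator {0<..<\<epsilon>} t \<partial>lborel)"
    proof (rule nn_integral_cong)
      fix t :: real
      have "(\<integral>\<^sup>+ x. ?g (x + t *\<^sub>R \<theta>) * indicator {0<..<\<epsilon>} t \<partial>lborel) = (\<integral>\<^sup>+ x. ?g (x + t *\<^sub>R \<theta>) \<partial>lborel) * indicator {0<..<\<epsilon>} t"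
        by (rule nn_integral_multc) measurable
      also have "(\<integral>\<^sup>+ x. ?g (x + t *\<^sub>R \<theta>) \<partial>lborel) = (\<integral>\<^sup>+ z. ?g z \<partial>lborel)"
        by (rule nn_integral_translate) measurable
      finally show "(\<integral>\<^sup>+ x. ?g (x + t *\<^sub>R \<theta>) * indicator {0<..<\<epsilon>} t \<partial>lborel) = (\<integral>\<^sup>+ z. ?g z \<partial>lborel) * indicator {0<..<\<epsilon>} t" .
    qed
    also have "\<dots> = ennreal \<epsilon> * (\<integral>\<^sup>+ z. ?g z \<partial>lborel)"
      using \<epsilon> by (subst nn_integral_cmult_indicator) (auto simp: mult.commute)
    finally have "(\<integral>\<^sup>+ x. (\<integral>\<^sup>+ t. ?g (x + t *\<^sub>R \<theta>) * indicator {0<..<\<epsilon>} t \<partial>lborel) \<partial>lborel) = ennreal \<epsilon> * (\<integral>\<^sup>+ z. ?g z \<partial>lborel)" .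
    moreover have "(\<integral>\<^sup>+ x. (\<integral>\<^sup>+ t. ?g (x + t *\<^sub>R \<theta>) * indicator {0<..<\<epsilon>} t \<partial>lborel) * indicator ?B \<theta> \<partial>lborel) =
       (\<integral>\<^sup>+ x. (\<integral>\<^sup>+ t. ?g (x + t *\<^sub>R \<theta>) * indicator {0<..<\<epsilon>} t \<partial>lborel) \<partial>lborel) * indicator ?B \<theta>"
      by (rule nn_integral_multc) measurable
    ultimately show "(\<integral>\<^sup>+ x. (\<integral>\<^sup>+ t. ?g (x + t *\<^sub>R \<theta>) * indicator {0<..<\<epsilon>} t \<partial>lborel) * indicator ?B \<theta> \<partial>lborel) =
       (ennreal \<epsilon> * (\<integral>\<^sup>+ z. ?g z \<partial>lborel)) * indicator ?B \<theta>" by simp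
  qed
  also have "\<dots> = (ennreal \<epsilon> * (\<integral>\<^sup>+ z. ?g z \<partial>lborel)) * ennreal ?\<beta>"
    using unit_ball_measure(1) by (subst nn_integral_cmult_indicator) auto
  also have "ennreal (1 / ?\<beta>) * ((ennreal \<epsilon> * (\<integral>\<^sup>+ z. ?g z \<partial>lborel)) * ennreal ?\<beta>) = (ennreal (1 / ?\<beta>) * ennreal ?\<beta>) * (ennreal \<epsilon> * (\<integral>\<^sup>+ z. ?g z \<partial>lborel))"
    by (simp only: mult_ac)
  also have "ennreal (1 / ?\<beta>) * ennreal ?\<beta> = 1"
    using unit_ball_measure(2) by (simp add: ennreal_mult[symmetric])
  finally show ?thesis by simp
qed

end

text \<open>At each scale 1 / (k + 1) the averages have a uniformly Cauchy subsequence by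
  Arzela-Ascoli, and a diagonal sequence serves all scales. The L1 distance of two members is then
  bounded by two smoothing errors and one uniform difference of averages. The conclusion is a Cauchy
  condition; an almost everywhere limit is extracted from it later.\<close>

lemma rellich:
  fixes \<Omega> :: "'a::euclidean_space set" and f :: "nat \<Rightarrow> 'a \<Rightarrow> real"
  assumes op: "open \<Omega>" and bd: "bounded \<Omega>" and f: "\<And>n. f n \<in> test_functions \<Omega>"
    and G: "\<And>n. (\<integral>\<^sup>+ x. ennreal (norm (grad (f n) x)) \<partial>lborel) \<le> ennreal G" "0 < G"
  obtains s :: "nat \<Rightarrow> nat" where "strict_mono s"
    "\<And>e. 0 < e \<Longrightarrow> \<exists>N. \<forall>i\<ge>N. \<forall>j\<ge>N. (\<integral>\<^sup>+ x. ennreal \<bar>f (s i) x - f (s j) x\<bar> \<partial>lborel) \<le> ennreal e"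
proof -
  note [measurable] = test_measurable[OF f] ball_average_measurable[OF f]
  let ?\<beta> = "measure lborel (ball (0::'a) 1)"
  note \<beta> = unit_ball_measure[OF f[of 0]]
  obtain C where C: "0 \<le> C" "\<And>f H. f \<in> test_functions \<Omega> \<Longrightarrow> 0 < H \<Longrightarrow> (\<integral>\<^sup>+ x. ennreal (norm (grad f x) powr 1) \<partial>lborel) \<le> ennreal H \<Longrightarrow>
     (\<integral>\<^sup>+ x. ennreal (\<bar>f x\<bar> powr 1) \<partial>lborel) \<le> ennreal (C * H powr (1 / 1))"
    using sobolev_inequality[OF op bd, of 1 1] by auto
  have L: "(\<integral>\<^sup>+ x. ennreal \<bar>f n x\<bar> \<partial>lborel) \<le> ennreal (C * G)" for n
    using C(2)[OF f G(2), of n] G by simp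
  define \<epsilon> where "\<epsilon> k = 1 / real (Suc k)" for k
  have \<epsilon>: "0 < \<epsilon> k" for k by (simp add: \<epsilon>_def)
  define P where "P k s \<longleftrightarrow> (\<forall>e>0. \<exists>N. \<forall>i\<ge>N. \<forall>j\<ge>N. \<forall>x\<in>\<Omega>. \<bar>ball_average (\<epsilon> k) (f (s i)) x - ball_average (\<epsilon> k) (f (s j)) x\<bar> \<le> e)"
    for k and s :: "nat \<Rightarrow> nat"
  interpret subseqs P
  proof
    fix k and s :: "nat \<Rightarrow> nat" assume "strict_mono s"
    let ?A = "\<lambda>n. ball_average (\<epsilon> k) (f (s n))"
    define c where "c = 1 / (?\<beta> * \<epsilon> k ^ DIM('a))"
    have c: "0 < c" using \<beta> \<epsilon> by (simp add: c_def)
    obtain g t where t: "strict_mono (t :: nat \<Rightarrow> nat)"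
      "\<And>e. 0 < e \<Longrightarrow> \<exists>N. \<forall>n x. n \<ge> N \<and> x \<in> closure \<Omega> \<longrightarrow> norm (?A (t n) x - g x) < e"
    proof (rule Arzela_Ascoli[of "closure \<Omega>" ?A "c * (C * G)"])
      show "compact (closure \<Omega>)" using bd by (simp add: compact_closure)
      show "norm (?A n x) \<le> c * (C * G)" for n x
      proof -
        have "ennreal \<bar>?A n x\<bar> \<le> ennreal c * (\<integral>\<^sup>+ x. ennreal \<bar>f (s n) x\<bar> \<partial>lborel)"
          unfolding c_def by (rule ball_average_le[OF f \<epsilon>])
        also have "\<dots> \<le> ennreal c * ennreal (C * G)" by (intro mult_left_mono L) simp
        also have "\<dots> = ennreal (c * (C * G))" using c C G by (simp add: ennreal_mult[symmetric])
        finally show ?thesis using c C G by (simp add: ennreal_le_iff)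
      qed
      have lip: "norm (?A n x - ?A n y) \<le> norm (x - y) * (c * G)" for n x y
      proof -
        have "ennreal \<bar>?A n x - ?A n y\<bar> \<le> ennreal (norm (x - y) * c) * (\<integral>\<^sup>+ x. ennreal (norm (grad (f (s n)) x)) \<partial>lborel)"
          using ball_average_lipschitz[OF f \<epsilon>, of k "s n" x y] by (simp add: c_def)
        also have "\<dots> \<le> ennreal (norm (x - y) * c) * ennreal G" by (intro mult_left_mono G) simp
        also have "\<dots> = ennreal (norm (x - y) * (c * G))" using c G by (simp add: ennreal_mult[symmetric] mult.assoc)
        finally show ?thesis using c G by (simp add: ennreal_le_iff)
      qed
      show "\<exists>d. 0 < d \<and> (\<forall>n y. y \<in> closure \<Omega> \<and> norm (x - y) < d \<longrightarrow> norm (?A n x - ?A n y) < e)" if "0 < e" for x e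
      proof (intro exI[of _ "e / (c * G)"] conjI allI impI)
        show "0 < e / (c * G)" using that c G by simp
        fix n y assume "y \<in> closure \<Omega> \<and> norm (x - y) < e / (c * G)"
        then have "norm (x - y) * (c * G) < e" using c G by (simp add: field_simps)
        then show "norm (?A n x - ?A n y) < e" using lip[of n x y] by linarith
      qed
    qed (use that in blast)
    have "P k (s \<circ> t)" unfolding P_def
    proof (intro allI impI)
      fix e :: real assume "0 < e"
      then obtain N where N: "\<And>n x. n \<ge> N \<Longrightarrow> x \<in> closure \<Omega> \<Longrightarrow> norm (?A (t n) x - g x) < e / 2"
        using t(2)[of "e / 2"] by auto
      have "\<bar>?A (t i) x - ?A (t j) x\<bar> \<le> e" if "i \<ge> N" "j \<ge> N" "x \<in> \<Omega>" for i j x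
      proof -
        have "x \<in> closure \<Omega>" using that(3) closure_subset by blast
        from N[OF that(1) this] N[OF that(2) this] show ?thesis unfolding real_norm_def by linarith
      qed
      then show "\<exists>N. \<forall>i\<ge>N. \<forall>j\<ge>N. \<forall>x\<in>\<Omega>. \<bar>ball_average (\<epsilon> k) (f ((s \<circ> t) i)) x - ball_average (\<epsilon> k) (f ((s \<circ> t) j)) x\<bar> \<le> e"
        by auto
    qed
    with t(1) show "\<exists>r'. strict_mono r' \<and> P k (s \<circ> r')" by blast
  qed
  \<comment> \<open>The diagonal construction guarantees the property only for the sequence started
    at index \<open>Suc k\<close>; a Cauchy condition is insensitive to that shift.\<close>
  have Pd: "P k diagseq" for k
  proof -
    have "P k (diagseq \<circ> ((+) (Suc k)))"
    proof (rule diagseq_holds)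
      fix r s :: "nat \<Rightarrow> nat" and n assume r: "strict_mono r" and "P n s"
      show "P n (s \<circ> r)" unfolding P_def
      proof (intro allI impI)
        fix e :: real assume "0 < e"
        with \<open>P n s\<close> obtain N where N: "\<forall>i\<ge>N. \<forall>j\<ge>N. \<forall>x\<in>\<Omega>. \<bar>ball_average (\<epsilon> n) (f (s i)) x - ball_average (\<epsilon> n) (f (s j)) x\<bar> \<le> e"
          unfolding P_def by blast
        have "N \<le> r i" if "N \<le> i" for i using seq_suble[OF r, of i] that by simp
        with N show "\<exists>N. \<forall>i\<ge>N. \<forall>j\<ge>N. \<forall>x\<in>\<Omega>. \<bar>ball_average (\<epsilon> n) (f ((s \<circ> r) i)) x - ball_average (\<epsilon> n) (f ((s \<circ> r) j)) x\<bar> \<le> e"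
          by (intro exI[of _ N]) auto
      qed
    qed
    have "\<exists>N. \<forall>i\<ge>N. \<forall>j\<ge>N. \<forall>x\<in>\<Omega>. \<bar>ball_average (\<epsilon> k) (f (diagseq i)) x - ball_average (\<epsilon> k) (f (diagseq j)) x\<bar> \<le> e"
      if "0 < e" for e
    proof -
      have "\<exists>N. \<forall>i\<ge>N. \<forall>j\<ge>N. \<forall>x\<in>\<Omega>. \<bar>ball_average (\<epsilon> k) (f (diagseq (Suc k + i))) x - ball_average (\<epsilon> k) (f (diagseq (Suc k + j))) x\<bar> \<le> e"
        using \<open>P k (diagseq \<circ> ((+) (Suc k)))\<close> \<open>0 < e\<close> unfolding P_def o_def by blast
      then obtain N where N: "\<forall>i\<ge>N. \<forall>j\<ge>N. \<forall>x\<in>\<Omega>. \<bar>ball_average (\<epsilon> k) (f (diagseq (Suc k + i))) x - ball_average (\<epsilon> k) (f (diagseq (Suc k + j))) x\<bar> \<le> e"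
        by blast
      have "\<bar>ball_average (\<epsilon> k) (f (diagseq i)) x - ball_average (\<epsilon> k) (f (diagseq j)) x\<bar> \<le> e"
        if "i \<ge> Suc k + N" "j \<ge> Suc k + N" "x \<in> \<Omega>" for i j x
        using N[rule_format, of "i - Suc k" "j - Suc k" x] that by simp
      then show ?thesis by blast
    qed
    then show ?thesis unfolding P_def by blast
  qed
  define m where "m = measure lborel \<Omega>"
  have m: "emeasure lborel \<Omega> = ennreal m" "0 \<le> m"
    using emeasure_bounded_finite[OF bd] by (auto simp: m_def intro!: emeasure_eq_ennreal_measure)
  show ?thesis
  proof (rule that[OF subseq_diagseq])
    fix e :: real assume e: "0 < e"
    obtain k where k: "\<epsilon> k * G \<le> e / 4"
    proof -
      obtain k where "4 * G / e < real (Suc k)" using reals_Archimedean2 less_trans[OF _ of_nat_less_iff[THEN iffD2, OF lessI]] by metis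
      then have "\<epsilon> k * G \<le> e / 4" using e G by (simp add: \<epsilon>_def field_simps del: of_nat_Suc)
      then show ?thesis by (rule that)
    qed
    \<comment> \<open>The uniform difference is integrated over \<Omega>, so its measure m is
      divided out; the +1 covers m = 0.\<close>
    define e' where "e' = e / (2 * (m + 1))"
    have e': "0 < e'" "e' * m \<le> e / 2" using e m by (auto simp: e'_def field_simps)
    obtain N where N: "\<And>i j x. i \<ge> N \<Longrightarrow> j \<ge> N \<Longrightarrow> x \<in> \<Omega> \<Longrightarrow> \<bar>ball_average (\<epsilon> k) (f (diagseq i)) x - ball_average (\<epsilon> k) (f (diagseq j)) x\<bar> \<le> e'"
      using Pd[of k] e'(1) unfolding P_def by blast
    have "(\<integral>\<^sup>+ x. ennreal \<bar>f (diagseq i) x - f (diagseq j) x\<bar> \<partial>lborel) \<le> ennreal e" if ij: "i \<ge> N" "j \<ge> N" for i j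
    proof -
      let ?A = "\<lambda>i. ball_average (\<epsilon> k) (f (diagseq i))"
      have appr: "(\<integral>\<^sup>+ x. ennreal \<bar>?A i x - f (diagseq i) x\<bar> \<partial>lborel) \<le> ennreal (e / 4)" for i
      proof -
        have "(\<integral>\<^sup>+ x. ennreal \<bar>?A i x - f (diagseq i) x\<bar> \<partial>lborel) \<le> ennreal (\<epsilon> k) * (\<integral>\<^sup>+ x. ennreal (norm (grad (f (diagseq i)) x)) \<partial>lborel)"
          by (rule ball_average_approx[OF f \<epsilon>])
        also have "\<dots> \<le> ennreal (\<epsilon> k) * ennreal G" by (intro mult_left_mono G) simp
        also have "\<dots> \<le> ennreal (e / 4)" using k \<epsilon>[of k] G by (simp add: ennreal_mult[symmetric] ennreal_leI)
        finally show ?thesis .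
      qed
      have "(\<integral>\<^sup>+ x. ennreal \<bar>f (diagseq i) x - f (diagseq j) x\<bar> \<partial>lborel) \<le>
         (\<integral>\<^sup>+ x. (ennreal \<bar>?A i x - f (diagseq i) x\<bar> + ennreal \<bar>?A j x - f (diagseq j) x\<bar>) + ennreal e' * indicator \<Omega> x \<partial>lborel)"
      proof (rule nn_integral_mono)
        fix x
        show "ennreal \<bar>f (diagseq i) x - f (diagseq j) x\<bar> \<le> (ennreal \<bar>?A i x - f (diagseq i) x\<bar> + ennreal \<bar>?A j x - f (diagseq j) x\<bar>) + ennreal e' * indicator \<Omega> x"
        proof (cases "x \<in> \<Omega>")
          case True
          have "\<bar>f (diagseq i) x - f (diagseq j) x\<bar> \<le> \<bar>?A i x - f (diagseq i) x\<bar> + \<bar>?A j x - f (diagseq j) x\<bar> + e'"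
            using N[OF ij True] by linarith
          then show ?thesis using True e'(1) by (simp add: ennreal_plus[symmetric] ennreal_leI del: ennreal_plus)
        next
          case False
          then show ?thesis using test_zero_outside[OF f False] by simp
        qed
      qed
      also have "\<dots> = ((\<integral>\<^sup>+ x. ennreal \<bar>?A i x - f (diagseq i) x\<bar> \<partial>lborel) + (\<integral>\<^sup>+ x. ennreal \<bar>?A j x - f (diagseq j) x\<bar> \<partial>lborel)) + ennreal e' * ennreal m"
        using op m by (simp add: nn_integral_add nn_integral_cmult_indicator)
      also have "\<dots> \<le> (ennreal (e / 4) + ennreal (e / 4)) + ennreal (e / 2)"
        using e' m by (intro add_mono appr) (simp add: ennreal_mult[symmetric] ennreal_leI)
      also have "\<dots> = ennreal e" using e by (simp add: ennreal_plus[symmetric] del: ennreal_plus)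
      finally show ?thesis .
    qed
    then show "\<exists>N. \<forall>i\<ge>N. \<forall>j\<ge>N. (\<integral>\<^sup>+ x. ennreal \<bar>f (diagseq i) x - f (diagseq j) x\<bar> \<partial>lborel) \<le> ennreal e"
      by blast
  qed
qed

subsection \<open>Convexity of powers of the norm\<close>

text \<open>The tangent inequality at d, the convex combination of the two norms, is applied to each
  norm and averaged with the weights 1 - t and t.\<close>

lemma powr_norm_convex:
  fixes u v :: "'a::real_normed_vector"
  assumes p: "1 \<le> p" and t: "0 \<le> t" "t \<le> 1"
  shows "norm ((1 - t) *\<^sub>R u + t *\<^sub>R v) powr p \<le> (1 - t) * norm u powr p + t * norm v powr p"
proof -
  define d where "d = (1 - t) * norm u + t * norm v"
  have d0: "0 \<le> d" using t by (simp add: d_def)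
  have "norm ((1 - t) *\<^sub>R u + t *\<^sub>R v) \<le> norm ((1 - t) *\<^sub>R u) + norm (t *\<^sub>R v)" by (rule norm_triangle_ineq)
  also have "\<dots> = d" using t by (simp add: d_def)
  finally have "norm ((1 - t) *\<^sub>R u + t *\<^sub>R v) powr p \<le> d powr p" using p by (intro powr_mono2) auto
  also have "d powr p \<le> (1 - t) * norm u powr p + t * norm v powr p"
  proof (cases "d = 0")
    case False
    then have dp: "0 < d" using d0 by simp
    have "(1 - t) * (p * d powr (p - 1) * norm u) + t * (p * d powr (p - 1) * norm v) \<le>
      (1 - t) * (norm u powr p + (p - 1) * d powr p) + t * (norm v powr p + (p - 1) * d powr p)"
      using t by (intro add_mono mult_left_mono powr_tangent p dp) auto
    also have "\<dots> = (1 - t) * norm u powr p + t * norm v powr p + (p * d powr p - d powr p)"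
      by (simp add: algebra_simps)
    also have "(1 - t) * (p * d powr (p - 1) * norm u) + t * (p * d powr (p - 1) * norm v) = p * (d powr (p - 1) * ((1 - t) * norm u + t * norm v))"
      by (simp add: algebra_simps)
    also have "d powr (p - 1) * ((1 - t) * norm u + t * norm v) = d powr p" using dp by (simp add: powr_diff flip: d_def)
    finally show ?thesis by simp
  qed (use t in simp)
  finally show ?thesis .
qed

text \<open>Strictness has two sources: the parallelogram law when the norms are equal, and the
  strict tangent inequality at their mean when they differ.\<close>

lemma powr_norm_midpoint_strict:
  fixes a b :: "'a::real_inner"
  assumes p: "1 < p" and ne: "a \<noteq> b"
  shows "norm ((a + b) /\<^sub>R 2) powr p < (norm a powr p + norm b powr p) / 2"
proof (cases "norm a = norm b")
  case True
  have "(norm (a + b))\<^sup>2 + (norm (a - b))\<^sup>2 = 4 * (norm a)\<^sup>2"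
  proof -
    have "(norm (a + b))\<^sup>2 + (norm (a - b))\<^sup>2 = 2 * (norm a)\<^sup>2 + 2 * (norm b)\<^sup>2"
      unfolding power2_norm_eq_inner by (simp add: inner_add_left inner_add_right inner_diff_left inner_diff_right)
    then show ?thesis using True by simp
  qed
  moreover have "0 < (norm (a - b))\<^sup>2" using ne by simp
  ultimately have "(norm (a + b))\<^sup>2 < 4 * (norm a)\<^sup>2" by linarith
  then have "(norm (a + b))\<^sup>2 < (2 * norm a)\<^sup>2" by (simp add: power_mult_distrib)
  then have "norm (a + b) < 2 * norm a" by (rule power_less_imp_less_base) simp
  then have "norm ((a + b) /\<^sub>R 2) < norm a" by simp
  then have "norm ((a + b) /\<^sub>R 2) powr p < norm a powr p" using p by (intro powr_less_mono2) auto
  then show ?thesis using True by simp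
next
  case False
  define d where "d = (norm a + norm b) / 2"
  have "a \<noteq> 0 \<or> b \<noteq> 0" using False by auto
  then have "0 < norm a + norm b" by (auto intro: add_pos_nonneg add_nonneg_pos)
  then have "0 < d" by (simp add: d_def)
  then have d: "0 < d" "norm a \<noteq> d" "norm b \<noteq> d" using False by (auto simp: d_def)
  have "norm ((a + b) /\<^sub>R 2) \<le> d" using norm_triangle_ineq[of a b] by (simp add: d_def)
  then have 1: "norm ((a + b) /\<^sub>R 2) powr p \<le> d powr p" using p by (intro powr_mono2) auto
  have "p * d powr (p - 1) * norm a + p * d powr (p - 1) * norm b <
     (norm a powr p + (p - 1) * d powr p) + (norm b powr p + (p - 1) * d powr p)"
    using d p by (intro add_strict_mono powr_tangent_strict) auto
  also have "p * d powr (p - 1) * norm a + p * d powr (p - 1) * norm b = 2 * p * (d powr (p - 1) * d)"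
    by (simp add: d_def algebra_simps)
  also have "d powr (p - 1) * d = d powr p" using d by (simp add: powr_diff)
  finally have "2 * d powr p < norm a powr p + norm b powr p" by (simp add: algebra_simps)
  then have "d powr p < (norm a powr p + norm b powr p) / 2" by simp
  with 1 show ?thesis by (rule le_less_trans)
qed

lemma powr_norm_midpoint:
  fixes a b :: "'a::real_inner"
  assumes p: "1 < p"
  shows "norm ((a + b) /\<^sub>R 2) powr p \<le> (norm a powr p + norm b powr p) / 2"
  using powr_norm_midpoint_strict[OF p, of a b] by (cases "a = b") (auto simp: scaleR_2[symmetric])

text \<open>All terms are homogeneous of degree p, so a and b may be normalised to maximum norm 1,
  and (p, a, b) then ranges over a compact set. Where the distance term is at least the \<epsilon>
  term, a and b differ; there the midpoint defect is positive and attains a positive minimum.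
  Uniformity over {r..P} comes from treating p as one of the compact variables.\<close>

lemma powr_norm_uniformly_convex:
  assumes r: "1 < r" and \<epsilon>: "0 < \<epsilon>"
  shows "\<exists>C\<ge>0. \<forall>p\<in>{r..P}. \<forall>a b :: 'a::euclidean_space. norm (a - b) powr p \<le>
    \<epsilon> * (norm a powr p + norm b powr p) + C * ((norm a powr p + norm b powr p) / 2 - norm ((a + b) /\<^sub>R 2) powr p)"
proof -
  define S where "S = {r..P} \<times> ({(a :: 'a, b :: 'a). max (norm a) (norm b) = 1})"
  have cl: "closed {(a :: 'a, b :: 'a). max (norm a) (norm b) = 1}"
  proof -
    have "closed {x :: 'a \<times> 'a. max (norm (fst x)) (norm (snd x)) = 1}"
      by (intro closed_Collect_eq continuous_intros)
    then show ?thesis by (simp add: case_prod_unfold)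
  qed
  have bd: "bounded {(a :: 'a, b :: 'a). max (norm a) (norm b) = 1}"
    by (rule bounded_subset[of "cball 0 1 \<times> cball 0 1"]) (auto intro: bounded_Times simp: max_def split: if_splits)
  have S: "compact S" unfolding S_def by (intro compact_Times compact_Icc) (use cl bd compact_eq_bounded_closed in blast)
  define N where "N x = norm (fst (snd x)) powr fst x + norm (snd (snd x)) powr fst x" for x :: "real \<times> 'a \<times> 'a"
  define E where "E x = norm (fst (snd x) - snd (snd x)) powr fst x" for x :: "real \<times> 'a \<times> 'a"
  define D where "D x = N x / 2 - norm ((fst (snd x) + snd (snd x)) /\<^sub>R 2) powr fst x" for x :: "real \<times> 'a \<times> 'a"
  have pos: "0 < fst x" if "x \<in> S" for x using that r by (auto simp: S_def)
  have cN: "continuous_on S N" unfolding N_def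
    by (intro continuous_intros continuous_on_powr') (use pos in auto)
  have cE: "continuous_on S E" unfolding E_def
    by (intro continuous_intros continuous_on_powr') (use pos in auto)
  have cD: "continuous_on S D" unfolding D_def
    by (intro continuous_intros continuous_on_powr' cN) (use pos in auto)
  define T where "T = {x \<in> S. \<epsilon> * N x \<le> E x}"
  have T: "compact T"
  proof -
    have "closed T" unfolding T_def
      by (rule continuous_on_closed_Collect_le) (auto intro!: continuous_intros cN cE compact_imp_closed S)
    moreover have "T = S \<inter> T" by (auto simp: T_def)
    ultimately show ?thesis using S by (metis compact_Int_closed)
  qed
  have NS: "1 \<le> N x" if "x \<in> S" for x
    using that by (auto simp: S_def N_def max_def add_increasing2 add_increasing split: if_splits)
  have Dpos: "0 < D x" if "x \<in> T" for x
  proof -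
    have xS: "x \<in> S" using that by (simp add: T_def)
    have "0 < \<epsilon> * N x" using NS[OF xS] \<epsilon> by (intro mult_pos_pos) auto
    then have "0 < E x" using that by (simp add: T_def)
    then have "fst (snd x) \<noteq> snd (snd x)" by (auto simp: E_def)
    moreover have "1 < fst x" using xS r by (auto simp: S_def)
    ultimately show ?thesis using powr_norm_midpoint_strict[of "fst x" "fst (snd x)" "snd (snd x)"] by (simp add: D_def N_def)
  qed
  have Dnn: "0 \<le> D x" if "x \<in> S" for x
    using powr_norm_midpoint[of "fst x" "fst (snd x)" "snd (snd x)"] that r by (auto simp: D_def N_def S_def)
  have "\<exists>d>0. \<forall>x\<in>T. d \<le> D x"
  proof (cases "T = {}")
    case True then show ?thesis by (intro exI[of _ 1]) auto
  next
    case False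
    have "continuous_on T D" by (rule continuous_on_subset[OF cD]) (auto simp: T_def)
    from continuous_attains_inf[OF T False this] obtain x where "x \<in> T" "\<forall>y\<in>T. D x \<le> D y" by blast
    then show ?thesis using Dpos by blast
  qed
  then obtain d where d: "0 < d" "\<And>x. x \<in> T \<Longrightarrow> d \<le> D x" by blast
  \<comment> \<open>On T the defect is at least d, while the left side is at most 2 powr P because
    normalised vectors are at distance at most 2.\<close>
  define C where "C = 2 powr P / d"
  have C: "0 \<le> C" using d by (simp add: C_def)
  have main: "E x \<le> \<epsilon> * N x + C * D x" if x: "x \<in> S" for x
  proof (cases "x \<in> T")
    case True
    have "norm (fst (snd x) - snd (snd x)) \<le> norm (fst (snd x)) + norm (snd (snd x))" by (rule norm_triangle_ineq4)
    also have "\<dots> \<le> 2" using x by (auto simp: S_def max_def split: if_splits)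
    finally have "E x \<le> 2 powr fst x" unfolding E_def using pos[OF x] by (intro powr_mono2) auto
    also have "\<dots> \<le> 2 powr P" using x by (intro powr_mono) (auto simp: S_def)
    also have "\<dots> = C * d" using d by (simp add: C_def)
    also have "\<dots> \<le> C * D x" using d(2)[OF True] C by (intro mult_left_mono)
    finally show ?thesis using NS[OF x] \<epsilon> by (simp add: add_increasing)
  next
    case False
    then have "E x \<le> \<epsilon> * N x" using x by (simp add: T_def)
    then show ?thesis using C Dnn[OF x] by (simp add: add_increasing2)
  qed
  show ?thesis
  proof (intro exI[of _ C] conjI C ballI allI)
    fix p and a b :: 'a assume p: "p \<in> {r..P}"
    show "norm (a - b) powr p \<le> \<epsilon> * (norm a powr p + norm b powr p) + C * ((norm a powr p + norm b powr p) / 2 - norm ((a + b) /\<^sub>R 2) powr p)"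
    proof (cases "a = 0 \<and> b = 0")
      case False
      define M where "M = max (norm a) (norm b)"
      have M: "0 < M" using False by (auto simp: M_def max_def)
      have "max (norm (a /\<^sub>R M)) (norm (b /\<^sub>R M)) = 1"
        using M by (auto simp: M_def max_def divide_simps)
      then have xS: "(p, a /\<^sub>R M, b /\<^sub>R M) \<in> S" using p by (simp add: S_def)
      have sc: "norm (c /\<^sub>R M) powr p = norm c powr p / M powr p" for c :: 'a
        using M by (simp add: powr_divide divide_inverse_commute[symmetric])
      have "a /\<^sub>R M - b /\<^sub>R M = (a - b) /\<^sub>R M" "(a /\<^sub>R M + b /\<^sub>R M) /\<^sub>R 2 = ((a + b) /\<^sub>R 2) /\<^sub>R M"
        by (simp_all add: scaleR_diff_right scaleR_add_right)
      then have "norm (a - b) powr p / M powr p \<le> \<epsilon> * (norm a powr p / M powr p + norm b powr p / M powr p) +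
          C * ((norm a powr p / M powr p + norm b powr p / M powr p) / 2 - norm ((a + b) /\<^sub>R 2) powr p / M powr p)"
        using main[OF xS] by (simp only: E_def N_def D_def fst_conv snd_conv sc)
      then have "M powr p * (norm (a - b) powr p / M powr p) \<le> M powr p * (\<epsilon> * (norm a powr p / M powr p + norm b powr p / M powr p) +
          C * ((norm a powr p / M powr p + norm b powr p / M powr p) / 2 - norm ((a + b) /\<^sub>R 2) powr p / M powr p))"
        by (intro mult_left_mono) auto
      moreover have "0 < M powr p" using M by simp
      ultimately show ?thesis by (simp add: field_simps)
    qed simp
  qed
qed

text \<open>Convexity with weights 1 - s and s at u / (1 - s) and v / s. Unlike in the estimate with
  factor 2 powr P, the factor of the first term tends to 1 as s tends to 0; continuity of the energy
  rests on this.\<close>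

lemma powr_norm_add_le:
  fixes u v :: "'a::real_normed_vector"
  assumes p: "1 \<le> p" "p \<le> P" and s: "0 < s" "s < 1"
  shows "norm (u + v) powr p \<le> (1 - s) powr (1 - P) * norm u powr p + s powr (1 - P) * norm v powr p"
proof -
  have sc: "c * norm (w /\<^sub>R c) powr p \<le> c powr (1 - P) * norm w powr p" if c: "0 < c" "c < 1" for c and w :: 'a
  proof -
    have "c * norm (w /\<^sub>R c) powr p = (c / c powr p) * norm w powr p"
      using c by (simp add: powr_divide divide_inverse_commute[symmetric])
    also have "c / c powr p = c powr (1 - p)" using c by (simp add: powr_diff)
    also have "c powr (1 - p) \<le> c powr (1 - P)" using c p by (intro powr_mono') auto
    finally show ?thesis by (simp add: mult_right_mono)
  qed
  have "norm (u + v) powr p = norm ((1 - s) *\<^sub>R (u /\<^sub>R (1 - s)) + s *\<^sub>R (v /\<^sub>R s)) powr p" using s by simp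
  also have "\<dots> \<le> (1 - s) * norm (u /\<^sub>R (1 - s)) powr p + s * norm (v /\<^sub>R s) powr p"
    using p s by (intro powr_norm_convex) auto
  also have "\<dots> \<le> (1 - s) powr (1 - P) * norm u powr p + s powr (1 - P) * norm v powr p"
    using s by (intro add_mono sc) auto
  finally show ?thesis .
qed

text \<open>Yields a dominating function independent of t. Upward, a + t b lies on the segment from
  a to a + b; downward, a lies on the segment from a + t b to a - b, with weight s = t / (1 + t).
  Convexity is applied on each.\<close>

lemma powr_norm_quotient_bound:
  fixes a b :: "'a::real_normed_vector"
  assumes p: "1 \<le> p" and t: "0 < t" "t \<le> 1"
  shows "\<bar>norm (a + t *\<^sub>R b) powr p - norm a powr p\<bar> \<le> t * (norm (a + b) powr p + norm (a - b) powr p)"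
proof -
  have "a + t *\<^sub>R b = (1 - t) *\<^sub>R a + t *\<^sub>R (a + b)" by (simp add: algebra_simps)
  then have "norm (a + t *\<^sub>R b) powr p \<le> (1 - t) * norm a powr p + t * norm (a + b) powr p"
    using powr_norm_convex[OF p, of t a "a + b"] t by simp
  moreover have "0 \<le> t * norm a powr p" "0 \<le> t * norm (a - b) powr p" "0 \<le> t * norm (a + b) powr p" using t by auto
  ultimately have u: "norm (a + t *\<^sub>R b) powr p - norm a powr p \<le> t * norm (a + b) powr p"
    by (simp add: algebra_simps)
  define s where "s = t / (1 + t)"
  have s: "0 \<le> s" "s \<le> 1" "1 - s = 1 / (1 + t)" using t by (auto simp: s_def field_simps)
  have st: "(1 - s) * t = s" using s(3) by (simp add: s_def)
  have "(1 - s) *\<^sub>R (a + t *\<^sub>R b) = (1 - s) *\<^sub>R a + ((1 - s) * t) *\<^sub>R b" by (simp add: scaleR_add_right)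
  then have "(1 - s) *\<^sub>R (a + t *\<^sub>R b) = (1 - s) *\<^sub>R a + s *\<^sub>R b" unfolding st .
  moreover have "(1 - s) *\<^sub>R a + s *\<^sub>R b + s *\<^sub>R (a - b) = a" by (simp add: algebra_simps)
  ultimately have "(1 - s) *\<^sub>R (a + t *\<^sub>R b) + s *\<^sub>R (a - b) = a" by simp
  then have "norm a powr p \<le> (1 - s) * norm (a + t *\<^sub>R b) powr p + s * norm (a - b) powr p"
    using powr_norm_convex[OF p s(1,2), of "a + t *\<^sub>R b" "a - b"] by simp
  then have "(1 + t) * norm a powr p \<le> (1 + t) * ((1 - s) * norm (a + t *\<^sub>R b) powr p + s * norm (a - b) powr p)"
    using t by (intro mult_left_mono) auto
  also have "\<dots> = norm (a + t *\<^sub>R b) powr p + t * norm (a - b) powr p"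
  proof -
    have "(1 + t) * (1 - s) = 1" using t by (simp add: s(3))
    moreover have "(1 + t) * s = t" using t by (simp add: s_def)
    ultimately show ?thesis by (simp only: distrib_left mult.assoc[symmetric] mult_1)
  qed
  finally have l: "- (t * norm (a - b) powr p) \<le> norm (a + t *\<^sub>R b) powr p - norm a powr p"
    using \<open>0 \<le> t * norm a powr p\<close> by (simp add: algebra_simps)
  show ?thesis using u l \<open>0 \<le> t * norm (a - b) powr p\<close> \<open>0 \<le> t * norm (a + b) powr p\<close> by (simp add: distrib_left abs_le_iff)
qed

text \<open>The directional derivative of the p-th power of the norm divided by p. For a different
  from 0, the squared norm along the line is a quadratic polynomial and its power p / 2 is
  differentiated. At a = 0 the quotient is a multiple of t powr (p - 1), which tends to 0.\<close>

lemma powr_norm_quotient_tendsto: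
  fixes a b :: "'a::real_inner"
  assumes p: "1 < p"
  shows "(\<lambda>n. (norm (a + inverse (real (Suc n)) *\<^sub>R b) powr p - norm a powr p) / p / inverse (real (Suc n))) \<longlonglongrightarrow> norm a powr (p - 2) * (a \<bullet> b)"
proof -
  define t where "t n = inverse (real (Suc n))" for n
  have t: "0 < t n" for n by (simp add: t_def)
  have tl: "t \<longlonglongrightarrow> 0" unfolding t_def by (rule LIMSEQ_inverse_real_of_nat)
  have "(\<lambda>n. (norm (a + t n *\<^sub>R b) powr p - norm a powr p) / p / t n) \<longlonglongrightarrow> norm a powr (p - 2) * (a \<bullet> b)"
  proof (cases "a = 0")
    case True
    have "(\<lambda>n. t n powr (p - 1) * (norm b powr p / p)) \<longlonglongrightarrow> 0 powr (p - 1) * (norm b powr p / p)"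
      using p t by (intro tendsto_intros tendsto_powr' tl) (auto simp: less_imp_le)
    moreover have "(norm (a + t n *\<^sub>R b) powr p - norm a powr p) / p / t n = t n powr (p - 1) * (norm b powr p / p)" for n
      using True t[of n] by (simp add: powr_mult powr_diff)
    ultimately show ?thesis using True by simp
  next
    case False
    define f where "f s = (a \<bullet> a + 2 * s * (a \<bullet> b) + s^2 * (b \<bullet> b)) powr (p / 2)" for s
    have sq: "norm c powr p = (c \<bullet> c) powr (p / 2)" for c :: 'a
      by (simp add: norm_eq_sqrt_inner powr_half_sqrt[symmetric] powr_powr)
    have fe: "norm (a + s *\<^sub>R b) powr p = f s" for s
      unfolding sq f_def by (simp add: inner_add_left inner_add_right inner_commute power2_eq_square algebra_simps)
    have "((\<lambda>s. a \<bullet> a + 2 * s * (a \<bullet> b) + s^2 * (b \<bullet> b)) has_real_derivative 2 * (a \<bullet> b)) (at 0)"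
      by (auto intro!: derivative_eq_intros)
    moreover have "((\<lambda>z. z powr (p / 2)) has_real_derivative (p / 2) * (a \<bullet> a) powr (p / 2 - 1)) (at (a \<bullet> a + 2 * 0 * (a \<bullet> b) + 0^2 * (b \<bullet> b)))"
      using False has_real_derivative_powr[of "a \<bullet> a" "p / 2"] by simp
    ultimately have "(f has_real_derivative (p / 2) * (a \<bullet> a) powr (p / 2 - 1) * (2 * (a \<bullet> b))) (at 0)"
      unfolding f_def[abs_def] by (rule DERIV_chain2[rotated])
    moreover have "(a \<bullet> a) powr (p / 2 - 1) = norm a powr (p - 2)"
      by (simp add: norm_eq_sqrt_inner powr_half_sqrt[symmetric] powr_powr diff_divide_distrib)
    ultimately have D: "((\<lambda>h. (f (0 + h) - f 0) / h) \<longlongrightarrow> p * (norm a powr (p - 2) * (a \<bullet> b))) (at 0)"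
      by (simp add: DERIV_def mult.assoc)
    have "filterlim t (at 0) sequentially"
      using tl t by (auto simp: filterlim_at less_imp_neq[THEN not_sym] eventually_sequentially)
    from filterlim_compose[OF D this] have "(\<lambda>n. (f (t n) - f 0) / t n) \<longlonglongrightarrow> p * (norm a powr (p - 2) * (a \<bullet> b))" by simp
    then have "(\<lambda>n. (f (t n) - f 0) / t n / p) \<longlonglongrightarrow> p * (norm a powr (p - 2) * (a \<bullet> b)) / p" by (intro tendsto_divide) (use p in auto)
    moreover have "(norm (a + t n *\<^sub>R b) powr p - norm a powr p) / p / t n = (f (t n) - f 0) / t n / p" for n
      using fe[of 0] fe[of "t n"] by simp
    ultimately show ?thesis using p by simp
  qed
  then show ?thesis by (simp add: t_def)
qed

text \<open>Differentiation under the integral, one-sided along 1 / (n + 1). Integrability at a + b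
  and at a - b supplies the dominating function of \<open>powr_norm_quotient_bound\<close>.\<close>

lemma integral_powr_norm_quotient_tendsto:
  fixes a b :: "'a \<Rightarrow> 'b::euclidean_space"
  assumes [measurable]: "p \<in> borel_measurable M" "a \<in> borel_measurable M" "b \<in> borel_measurable M"
    and p: "\<And>x. x \<in> space M \<Longrightarrow> 1 < p x"
    and int: "integrable M (\<lambda>x. norm (a x) powr p x)" "integrable M (\<lambda>x. norm (a x + b x) powr p x)" "integrable M (\<lambda>x. norm (a x - b x) powr p x)"
  shows "(\<lambda>n. ((\<integral>x. norm (a x + inverse (real (Suc n)) *\<^sub>R b x) powr p x / p x \<partial>M) - (\<integral>x. norm (a x) powr p x / p x \<partial>M)) / inverse (real (Suc n)))
    \<longlonglongrightarrow> (\<integral>x. norm (a x) powr (p x - 2) * (a x \<bullet> b x) \<partial>M)"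
proof -
  define t where "t n = inverse (real (Suc n))" for n
  have t: "0 < t n" "t n \<le> 1" for n by (auto simp: t_def inverse_le_1_iff)
  have ia: "integrable M (\<lambda>x. norm (a x) powr p x / p x)"
  proof (rule Bochner_Integration.integrable_bound[OF int(1)])
    show "AE x in M. norm (norm (a x) powr p x / p x) \<le> norm (norm (a x) powr p x)"
      using AE_space by eventually_elim (use p in \<open>force simp: divide_le_eq_1 intro: divide_le_eq[THEN iffD2] mult_left_mono[of 1, simplified] \<close>)
  qed measurable
  have q: "\<bar>(norm (a x + t n *\<^sub>R b x) powr p x - norm (a x) powr p x) / p x / t n\<bar> \<le> norm (a x + b x) powr p x + norm (a x - b x) powr p x"
    if x: "x \<in> space M" for x n
  proof -
    have "\<bar>norm (a x + t n *\<^sub>R b x) powr p x - norm (a x) powr p x\<bar> \<le> t n * (norm (a x + b x) powr p x + norm (a x - b x) powr p x)"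
      using p[OF x] t by (intro powr_norm_quotient_bound) auto
    also have "\<dots> \<le> p x * t n * (norm (a x + b x) powr p x + norm (a x - b x) powr p x)"
      using p[OF x] t[of n] by (intro mult_right_mono) auto
    finally show ?thesis using p[OF x] t[of n] by (simp add: abs_divide divide_le_eq mult_ac)
  qed
  have iq: "integrable M (\<lambda>x. (norm (a x + t n *\<^sub>R b x) powr p x - norm (a x) powr p x) / p x / t n)" for n
  proof (rule Bochner_Integration.integrable_bound[OF Bochner_Integration.integrable_add[OF int(2,3)]])
    show "AE x in M. norm ((norm (a x + t n *\<^sub>R b x) powr p x - norm (a x) powr p x) / p x / t n) \<le> norm (norm (a x + b x) powr p x + norm (a x - b x) powr p x)"
      using AE_space by eventually_elim (use q in force)
  qed measurable
  have iat: "integrable M (\<lambda>x. norm (a x + t n *\<^sub>R b x) powr p x / p x)" for n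
  proof -
    have "integrable M (\<lambda>x. t n * ((norm (a x + t n *\<^sub>R b x) powr p x - norm (a x) powr p x) / p x / t n) + norm (a x) powr p x / p x)"
      by (intro Bochner_Integration.integrable_add integrable_mult_right iq ia)
    moreover have "t n * ((norm (a x + t n *\<^sub>R b x) powr p x - norm (a x) powr p x) / p x / t n) + norm (a x) powr p x / p x = norm (a x + t n *\<^sub>R b x) powr p x / p x" for x
    proof -
      have e: "t n * (c / t n) = c" for c using t[of n] by simp
      show ?thesis unfolding e by (simp add: diff_divide_distrib)
    qed
    ultimately show ?thesis by simp
  qed
  have "(\<lambda>n. \<integral>x. (norm (a x + t n *\<^sub>R b x) powr p x - norm (a x) powr p x) / p x / t n \<partial>M) \<longlonglongrightarrow> (\<integral>x. norm (a x) powr (p x - 2) * (a x \<bullet> b x) \<partial>M)"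
  proof (rule integral_dominated_convergence[where w="\<lambda>x. norm (a x + b x) powr p x + norm (a x - b x) powr p x"])
    show "integrable M (\<lambda>x. norm (a x + b x) powr p x + norm (a x - b x) powr p x)" by (intro Bochner_Integration.integrable_add int)
    show "AE x in M. (\<lambda>n. (norm (a x + t n *\<^sub>R b x) powr p x - norm (a x) powr p x) / p x / t n) \<longlonglongrightarrow> norm (a x) powr (p x - 2) * (a x \<bullet> b x)"
      using AE_space unfolding t_def by eventually_elim (intro powr_norm_quotient_tendsto p)
    show "AE x in M. norm ((norm (a x + t n *\<^sub>R b x) powr p x - norm (a x) powr p x) / p x / t n) \<le> norm (a x + b x) powr p x + norm (a x - b x) powr p x" for n
      using AE_space by eventually_elim (use q in force)
  qed measurable
  moreover have "(\<integral>x. (norm (a x + t n *\<^sub>R b x) powr p x - norm (a x) powr p x) / p x / t n \<partial>M) =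
     ((\<integral>x. norm (a x + t n *\<^sub>R b x) powr p x / p x \<partial>M) - (\<integral>x. norm (a x) powr p x / p x \<partial>M)) / t n" for n
  proof -
    have "(\<integral>x. (norm (a x + t n *\<^sub>R b x) powr p x - norm (a x) powr p x) / p x / t n \<partial>M) =
      (\<integral>x. (norm (a x + t n *\<^sub>R b x) powr p x - norm (a x) powr p x) / p x \<partial>M) / t n"
      by (rule integral_divide_zero)
    then show ?thesis
      using Bochner_Integration.integral_diff[OF iat[of n] ia] by (simp only: diff_divide_distrib)
  qed
  ultimately show ?thesis by (simp add: t_def)
qed

text \<open>Values beyond a level L contribute at most L powr (Q - r) times the bound K on the r-th
  moment, uniformly in n. Below L dominated convergence applies because the measure is finite. The
  limit inherits the moment bound by Fatou's lemma, so its own tail is equally small.\<close>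

lemma subcritical_powr_convergence:
  fixes f :: "nat \<Rightarrow> 'a \<Rightarrow> real"
  assumes fin: "finite_measure M" and [measurable]: "\<And>n. f n \<in> borel_measurable M" "g \<in> borel_measurable M" "q \<in> borel_measurable M"
    and q: "\<And>x. x \<in> space M \<Longrightarrow> 1 \<le> q x \<and> q x \<le> Q" and Q: "Q < r"
    and ae: "AE x in M. (\<lambda>n. f n x) \<longlonglongrightarrow> g x" and K: "\<And>n. (\<integral>\<^sup>+ x. ennreal (\<bar>f n x\<bar> powr r) \<partial>M) \<le> ennreal K" "0 \<le> K"
  shows "(\<lambda>n. \<integral>x. \<bar>f n x\<bar> powr q x / q x \<partial>M) \<longlonglongrightarrow> (\<integral>x. \<bar>g x\<bar> powr q x / q x \<partial>M)"
    and "(\<integral>\<^sup>+ x. ennreal (\<bar>g x\<bar> powr r) \<partial>M) \<le> ennreal K"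
proof -
  interpret finite_measure M by (rule fin)
  show Kg: "(\<integral>\<^sup>+ x. ennreal (\<bar>g x\<bar> powr r) \<partial>M) \<le> ennreal K"
  proof (cases "space M = {}")
    case True
    then show ?thesis by (simp add: nn_integral_empty)
  next
    case False
    then have r: "0 < r" using q Q by fastforce
    show ?thesis
    proof (rule Fatou_le[where u="\<lambda>n x. ennreal (\<bar>f n x\<bar> powr r)"])
      show "AE x in M. (\<lambda>n. ennreal (\<bar>f n x\<bar> powr r)) \<longlonglongrightarrow> ennreal (\<bar>g x\<bar> powr r)"
        using ae by eventually_elim (intro tendsto_ennrealI tendsto_powr' tendsto_rabs tendsto_const; use r in auto)
    qed (use K in auto)
  qed
  define T where "T L y = min \<bar>y\<bar> L" for L y :: real
  have [measurable]: "T L \<in> borel_measurable borel" for L unfolding T_def[abs_def] by measurable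
  have tail: "0 \<le> \<bar>y\<bar> powr q x / q x - T L y powr q x / q x \<and> \<bar>y\<bar> powr q x / q x - T L y powr q x / q x \<le> L powr (Q - r) * \<bar>y\<bar> powr r"
    if L: "1 \<le> L" and x: "x \<in> space M" for L y x
  proof (cases "\<bar>y\<bar> \<le> L")
    case True
    then show ?thesis by (simp add: T_def)
  next
    case False
    have qx: "1 \<le> q x" "q x \<le> Q" using q[OF x] by auto
    have "T L y = L" using False by (simp add: T_def)
    moreover have "L powr q x / q x \<le> \<bar>y\<bar> powr q x / q x" using False L qx by (intro divide_right_mono powr_mono2) auto
    moreover have "\<bar>y\<bar> powr q x / q x \<le> L powr (Q - r) * \<bar>y\<bar> powr r"
    proof -
      have "\<bar>y\<bar> powr q x / q x \<le> \<bar>y\<bar> powr q x" using qx by (simp add: divide_le_eq mult_left_le[of 1] mult_le_cancel_left1)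
      also have "\<dots> \<le> \<bar>y\<bar> powr Q" using qx False L by (intro powr_mono) auto
      also have "\<dots> = \<bar>y\<bar> powr (Q - r) * \<bar>y\<bar> powr r" by (simp add: powr_add[symmetric])
      also have "\<dots> \<le> L powr (Q - r) * \<bar>y\<bar> powr r" using Q L False by (intro mult_right_mono powr_mono2') auto
      finally show ?thesis .
    qed
    moreover have "0 \<le> L powr q x / q x" using qx by simp
    ultimately show ?thesis by simp
  qed
  have intT: "integrable M (\<lambda>x. T L (h x) powr q x / q x)" and boundT: "\<And>x. x \<in> space M \<Longrightarrow> \<bar>T L (h x) powr q x / q x\<bar> \<le> L powr Q"
    if L: "1 \<le> L" and [measurable]: "h \<in> borel_measurable M" for L h
  proof -
    show b: "\<bar>T L (h x) powr q x / q x\<bar> \<le> L powr Q" if x: "x \<in> space M" for x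
    proof -
      have qx: "1 \<le> q x" "q x \<le> Q" using q[OF x] by auto
      have "T L (h x) powr q x / q x \<le> T L (h x) powr q x" using qx by (simp add: divide_le_eq mult_le_cancel_left1)
      also have "\<dots> \<le> L powr q x" using L qx by (intro powr_mono2) (auto simp: T_def)
      also have "\<dots> \<le> L powr Q" using L qx by (intro powr_mono) auto
      finally show ?thesis using qx by simp
    qed
    show "integrable M (\<lambda>x. T L (h x) powr q x / q x)"
      by (rule integrable_const_bound[where B="L powr Q"]) (use b in auto)
  qed
  have intr: "integrable M (\<lambda>x. \<bar>h x\<bar> powr r)" "(\<integral>x. \<bar>h x\<bar> powr r \<partial>M) \<le> K"
    if [measurable]: "h \<in> borel_measurable M" and le: "(\<integral>\<^sup>+ x. ennreal (\<bar>h x\<bar> powr r) \<partial>M) \<le> ennreal K" for h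
  proof -
    show i: "integrable M (\<lambda>x. \<bar>h x\<bar> powr r)"
      using le by (auto simp: integrable_iff_bounded intro: le_less_trans)
    then have "ennreal (\<integral>x. \<bar>h x\<bar> powr r \<partial>M) \<le> ennreal K" using le by (simp add: nn_integral_eq_integral)
    then show "(\<integral>x. \<bar>h x\<bar> powr r \<partial>M) \<le> K" using K(2) by (simp add: ennreal_le_iff)
  qed
  have diff: "\<bar>(\<integral>x. \<bar>h x\<bar> powr q x / q x \<partial>M) - (\<integral>x. T L (h x) powr q x / q x \<partial>M)\<bar> \<le> L powr (Q - r) * K"
    if L: "1 \<le> L" and h[measurable]: "h \<in> borel_measurable M" and le: "(\<integral>\<^sup>+ x. ennreal (\<bar>h x\<bar> powr r) \<partial>M) \<le> ennreal K" for h L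
  proof -
    have id: "integrable M (\<lambda>x. \<bar>h x\<bar> powr q x / q x - T L (h x) powr q x / q x)"
    proof (rule Bochner_Integration.integrable_bound[OF integrable_mult_right[OF intr(1)[OF h le], of "L powr (Q - r)"]])
      show "AE x in M. norm (\<bar>h x\<bar> powr q x / q x - T L (h x) powr q x / q x) \<le> norm (L powr (Q - r) * \<bar>h x\<bar> powr r)"
        using AE_space by eventually_elim (use tail[OF L] in \<open>simp add: abs_of_nonneg\<close>)
    qed measurable
    have "integrable M (\<lambda>x. (\<bar>h x\<bar> powr q x / q x - T L (h x) powr q x / q x) + T L (h x) powr q x / q x)"
      by (intro Bochner_Integration.integrable_add id intT L h)
    then have ih: "integrable M (\<lambda>x. \<bar>h x\<bar> powr q x / q x)" by simp
    have "(\<integral>x. \<bar>h x\<bar> powr q x / q x \<partial>M) - (\<integral>x. T L (h x) powr q x / q x \<partial>M) = (\<integral>x. \<bar>h x\<bar> powr q x / q x - T L (h x) powr q x / q x \<partial>M)"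
      by (rule Bochner_Integration.integral_diff[symmetric, OF ih intT[OF L h]])
    moreover have "0 \<le> (\<integral>x. \<bar>h x\<bar> powr q x / q x - T L (h x) powr q x / q x \<partial>M)"
      using tail[OF L] by (intro Bochner_Integration.integral_nonneg) auto
    moreover have "(\<integral>x. \<bar>h x\<bar> powr q x / q x - T L (h x) powr q x / q x \<partial>M) \<le> (\<integral>x. L powr (Q - r) * \<bar>h x\<bar> powr r \<partial>M)"
      using tail[OF L] by (intro integral_mono id integrable_mult_right intr(1)[OF h le]) auto
    moreover have "(\<integral>x. L powr (Q - r) * \<bar>h x\<bar> powr r \<partial>M) \<le> L powr (Q - r) * K"
      using intr[OF h le] by (simp add: mult_left_mono)
    ultimately show ?thesis by linarith
  qed
  show "(\<lambda>n. \<integral>x. \<bar>f n x\<bar> powr q x / q x \<partial>M) \<longlonglongrightarrow> (\<integral>x. \<bar>g x\<bar> powr q x / q x \<partial>M)"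
  proof (rule LIMSEQ_I)
    fix e :: real assume e: "0 < e"
    have "((\<lambda>L. L powr (Q - r) * K) \<longlongrightarrow> 0 * K) at_top"
      using Q by (intro tendsto_mult tendsto_const tendsto_neg_powr filterlim_ident) auto
    then have "\<forall>\<^sub>F L in at_top. L powr (Q - r) * K < e / 3" using e by (intro order_tendstoD(2)) auto
    then have "\<forall>\<^sub>F L in at_top. L powr (Q - r) * K < e / 3 \<and> 1 \<le> L"
      using eventually_ge_at_top[of 1] by (rule eventually_conj)
    then obtain L where L: "L powr (Q - r) * K < e / 3" "1 \<le> L"
      using eventually_happens'[OF trivial_limit_at_top_linorder] by (metis (no_types, lifting))
    have "(\<lambda>n. \<integral>x. T L (f n x) powr q x / q x \<partial>M) \<longlonglongrightarrow> (\<integral>x. T L (g x) powr q x / q x \<partial>M)"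
    proof (rule integral_dominated_convergence[where w="\<lambda>x. L powr Q"])
      show "AE x in M. (\<lambda>n. T L (f n x) powr q x / q x) \<longlonglongrightarrow> T L (g x) powr q x / q x"
        using ae AE_space
      proof eventually_elim
        fix x assume l: "(\<lambda>n. f n x) \<longlonglongrightarrow> g x" and x: "x \<in> space M"
        have qx: "1 \<le> q x" using q[OF x] by auto
        show "(\<lambda>n. T L (f n x) powr q x / q x) \<longlonglongrightarrow> T L (g x) powr q x / q x"
          unfolding T_def using qx L
          by (intro tendsto_divide tendsto_powr' tendsto_min tendsto_rabs l tendsto_const) auto
      qed
      show "AE x in M. norm (T L (f n x) powr q x / q x) \<le> L powr Q" for n
        using AE_space by eventually_elim (use boundT[OF L(2)] in auto)
    qed auto
    from LIMSEQ_D[OF this, of "e / 3"] e obtain N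
      where N: "\<And>n. n \<ge> N \<Longrightarrow> \<bar>(\<integral>x. T L (f n x) powr q x / q x \<partial>M) - (\<integral>x. T L (g x) powr q x / q x \<partial>M)\<bar> < e / 3"
      by auto
    show "\<exists>N. \<forall>n\<ge>N. norm ((\<integral>x. \<bar>f n x\<bar> powr q x / q x \<partial>M) - (\<integral>x. \<bar>g x\<bar> powr q x / q x \<partial>M)) < e"
    proof (intro exI[of _ N] allI impI)
      fix n assume "N \<le> n"
      from N[OF this] diff[OF L(2) _ K(1), of n] diff[OF L(2) _ Kg] L(1)
      show "norm ((\<integral>x. \<bar>f n x\<bar> powr q x / q x \<partial>M) - (\<integral>x. \<bar>g x\<bar> powr q x / q x \<partial>M)) < e" by (simp add: abs_if split: if_splits)
    qed
  qed
qed

subsection \<open>The eigenvalue problem\<close>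

lemma measurable_norm_powr:
  fixes g :: "'a \<Rightarrow> 'b::euclidean_space"
  assumes [measurable]: "g \<in> borel_measurable M" shows "(\<lambda>x. norm (g x) powr c) \<in> borel_measurable M"
  by measurable

text \<open>A violated Cauchy condition produces index sequences i and j with i k >= k and j k >= k
  along which X stays large. Statements about sequences can thus be turned into Cauchy
  conditions.\<close>

lemma double_limitI:
  fixes X :: "nat \<Rightarrow> nat \<Rightarrow> ennreal"
  assumes "\<And>i j. (\<And>k. k \<le> i k) \<Longrightarrow> (\<And>k. k \<le> j k) \<Longrightarrow> (\<lambda>k. X (i k) (j k)) \<longlonglongrightarrow> 0" and e: "0 < e"
  shows "\<exists>N. \<forall>i\<ge>N. \<forall>j\<ge>N. X i j \<le> ennreal e"
proof (rule ccontr)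
  assume "\<nexists>N. \<forall>i\<ge>N. \<forall>j\<ge>N. X i j \<le> ennreal e"
  then have "\<forall>N. \<exists>i j. N \<le> i \<and> N \<le> j \<and> \<not> X i j \<le> ennreal e" by blast
  then obtain i j where ij: "\<And>k. k \<le> i k" "\<And>k. k \<le> j k" "\<And>k. \<not> X (i k) (j k) \<le> ennreal e" by metis
  from ennreal_tendsto_0D[OF assms(1)[OF ij(1,2)] e] ij(3) show False by (auto simp: eventually_sequentially)
qed

lemma INF_eq_0I:
  fixes f :: "'a \<Rightarrow> real"
  assumes nn: "\<And>x. 0 \<le> f x" and "\<And>e. 0 < e \<Longrightarrow> \<exists>x\<in>A. f x < e"
  shows "(INF x\<in>A. f x) = 0"
proof (rule antisym)
  have bdd: "bdd_below (f ` A)" by (rule bdd_belowI2[of _ 0]) (rule nn)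
  show "(INF x\<in>A. f x) \<le> 0"
  proof (rule field_le_epsilon)
    fix e :: real assume "0 < e"
    then obtain x where "x \<in> A" "f x < e" using assms(2) by blast
    then show "(INF x\<in>A. f x) \<le> 0 + e" using cINF_lower[OF bdd, of x] by simp
  qed
  have "A \<noteq> {}" using assms(2)[of 1] by auto
  then show "0 \<le> (INF x\<in>A. f x)" using nn by (intro cINF_greatest)
qed

text \<open>For fixed s the limit in n removes the error B s * D n; only afterwards does s tend to
  0. The order matters, since no bound on B s is available as s shrinks.\<close>

lemma tendsto_of_approx_bounds:
  fixes x D :: "nat \<Rightarrow> real" and A B :: "real \<Rightarrow> real"
  assumes 1: "\<And>s n. 0 < s \<Longrightarrow> s < 1 \<Longrightarrow> x n \<le> A s * y + B s * D n"
    and 2: "\<And>s n. 0 < s \<Longrightarrow> s < 1 \<Longrightarrow> y \<le> A s * x n + B s * D n"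
    and A: "(A \<longlongrightarrow> 1) (at_right 0)" "\<And>s. 0 < s \<Longrightarrow> s < 1 \<Longrightarrow> 0 < A s" and D: "D \<longlonglongrightarrow> 0"
  shows "x \<longlonglongrightarrow> y"
proof -
  have ev: "\<forall>\<^sub>F s in at_right (0::real). 0 < s \<and> s < 1"
    unfolding eventually_at_right_field by (intro exI[of _ 1]) auto
  show ?thesis
  proof (rule order_tendstoI)
    fix a assume a: "y < a"
    have "((\<lambda>s. A s * y) \<longlongrightarrow> 1 * y) (at_right 0)" by (intro tendsto_intros A)
    then have "\<forall>\<^sub>F s in at_right 0. A s * y < a" using a by (intro order_tendstoD(2)) auto
    from eventually_happens'[OF trivial_limit_at_right_real eventually_conj[OF this ev]]
    obtain s where s: "A s * y < a" "0 < s" "s < 1" by blast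
    have "(\<lambda>n. A s * y + B s * D n) \<longlonglongrightarrow> A s * y + B s * 0" by (intro tendsto_intros D)
    then have "\<forall>\<^sub>F n in sequentially. A s * y + B s * D n < a" using s by (intro order_tendstoD(2)) auto
    then show "\<forall>\<^sub>F n in sequentially. x n < a"
      by eventually_elim (use 1[OF s(2,3)] in \<open>auto intro: le_less_trans\<close>)
  next
    fix a assume a: "a < y"
    have "((\<lambda>s. A s * a) \<longlongrightarrow> 1 * a) (at_right 0)" by (intro tendsto_intros A)
    then have "\<forall>\<^sub>F s in at_right 0. A s * a < y" using a by (intro order_tendstoD(2)) auto
    from eventually_happens'[OF trivial_limit_at_right_real eventually_conj[OF this ev]]
    obtain s where s: "A s * a < y" "0 < s" "s < 1" by blast
    have "(\<lambda>n. A s * a + B s * D n) \<longlonglongrightarrow> A s * a + B s * 0" by (intro tendsto_intros D)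
    then have "\<forall>\<^sub>F n in sequentially. A s * a + B s * D n < y" using s by (intro order_tendstoD(2)) auto
    then show "\<forall>\<^sub>F n in sequentially. a < x n"
    proof eventually_elim
      fix n assume "A s * a + B s * D n < y"
      then have "A s * a < A s * x n" using 2[OF s(2,3), of n] by linarith
      then show "a < x n" using A(2)[OF s(2,3)] by simp
    qed
  qed
qed

section \<open>The energy and its continuity\<close>

context exponent_domain begin

definition energy :: "('a \<Rightarrow> 'a) \<Rightarrow> real" where
  "energy g = (\<integral>x. norm (g x) powr p x / p x \<partial>\<mu>)"

text \<open>Real-valued counterpart of \<open>modular\<close> for vector fields, in which
  differences can be formed; it is faithful whenever the modular is finite.\<close>

definition rmodular :: "('a \<Rightarrow> 'a) \<Rightarrow> real" where
  "rmodular g = (\<integral>x. norm (g x) powr p x \<partial>\<mu>)"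

lemma rmodular_eq: assumes "g \<in> borel_measurable \<mu>" "modular \<Omega> p g < \<infinity>"
  shows "modular \<Omega> p g = ennreal (rmodular g)" "0 \<le> rmodular g"
  using nn_integral_eq_integral[OF modular_finite_integrable(2)[OF assms]]
  by (auto simp: modular_def rmodular_def)

lemma energy_integrable:
  fixes g :: "'a \<Rightarrow> 'a"
  assumes g: "g \<in> borel_measurable \<mu>" "modular \<Omega> p g < \<infinity>"
  shows "integrable \<mu> (\<lambda>x. norm (g x) powr p x / p x)"
proof (rule Bochner_Integration.integrable_bound[OF modular_finite_integrable(2)[OF g]])
  note [measurable] = g(1)
  show "(\<lambda>x. norm (g x) powr p x / p x) \<in> borel_measurable \<mu>" by measurable
  show "AE x in \<mu>. norm (norm (g x) powr p x / p x) \<le> norm (norm (g x) powr p x)"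
  proof (rule AE_I2)
    fix x assume "x \<in> space \<mu>"
    then have "1 \<le> p x" using p_bounds[of x] r_gt_1 by auto
    then show "norm (norm (g x) powr p x / p x) \<le> norm (norm (g x) powr p x)"
      by (simp add: divide_le_eq mult_le_cancel_left1)
  qed
qed

lemma energy_bounds:
  fixes g :: "'a \<Rightarrow> 'a"
  assumes g: "g \<in> borel_measurable \<mu>" "modular \<Omega> p g < \<infinity>"
  shows "0 \<le> energy g" "energy g \<le> rmodular g" "rmodular g \<le> P * energy g"
proof -
  note i = modular_finite_integrable(2)[OF g] energy_integrable[OF g]
  have px: "1 \<le> p x" "p x \<le> P" "0 < P" if "x \<in> \<Omega>" for x using p_bounds[OF that] r_gt_1 by auto
  show "0 \<le> energy g" unfolding energy_def using px by (intro Bochner_Integration.integral_nonneg) (force intro!: divide_nonneg_nonneg)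
  show "energy g \<le> rmodular g" unfolding energy_def rmodular_def using px
    by (intro integral_mono i) (auto simp: divide_le_eq mult_le_cancel_left1)
  have "rmodular g \<le> (\<integral>x. P * (norm (g x) powr p x / p x) \<partial>\<mu>)"
    unfolding rmodular_def
  proof (intro integral_mono i integrable_mult_right)
    fix x assume "x \<in> space \<mu>"
    then have "1 \<le> p x" "p x \<le> P" using px[of x] by auto
    then have "norm (g x) powr p x * p x \<le> P * norm (g x) powr p x"
      by (subst mult.commute) (intro mult_right_mono; simp)
    then show "norm (g x) powr p x \<le> P * (norm (g x) powr p x / p x)"
      using \<open>1 \<le> p x\<close> by (simp add: le_divide_eq)
  qed
  then show "rmodular g \<le> P * energy g" unfolding energy_def by (simp only: integral_mult_right_zero)
qed

lemma modular_diff_finite: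
  fixes f g :: "'a \<Rightarrow> 'b::euclidean_space"
  assumes "f \<in> borel_measurable \<mu>" "g \<in> borel_measurable \<mu>" "modular \<Omega> p f < \<infinity>" "modular \<Omega> p g < \<infinity>"
  shows "modular \<Omega> p (\<lambda>x. f x - g x) < \<infinity>"
proof -
  have "modular \<Omega> p (\<lambda>x. f x + (- g x)) \<le> ennreal (2 powr P) * (modular \<Omega> p f + modular \<Omega> p (\<lambda>x. - g x))"
    using assms by (intro modular_add) auto
  also have "modular \<Omega> p (\<lambda>x. - g x) = modular \<Omega> p g" by (simp add: modular_def)
  also have "ennreal (2 powr P) * (modular \<Omega> p f + modular \<Omega> p g) < \<infinity>"
    using assms by (simp add: ennreal_mult_less_top)
  finally show ?thesis by simp
qed

lemma energy_triangle:
  fixes g h :: "'a \<Rightarrow> 'a"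
  assumes g: "g \<in> borel_measurable \<mu>" "modular \<Omega> p g < \<infinity>"
    and h: "h \<in> borel_measurable \<mu>" "modular \<Omega> p h < \<infinity>" and s: "0 < s" "s < 1"
  shows "energy h \<le> (1 - s) powr (1 - P) * energy g + s powr (1 - P) * rmodular (\<lambda>x. g x - h x)"
proof -
  note [measurable] = g(1) h(1)
  have dm: "(\<lambda>x. g x - h x) \<in> borel_measurable \<mu>" by measurable
  note df = modular_diff_finite[OF g(1) h(1) g(2) h(2)]
  have "energy h \<le> (\<integral>x. (1 - s) powr (1 - P) * (norm (g x) powr p x / p x) + s powr (1 - P) * norm (g x - h x) powr p x \<partial>\<mu>)"
    unfolding energy_def
  proof (intro integral_mono energy_integrable g h Bochner_Integration.integrable_add integrable_mult_right modular_finite_integrable(2)[OF dm df])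
    fix x assume "x \<in> space \<mu>"
    then have px: "1 \<le> p x" "p x \<le> P" using p_bounds[of x] r_gt_1 by auto
    have "norm (g x + (h x - g x)) powr p x \<le> (1 - s) powr (1 - P) * norm (g x) powr p x + s powr (1 - P) * norm (h x - g x) powr p x"
      by (rule powr_norm_add_le[OF px s])
    then have "norm (h x) powr p x / p x \<le> ((1 - s) powr (1 - P) * norm (g x) powr p x + s powr (1 - P) * norm (g x - h x) powr p x) / p x"
      using px by (intro divide_right_mono) (auto simp: norm_minus_commute)
    also have "\<dots> = (1 - s) powr (1 - P) * (norm (g x) powr p x / p x) + s powr (1 - P) * norm (g x - h x) powr p x / p x"
      by (simp add: add_divide_distrib)
    also have "s powr (1 - P) * norm (g x - h x) powr p x / p x \<le> s powr (1 - P) * norm (g x - h x) powr p x"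
    proof -
      have "c / p x \<le> c" if "0 \<le> c" for c using that px by (auto simp: divide_le_eq mult_le_cancel_left1)
      then show ?thesis by simp
    qed
    finally show "norm (h x) powr p x / p x \<le> (1 - s) powr (1 - P) * (norm (g x) powr p x / p x) + s powr (1 - P) * norm (g x - h x) powr p x"
      by simp
  qed
  also have "\<dots> = (1 - s) powr (1 - P) * energy g + s powr (1 - P) * rmodular (\<lambda>x. g x - h x)"
    unfolding energy_def rmodular_def
    by (simp only: Bochner_Integration.integral_add[OF integrable_mult_right[OF energy_integrable[OF g]]
        integrable_mult_right[OF modular_finite_integrable(2)[OF dm df]]] integral_mult_right_zero)
  finally show ?thesis .
qed

lemma energy_tendsto:
  fixes g :: "'a \<Rightarrow> 'a"
  assumes g: "g \<in> borel_measurable \<mu>" "modular \<Omega> p g < \<infinity>"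
    and h: "\<And>n. h n \<in> borel_measurable \<mu>" "\<And>n. modular \<Omega> p (h n) < \<infinity>"
    and l: "(\<lambda>n. modular \<Omega> p (\<lambda>x. g x - h n x)) \<longlonglongrightarrow> 0"
  shows "(\<lambda>n. energy (h n)) \<longlonglongrightarrow> energy g"
proof (rule tendsto_of_approx_bounds[where A="\<lambda>s. (1 - s) powr (1 - P)" and B="\<lambda>s. s powr (1 - P)" and D="\<lambda>n. rmodular (\<lambda>x. g x - h n x)"])
  have dm: "(\<lambda>x. g x - h n x) \<in> borel_measurable \<mu>" for n using g h by (intro borel_measurable_diff)
  show "energy (h n) \<le> (1 - s) powr (1 - P) * energy g + s powr (1 - P) * rmodular (\<lambda>x. g x - h n x)" if "0 < s" "s < 1" for s n
    by (rule energy_triangle[OF g h that])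
  show "energy g \<le> (1 - s) powr (1 - P) * energy (h n) + s powr (1 - P) * rmodular (\<lambda>x. g x - h n x)" if "0 < s" "s < 1" for s n
    using energy_triangle[OF h g that, of n] by (simp add: rmodular_def norm_minus_commute)
  have "((\<lambda>s. (1 - s) powr (1 - P)) \<longlongrightarrow> (1 - 0) powr (1 - P)) (at_right (0::real))"
    by (intro tendsto_intros) auto
  then show "((\<lambda>s. (1 - s) powr (1 - P)) \<longlongrightarrow> 1) (at_right (0::real))" by simp
  have "(\<lambda>n. ennreal (rmodular (\<lambda>x. g x - h n x))) \<longlonglongrightarrow> 0"
    using l rmodular_eq(1)[OF dm modular_diff_finite[OF g(1) h(1) g(2) h(2)]] by simp
  then show "(\<lambda>n. rmodular (\<lambda>x. g x - h n x)) \<longlonglongrightarrow> 0"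
    using rmodular_eq(2)[OF dm modular_diff_finite[OF g(1) h(1) g(2) h(2)]] by (simp add: ennreal_tendsto_0_iff)
qed simp

lemma energy_cong:
  assumes "AE x in \<mu>. g x = h x" "g \<in> borel_measurable \<mu>" "h \<in> borel_measurable \<mu>"
  shows "energy g = energy h"
  unfolding energy_def
proof (rule integral_cong_AE)
  note [measurable] = assms(2,3)
  show "(\<lambda>x. norm (g x) powr p x / p x) \<in> borel_measurable \<mu>" "(\<lambda>x. norm (h x) powr p x / p x) \<in> borel_measurable \<mu>"
    by measurable
  show "AE x in \<mu>. norm (g x) powr p x / p x = norm (h x) powr p x / p x"
    using assms(1) by eventually_elim simp
qed

text \<open>The approximating test functions have gradients tending to zero, so by the Poincare
  inequality they tend to zero themselves. Hence a nonzero element has a nonzero gradient, which is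
  what excludes nonpositive eigenvalues.\<close>

lemma sobolev_pair_zero:
  assumes u: "sobolev_pair u g" and g: "AE x in \<mu>. g x = 0"
  shows "AE x in \<mu>. u x = 0"
proof -
  obtain \<eta> where e: "\<And>n. \<eta> n \<in> test_functions \<Omega>" "(\<lambda>n. modular \<Omega> p (\<lambda>x. u x - \<eta> n x)) \<longlonglongrightarrow> 0"
      "(\<lambda>n. modular \<Omega> p (\<lambda>x. g x - grad (\<eta> n) x)) \<longlonglongrightarrow> 0"
    using u by (auto simp: sobolev_pair_def)
  note [measurable] = sobolev_pairD(1)[OF u] test_measurable_on[OF e(1)]
  have "modular \<Omega> p (\<lambda>x. g x - grad (\<eta> n) x) = modular \<Omega> p (grad (\<eta> n))" for n
  proof -
    have "modular \<Omega> p (\<lambda>x. g x - grad (\<eta> n) x) = modular \<Omega> p (\<lambda>x. - grad (\<eta> n) x)"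
      using g by (intro modular_cong) (auto elim: eventually_mono)
    then show ?thesis by (simp add: modular_def)
  qed
  then have "(\<lambda>n. modular \<Omega> p (\<eta> n)) \<longlonglongrightarrow> 0" using e(3) by (intro modular_poincare e(1)) simp
  then have "(\<lambda>n. modular \<Omega> p (\<lambda>x. u x - \<eta> n x) + modular \<Omega> p (\<eta> n)) \<longlonglongrightarrow> 0 + 0" by (intro tendsto_add e(2))
  then have l: "(\<lambda>n. ennreal (2 powr P) * (modular \<Omega> p (\<lambda>x. u x - \<eta> n x) + modular \<Omega> p (\<eta> n))) \<longlonglongrightarrow> 0"
    by (intro ennreal_tendsto_0_mult) simp
  have "modular \<Omega> p u \<le> ennreal (2 powr P) * (modular \<Omega> p (\<lambda>x. u x - \<eta> n x) + modular \<Omega> p (\<eta> n))" for n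
    using modular_add[of "\<lambda>x. u x - \<eta> n x" "\<eta> n"] by simp
  then have "(\<lambda>n::nat. modular \<Omega> p u) \<longlonglongrightarrow> 0" by (rule ennreal_tendsto_0_le[OF l])
  then have "modular \<Omega> p u = 0" by (simp add: LIMSEQ_const_iff)
  then have "AE x in \<mu>. ennreal (norm (u x) powr p x) = 0"
    unfolding modular_def by (subst (asm) nn_integral_0_iff_AE) auto
  then show ?thesis by eventually_elim (auto simp: ennreal_eq_0_iff)
qed

end

section \<open>The lower order term as an integral over a weighted measure\<close>

locale eigenvalue_problem = exponent_domain \<Omega> p r P
  for \<Omega> :: "'a::euclidean_space set" and p r P +
  fixes q V :: "'a \<Rightarrow> real" and Q \<sigma> :: real
  assumes nonempty_dom: "\<Omega> \<noteq> {}" and q_measurable [measurable]: "q \<in> borel_measurable (lebesgue_on \<Omega>)"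
    and q_bounds: "\<And>x. x \<in> \<Omega> \<Longrightarrow> 1 < q x \<and> q x \<le> Q" and Q_less_r: "Q < r"
    and V_measurable [measurable]: "V \<in> borel_measurable (lebesgue_on \<Omega>)" and V_pos: "AE x in lebesgue_on \<Omega>. 0 < V x"
    and \<sigma>_gt_dim: "real DIM('a) < \<sigma>" and V_integrable: "(\<integral>\<^sup>+ x. ennreal (\<bar>V x\<bar> powr \<sigma>) \<partial>lebesgue_on \<Omega>) < \<infinity>"
begin

text \<open>Absorbing the weight into the measure makes the lower order term unweighted, so that
  results for general finite measures apply. Positivity of V almost everywhere keeps the null sets
  unchanged.\<close>

definition \<nu> :: "'a measure" where "\<nu> = density \<mu> (\<lambda>x. ennreal (V x))"

definition W :: real where "W = enn2real (\<integral>\<^sup>+ x. ennreal (\<bar>V x\<bar> powr \<sigma>) \<partial>\<mu>)"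

lemma W: "(\<integral>\<^sup>+ x. ennreal (\<bar>V x\<bar> powr \<sigma>) \<partial>\<mu>) = ennreal W" "0 \<le> W"
  using V_integrable by (auto simp: W_def)

lemma \<nu>_space [simp]: "space \<nu> = \<Omega>" by (simp add: \<nu>_def)

lemma \<nu>_measurable [simp]: "borel_measurable \<nu> = borel_measurable \<mu>"
  by (rule measurable_cong_sets) (simp_all add: \<nu>_def)

lemma \<sigma>_gt_1: "1 < \<sigma>"
  using \<sigma>_gt_dim DIM_positive[where 'a='a] by linarith

lemma AE_\<nu>_iff: "(AE x in \<nu>. R x) \<longleftrightarrow> (AE x in \<mu>. R x)"
proof -
  have "(AE x in \<nu>. R x) \<longleftrightarrow> (AE x in \<mu>. 0 < ennreal (V x) \<longrightarrow> R x)"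
    unfolding \<nu>_def by (rule AE_density) measurable
  also have "\<dots> \<longleftrightarrow> (AE x in \<mu>. R x)"
    using V_pos by (auto elim: eventually_elim2)
  finally show ?thesis .
qed

lemma nn_integral_\<nu>:
  assumes [measurable]: "f \<in> borel_measurable \<mu>"
  shows "(\<integral>\<^sup>+ x. f x \<partial>\<nu>) = (\<integral>\<^sup>+ x. ennreal (V x) * f x \<partial>\<mu>)"
  unfolding \<nu>_def by (rule nn_integral_density) measurable

lemma integral_\<nu>:
  fixes f :: "'a \<Rightarrow> real"
  assumes [measurable]: "f \<in> borel_measurable \<mu>"
  shows "(\<integral>x. f x \<partial>\<nu>) = (\<integral>x. V x * f x \<partial>\<mu>)"
  unfolding \<nu>_def using V_pos by (subst integral_density) (auto elim: eventually_mono)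

lemma finite_\<nu>: "finite_measure \<nu>"
proof
  have "emeasure \<nu> (space \<nu>) = (\<integral>\<^sup>+ x. 1 \<partial>\<nu>)" by simp
  also have "\<dots> = (\<integral>\<^sup>+ x. ennreal (V x) * 1 \<partial>\<mu>)" by (rule nn_integral_\<nu>) simp
  also have "\<dots> \<le> (\<integral>\<^sup>+ x. 1 + ennreal (\<bar>V x\<bar> powr \<sigma>) \<partial>\<mu>)"
  proof (rule nn_integral_mono)
    fix x
    have "V x \<le> 1 + \<bar>V x\<bar> powr \<sigma>"
    proof (cases "V x \<le> 1")
      case False
      then have "\<bar>V x\<bar> powr 1 \<le> \<bar>V x\<bar> powr \<sigma>" using \<sigma>_gt_1 by (intro powr_mono) auto
      then show ?thesis using False by simp
    qed (simp add: add_increasing2)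
    then have "ennreal (V x) \<le> ennreal (1 + \<bar>V x\<bar> powr \<sigma>)" by (rule ennreal_leI)
    then show "ennreal (V x) * 1 \<le> 1 + ennreal (\<bar>V x\<bar> powr \<sigma>)" by (simp add: ennreal_plus)
  qed
  also have "\<dots> = ennreal (measure lebesgue \<Omega>) + ennreal W"
    using open_dom by (simp add: nn_integral_add W emeasure_restrict_space emeasure_dom)
  also have "\<dots> < \<infinity>" by simp
  finally show "emeasure \<nu> (space \<nu>) \<noteq> \<infinity>" by simp
qed

text \<open>Young's inequality with exponents \<sigma> and \<tau> separates the weight from the
  power of f, and the Sobolev inequality from r to r \<tau> bounds the latter. Linearity of the
  bound in E is essential: it is what the energy can absorb in the coercivity estimate.\<close>

lemma moment_bound:
  "\<exists>K\<ge>0. \<forall>f\<in>test_functions \<Omega>. \<forall>E\<ge>0. modular \<Omega> p (grad f) \<le> ennreal E \<longrightarrow>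
     (\<integral>\<^sup>+ x. ennreal (\<bar>f x\<bar> powr r) \<partial>\<nu>) \<le> ennreal (K * (E + 1))"
proof -
  define \<tau> where "\<tau> = \<sigma> / (\<sigma> - 1)"
  have \<tau>: "1 < \<tau>" "1 / \<sigma> + 1 / \<tau> = 1" using \<sigma>_gt_1 by (auto simp: \<tau>_def field_simps)
  \<comment> \<open>r \<tau> - r equals r / (\<sigma> - 1), so \<sigma> > N bounds the left side by
    r \<tau>, and r > 1 does the rest.\<close>
  have gap: "real DIM('a) * (r * \<tau> - r) < r * (r * \<tau>)"
  proof -
    have "real DIM('a) * (r * \<tau> - r) = real DIM('a) * (r / (\<sigma> - 1))"
      using \<sigma>_gt_1 by (simp add: \<tau>_def field_simps)
    also have "\<dots> < \<sigma> * (r / (\<sigma> - 1))" using \<sigma>_gt_1 \<sigma>_gt_dim r_gt_1 by (intro mult_strict_right_mono) auto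
    also have "\<dots> = 1 * (r * \<tau>)" by (simp add: \<tau>_def)
    also have "\<dots> \<le> r * (r * \<tau>)" using r_gt_1 \<tau> by (intro mult_right_mono) auto
    finally show ?thesis .
  qed
  obtain C where C: "0 \<le> C" and sob: "\<And>f H. f \<in> test_functions \<Omega> \<Longrightarrow> 0 < H \<Longrightarrow> (\<integral>\<^sup>+ x. ennreal (norm (grad f x) powr r) \<partial>lborel) \<le> ennreal H \<Longrightarrow>
     (\<integral>\<^sup>+ x. ennreal (\<bar>f x\<bar> powr (r * \<tau>)) \<partial>lborel) \<le> ennreal (C * H powr (r * \<tau> / r))"
    using sobolev_inequality[OF open_dom bounded_dom, of r "r * \<tau>"] gap \<tau> r_gt_1 by auto
  define m where "m = measure lebesgue \<Omega>"
  have m0: "0 \<le> m" by (simp add: m_def)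
  show ?thesis
  proof (intro exI[of _ "(W + C) * (m + 1)"] conjI ballI allI impI)
    show "0 \<le> (W + C) * (m + 1)" using W(2) C m0 by simp
    fix f E assume f: "f \<in> test_functions \<Omega>" and E: "0 \<le> (E::real)" "modular \<Omega> p (grad f) \<le> ennreal E"
    define S where "S = m + E + 1"
    have S: "1 \<le> S" using m0 E by (simp add: S_def)
    note [measurable] = test_measurable_on[OF f]
    have gr: "(\<integral>\<^sup>+ x. ennreal (norm (grad f x) powr r) \<partial>lborel) \<le> ennreal S"
    proof -
      have "(\<integral>\<^sup>+ x. ennreal (norm (grad f x) powr r) \<partial>lborel) = (\<integral>\<^sup>+ x. ennreal (norm (grad f x) powr r) * indicator UNIV x \<partial>\<mu>)"
        using r_gt_1 by (subst test_nn_integral_on(1)[OF f]) auto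
      also have "\<dots> = (\<integral>\<^sup>+ x. ennreal (norm (grad f x) powr r) * indicator \<Omega> x \<partial>\<mu>)"
        by (intro nn_integral_cong) auto
      also have "\<dots> \<le> ennreal (1 powr r * m) + ennreal (1 powr (- P)) * modular \<Omega> p (grad f)"
        unfolding m_def using p_bounds r_gt_1 by (intro moment_le test_measurable_on f) auto
      also have "\<dots> \<le> ennreal m + ennreal E" using E(2) by simp
      also have "\<dots> \<le> ennreal S" using m0 E(1) by (simp add: S_def ennreal_plus[symmetric] ennreal_leI del: ennreal_plus)
      finally show ?thesis .
    qed
    \<comment> \<open>Young's inequality is not homogeneous. f is scaled so that its gradient has
      r-th moment at most 1, and S, the inverse of c powr r, is multiplied back afterwards.\<close>
    define c where "c = S powr (- 1 / r)"
    have "c powr r = S powr (- 1)" unfolding c_def powr_powr using r_gt_1 by simp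
    then have c: "0 < c" "c powr r = 1 / S" using S by (auto simp: c_def powr_minus_divide)
    have fc: "(\<lambda>x. c * f x) \<in> test_functions \<Omega>" by (rule test_scale[OF f])
    have "(\<integral>\<^sup>+ x. ennreal (norm (grad (\<lambda>x. c * f x) x) powr r) \<partial>lborel) = (\<integral>\<^sup>+ x. ennreal (1 / S) * ennreal (norm (grad f x) powr r) \<partial>lborel)"
      using c S by (simp add: grad_scale[OF test_imp_smooth[OF f]] powr_mult ennreal_mult[symmetric])
    also have "\<dots> = ennreal (1 / S) * (\<integral>\<^sup>+ x. ennreal (norm (grad f x) powr r) \<partial>lborel)"
      by (rule nn_integral_cmult) (use measurable_norm_powr[OF grad_measurable[OF f]] in simp)
    also have "\<dots> \<le> ennreal (1 / S) * ennreal S" by (intro mult_left_mono gr) simp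
    also have "\<dots> = ennreal 1" using S by (simp add: ennreal_mult[symmetric])
    finally have "(\<integral>\<^sup>+ x. ennreal (\<bar>c * f x\<bar> powr (r * \<tau>)) \<partial>lborel) \<le> ennreal C"
      using sob[OF fc, of 1] by simp
    then have sc: "(\<integral>\<^sup>+ x. ennreal (\<bar>c * f x\<bar> powr (r * \<tau>)) \<partial>\<mu>) \<le> ennreal C"
      using test_nn_integral_on(2)[OF fc, of "r * \<tau>" UNIV] r_gt_1 \<tau> by simp
    have "(\<integral>\<^sup>+ x. ennreal (\<bar>f x\<bar> powr r) \<partial>\<nu>) = (\<integral>\<^sup>+ x. ennreal (V x) * ennreal (\<bar>f x\<bar> powr r) \<partial>\<mu>)"
      by (rule nn_integral_\<nu>) measurable
    also have "\<dots> \<le> (\<integral>\<^sup>+ x. ennreal S * (ennreal (\<bar>V x\<bar> powr \<sigma>) + ennreal (\<bar>c * f x\<bar> powr (r * \<tau>))) \<partial>\<mu>)"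
    proof (rule nn_integral_mono)
      fix x
      have "\<bar>V x\<bar> * \<bar>c * f x\<bar> powr r \<le> \<bar>V x\<bar> powr \<sigma> / \<sigma> + (\<bar>c * f x\<bar> powr r) powr \<tau> / \<tau>"
        using \<sigma>_gt_1 \<tau> by (intro Youngs_inequality) auto
      also have "\<dots> \<le> \<bar>V x\<bar> powr \<sigma> + \<bar>c * f x\<bar> powr (r * \<tau>)"
        using \<sigma>_gt_1 \<tau> by (intro add_mono) (auto simp: powr_powr divide_le_eq mult_le_cancel_left1)
      finally have "\<bar>V x\<bar> * \<bar>c * f x\<bar> powr r \<le> \<bar>V x\<bar> powr \<sigma> + \<bar>c * f x\<bar> powr (r * \<tau>)" .
      then have "S * (\<bar>V x\<bar> * \<bar>c * f x\<bar> powr r) \<le> S * (\<bar>V x\<bar> powr \<sigma> + \<bar>c * f x\<bar> powr (r * \<tau>))" using S by (intro mult_left_mono) auto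
      moreover have "S * (\<bar>V x\<bar> * \<bar>c * f x\<bar> powr r) = \<bar>V x\<bar> * \<bar>f x\<bar> powr r"
        using c S by (simp add: abs_mult powr_mult)
      ultimately have le: "\<bar>V x\<bar> * \<bar>f x\<bar> powr r \<le> S * (\<bar>V x\<bar> powr \<sigma> + \<bar>c * f x\<bar> powr (r * \<tau>))" by simp
      have "ennreal (V x) * ennreal (\<bar>f x\<bar> powr r) \<le> ennreal \<bar>V x\<bar> * ennreal (\<bar>f x\<bar> powr r)"
        by (intro mult_right_mono ennreal_leI) auto
      also have "\<dots> = ennreal (\<bar>V x\<bar> * \<bar>f x\<bar> powr r)" by (simp add: ennreal_mult)
      also have "\<dots> \<le> ennreal (S * (\<bar>V x\<bar> powr \<sigma> + \<bar>c * f x\<bar> powr (r * \<tau>)))" by (rule ennreal_leI[OF le])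
      also have "\<dots> = ennreal S * (ennreal (\<bar>V x\<bar> powr \<sigma>) + ennreal (\<bar>c * f x\<bar> powr (r * \<tau>)))"
        using S by (simp add: ennreal_mult ennreal_plus)
      finally show "ennreal (V x) * ennreal (\<bar>f x\<bar> powr r) \<le> ennreal S * (ennreal (\<bar>V x\<bar> powr \<sigma>) + ennreal (\<bar>c * f x\<bar> powr (r * \<tau>)))" .
    qed
    also have "\<dots> = ennreal S * (ennreal W + (\<integral>\<^sup>+ x. ennreal (\<bar>c * f x\<bar> powr (r * \<tau>)) \<partial>\<mu>))"
      by (simp add: nn_integral_cmult nn_integral_add W)
    also have "\<dots> \<le> ennreal S * (ennreal W + ennreal C)" by (intro mult_left_mono add_left_mono sc) simp
    also have "\<dots> = ennreal (S * (W + C))" using S W(2) C by (simp add: ennreal_mult[symmetric] ennreal_plus[symmetric] del: ennreal_plus)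
    also have "\<dots> \<le> ennreal ((W + C) * (m + 1) * (E + 1))"
    proof (rule ennreal_leI)
      have "S \<le> (m + 1) * (E + 1)" using m0 E by (simp add: S_def algebra_simps)
      then have "(W + C) * S \<le> (W + C) * ((m + 1) * (E + 1))" using W(2) C by (intro mult_left_mono) auto
      then show "S * (W + C) \<le> (W + C) * (m + 1) * (E + 1)" by (simp add: mult_ac)
    qed
    finally show "(\<integral>\<^sup>+ x. ennreal (\<bar>f x\<bar> powr r) \<partial>\<nu>) \<le> ennreal ((W + C) * (m + 1) * (E + 1))" .
  qed
qed

definition source :: "('a \<Rightarrow> real) \<Rightarrow> real" where
  "source u = (\<integral>x. \<bar>u x\<bar> powr q x / q x \<partial>\<nu>)"

lemma source_tendsto:
  assumes f: "\<And>n. f n \<in> borel_measurable \<mu>" and g: "g \<in> borel_measurable \<mu>"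
    and ae: "AE x in \<mu>. (\<lambda>n. f n x) \<longlonglongrightarrow> g x"
    and K: "\<And>n. (\<integral>\<^sup>+ x. ennreal (\<bar>f n x\<bar> powr r) \<partial>\<nu>) \<le> ennreal K" "0 \<le> K"
  shows "(\<lambda>n. source (f n)) \<longlonglongrightarrow> source g" "(\<integral>\<^sup>+ x. ennreal (\<bar>g x\<bar> powr r) \<partial>\<nu>) \<le> ennreal K"
proof -
  have q1: "1 \<le> q x \<and> q x \<le> Q" if "x \<in> space \<nu>" for x using q_bounds[of x] that by auto
  have m: "\<And>n. f n \<in> borel_measurable \<nu>" "g \<in> borel_measurable \<nu>" "q \<in> borel_measurable \<nu>" using f g by auto
  have ae': "AE x in \<nu>. (\<lambda>n. f n x) \<longlonglongrightarrow> g x" using ae by (simp add: AE_\<nu>_iff)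
  show "(\<lambda>n. source (f n)) \<longlonglongrightarrow> source g"
    unfolding source_def by (rule subcritical_powr_convergence(1)[OF finite_\<nu> m q1 Q_less_r ae' K])
  show "(\<integral>\<^sup>+ x. ennreal (\<bar>g x\<bar> powr r) \<partial>\<nu>) \<le> ennreal K"
    by (rule subcritical_powr_convergence(2)[OF finite_\<nu> m q1 Q_less_r ae' K])
qed

text \<open>The approximants are thinned out to converge almost everywhere, and initial ones are
  dropped so that all gradients have modular at most a common E. The moment bound then gives
  convergence of the lower order term and, through Fatou's lemma, a finite r-th moment of u.\<close>

lemma sobolev_pair_approx:
  assumes u: "sobolev_pair u g"
  obtains \<zeta> where "\<And>n. \<zeta> n \<in> test_functions \<Omega>" "(\<lambda>n. modular \<Omega> p (\<lambda>x. g x - grad (\<zeta> n) x)) \<longlonglongrightarrow> 0"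
    "(\<lambda>n. source (\<zeta> n)) \<longlonglongrightarrow> source u" "(\<integral>\<^sup>+ x. ennreal (\<bar>u x\<bar> powr r) \<partial>\<nu>) < \<infinity>"
proof -
  note D = sobolev_pairD[OF u]
  obtain \<eta> where e: "\<And>n. \<eta> n \<in> test_functions \<Omega>" "(\<lambda>n. modular \<Omega> p (\<lambda>x. u x - \<eta> n x)) \<longlonglongrightarrow> 0"
      "(\<lambda>n. modular \<Omega> p (\<lambda>x. g x - grad (\<eta> n) x)) \<longlonglongrightarrow> 0"
    using u by (auto simp: sobolev_pair_def)
  note [measurable] = D(1,2) test_measurable_on[OF e(1)]
  obtain K where K: "0 \<le> K" "\<And>f E. f \<in> test_functions \<Omega> \<Longrightarrow> 0 \<le> E \<Longrightarrow> modular \<Omega> p (grad f) \<le> ennreal E \<Longrightarrow>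
     (\<integral>\<^sup>+ x. ennreal (\<bar>f x\<bar> powr r) \<partial>\<nu>) \<le> ennreal (K * (E + 1))"
    using moment_bound by blast
  obtain s where s: "strict_mono s" "AE x in \<mu>. (\<lambda>i. \<eta> (s i) x) \<longlonglongrightarrow> u x"
  proof (rule modular_AE_subseq[of \<eta> u])
    have "modular \<Omega> p (\<lambda>x. \<eta> n x - u x) = modular \<Omega> p (\<lambda>x. u x - \<eta> n x)" for n
      by (rule modular_minus_commute)
    then show "(\<lambda>n. modular \<Omega> p (\<lambda>x. \<eta> n x - u x)) \<longlonglongrightarrow> 0" using e(2) by simp
  qed (use D(1) test_measurable_on[OF e(1)] in auto)
  from ennreal_tendsto_0D[OF e(3), of 1] obtain N where N: "\<And>n. n \<ge> N \<Longrightarrow> modular \<Omega> p (\<lambda>x. g x - grad (\<eta> n) x) \<le> 1"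
    by (auto simp: eventually_sequentially)
  define \<zeta> where "\<zeta> n = \<eta> (s (n + N))" for n
  define E where "E = 2 powr P * (1 + rmodular g)"
  have E0: "0 \<le> E" using rmodular_eq(2)[OF D(2,4)] by (simp add: E_def)
  have zE: "modular \<Omega> p (grad (\<zeta> n)) \<le> ennreal E" for n
  proof -
    have "N \<le> s (n + N)" using seq_suble[OF s(1), of "n + N"] by simp
    then have 1: "modular \<Omega> p (\<lambda>x. grad (\<zeta> n) x - g x) \<le> 1" using N by (simp add: \<zeta>_def modular_minus_commute[of _ g])
    have "modular \<Omega> p (\<lambda>x. (grad (\<zeta> n) x - g x) + g x) \<le> ennreal (2 powr P) * (modular \<Omega> p (\<lambda>x. grad (\<zeta> n) x - g x) + modular \<Omega> p g)"
      unfolding \<zeta>_def by (rule modular_add) measurable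
    also have "\<dots> \<le> ennreal (2 powr P) * (1 + ennreal (rmodular g))"
      unfolding rmodular_eq(1)[OF D(2,4)] by (intro mult_left_mono add_right_mono 1) simp
    also have "\<dots> = ennreal E" using rmodular_eq(2)[OF D(2,4)]
      by (simp add: E_def ennreal_mult ennreal_plus)
    finally show ?thesis by simp
  qed
  have aez: "AE x in \<mu>. (\<lambda>i. \<zeta> i x) \<longlonglongrightarrow> u x"
    using s(2)
  proof eventually_elim
    fix x assume "(\<lambda>i. \<eta> (s i) x) \<longlonglongrightarrow> u x"
    from LIMSEQ_ignore_initial_segment[OF this, of N] show "(\<lambda>i. \<zeta> i x) \<longlonglongrightarrow> u x" by (simp add: \<zeta>_def)
  qed
  have zt: "\<zeta> n \<in> test_functions \<Omega>" for n by (simp add: \<zeta>_def e)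
  note st = source_tendsto[OF test_measurable_on(1)[OF zt] D(1) aez K(2)[OF zt E0 zE]]
  show ?thesis
  proof (rule that[of \<zeta>])
    have "strict_mono (\<lambda>n. s (n + N))" using s(1) by (simp add: strict_mono_def)
    from LIMSEQ_subseq_LIMSEQ[OF e(3) this]
    show "(\<lambda>n. modular \<Omega> p (\<lambda>x. g x - grad (\<zeta> n) x)) \<longlonglongrightarrow> 0" by (simp add: \<zeta>_def o_def)
    have KE: "0 \<le> K * (E + 1)" using K E0 by simp
    show "(\<lambda>n. source (\<zeta> n)) \<longlonglongrightarrow> source u" by (rule st(1)[OF KE])
    show "(\<integral>\<^sup>+ x. ennreal (\<bar>u x\<bar> powr r) \<partial>\<nu>) < \<infinity>" by (rule le_less_trans[OF st(2)[OF KE]]) simp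
  qed (rule zt)
qed

lemma source_integrable:
  assumes [measurable]: "u \<in> borel_measurable \<mu>" and fin: "(\<integral>\<^sup>+ x. ennreal (\<bar>u x\<bar> powr r) \<partial>\<nu>) < \<infinity>"
  shows "integrable \<nu> (\<lambda>x. \<bar>u x\<bar> powr q x)" "integrable \<nu> (\<lambda>x. \<bar>u x\<bar> powr q x / q x)" "integrable \<nu> (\<lambda>x. \<bar>u x\<bar> powr r)"
proof -
  interpret finite_measure \<nu> by (rule finite_\<nu>)
  show ir: "integrable \<nu> (\<lambda>x. \<bar>u x\<bar> powr r)" using fin by (simp add: integrable_iff_bounded)
  have q1: "1 < q x" "q x \<le> Q" if "x \<in> \<Omega>" for x using q_bounds[OF that] by auto
  show i: "integrable \<nu> (\<lambda>x. \<bar>u x\<bar> powr q x)"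
  proof (rule Bochner_Integration.integrable_bound[OF Bochner_Integration.integrable_add[OF integrable_const[of 1] ir]])
    show "AE x in \<nu>. norm (\<bar>u x\<bar> powr q x) \<le> norm (1 + \<bar>u x\<bar> powr r)"
    proof (rule AE_I2)
      fix x assume "x \<in> space \<nu>"
      then have x: "x \<in> \<Omega>" by simp
      have "\<bar>u x\<bar> powr q x \<le> 1 + \<bar>u x\<bar> powr r"
      proof (cases "\<bar>u x\<bar> \<le> 1")
        case True
        then have "\<bar>u x\<bar> powr q x \<le> 1" using q1[OF x] by (intro powr_le1) auto
        then show ?thesis by (simp add: add_increasing2)
      next
        case False
        then have "\<bar>u x\<bar> powr q x \<le> \<bar>u x\<bar> powr r" using q1[OF x] Q_less_r by (intro powr_mono) auto
        then show ?thesis by simp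
      qed
      then show "norm (\<bar>u x\<bar> powr q x) \<le> norm (1 + \<bar>u x\<bar> powr r)" by simp
    qed
  qed simp
  show "integrable \<nu> (\<lambda>x. \<bar>u x\<bar> powr q x / q x)"
  proof (rule Bochner_Integration.integrable_bound[OF i])
    show "AE x in \<nu>. norm (\<bar>u x\<bar> powr q x / q x) \<le> norm (\<bar>u x\<bar> powr q x)"
      using q1 by (intro AE_I2) (force simp: divide_le_eq mult_le_cancel_left1)
  qed simp
qed

lemma test_source_finite: "f \<in> test_functions \<Omega> \<Longrightarrow> (\<integral>\<^sup>+ x. ennreal (\<bar>f x\<bar> powr r) \<partial>\<nu>) < \<infinity>"
  using sobolev_pair_approx[OF sobolev_pair_test] by metis

lemma positive_test_function:
  obtains \<eta> where "\<eta> \<in> test_functions \<Omega>" "0 < source \<eta>" "\<not> (AE x in \<mu>. \<eta> x = 0)"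
proof -
  obtain z where "z \<in> \<Omega>" using nonempty_dom by blast
  then obtain a b where ab: "z \<in> box a b" "cbox a b \<subseteq> \<Omega>" using open_dom open_contains_cbox by metis
  define \<eta> where "\<eta> = box_bump 0 a b"
  have t: "\<eta> \<in> test_functions \<Omega>" unfolding \<eta>_def by (rule box_bump_test[OF ab(2)])
  note [measurable] = test_measurable_on(1)[OF t]
  have nz: "\<not> (AE x in \<mu>. \<eta> x = 0)"
  proof
    assume "AE x in \<mu>. \<eta> x = 0"
    then have "AE x in lebesgue. x \<in> \<Omega> \<longrightarrow> \<eta> x = 0" using open_dom by (subst (asm) AE_restrict_space_iff) auto
    then have "AE x in lebesgue. x \<notin> box a b"
      using box_bump_pos[of _ a b 0] ab(2) box_subset_cbox[of a b] unfolding \<eta>_def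
      by (auto elim!: eventually_mono) (metis less_irrefl subsetD)
    then have "negligible (box a b)"
      by (simp add: negligible_iff_null_sets AE_iff_null_sets[symmetric])
    then show False using ab(1) open_not_negligible[OF open_box] by blast
  qed
  have q0: "0 < q x" if "x \<in> \<Omega>" for x using q_bounds[OF that] by simp
  have "source \<eta> \<noteq> 0"
  proof
    assume "source \<eta> = 0"
    then have "AE x in \<nu>. \<bar>\<eta> x\<bar> powr q x / q x = 0"
      unfolding source_def using source_integrable(2)[OF test_measurable_on(1)[OF t] test_source_finite[OF t]] q0
      by (subst (asm) integral_nonneg_eq_0_iff_AE) (auto intro!: AE_I2 divide_nonneg_nonneg simp: less_imp_le)
    then have "AE x in \<mu>. \<bar>\<eta> x\<bar> powr q x / q x = 0" by (simp add: AE_\<nu>_iff)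
    then have "AE x in \<mu>. \<eta> x = 0"
      using AE_space by eventually_elim (use q0 in force)
    with nz show False by simp
  qed
  moreover have "0 \<le> source \<eta>" unfolding source_def using q0
    by (intro Bochner_Integration.integral_nonneg) (auto intro!: divide_nonneg_nonneg simp: less_imp_le)
  ultimately show ?thesis using t nz by (intro that) auto
qed

end

section \<open>Scaling and midpoint convexity of the energy\<close>

context exponent_domain begin

lemma rmodular_scale:
  assumes g: "g \<in> borel_measurable \<mu>" "modular \<Omega> p g < \<infinity>" and c: "\<bar>c\<bar> \<le> 1"
  shows "rmodular (\<lambda>x. c *\<^sub>R g x) \<le> \<bar>c\<bar> powr r * rmodular g"
proof -
  have le: "modular \<Omega> p (\<lambda>x. c *\<^sub>R g x) \<le> ennreal (\<bar>c\<bar> powr r) * modular \<Omega> p g"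
    by (rule modular_scale_small[OF g(1) c])
  note [measurable] = g(1)
  have cg: "(\<lambda>x. c *\<^sub>R g x) \<in> borel_measurable \<mu>" by measurable
  have fin: "modular \<Omega> p (\<lambda>x. c *\<^sub>R g x) < \<infinity>"
    by (rule le_less_trans[OF le]) (use g in \<open>simp add: ennreal_mult_less_top\<close>)
  have "ennreal (rmodular (\<lambda>x. c *\<^sub>R g x)) \<le> ennreal (\<bar>c\<bar> powr r * rmodular g)"
    using le unfolding rmodular_eq(1)[OF cg fin] rmodular_eq(1)[OF g]
    using rmodular_eq(2)[OF g] by (simp add: ennreal_mult)
  then show ?thesis using rmodular_eq(2)[OF g] by (subst (asm) ennreal_le_iff) auto
qed

lemma modular_le_rmodular:
  assumes "g \<in> borel_measurable \<mu>" "modular \<Omega> p g < \<infinity>" "rmodular g \<le> E"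
  shows "modular \<Omega> p g \<le> ennreal E"
  using rmodular_eq[OF assms(1,2)] assms(3) by (simp add: ennreal_leI)

text \<open>The last inequality passes from the midpoint defect of the modular to that of the
  energy: the integrands differ by the factor p, the pointwise defect is nonnegative, and p <=
  P.\<close>

lemma midpoint_energy:
  fixes a b :: "'a \<Rightarrow> 'a"
  assumes a: "a \<in> borel_measurable \<mu>" "modular \<Omega> p a < \<infinity>"
    and b: "b \<in> borel_measurable \<mu>" "modular \<Omega> p b < \<infinity>"
  shows "energy (\<lambda>x. (a x + b x) /\<^sub>R 2) \<le> (energy a + energy b) / 2"
    and "rmodular (\<lambda>x. (a x + b x) /\<^sub>R 2) \<le> (rmodular a + rmodular b) / 2"
    and "modular \<Omega> p (\<lambda>x. (a x + b x) /\<^sub>R 2) < \<infinity>"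
    and "(rmodular a + rmodular b) / 2 - rmodular (\<lambda>x. (a x + b x) /\<^sub>R 2) \<le>
      P * ((energy a + energy b) / 2 - energy (\<lambda>x. (a x + b x) /\<^sub>R 2))"
proof -
  note [measurable] = a(1) b(1)
  let ?c = "\<lambda>x. (a x + b x) /\<^sub>R 2"
  have cm: "?c \<in> borel_measurable \<mu>" by measurable
  have px: "1 < p x" "p x \<le> P" if "x \<in> \<Omega>" for x using p_bounds[OF that] r_gt_1 by auto
  show cf: "modular \<Omega> p ?c < \<infinity>"
  proof -
    have "modular \<Omega> p ?c \<le> ennreal (max 1 (\<bar>inverse 2\<bar> powr P)) * modular \<Omega> p (\<lambda>x. a x + b x)"
      by (rule modular_scale) measurable
    also have "\<dots> \<le> ennreal (max 1 (\<bar>inverse 2\<bar> powr P)) * (ennreal (2 powr P) * (modular \<Omega> p a + modular \<Omega> p b))"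
      by (intro mult_left_mono modular_add a b) simp
    also have "\<dots> < \<infinity>" using a b by (simp add: ennreal_mult_less_top)
    finally show ?thesis .
  qed
  note i = modular_finite_integrable(2)[OF a] modular_finite_integrable(2)[OF b] modular_finite_integrable(2)[OF cm cf]
  note j = energy_integrable[OF a] energy_integrable[OF b] energy_integrable[OF cm cf]
  define D where "D x = (norm (a x) powr p x + norm (b x) powr p x) / 2 - norm (?c x) powr p x" for x
  define F where "F x = (norm (a x) powr p x / p x + norm (b x) powr p x / p x) / 2 - norm (?c x) powr p x / p x" for x
  have D0: "0 \<le> D x" if "x \<in> \<Omega>" for x
    using powr_norm_midpoint[OF px(1)[OF that], of "a x" "b x"] by (simp add: D_def)
  have FD: "F x = D x / p x" for x by (simp add: F_def D_def diff_divide_distrib add_divide_distrib)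
  have intD: "integrable \<mu> D" "integral\<^sup>L \<mu> D = (rmodular a + rmodular b) / 2 - rmodular ?c"
    unfolding D_def[abs_def] rmodular_def using i by simp_all
  have intF: "integrable \<mu> F" "integral\<^sup>L \<mu> F = (energy a + energy b) / 2 - energy ?c"
    unfolding F_def[abs_def] energy_def using j by simp_all
  have "0 \<le> integral\<^sup>L \<mu> D" by (rule Bochner_Integration.integral_nonneg) (simp add: D0)
  then show "rmodular ?c \<le> (rmodular a + rmodular b) / 2" unfolding intD by simp
  have "0 \<le> integral\<^sup>L \<mu> F"
    by (rule Bochner_Integration.integral_nonneg) (use D0 px in \<open>force simp: FD intro: divide_nonneg_nonneg\<close>)
  then show "energy ?c \<le> (energy a + energy b) / 2" unfolding intF by simp
  have "integral\<^sup>L \<mu> D \<le> (\<integral>x. P * F x \<partial>\<mu>)"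
  proof (intro integral_mono intD integrable_mult_right intF)
    fix x assume "x \<in> space \<mu>"
    then have x: "x \<in> \<Omega>" by simp
    have "p x * D x \<le> P * D x" using px[OF x] D0[OF x] by (intro mult_right_mono) auto
    then show "D x \<le> P * F x" using px[OF x] by (simp add: FD field_simps)
  qed
  then show "(rmodular a + rmodular b) / 2 - rmodular ?c \<le> P * ((energy a + energy b) / 2 - energy ?c)"
    using intD intF by simp
qed

lemma energy_uniformly_convex:
  assumes e: "0 < \<epsilon>"
  shows "\<exists>C\<ge>0. \<forall>a b. a \<in> borel_measurable \<mu> \<longrightarrow> modular \<Omega> p a < \<infinity> \<longrightarrow>
    b \<in> borel_measurable \<mu> \<longrightarrow> modular \<Omega> p b < \<infinity> \<longrightarrow>
    rmodular (\<lambda>x. a x - b x) \<le> \<epsilon> * (rmodular a + rmodular b) + C * ((energy a + energy b) / 2 - energy (\<lambda>x. (a x + b x) /\<^sub>R 2))"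
proof -
  obtain C where C: "0 \<le> C" "\<And>t (a :: 'a) b. t \<in> {r..P} \<Longrightarrow> norm (a - b) powr t \<le>
      \<epsilon> * (norm a powr t + norm b powr t) + C * ((norm a powr t + norm b powr t) / 2 - norm ((a + b) /\<^sub>R 2) powr t)"
    using powr_norm_uniformly_convex[OF r_gt_1 e, of P] by blast
  show ?thesis
  \<comment> \<open>The locale admits an empty \<Omega>, for which P may be negative; the maximum
    keeps the constant nonnegative.\<close>
  proof (intro exI[of _ "C * max 0 P"] conjI allI impI)
    show "0 \<le> C * max 0 P" using C by simp
    fix a b :: "'a \<Rightarrow> 'a"
    assume a: "a \<in> borel_measurable \<mu>" "modular \<Omega> p a < \<infinity>"
      and b: "b \<in> borel_measurable \<mu>" "modular \<Omega> p b < \<infinity>"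
    note [measurable] = a(1) b(1)
    let ?c = "\<lambda>x. (a x + b x) /\<^sub>R 2"
    have cm: "?c \<in> borel_measurable \<mu>" and dm: "(\<lambda>x. a x - b x) \<in> borel_measurable \<mu>" by measurable
    note mid = midpoint_energy[OF a b]
    note i = modular_finite_integrable(2)[OF a] modular_finite_integrable(2)[OF b] modular_finite_integrable(2)[OF cm mid(3)]
      modular_finite_integrable(2)[OF dm modular_diff_finite[OF a(1) b(1) a(2) b(2)]]
    have "rmodular (\<lambda>x. a x - b x) \<le> (\<integral>x. \<epsilon> * (norm (a x) powr p x + norm (b x) powr p x) +
        C * ((norm (a x) powr p x + norm (b x) powr p x) / 2 - norm (?c x) powr p x) \<partial>\<mu>)"
      unfolding rmodular_def
    proof (rule integral_mono)
      show "integrable \<mu> (\<lambda>x. \<epsilon> * (norm (a x) powr p x + norm (b x) powr p x) +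
          C * ((norm (a x) powr p x + norm (b x) powr p x) / 2 - norm (?c x) powr p x))"
        by (intro Bochner_Integration.integrable_add Bochner_Integration.integrable_diff integrable_mult_right integrable_divide i)
      fix x assume "x \<in> space \<mu>"
      then show "norm (a x - b x) powr p x \<le> \<epsilon> * (norm (a x) powr p x + norm (b x) powr p x) +
          C * ((norm (a x) powr p x + norm (b x) powr p x) / 2 - norm (?c x) powr p x)"
        using p_bounds[of x] by (intro C(2)) auto
    qed (rule i)
    also have "\<dots> = \<epsilon> * (rmodular a + rmodular b) + C * ((rmodular a + rmodular b) / 2 - rmodular ?c)"
      unfolding rmodular_def using i by simp
    also have "C * ((rmodular a + rmodular b) / 2 - rmodular ?c) \<le> C * (P * ((energy a + energy b) / 2 - energy ?c))"
      by (intro mult_left_mono mid(4) C)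
    also have "\<dots> \<le> C * (max 0 P * ((energy a + energy b) / 2 - energy ?c))"
      using mid(1) by (intro mult_left_mono C mult_right_mono) auto
    finally show "rmodular (\<lambda>x. a x - b x) \<le> \<epsilon> * (rmodular a + rmodular b) + C * max 0 P * ((energy a + energy b) / 2 - energy ?c)"
      by (simp add: mult.assoc)
  qed
qed

end

section \<open>Minimising the functional\<close>

context eigenvalue_problem begin

lemma P_pos: "0 < P"
proof -
  obtain x where "x \<in> \<Omega>" using nonempty_dom by blast
  then show ?thesis using p_bounds r_gt_1 by fastforce
qed

lemma source_scale:
  assumes f: "f \<in> test_functions \<Omega>" and t: "0 < t" "t \<le> 1"
  shows "t powr Q * source f \<le> source (\<lambda>x. t * f x)"
proof -
  have ft: "(\<lambda>x. t * f x) \<in> test_functions \<Omega>" by (rule test_scale[OF f])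
  have "t powr Q * source f = (\<integral>x. t powr Q * (\<bar>f x\<bar> powr q x / q x) \<partial>\<nu>)"
    unfolding source_def by (simp only: integral_mult_right_zero)
  also have "\<dots> \<le> source (\<lambda>x. t * f x)" unfolding source_def
  proof (intro integral_mono integrable_mult_right source_integrable test_measurable_on f ft test_source_finite)
    fix x assume "x \<in> space \<nu>"
    then have q: "1 < q x" "q x \<le> Q" using q_bounds[of x] by auto
    have "t powr Q \<le> t powr q x" using t q by (intro powr_mono') auto
    then have "t powr Q * (\<bar>f x\<bar> powr q x / q x) \<le> t powr q x * (\<bar>f x\<bar> powr q x / q x)"
      using q by (intro mult_right_mono) auto
    then show "t powr Q * (\<bar>f x\<bar> powr q x / q x) \<le> \<bar>t * f x\<bar> powr q x / q x"
      using t by (simp add: abs_mult powr_mult)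
  qed
  finally show ?thesis .
qed

lemma rmodular_grad_scale:
  assumes f: "f \<in> test_functions \<Omega>" and t: "0 < t" "t \<le> 1"
  shows "rmodular (grad (\<lambda>x. t * f x)) \<le> t powr r * rmodular (grad f)"
proof -
  have "grad (\<lambda>x. t * f x) = (\<lambda>x. t *\<^sub>R grad f x)" by (rule ext) (rule grad_scale[OF test_imp_smooth[OF f]])
  then show ?thesis using rmodular_scale[OF test_measurable_on(2)[OF f] test_modular_finite(2)[OF f], of t] t by simp
qed

text \<open>Under scaling by t the gradient modular is at most of order t powr r and the source at
  least of order t powr Q, so t powr (r - Q) governs their ratio. The second bound additionally
  keeps the energy below a prescribed level.\<close>

lemma small_scale_exists:
  assumes "0 < d"
  obtains t where "0 < t" "t \<le> 1" "t powr (r - Q) * A < d" "t powr r * A \<le> d"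
proof -
  have "((\<lambda>t. t powr (r - Q) * A) \<longlongrightarrow> 0 powr (r - Q) * A) (at_right 0)"
    using Q_less_r by (intro tendsto_intros tendsto_powr') (auto simp: eventually_at_filter)
  then have "((\<lambda>t. t powr (r - Q) * A) \<longlongrightarrow> 0) (at_right 0)" by simp
  then have 1: "\<forall>\<^sub>F t in at_right 0. t powr (r - Q) * A < d" using assms by (intro order_tendstoD(2)) auto
  have "((\<lambda>t. t powr r * A) \<longlongrightarrow> 0 powr r * A) (at_right 0)"
    using r_gt_1 by (intro tendsto_intros tendsto_powr') (auto simp: eventually_at_filter)
  then have "((\<lambda>t. t powr r * A) \<longlongrightarrow> 0) (at_right 0)" by simp
  then have 2: "\<forall>\<^sub>F t in at_right 0. t powr r * A < d" using assms by (intro order_tendstoD(2)) auto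
  have 3: "\<forall>\<^sub>F t in at_right (0::real). 0 < t \<and> t < 1"
    unfolding eventually_at_right_field by (intro exI[of _ 1]) auto
  from eventually_happens'[OF trivial_limit_at_right_real eventually_conj[OF 1 eventually_conj[OF 2 3]]]
  obtain t where "t powr (r - Q) * A < d" "t powr r * A < d" "0 < t" "t < 1" by blast
  then show ?thesis by (intro that[of t]) auto
qed

definition functional :: "real \<Rightarrow> ('a \<Rightarrow> real) \<Rightarrow> ('a \<Rightarrow> 'a) \<Rightarrow> real" where
  "functional l u g = energy g - l * source u"

lemma functional_negative:
  assumes l: "0 < l"
  obtains \<eta> where "\<eta> \<in> test_functions \<Omega>" "functional l \<eta> (grad \<eta>) < 0"
proof -
  obtain \<eta> where e: "\<eta> \<in> test_functions \<Omega>" "0 < source \<eta>" using positive_test_function by metis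
  obtain t where t: "0 < t" "t \<le> 1" "t powr (r - Q) * rmodular (grad \<eta>) < l * source \<eta>"
    using small_scale_exists[of "l * source \<eta>" "rmodular (grad \<eta>)"] l e by auto
  have te: "(\<lambda>x. t * \<eta> x) \<in> test_functions \<Omega>" by (rule test_scale[OF e(1)])
  have "energy (grad (\<lambda>x. t * \<eta> x)) \<le> rmodular (grad (\<lambda>x. t * \<eta> x))"
    by (intro energy_bounds test_measurable_on test_modular_finite te)
  also have "\<dots> \<le> t powr r * rmodular (grad \<eta>)" by (rule rmodular_grad_scale[OF e(1) t(1,2)])
  also have "t powr r = t powr Q * t powr (r - Q)" by (simp add: powr_add[symmetric])
  also have "t powr Q * t powr (r - Q) * rmodular (grad \<eta>) = t powr Q * (t powr (r - Q) * rmodular (grad \<eta>))" by simp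
  also have "\<dots> < t powr Q * (l * source \<eta>)" using t by (intro mult_strict_left_mono) auto
  also have "\<dots> = l * (t powr Q * source \<eta>)" by simp
  also have "\<dots> \<le> l * source (\<lambda>x. t * \<eta> x)" using l by (intro mult_left_mono source_scale e t) auto
  finally show ?thesis by (intro that[OF te]) (simp add: functional_def)
qed

text \<open>Splitting the source at a level L bounds it by a constant plus L powr (Q - r) times the
  r-th moment, and that moment is linear in the gradient modular E. For large L this consumes at
  most half of the lower bound E / P for the energy.\<close>

lemma functional_coercive:
  assumes l: "0 < l"
  obtains C where "0 \<le> C" "\<And>\<eta>. \<eta> \<in> test_functions \<Omega> \<Longrightarrow> rmodular (grad \<eta>) \<le> 2 * P * (functional l \<eta> (grad \<eta>) + C)"
proof -
  interpret finite_measure \<nu> by (rule finite_\<nu>)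
  obtain K where K: "0 \<le> K" "\<And>f E. f \<in> test_functions \<Omega> \<Longrightarrow> 0 \<le> E \<Longrightarrow> modular \<Omega> p (grad f) \<le> ennreal E \<Longrightarrow>
     (\<integral>\<^sup>+ x. ennreal (\<bar>f x\<bar> powr r) \<partial>\<nu>) \<le> ennreal (K * (E + 1))"
    using moment_bound by blast
  \<comment> \<open>The threshold 1 / (2 P) used next is half of the factor 1 / P in the lower bound
    of the energy.\<close>
  have "((\<lambda>L. L powr (Q - r) * (l * K)) \<longlongrightarrow> 0 * (l * K)) at_top"
    using Q_less_r by (intro tendsto_mult tendsto_const tendsto_neg_powr filterlim_ident) auto
  then have "\<forall>\<^sub>F L in at_top. L powr (Q - r) * (l * K) < 1 / (2 * P)" using P_pos by (intro order_tendstoD(2)) auto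
  from eventually_happens'[OF trivial_limit_at_top_linorder eventually_conj[OF this eventually_ge_at_top[of 1]]]
  obtain L where L: "L powr (Q - r) * (l * K) < 1 / (2 * P)" "1 \<le> L" by blast
  define N where "N = measure \<nu> \<Omega>"
  have N0: "0 \<le> N" by (simp add: N_def)
  define C where "C = l * (L powr Q * N) + 1 / (2 * P)"
  show ?thesis
  proof (rule that[of C])
    show "0 \<le> C" using l P_pos N0 by (simp add: C_def)
    fix \<eta> assume e: "\<eta> \<in> test_functions \<Omega>"
    note m = test_measurable_on[OF e] and f = test_modular_finite[OF e]
    define E where "E = rmodular (grad \<eta>)"
    have E0: "0 \<le> E" unfolding E_def by (rule rmodular_eq(2)[OF m(2) f(2)])
    have mom: "(\<integral>\<^sup>+ x. ennreal (\<bar>\<eta> x\<bar> powr r) \<partial>\<nu>) \<le> ennreal (K * (E + 1))"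
      by (rule K(2)[OF e E0]) (simp add: E_def rmodular_eq(1)[OF m(2) f(2)])
    note si = source_integrable[OF m(1) test_source_finite[OF e]]
    have "ennreal (\<integral>x. \<bar>\<eta> x\<bar> powr r \<partial>\<nu>) \<le> ennreal (K * (E + 1))"
      using mom nn_integral_eq_integral[OF si(3)] by simp
    then have mr: "(\<integral>x. \<bar>\<eta> x\<bar> powr r \<partial>\<nu>) \<le> K * (E + 1)" using K E0 by (subst (asm) ennreal_le_iff) auto
    have "source \<eta> \<le> (\<integral>x. L powr Q + L powr (Q - r) * \<bar>\<eta> x\<bar> powr r \<partial>\<nu>)"
      unfolding source_def
    proof (rule integral_mono)
      show "integrable \<nu> (\<lambda>x. L powr Q + L powr (Q - r) * \<bar>\<eta> x\<bar> powr r)" using si by simp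
      fix x assume "x \<in> space \<nu>"
      then have q: "1 < q x" "q x \<le> Q" using q_bounds[of x] by auto
      have "\<bar>\<eta> x\<bar> powr q x / q x \<le> \<bar>\<eta> x\<bar> powr q x" using q by (simp add: divide_le_eq mult_le_cancel_left1)
      also have "\<dots> \<le> L powr Q + L powr (Q - r) * \<bar>\<eta> x\<bar> powr r"
      proof (cases "\<bar>\<eta> x\<bar> \<le> L")
        case True
        then have "\<bar>\<eta> x\<bar> powr q x \<le> L powr q x" using q by (intro powr_mono2) auto
        also have "\<dots> \<le> L powr Q" using L q by (intro powr_mono) auto
        finally show ?thesis by (simp add: add_increasing2)
      next
        case False
        have "\<bar>\<eta> x\<bar> powr q x \<le> \<bar>\<eta> x\<bar> powr Q" using q False L by (intro powr_mono) auto
        also have "\<dots> = \<bar>\<eta> x\<bar> powr (Q - r) * \<bar>\<eta> x\<bar> powr r" by (simp add: powr_add[symmetric])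
        also have "\<dots> \<le> L powr (Q - r) * \<bar>\<eta> x\<bar> powr r" using Q_less_r L False by (intro mult_right_mono powr_mono2') auto
        finally show ?thesis by (simp add: add_increasing)
      qed
      finally show "\<bar>\<eta> x\<bar> powr q x / q x \<le> L powr Q + L powr (Q - r) * \<bar>\<eta> x\<bar> powr r" .
    qed (rule si)
    also have "\<dots> = L powr Q * N + L powr (Q - r) * (\<integral>x. \<bar>\<eta> x\<bar> powr r \<partial>\<nu>)"
      using si(3) by (simp add: N_def)
    also have "\<dots> \<le> L powr Q * N + L powr (Q - r) * (K * (E + 1))"
      by (intro add_left_mono mult_left_mono mr) simp
    finally have "l * source \<eta> \<le> l * (L powr Q * N + L powr (Q - r) * (K * (E + 1)))" using l by (intro mult_left_mono) auto
    also have "\<dots> = l * (L powr Q * N) + (L powr (Q - r) * (l * K)) * (E + 1)" by (simp add: algebra_simps)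
    also have "\<dots> \<le> l * (L powr Q * N) + 1 / (2 * P) * (E + 1)"
      using L E0 by (intro add_left_mono mult_right_mono) auto
    also have "\<dots> = C + E / (2 * P)" by (simp add: C_def add_divide_distrib)
    finally have s: "l * source \<eta> \<le> C + E / (2 * P)" .
    have "E / P \<le> energy (grad \<eta>)" using energy_bounds(3)[OF m(2) f(2)] P_pos
      by (simp add: E_def divide_le_eq mult.commute)
    with s have "E / P - E / (2 * P) \<le> functional l \<eta> (grad \<eta>) + C" by (simp add: functional_def)
    moreover have "E / P - E / (2 * P) = E / (2 * P)" using P_pos by (simp add: field_simps)
    ultimately have "E / (2 * P) \<le> functional l \<eta> (grad \<eta>) + C" by simp
    then show "rmodular (grad \<eta>) \<le> 2 * P * (functional l \<eta> (grad \<eta>) + C)"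
      using P_pos by (simp add: E_def divide_le_eq mult.commute)
  qed
qed

text \<open>The infimum is taken over test functions, where all estimates are available; comparison
  with general pairs follows at the end by approximation.\<close>

lemma minimiser_exists:
  assumes l: "0 < l"
  obtains u g where "sobolev_pair u g" "functional l u g < 0"
    "\<And>v h. sobolev_pair v h \<Longrightarrow> functional l u g \<le> functional l v h"
proof -
  define J where "J \<eta> = functional l \<eta> (grad \<eta>)" for \<eta>
  obtain C where C: "0 \<le> C" "\<And>\<eta>. \<eta> \<in> test_functions \<Omega> \<Longrightarrow> rmodular (grad \<eta>) \<le> 2 * P * (J \<eta> + C)"
    using functional_coercive[OF l] unfolding J_def by metis
  have Jge: "- C \<le> J \<eta>" if "\<eta> \<in> test_functions \<Omega>" for \<eta>
  proof -
    have "0 \<le> 2 * P * (J \<eta> + C)" using C(2)[OF that] rmodular_eq(2)[OF test_measurable_on(2)[OF that] test_modular_finite(2)[OF that]] by linarith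
    then show ?thesis using P_pos by (simp add: zero_le_mult_iff)
  qed
  define m where "m = (INF \<eta>\<in>test_functions \<Omega>. J \<eta>)"
  have bdd: "bdd_below (J ` test_functions \<Omega>)" using Jge by (auto intro!: bdd_belowI2)
  have mle: "m \<le> J \<eta>" if "\<eta> \<in> test_functions \<Omega>" for \<eta> unfolding m_def by (rule cINF_lower[OF bdd that])
  have m0: "m < 0"
  proof -
    obtain \<eta> where "\<eta> \<in> test_functions \<Omega>" "J \<eta> < 0" using functional_negative[OF l] unfolding J_def by metis
    then show ?thesis using mle by (meson le_less_trans)
  qed
  have "\<exists>\<eta>\<in>test_functions \<Omega>. J \<eta> < m + inverse (real (Suc n))" for n
  proof -
    have "J ` test_functions \<Omega> \<noteq> {}" using test_zero by blast
    from cInf_lessD[OF this, of "m + inverse (real (Suc n))"] show ?thesis by (auto simp: m_def)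
  qed
  then obtain \<eta> where \<eta>: "\<And>n. \<eta> n \<in> test_functions \<Omega>" "\<And>n. J (\<eta> n) < m + inverse (real (Suc n))" by metis
  have Jlim: "(\<lambda>n. J (\<eta> n)) \<longlonglongrightarrow> m"
  proof (rule tendsto_sandwich[OF _ _ tendsto_const])
    show "\<forall>\<^sub>F n in sequentially. m \<le> J (\<eta> n)" by (intro always_eventually allI mle \<eta>)
    show "\<forall>\<^sub>F n in sequentially. J (\<eta> n) \<le> m + inverse (real (Suc n))" using \<eta>(2) by (intro always_eventually allI less_imp_le)
    have "(\<lambda>n. m + inverse (real (Suc n))) \<longlonglongrightarrow> m + 0" by (intro tendsto_intros LIMSEQ_inverse_real_of_nat)
    then show "(\<lambda>n. m + inverse (real (Suc n))) \<longlonglongrightarrow> m" by simp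
  qed
  define E where "E = 2 * P * (m + 1 + C)"
  have E: "rmodular (grad (\<eta> n)) \<le> E" for n
  proof -
    have "J (\<eta> n) \<le> m + 1" using \<eta>(2)[of n] inverse_le_1_iff[of "real (Suc n)"] by simp
    then have "2 * P * (J (\<eta> n) + C) \<le> E" unfolding E_def using P_pos by (intro mult_left_mono) auto
    then show ?thesis using C(2)[OF \<eta>(1)[of n]] by linarith
  qed
  have E0: "0 \<le> E" using E[of 0] rmodular_eq(2)[OF test_measurable_on(2)[OF \<eta>(1)] test_modular_finite(2)[OF \<eta>(1)], of 0] by linarith
  have G: "(\<integral>\<^sup>+ x. ennreal (norm (grad (\<eta> n) x)) \<partial>lborel) \<le> ennreal (measure lebesgue \<Omega> + E + 1)" for n
  proof -
    have "(\<integral>\<^sup>+ x. ennreal (norm (grad (\<eta> n) x)) \<partial>lborel) = (\<integral>\<^sup>+ x. ennreal (norm (grad (\<eta> n) x)) \<partial>\<mu>)"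
      using test_nn_integral_on(1)[OF \<eta>(1), of 1 UNIV n] by simp
    also have "\<dots> \<le> ennreal (1 * measure lebesgue \<Omega>) + ennreal (1 powr (- P)) * modular \<Omega> p (grad (\<eta> n))"
      by (intro L1_le_modular test_measurable_on \<eta>) auto
    also have "\<dots> \<le> ennreal (1 * measure lebesgue \<Omega>) + ennreal (1 powr (- P)) * ennreal E"
      by (intro add_left_mono mult_left_mono modular_le_rmodular test_measurable_on test_modular_finite \<eta> E) simp
    also have "\<dots> \<le> ennreal (measure lebesgue \<Omega> + E + 1)"
      using E0 by (simp add: ennreal_plus[symmetric] ennreal_leI del: ennreal_plus)
    finally show ?thesis .
  qed
  \<comment> \<open>Rellich's theorem gives an L1 Cauchy subsequence, and a further subsequence
    converges almost everywhere. Pointwise convergence with bounded energy is the form of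
    compactness that \<open>source_tendsto\<close> takes.\<close>
  obtain s1 :: "nat \<Rightarrow> nat" where s1: "strict_mono s1"
    "\<And>e. 0 < e \<Longrightarrow> \<exists>N. \<forall>i\<ge>N. \<forall>j\<ge>N. (\<integral>\<^sup>+ x. ennreal \<bar>\<eta> (s1 i) x - \<eta> (s1 j) x\<bar> \<partial>lborel) \<le> ennreal e"
  proof (rule rellich[OF open_dom bounded_dom, of \<eta> "measure lebesgue \<Omega> + E + 1"])
    show "0 < measure lebesgue \<Omega> + E + 1" using E0 measure_nonneg[of lebesgue \<Omega>] by linarith
  next
    fix s :: "nat \<Rightarrow> nat"
    assume "strict_mono s" "\<And>e. 0 < e \<Longrightarrow> \<exists>N. \<forall>i\<ge>N. \<forall>j\<ge>N. (\<integral>\<^sup>+ x. ennreal \<bar>\<eta> (s i) x - \<eta> (s j) x\<bar> \<partial>lborel) \<le> ennreal e"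
    then show thesis by (rule that)
  qed (rule \<eta>(1) G)+
  obtain s2 u where s2: "strict_mono s2" "u \<in> borel_measurable \<mu>" "AE x in \<mu>. (\<lambda>i. \<eta> (s1 (s2 i)) x) \<longlonglongrightarrow> u x"
  proof (rule L1_Cauchy_subseq[of "\<lambda>n. \<eta> (s1 n)" "\<mu>"])
    show "\<eta> (s1 n) \<in> borel_measurable \<mu>" for n by (rule test_measurable_on[OF \<eta>(1)])
    show "(\<integral>\<^sup>+ x. ennreal (norm (\<eta> (s1 n) x)) \<partial>\<mu>) < \<infinity>" for n
      using modular_finite_integrable(1)[OF test_measurable_on(1)[OF \<eta>(1)] test_modular_finite(1)[OF \<eta>(1)], of "s1 n"]
      by (simp add: integrable_iff_bounded)
    fix e :: real assume "0 < e"
    have "(\<integral>\<^sup>+ x. ennreal (norm (\<eta> (s1 i) x - \<eta> (s1 j) x)) \<partial>\<mu>) = (\<integral>\<^sup>+ x. ennreal \<bar>\<eta> (s1 i) x - \<eta> (s1 j) x\<bar> \<partial>lborel)" for i j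
      using test_nn_integral_on(2)[OF test_diff[OF \<eta>(1) \<eta>(1)], of 1 UNIV "s1 i" "s1 j"] by simp
    then show "\<exists>N. \<forall>i\<ge>N. \<forall>j\<ge>N. (\<integral>\<^sup>+ x. ennreal (norm (\<eta> (s1 i) x - \<eta> (s1 j) x)) \<partial>\<mu>) \<le> ennreal e"
      using s1(2)[OF \<open>0 < e\<close>] by simp
  qed blast
  define \<zeta> where "\<zeta> n = \<eta> (s1 (s2 n))" for n
  have zt: "\<zeta> n \<in> test_functions \<Omega>" for n by (simp add: \<zeta>_def \<eta>)
  note zm = test_measurable_on[OF zt] and zf = test_modular_finite[OF zt]
  note [measurable] = zm s2(2)
  have zE: "rmodular (grad (\<zeta> n)) \<le> E" for n unfolding \<zeta>_def by (rule E)
  have "strict_mono (s1 \<circ> s2)" by (rule strict_mono_o[OF s1(1) s2(1)])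
  from LIMSEQ_subseq_LIMSEQ[OF Jlim this] have Jz: "(\<lambda>n. J (\<zeta> n)) \<longlonglongrightarrow> m" by (simp add: \<zeta>_def o_def)
  have az: "AE x in \<mu>. (\<lambda>i. \<zeta> i x) \<longlonglongrightarrow> u x" using s2(3) by (simp add: \<zeta>_def)
  obtain K where K: "0 \<le> K" "\<And>f E. f \<in> test_functions \<Omega> \<Longrightarrow> 0 \<le> E \<Longrightarrow> modular \<Omega> p (grad f) \<le> ennreal E \<Longrightarrow>
     (\<integral>\<^sup>+ x. ennreal (\<bar>f x\<bar> powr r) \<partial>\<nu>) \<le> ennreal (K * (E + 1))"
    using moment_bound by blast
  have KE: "0 \<le> K * (E + 1)" using K E0 by simp
  have src: "(\<lambda>k. source (w k)) \<longlonglongrightarrow> source u"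
    if w: "\<And>k. w k \<in> test_functions \<Omega>" "\<And>k. rmodular (grad (w k)) \<le> E" "AE x in \<mu>. (\<lambda>k. w k x) \<longlonglongrightarrow> u x" for w
    by (rule source_tendsto(1)[OF test_measurable_on(1)[OF w(1)] s2(2) w(3) K(2)[OF w(1) E0] KE])
      (intro modular_le_rmodular test_measurable_on test_modular_finite w)
  have at_top: "filterlim i at_top sequentially" if "\<And>k. k \<le> i k" for i :: "nat \<Rightarrow> nat"
    by (rule filterlim_at_top_mono[OF filterlim_ident]) (use that in auto)
  \<comment> \<open>Two arbitrary index sequences stand for two late members of the sequence;
    \<open>double_limitI\<close> converts this into the Cauchy condition.\<close>
  have X: "(\<lambda>k. modular \<Omega> p (\<lambda>x. grad (\<zeta> (i k)) x - grad (\<zeta> (j k)) x)) \<longlonglongrightarrow> 0"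
    if ij: "\<And>k. k \<le> i k" "\<And>k. k \<le> j k" for i j
  proof -
    \<comment> \<open>Midpoints are again test functions, with the same energy bound and the same
      pointwise limit. Hence J is at least m on them, while their source tends to that of u.\<close>
    define w where "w k x = (1/2) * (\<zeta> (i k) x + \<zeta> (j k) x)" for k x
    have wt: "w k \<in> test_functions \<Omega>" for k unfolding w_def[abs_def] by (intro test_scale test_add zt)
    have wg: "grad (w k) = (\<lambda>x. (grad (\<zeta> (i k)) x + grad (\<zeta> (j k)) x) /\<^sub>R 2)" for k
      unfolding w_def[abs_def]
      by (rule ext) (simp only: grad_scale[OF test_imp_smooth[OF test_add[OF zt zt]]]
          grad_add[OF test_imp_smooth[OF zt] test_imp_smooth[OF zt]] inverse_eq_divide)
    note mid = midpoint_energy[OF zm(2) zf(2) zm(2) zf(2)]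
    have wE: "rmodular (grad (w k)) \<le> E" for k
      using mid(2)[of "i k" "j k"] zE[of "i k"] zE[of "j k"] by (simp add: wg)
    have wl: "AE x in \<mu>. (\<lambda>k. w k x) \<longlonglongrightarrow> u x"
      using az
    proof eventually_elim
      fix x assume a: "(\<lambda>i. \<zeta> i x) \<longlonglongrightarrow> u x"
      have "(\<lambda>k. w k x) \<longlonglongrightarrow> (1/2) * (u x + u x)"
        unfolding w_def by (intro tendsto_intros filterlim_compose[OF a] at_top ij)
      then show "(\<lambda>k. w k x) \<longlonglongrightarrow> u x" by simp
    qed
    \<comment> \<open>By J >= m at the midpoint, this defect is at most the mean of two values of J
      minus m, plus l times a difference of sources; each part tends to zero.\<close>
    define d where "d k = (energy (grad (\<zeta> (i k))) + energy (grad (\<zeta> (j k)))) / 2 - energy (grad (w k))" for k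
    have d0: "0 \<le> d k" for k using mid(1)[of "i k" "j k"] by (simp add: d_def wg)
    have dlim: "d \<longlonglongrightarrow> 0"
    proof (rule tendsto_sandwich[OF _ _ tendsto_const])
      show "\<forall>\<^sub>F k in sequentially. 0 \<le> d k" using d0 by simp
      show "\<forall>\<^sub>F k in sequentially. d k \<le> (J (\<zeta> (i k)) + J (\<zeta> (j k))) / 2 - m + l * ((source (\<zeta> (i k)) + source (\<zeta> (j k))) / 2 - source (w k))"
      proof (intro always_eventually allI)
        fix k
        show "d k \<le> (J (\<zeta> (i k)) + J (\<zeta> (j k))) / 2 - m + l * ((source (\<zeta> (i k)) + source (\<zeta> (j k))) / 2 - source (w k))"
          using mle[OF wt[of k]] by (simp add: d_def J_def functional_def algebra_simps add_divide_distrib diff_divide_distrib)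
      qed
      have sz: "(\<lambda>k. source (\<zeta> k)) \<longlonglongrightarrow> source u" by (rule src[OF zt zE az])
      have "(\<lambda>k. (J (\<zeta> (i k)) + J (\<zeta> (j k))) / 2 - m + l * ((source (\<zeta> (i k)) + source (\<zeta> (j k))) / 2 - source (w k)))
         \<longlonglongrightarrow> (m + m) / 2 - m + l * ((source u + source u) / 2 - source u)"
        by (intro tendsto_intros filterlim_compose[OF Jz] filterlim_compose[OF sz] at_top ij src wt wE wl) auto
      then show "(\<lambda>k. (J (\<zeta> (i k)) + J (\<zeta> (j k))) / 2 - m + l * ((source (\<zeta> (i k)) + source (\<zeta> (j k))) / 2 - source (w k))) \<longlonglongrightarrow> 0"
        by simp
    qed
    show ?thesis
    proof (rule ennreal_tendsto_0I)
      fix e :: real assume e: "0 < e"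
      \<comment> \<open>The two modulars add up to at most 2 E, so this share is at most e / 2. The
        constant D obtained next depends on \<epsilon> but not on k.\<close>
      define \<epsilon> where "\<epsilon> = e / (4 * (E + 1))"
      have eps: "0 < \<epsilon>" "\<epsilon> * (2 * E) \<le> e / 2" using e E0 by (auto simp: \<epsilon>_def field_simps)
      obtain D where D: "0 \<le> D" "\<And>a b. a \<in> borel_measurable \<mu> \<Longrightarrow> modular \<Omega> p a < \<infinity> \<Longrightarrow>
          b \<in> borel_measurable \<mu> \<Longrightarrow> modular \<Omega> p b < \<infinity> \<Longrightarrow>
          rmodular (\<lambda>x. a x - b x) \<le> \<epsilon> * (rmodular a + rmodular b) + D * ((energy a + energy b) / 2 - energy (\<lambda>x. (a x + b x) /\<^sub>R 2))"
        using energy_uniformly_convex[OF eps(1)] by blast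
      have "(\<lambda>k. D * d k) \<longlonglongrightarrow> D * 0" by (intro tendsto_intros dlim)
      then have "\<forall>\<^sub>F k in sequentially. D * d k < e / 2" using e by (intro order_tendstoD(2)) auto
      then show "\<forall>\<^sub>F k in sequentially. modular \<Omega> p (\<lambda>x. grad (\<zeta> (i k)) x - grad (\<zeta> (j k)) x) \<le> ennreal e"
      proof eventually_elim
        fix k assume k: "D * d k < e / 2"
        have "rmodular (\<lambda>x. grad (\<zeta> (i k)) x - grad (\<zeta> (j k)) x) \<le> \<epsilon> * (rmodular (grad (\<zeta> (i k))) + rmodular (grad (\<zeta> (j k)))) + D * d k"
          using D(2)[OF zm(2) zf(2) zm(2) zf(2), of "i k" "j k"] by (simp add: d_def wg)
        also have "\<dots> \<le> \<epsilon> * (2 * E) + D * d k"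
          using zE[of "i k"] zE[of "j k"] eps by (intro add_right_mono mult_left_mono) auto
        also have "\<dots> \<le> e" using eps k by linarith
        finally show "modular \<Omega> p (\<lambda>x. grad (\<zeta> (i k)) x - grad (\<zeta> (j k)) x) \<le> ennreal e"
          by (intro modular_le_rmodular modular_diff_finite zm zf) measurable
      qed
    qed
  qed
  obtain g where g: "g \<in> borel_measurable \<mu>" "(\<lambda>n. modular \<Omega> p (\<lambda>x. g x - grad (\<zeta> n) x)) \<longlonglongrightarrow> 0"
  proof (rule modular_complete[OF zm(2) zf(2)])
    show "\<exists>N. \<forall>i\<ge>N. \<forall>j\<ge>N. modular \<Omega> p (\<lambda>x. grad (\<zeta> i) x - grad (\<zeta> j) x) \<le> ennreal e" if "0 < e" for e
      by (rule double_limitI[OF X that])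
  qed (rule that)
  \<comment> \<open>The Poincare inequality carries the Cauchy property from gradients to values;
    with it u, so far only an almost everywhere limit, becomes the modular limit.\<close>
  have Xu: "(\<lambda>k. modular \<Omega> p (\<lambda>x. \<zeta> (i k) x - \<zeta> (j k) x)) \<longlonglongrightarrow> 0"
    if ij: "\<And>k. k \<le> i k" "\<And>k. k \<le> j k" for i j
  proof (rule modular_poincare)
    show "(\<lambda>x. \<zeta> (i k) x - \<zeta> (j k) x) \<in> test_functions \<Omega>" for k by (intro test_diff zt)
    have "grad (\<lambda>x. \<zeta> (i k) x - \<zeta> (j k) x) = (\<lambda>x. grad (\<zeta> (i k)) x - grad (\<zeta> (j k)) x)" for k
      by (rule ext) (rule grad_diff[OF test_imp_smooth[OF zt] test_imp_smooth[OF zt]])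
    then show "(\<lambda>k. modular \<Omega> p (grad (\<lambda>x. \<zeta> (i k) x - \<zeta> (j k) x))) \<longlonglongrightarrow> 0" using X[OF ij] by simp
  qed
  have ulim: "(\<lambda>n. modular \<Omega> p (\<lambda>x. u x - \<zeta> n x)) \<longlonglongrightarrow> 0"
  proof (rule modular_limit_of_Cauchy[OF zm(1) s2(2), of id])
    show "AE x in \<mu>. (\<lambda>i. \<zeta> (id i) x) \<longlonglongrightarrow> u x" using az by simp
    show "\<exists>N. \<forall>i\<ge>N. \<forall>j\<ge>N. modular \<Omega> p (\<lambda>x. \<zeta> i x - \<zeta> j x) \<le> ennreal e" if "0 < e" for e
      by (rule double_limitI[OF Xu that])
  qed (simp add: strict_mono_def)
  have pair: "sobolev_pair u g"
    unfolding sobolev_pair_def using s2(2) g zt ulim by blast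
  note gD = sobolev_pairD[OF pair]
  have Jm: "functional l u g = m"
  proof -
    have "(\<lambda>n. energy (grad (\<zeta> n)) - l * source (\<zeta> n)) \<longlonglongrightarrow> energy g - l * source u"
      by (intro tendsto_intros energy_tendsto[OF gD(2,4) zm(2) zf(2) g(2)] src zt zE az)
    then have "(\<lambda>n. J (\<zeta> n)) \<longlonglongrightarrow> functional l u g" by (simp add: J_def functional_def)
    then show ?thesis using Jz LIMSEQ_unique by blast
  qed
  show ?thesis
  proof (rule that[OF pair])
    show "functional l u g < 0" using Jm m0 by simp
    fix v h assume vh: "sobolev_pair v h"
    obtain \<xi> where x: "\<And>n. \<xi> n \<in> test_functions \<Omega>" "(\<lambda>n. modular \<Omega> p (\<lambda>x. h x - grad (\<xi> n) x)) \<longlonglongrightarrow> 0"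
      "(\<lambda>n. source (\<xi> n)) \<longlonglongrightarrow> source v" using sobolev_pair_approx[OF vh] by metis
    have "(\<lambda>n. energy (grad (\<xi> n)) - l * source (\<xi> n)) \<longlonglongrightarrow> energy h - l * source v"
      by (intro tendsto_intros x energy_tendsto[OF sobolev_pairD(2,4)[OF vh] test_measurable_on(2)[OF x(1)] test_modular_finite(2)[OF x(1)] x(2)])
    moreover have "m \<le> energy (grad (\<xi> n)) - l * source (\<xi> n)" for n
      using mle[OF x(1)] by (simp add: J_def functional_def)
    ultimately have "m \<le> energy h - l * source v" by (intro LIMSEQ_le_const) auto
    then show "functional l u g \<le> functional l v h" unfolding Jm by (simp add: functional_def)
  qed
qed

section \<open>Eigenfunctions from minimisers, and positivity of eigenvalues\<close>

lemma euler_lagrange: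
  assumes u: "sobolev_pair u g" and min: "\<And>v h. sobolev_pair v h \<Longrightarrow> functional l u g \<le> functional l v h"
    and v: "sobolev_pair v h"
  shows "(\<integral>x. norm (g x) powr (p x - 2) * (g x \<bullet> h x) \<partial>\<mu>) = l * (\<integral>x. \<bar>u x\<bar> powr (q x - 2) * (u x * v x) \<partial>\<nu>)"
proof -
  note uD = sobolev_pairD[OF u]
  \<comment> \<open>Minimality along u + t v with t > 0 gives only one inequality; applying it to -v
    as well gives equality.\<close>
  have ineq: "0 \<le> (\<integral>x. norm (g x) powr (p x - 2) * (g x \<bullet> h x) \<partial>\<mu>) - l * (\<integral>x. \<bar>u x\<bar> powr (q x - 2) * (u x * v x) \<partial>\<nu>)"
    if v: "sobolev_pair v h" for v h
  proof -
    note vD = sobolev_pairD[OF v]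
    note [measurable] = uD(1,2) vD(1,2)
    define t where "t n = inverse (real (Suc n))" for n
    have t: "0 < t n" for n by (simp add: t_def)
    have sp: "sobolev_pair (\<lambda>x. u x + c * v x) (\<lambda>x. g x + c *\<^sub>R h x)" for c by (rule sobolev_pair_lincomb[OF u v])
    have gi: "integrable \<mu> (\<lambda>x. norm (g x + c *\<^sub>R h x) powr p x)" for c
      by (rule modular_finite_integrable(2)[OF sobolev_pairD(2,4)[OF sp]])
    have ui: "integrable \<nu> (\<lambda>x. \<bar>u x + c * v x\<bar> powr q x)" for c
    proof -
      have "(\<integral>\<^sup>+ x. ennreal (\<bar>u x + c * v x\<bar> powr r) \<partial>\<nu>) < \<infinity>" by (rule sobolev_pair_approx[OF sp])
      then show ?thesis by (rule source_integrable(1)[OF sobolev_pairD(1)[OF sp]])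
    qed
    have 1: "(\<lambda>n. (energy (\<lambda>x. g x + t n *\<^sub>R h x) - energy g) / t n) \<longlonglongrightarrow> (\<integral>x. norm (g x) powr (p x - 2) * (g x \<bullet> h x) \<partial>\<mu>)"
      unfolding energy_def t_def
    proof (rule integral_powr_norm_quotient_tendsto)
      show "1 < p x" if "x \<in> space \<mu>" for x using p_bounds[of x] r_gt_1 that by auto
      show "integrable \<mu> (\<lambda>x. norm (g x) powr p x)" "integrable \<mu> (\<lambda>x. norm (g x + h x) powr p x)"
        "integrable \<mu> (\<lambda>x. norm (g x - h x) powr p x)"
        using gi[of 0] gi[of 1] gi[of "-1"] by simp_all
    qed measurable
    have "(\<lambda>n. ((\<integral>x. norm (u x + inverse (real (Suc n)) *\<^sub>R v x) powr q x / q x \<partial>\<nu>) - (\<integral>x. norm (u x) powr q x / q x \<partial>\<nu>)) / inverse (real (Suc n)))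
      \<longlonglongrightarrow> (\<integral>x. norm (u x) powr (q x - 2) * (u x \<bullet> v x) \<partial>\<nu>)"
    proof (rule integral_powr_norm_quotient_tendsto)
      show "1 < q x" if "x \<in> space \<nu>" for x using q_bounds[of x] that by auto
      show "integrable \<nu> (\<lambda>x. norm (u x) powr q x)" "integrable \<nu> (\<lambda>x. norm (u x + v x) powr q x)"
        "integrable \<nu> (\<lambda>x. norm (u x - v x) powr q x)"
        using ui[of 0] ui[of 1] ui[of "-1"] by simp_all
    qed (use uD vD in auto)
    then have 2: "(\<lambda>n. (source (\<lambda>x. u x + t n * v x) - source u) / t n) \<longlonglongrightarrow> (\<integral>x. \<bar>u x\<bar> powr (q x - 2) * (u x * v x) \<partial>\<nu>)"
      by (simp add: source_def t_def)
    have "(\<lambda>n. (energy (\<lambda>x. g x + t n *\<^sub>R h x) - energy g) / t n - l * ((source (\<lambda>x. u x + t n * v x) - source u) / t n)) \<longlonglongrightarrow>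
      (\<integral>x. norm (g x) powr (p x - 2) * (g x \<bullet> h x) \<partial>\<mu>) - l * (\<integral>x. \<bar>u x\<bar> powr (q x - 2) * (u x * v x) \<partial>\<nu>)"
      by (intro tendsto_intros 1 2)
    moreover have "0 \<le> (energy (\<lambda>x. g x + t n *\<^sub>R h x) - energy g) / t n - l * ((source (\<lambda>x. u x + t n * v x) - source u) / t n)" for n
    proof -
      have "0 \<le> (functional l (\<lambda>x. u x + t n * v x) (\<lambda>x. g x + t n *\<^sub>R h x) - functional l u g) / t n"
        using min[OF sp[of "t n"]] t[of n] by (intro divide_nonneg_pos) auto
      also have "\<dots> = (energy (\<lambda>x. g x + t n *\<^sub>R h x) - energy g) / t n - l * ((source (\<lambda>x. u x + t n * v x) - source u) / t n)"
        using t[of n] by (simp add: functional_def field_simps)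
      finally show ?thesis .
    qed
    ultimately show ?thesis by (intro LIMSEQ_le_const) auto
  qed
  \<comment> \<open>The pair for -v is reached as a combination of the zero test function with
    v.\<close>
  have "grad (\<lambda>x. 0) = (\<lambda>x::'a. 0)" by (rule ext, rule grad_eqI) simp
  then have "sobolev_pair (\<lambda>x. - v x) (\<lambda>x. - h x)"
    using sobolev_pair_lincomb[OF sobolev_pair_test[OF test_zero] v, of "-1"] by simp
  from ineq[OF this] ineq[OF v] show ?thesis by simp
qed

lemma pos_eigenvalue:
  assumes l: "0 < l" shows "l \<in> eigenvalues \<Omega> p q V"
proof -
  obtain u g where ug: "sobolev_pair u g" "functional l u g < 0"
    "\<And>v h. sobolev_pair v h \<Longrightarrow> functional l u g \<le> functional l v h"
    using minimiser_exists[OF l] by blast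
  have uW: "u \<in> W1p0 \<Omega> p" by (rule sobolev_pair_imp_W1p0[OF ug(1)])
  have u: "sobolev_pair u (weak_grad \<Omega> u)" by (rule W1p0_imp_sobolev_pair[OF uW])
  note D = sobolev_pairD[OF u]
  \<comment> \<open>The eigenvalue equation is phrased with \<open>weak_grad\<close>, while the
    minimiser comes with its own gradient g. They agree almost everywhere, so minimality carries
    over.\<close>
  have "energy (weak_grad \<Omega> u) = energy g"
    by (rule energy_cong[OF sobolev_pair_AE[OF ug(1)] D(2) sobolev_pairD(2)[OF ug(1)]])
  then have F: "functional l u (weak_grad \<Omega> u) = functional l u g" by (simp add: functional_def)
  \<comment> \<open>A function vanishing almost everywhere has source 0 and hence a nonnegative
    value of the functional, contrary to the negative minimum.\<close>
  have nz: "\<not> (AE x in \<mu>. u x = 0)"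
  proof
    assume "AE x in \<mu>. u x = 0"
    then have "AE x in \<nu>. \<bar>u x\<bar> powr q x / q x = 0" unfolding AE_\<nu>_iff by eventually_elim simp
    then have "source u = 0" unfolding source_def by (rule integral_eq_zero_AE)
    then show False using ug(2) F energy_bounds(1)[OF D(2,4)] by (simp add: functional_def)
  qed
  have "eigenpair \<Omega> p q V l u" unfolding eigenpair_def
  proof (intro conjI ballI)
    show "u \<in> W1p0_nonzero \<Omega> p" using uW nz by (simp add: W1p0_nonzero_def)
    fix v assume "v \<in> W1p0 \<Omega> p"
    then have v: "sobolev_pair v (weak_grad \<Omega> v)" by (rule W1p0_imp_sobolev_pair)
    note [measurable] = D(1) sobolev_pairD(1)[OF v]
    have "(\<integral>x. \<bar>u x\<bar> powr (q x - 2) * (u x * v x) \<partial>\<nu>) = (\<integral>x. V x * (\<bar>u x\<bar> powr (q x - 2) * (u x * v x)) \<partial>\<mu>)"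
      by (rule integral_\<nu>) measurable
    then show "(\<integral>x. norm (weak_grad \<Omega> u x) powr (p x - 2) * (weak_grad \<Omega> u x \<bullet> weak_grad \<Omega> v x) \<partial>\<mu>) =
      l * (\<integral>x. V x * \<bar>u x\<bar> powr (q x - 2) * u x * v x \<partial>\<mu>)"
      using euler_lagrange[OF u _ v, of l] ug(3) F by (simp add: mult.assoc)
  qed
  then show ?thesis by (auto simp: eigenvalues_def)
qed

lemma eigenvalue_pos:
  assumes "eigenpair \<Omega> p q V l u" shows "0 < l"
proof (rule ccontr)
  assume l: "\<not> 0 < l"
  have uW: "u \<in> W1p0 \<Omega> p" and nz: "\<not> (AE x in \<mu>. u x = 0)"
    using assms by (auto simp: eigenpair_def W1p0_nonzero_def)
  have u: "sobolev_pair u (weak_grad \<Omega> u)" by (rule W1p0_imp_sobolev_pair[OF uW])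
  note D = sobolev_pairD[OF u]
  let ?w = "weak_grad \<Omega> u"
  \<comment> \<open>Where the gradient vanishes both sides are 0, since \<open>0 powr a = 0\<close>
    for every a.\<close>
  have eq: "norm (?w x) powr (p x - 2) * (?w x \<bullet> ?w x) = norm (?w x) powr p x" for x
  proof (cases "?w x = 0")
    case False
    then have e: "?w x \<bullet> ?w x = norm (?w x) powr 2" by (simp add: power2_norm_eq_inner[symmetric])
    show ?thesis unfolding e powr_add[symmetric] by simp
  qed simp
  have "(\<integral>x. norm (?w x) powr p x \<partial>\<mu>) = l * (\<integral>x. V x * \<bar>u x\<bar> powr (q x - 2) * u x * u x \<partial>\<mu>)"
    using assms uW unfolding eigenpair_def eq[symmetric] by blast
  also have "\<dots> \<le> 0"
  proof -
    have "0 \<le> (\<integral>x. V x * \<bar>u x\<bar> powr (q x - 2) * u x * u x \<partial>\<mu>)"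
      using V_pos by (intro integral_nonneg_AE) (auto elim!: eventually_mono simp: mult.assoc)
    then show ?thesis using l by (simp add: mult_le_0_iff)
  qed
  finally have "(\<integral>x. norm (?w x) powr p x \<partial>\<mu>) = 0"
    using rmodular_eq(2)[OF D(2,4)] unfolding rmodular_def by linarith
  then have "AE x in \<mu>. norm (?w x) powr p x = 0"
    using modular_finite_integrable(2)[OF D(2,4)] by (subst (asm) integral_nonneg_eq_0_iff_AE) auto
  then have "AE x in \<mu>. ?w x = 0" by eventually_elim simp
  from sobolev_pair_zero[OF u this] nz show False by simp
qed

lemma eigenvalues_eq: "eigenvalues \<Omega> p q V = {0<..}"
  using pos_eigenvalue eigenvalue_pos by (auto simp: eigenvalues_def)

section \<open>The vanishing infima\<close>

lemma small_quotient:
  assumes e: "0 < e" and \<alpha>: "0 < \<alpha>"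
  shows "\<exists>u\<in>W1p0_nonzero \<Omega> p. G_fun \<Omega> p u \<le> \<alpha> \<and> psi_fun \<Omega> p u / phi_fun \<Omega> q V u < e"
proof -
  obtain \<eta> where n: "\<eta> \<in> test_functions \<Omega>" "0 < source \<eta>" "\<not> (AE x in \<mu>. \<eta> x = 0)"
    using positive_test_function by blast
  define A where "A = rmodular (grad \<eta>)"
  \<comment> \<open>One t serves two aims: the bound by e * source \<eta> makes the quotient small,
    the bound by \<alpha> meets the constraint on \<open>G_fun\<close>. The same function thus
    witnesses both infima.\<close>
  have "0 < min \<alpha> (e * source \<eta>)" using e \<alpha> n by simp
  then obtain t where t: "0 < t" "t \<le> 1" "t powr (r - Q) * A < min \<alpha> (e * source \<eta>)" "t powr r * A \<le> min \<alpha> (e * source \<eta>)"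
    using small_scale_exists by metis
  define u where "u = (\<lambda>x. t * \<eta> x)"
  have ut: "u \<in> test_functions \<Omega>" unfolding u_def by (rule test_scale[OF n(1)])
  have up: "sobolev_pair u (grad u)" by (rule sobolev_pair_test[OF ut])
  have uW: "u \<in> W1p0 \<Omega> p" by (rule sobolev_pair_imp_W1p0[OF up])
  note u2 = sobolev_pairD[OF W1p0_imp_sobolev_pair[OF uW]]
  note ae = sobolev_pair_AE[OF up]
  have unz: "\<not> (AE x in \<mu>. u x = 0)" using n(3) t by (simp add: u_def)
  have G: "G_fun \<Omega> p u = energy (grad u)"
    using energy_cong[OF ae u2(2) test_measurable_on(2)[OF ut]] by (simp add: G_fun_def energy_def)
  \<comment> \<open>The passage from \<open>weak_grad\<close> to the classical gradient goes through
    the modulars, which do not see null sets.\<close>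
  have psi: "psi_fun \<Omega> p u = rmodular (grad u)"
  proof -
    have "ennreal (rmodular (weak_grad \<Omega> u)) = ennreal (rmodular (grad u))"
      using modular_cong[OF ae] rmodular_eq(1)[OF u2(2,4)] rmodular_eq(1)[OF test_measurable_on(2)[OF ut] test_modular_finite(2)[OF ut]] by simp
    then show ?thesis using rmodular_eq(2)[OF u2(2,4)] rmodular_eq(2)[OF test_measurable_on(2)[OF ut] test_modular_finite(2)[OF ut]]
      by (simp add: psi_fun_def rmodular_def)
  qed
  note [measurable] = test_measurable_on(1)[OF ut]
  have phi: "phi_fun \<Omega> q V u = (\<integral>x. \<bar>u x\<bar> powr q x \<partial>\<nu>)"
    unfolding phi_fun_def by (rule integral_\<nu>[symmetric]) measurable
  have "source u \<le> phi_fun \<Omega> q V u"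
    unfolding phi source_def
  proof (intro integral_mono source_integrable test_measurable_on ut test_source_finite)
    fix x assume "x \<in> space \<nu>"
    then show "\<bar>u x\<bar> powr q x / q x \<le> \<bar>u x\<bar> powr q x" using q_bounds[of x] by (force simp: divide_le_eq mult_le_cancel_left1)
  qed
  then have phi_ge: "t powr Q * source \<eta> \<le> phi_fun \<Omega> q V u"
    using source_scale[OF n(1) t(1,2)] by (simp add: u_def)
  have phi_pos: "0 < t powr Q * source \<eta>" using t n by simp
  have rm: "rmodular (grad u) \<le> t powr r * A" unfolding u_def A_def by (rule rmodular_grad_scale[OF n(1) t(1,2)])
  have "G_fun \<Omega> p u \<le> \<alpha>"
    using G energy_bounds(2)[OF test_measurable_on(2)[OF ut] test_modular_finite(2)[OF ut]] rm t(4) by simp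
  moreover have "psi_fun \<Omega> p u / phi_fun \<Omega> q V u < e"
  proof -
    have "psi_fun \<Omega> p u \<le> t powr Q * (t powr (r - Q) * A)"
      using rm by (simp add: psi mult.assoc[symmetric] powr_add[symmetric])
    also have "\<dots> < t powr Q * (e * source \<eta>)" using t by (intro mult_strict_left_mono) auto
    also have "\<dots> = e * (t powr Q * source \<eta>)" by simp
    also have "\<dots> \<le> e * phi_fun \<Omega> q V u" using e phi_ge by (intro mult_left_mono) auto
    finally show ?thesis using phi_ge phi_pos by (simp add: divide_less_eq)
  qed
  ultimately show ?thesis using uW unz by (auto simp: W1p0_nonzero_def)
qed

lemma quotient_nonneg: "0 \<le> psi_fun \<Omega> p u / phi_fun \<Omega> q V u"
  unfolding psi_fun_def phi_fun_def using V_pos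
  by (intro divide_nonneg_nonneg integral_nonneg_AE) (auto elim!: eventually_mono)

lemma lambda_star_eq: "0 < \<alpha> \<Longrightarrow> lambda_star \<Omega> p q V \<alpha> = 0"
  unfolding lambda_star_def using small_quotient by (intro INF_eq_0I quotient_nonneg) blast

lemma mu_star_eq: "mu_star \<Omega> p q V = 0"
  unfolding mu_star_def using small_quotient[of _ 1] by (intro INF_eq_0I quotient_nonneg) (metis zero_less_one)

end

theorem corollary3p1:
  fixes \<Omega> :: "(real ^ 'n) set" and p q s V :: "real ^ 'n \<Rightarrow> real"
  assumes "CARD('n) \<ge> 2"
    and "bounded_smooth_domain \<Omega>"
    and "continuous_on (closure \<Omega>) p"
    and "continuous_on (closure \<Omega>) q"
    and "continuous_on (closure \<Omega>) s"
    and "\<And>x. x \<in> closure \<Omega> \<Longrightarrow> 1 < p x \<and> p x < real CARD('n)"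
    and "\<And>x. x \<in> closure \<Omega> \<Longrightarrow> 1 < q x \<and> q x < real CARD('n)"
    and "\<And>x. x \<in> closure \<Omega> \<Longrightarrow> real CARD('n) < s x"
    and "\<And>x. x \<in> closure \<Omega> \<Longrightarrow> s x * q x / (s x - 1) < sobolev_conj p x"
    and "V \<in> Lp_var \<Omega> s"
    and "AE x in lebesgue_on \<Omega>. V x > 0"
    and "exp_plus \<Omega> q < exp_minus \<Omega> p"
  shows "eigenvalues \<Omega> p q V = {0<..} \<and>
         (\<forall>\<alpha>>0. lambda_star \<Omega> p q V \<alpha> = 0) \<and>
         mu_star \<Omega> p q V = 0"
proof -
  have dom: "open \<Omega>" "bounded \<Omega>" "\<Omega> \<noteq> {}" using assms(2) by (auto simp: bounded_smooth_domain_def)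
  have cpt: "compact (closure \<Omega>)" "closure \<Omega> \<noteq> {}" using dom by (simp_all add: compact_closure)
  have sub: "\<Omega> \<subseteq> closure \<Omega>" by (rule closure_subset)
  \<comment> \<open>By compactness the infimum is attained, so a strict bound valid at every point
    of the closure is strict for \<open>exp_minus\<close> too.\<close>
  have inf: "\<exists>y\<in>closure \<Omega>. exp_minus \<Omega> h = h y \<and> (\<forall>x\<in>closure \<Omega>. h y \<le> h x)" if h: "continuous_on (closure \<Omega>) h" for h
  proof -
    obtain y where y: "y \<in> closure \<Omega>" "\<forall>x\<in>closure \<Omega>. h y \<le> h x"
      using continuous_attains_inf[OF cpt h] by blast
    then have "exp_minus \<Omega> h = h y" unfolding exp_minus_def by (intro cInf_eq_minimum) auto
    with y show ?thesis by blast
  qed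
  have qQ: "q x \<le> exp_plus \<Omega> q" if "x \<in> closure \<Omega>" for x
    unfolding exp_plus_def
    by (rule cSUP_upper[OF that bounded_imp_bdd_above[OF compact_imp_bounded[OF compact_continuous_image[OF assms(4) cpt(1)]]]])
  obtain y where y: "y \<in> closure \<Omega>" "exp_minus \<Omega> p = p y" "\<forall>x\<in>closure \<Omega>. p y \<le> p x" using inf[OF assms(3)] by blast
  obtain z where z: "z \<in> closure \<Omega>" "exp_minus \<Omega> s = s z" "\<forall>x\<in>closure \<Omega>. s z \<le> s x" using inf[OF assms(5)] by blast
  have Vm: "V \<in> borel_measurable (lebesgue_on \<Omega>)" and Vs: "modular \<Omega> s V < \<infinity>" using assms(10) by (auto simp: Lp_var_def)
  have sz: "real CARD('n) < s z" using assms(8)[OF z(1)] .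
  \<comment> \<open>The constants: r is the minimum of p, attained at y; P is the dimension; Q is
    the maximum of q; \<sigma> is the minimum of s, attained at z and therefore still strictly above
    the dimension.\<close>
  interpret eigenvalue_problem \<Omega> p "p y" "real CARD('n)" q V "exp_plus \<Omega> q" "s z"
  proof
    show "q \<in> borel_measurable (lebesgue_on \<Omega>)"
      using dom by (intro continuous_imp_measurable_on_sets_lebesgue continuous_on_subset[OF assms(4) sub]) auto
    show "p y \<le> p x \<and> p x \<le> real CARD('n)" if "x \<in> \<Omega>" for x using y assms(6)[of x] sub that by auto
    show "1 < q x \<and> q x \<le> exp_plus \<Omega> q" if "x \<in> \<Omega>" for x using assms(7)[of x] qQ[of x] sub that by auto
    show "exp_plus \<Omega> q < p y" using assms(12) y by simp
    show "real DIM(real ^ 'n) < s z" using sz by simp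
    show "(\<integral>\<^sup>+ x. ennreal (\<bar>V x\<bar> powr s z) \<partial>lebesgue_on \<Omega>) < \<infinity>"
    proof -
      have sm: "s \<in> borel_measurable (lebesgue_on \<Omega>)"
        using dom by (intro continuous_imp_measurable_on_sets_lebesgue continuous_on_subset[OF assms(5) sub]) auto
      note [measurable] = Vm sm
      have "(\<integral>\<^sup>+ x. ennreal (\<bar>V x\<bar> powr s z) \<partial>lebesgue_on \<Omega>) \<le> (\<integral>\<^sup>+ x. 1 + ennreal (\<bar>V x\<bar> powr s x) \<partial>lebesgue_on \<Omega>)"
      proof (rule nn_integral_mono)
        fix x assume "x \<in> space (lebesgue_on \<Omega>)"
        then have x: "s z \<le> s x" using z sub by auto
        \<comment> \<open>The additive 1, integrable over the bounded \<Omega>, covers the points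
          with |V| <= 1; elsewhere the larger exponent dominates.\<close>
        have "\<bar>V x\<bar> powr s z \<le> 1 + \<bar>V x\<bar> powr s x"
        proof (cases "\<bar>V x\<bar> \<le> 1")
          case True
          then have "\<bar>V x\<bar> powr s z \<le> 1" using sz by (intro powr_le1) auto
          then show ?thesis by (simp add: add_increasing2)
        next
          case False
          then have "\<bar>V x\<bar> powr s z \<le> \<bar>V x\<bar> powr s x" using x by (intro powr_mono) auto
          then show ?thesis by simp
        qed
        then have "ennreal (\<bar>V x\<bar> powr s z) \<le> ennreal (1 + \<bar>V x\<bar> powr s x)" by (rule ennreal_leI)
        then show "ennreal (\<bar>V x\<bar> powr s z) \<le> 1 + ennreal (\<bar>V x\<bar> powr s x)" by (simp add: ennreal_plus)
      qed
      also have "\<dots> = emeasure (lebesgue_on \<Omega>) \<Omega> + modular \<Omega> s V"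
        by (simp add: nn_integral_add modular_def)
      also have "\<dots> < \<infinity>"
        using Vs finite_measure.emeasure_finite[OF finite_measure_lebesgue_on[OF lmeasurable_open[OF dom(2,1)]], of \<Omega>]
        by (simp add: less_top)
      finally show ?thesis .
    qed
  qed (use dom assms(3,6,11) Vm y in auto)
  show ?thesis using eigenvalues_eq lambda_star_eq mu_star_eq by blast
qed

end
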